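(* Let $b:[0,T]\times\mathbb{R}\times\mathcal{P}_1(\mathbb{R})\to\mathbb{R}$ be a measurable function such that: (1) (linear growth) there exists a constant $C>0$ such that $|b(t,y,\mu)|\le C(1+|y|+\mathcal{K}(\mu,\delta_0))$ for all $t\in[0,T]$, $y\in\mathbb{R}$, $\mu\in\mathcal{P}_1(\mathbb{R})$; (2) (modulus of continuity in the third variable) there exists a continuous function $\theta:[0,\infty)\to[0,\infty)$ with $\theta(y)>0$ for all $y>0$ and $\int_0^z\frac{dy}{\theta(y)}=\infty$ for all $z>0$, such that $|b(t,y,\mu)-b(t,y,\nu)|^2\le\theta(\mathcal{K}(\mu,\nu)^2)$ for all $t\in[0,T]$, $y\in\mathbb{R}$, $\mu,\nu\in\mathcal{P}_1(\mathbb{R})$. Let $x\in\mathbb{R}$ and let $(\Omega^i,\mathcal{F}^i,\mathbb{F}^i,\mathbb{P}^i,B^i,X^i)$, $i=1,2$, be two weak solutions of $$dX_t=b(t,X_t,\mathbb{P}_{X_t})\,dt+dB_t,\quad X_0=x,\quad t\in[0,T].$$ Then $\mathbb{P}^1_{(X^1,B^1)}=\mathbb{P}^2_{(X^2,B^2)}$, i.e. the joint law of $(X^1,B^1)$ under $\mathbb{P}^1$ equals the joint law of $(X^2,B^2)$ under $\mathbb{P}^2$. In particular the solutions are unique in law.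
   Context: $T>0$ is a fixed time horizon. $\mathcal{P}_1(\mathbb{R})$ is the set of Borel probability measures $\mu$ on $\mathbb{R}$ with $\int|x|\,\mu(dx)<\infty$, endowed with the Kantorovich metric $\mathcal{K}(\lambda,\nu)=\sup\{|\int_{\mathbb{R}}h\,d(\lambda-\nu)| : h:\mathbb{R}\to\mathbb{R}\text{ Lipschitz with constant }1\}$; $\delta_0$ is the Dirac measure at $0$. A weak solution of the mean-field SDE is a six-tuple $(\Omega,\mathcal{F},\mathbb{F},\mathbb{P},B,X)$ where $(\Omega,\mathcal{F},\mathbb{P})$ is a complete probability space, $\mathbb{F}=(\mathcal{F}_t)_{t\in[0,T]}$ is a filtration satisfying the usual conditions, $B$ is a one-dimensional $(\mathbb{F},\mathbb{P})$-Brownian motion, $X$ is a continuous $\mathbb{F}$-adapted real-valued process, the law $\mathbb{P}_{X_t}$ of $X_t$ under $\mathbb{P}$ lies in $\mathcal{P}_1(\mathbb{R})$ for all $t\in[0,T]$, and $\mathbb{P}$-a.s. $X_t=x+\int_0^t b(s,X_s,\mathbb{P}_{X_s})\,ds+B_t$ for $t\in[0,T]$. Unique in law: any two weak solutions with the same initial value have the same law on path space $\mathcal{C}([0,T];\mathbb{R})$. *)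

theory Defs
  imports "HOL-Probability.Probability"
begin

section \<open>The Kantorovich space \<open>P\<^sub>1(\<real>)\<close>\<close>

definition P1 :: "real measure set" where
  "P1 = {\<mu>. prob_space \<mu> \<and> sets \<mu> = sets borel \<and> integrable \<mu> (\<lambda>x. \<bar>x\<bar>)}"

text \<open>The supremum is taken in the reals; it is bounded on \<open>P1\<close>, which makes the value
  \<open>0\<close> outside \<open>P1\<close> a mere totalisation, as \<open>Metric_space\<close> asks for nonnegativity everywhere.\<close>

definition kantorovich :: "real measure \<Rightarrow> real measure \<Rightarrow> real" where
  "kantorovich \<mu> \<nu> =
     (if \<mu> \<in> P1 \<and> \<nu> \<in> P1
      then SUP h\<in>{h :: real \<Rightarrow> real. 1-lipschitz_on UNIV h}. \<bar>(LINT x|\<mu>. h x) - (LINT x|\<nu>. h x)\<bar>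
      else 0)"

lemma P1D:
  assumes "\<mu> \<in> P1"
  shows "prob_space \<mu>" "sets \<mu> = sets borel" "space \<mu> = UNIV" "integrable \<mu> (\<lambda>x. \<bar>x\<bar>)"
  using assms sets_eq_imp_space_eq[of \<mu> borel] by (auto simp: P1_def)

lemma lipschitz_measurable_P1:
  assumes "\<mu> \<in> P1" "C-lipschitz_on UNIV (h :: real \<Rightarrow> real)"
  shows "h \<in> borel_measurable \<mu>"
proof -
  have "h \<in> borel_measurable borel"
    using lipschitz_on_continuous_on[OF assms(2)] by (rule borel_measurable_continuous_onI)
  then show ?thesis
    using P1D(2)[OF assms(1)] measurable_cong_sets by blast
qed

lemma lipschitz_integrable_P1:
  assumes \<mu>: "\<mu> \<in> P1" and h: "1-lipschitz_on UNIV (h :: real \<Rightarrow> real)"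
  shows "integrable \<mu> h"
    and "\<bar>(LINT x|\<mu>. h x) - h 0\<bar> \<le> (LINT x|\<mu>. \<bar>x\<bar>)"
proof -
  interpret prob_space \<mu> using P1D(1)[OF \<mu>] .
  have le: "\<bar>h x - h 0\<bar> \<le> \<bar>x\<bar>" for x
    using lipschitz_onD[OF h, of x 0] by (simp add: dist_real_def)
  have ha: "integrable \<mu> (\<lambda>x. \<bar>x\<bar>)" using P1D(4)[OF \<mu>] .
  have m: "h \<in> borel_measurable \<mu>" using lipschitz_measurable_P1[OF \<mu> h] .
  have d: "integrable \<mu> (\<lambda>x. h x - h 0)"
    by (rule Bochner_Integration.integrable_bound[OF ha]) (use m le in auto)
  have "integrable \<mu> (\<lambda>x. (h x - h 0) + h 0)"
    using d by (intro Bochner_Integration.integrable_add) auto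
  then show i: "integrable \<mu> h" by simp
  have "(LINT x|\<mu>. h x) - h 0 = (LINT x|\<mu>. h x - h 0)"
    using i by (simp add: prob_space)
  moreover have "\<bar>LINT x|\<mu>. h x - h 0\<bar> \<le> (LINT x|\<mu>. \<bar>h x - h 0\<bar>)"
    by (rule integral_abs_bound)
  moreover have "\<dots> \<le> (LINT x|\<mu>. \<bar>x\<bar>)"
    using d ha le by (intro integral_mono) auto
  ultimately show "\<bar>(LINT x|\<mu>. h x) - h 0\<bar> \<le> (LINT x|\<mu>. \<bar>x\<bar>)" by linarith
qed

lemma kantorovich_bdd_above:
  assumes "\<mu> \<in> P1" "\<nu> \<in> P1"
  shows "bdd_above ((\<lambda>h. \<bar>(LINT x|\<mu>. h x) - (LINT x|\<nu>. h x)\<bar>) `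
    {h :: real \<Rightarrow> real. 1-lipschitz_on UNIV h})"
proof (rule bdd_aboveI2)
  fix h :: "real \<Rightarrow> real" assume "h \<in> {h. 1-lipschitz_on UNIV h}"
  then show "\<bar>(LINT x|\<mu>. h x) - (LINT x|\<nu>. h x)\<bar> \<le> (LINT x|\<mu>. \<bar>x\<bar>) + (LINT x|\<nu>. \<bar>x\<bar>)"
    using lipschitz_integrable_P1(2)[OF assms(1), of h] lipschitz_integrable_P1(2)[OF assms(2), of h]
    by (auto simp: abs_le_iff)
qed

lemma kantorovich_upper:
  assumes "\<mu> \<in> P1" "\<nu> \<in> P1" "1-lipschitz_on UNIV (h :: real \<Rightarrow> real)"
  shows "\<bar>(LINT x|\<mu>. h x) - (LINT x|\<nu>. h x)\<bar> \<le> kantorovich \<mu> \<nu>"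
  unfolding kantorovich_def using assms
  by (auto intro!: cSUP_upper[OF _ kantorovich_bdd_above[OF assms(1,2)]])

lemma lipschitz_ne: "{h :: real \<Rightarrow> real. 1-lipschitz_on UNIV h} \<noteq> {}"
  using lipschitz_on_id[of UNIV] by (auto intro: exI[of _ id])

lemma kantorovich_zero_imp_eq:
  assumes \<mu>: "\<mu> \<in> P1" and \<nu>: "\<nu> \<in> P1" and z: "kantorovich \<mu> \<nu> = 0"
  shows "\<mu> = \<nu>"
proof -
  have rd: "real_distribution \<mu>" "real_distribution \<nu>"
    using P1D[OF \<mu>] P1D[OF \<nu>]
    by (auto simp: real_distribution_def real_distribution_axioms_def)
  define g where "g n a x = max 0 (min 1 (1 - real (Suc n) * (x - a)))" for n :: nat and a x :: real
  have lip: "1-lipschitz_on UNIV (\<lambda>x. g n a x / real (Suc n))" for n a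
  proof (rule lipschitz_onI)
    fix x y :: real
    have "\<bar>g n a x - g n a y\<bar> \<le> \<bar>real (Suc n) * (x - a) - real (Suc n) * (y - a)\<bar>"
      unfolding g_def by linarith
    also have "\<dots> = real (Suc n) * \<bar>x - y\<bar>"
      by (simp only: right_diff_distrib[symmetric] abs_mult) simp
    finally have "\<bar>g n a x - g n a y\<bar> / real (Suc n) \<le> \<bar>x - y\<bar>"
      by (simp add: divide_le_eq mult.commute)
    then show "dist (g n a x / real (Suc n)) (g n a y / real (Suc n)) \<le> 1 * dist x y"
      by (simp add: dist_real_def diff_divide_distrib[symmetric] del: of_nat_Suc)
  qed simp
  have eqg: "(LINT x|\<mu>. g n a x) = (LINT x|\<nu>. g n a x)" for n a
    using kantorovich_upper[OF \<mu> \<nu> lip[of n a]] z by (simp del: of_nat_Suc)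
  have lim: "(\<lambda>n. g n a x) \<longlonglongrightarrow> indicator {..a} x" for a x
  proof (cases "x \<le> a")
    case True
    then have "g n a x = 1" for n
    proof -
      have "real (Suc n) * (x - a) \<le> 0"
        using True by (intro mult_nonneg_nonpos) auto
      then show ?thesis by (simp add: g_def del: of_nat_Suc)
    qed
    with True show ?thesis by simp
  next
    case False
    obtain N :: nat where N: "1 < real N * (x - a)"
      using False reals_Archimedean3[of "x - a"] by fastforce
    have "g n a x = 0" if "n \<ge> N" for n
    proof -
      have "real N * (x - a) \<le> real (Suc n) * (x - a)"
        using that False by (intro mult_right_mono) auto
      then show ?thesis using N by (simp add: g_def del: of_nat_Suc)
    qed
    with False show ?thesis
      by (intro tendsto_eventually) (auto simp: eventually_sequentially)
  qed
  have conv: "(\<lambda>n. LINT x|M. g n a x) \<longlonglongrightarrow> cdf M a" if M: "M \<in> P1" for M a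
  proof -
    interpret real_distribution M
      using P1D[OF M] by (auto simp: real_distribution_def real_distribution_axioms_def)
    have "(\<lambda>n. LINT x|M. g n a x) \<longlonglongrightarrow> (LINT x|M. indicator {..a} x)"
    proof (rule integral_dominated_convergence[where w = "\<lambda>_. 1"])
      show "(\<lambda>x. g n a x) \<in> borel_measurable M" for n
        unfolding g_def by measurable
    qed (use lim in \<open>auto simp: g_def\<close>)
    then show ?thesis by (simp add: cdf_def)
  qed
  have "cdf \<mu> = cdf \<nu>"
  proof
    fix a show "cdf \<mu> a = cdf \<nu> a"
      using conv[OF \<mu>, of a] conv[OF \<nu>, of a] LIMSEQ_unique by (simp add: eqg)
  qed
  with rd show ?thesis by (rule cdf_unique)
qed

lemma Metric_space_P1: "Metric_space P1 kantorovich"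
proof
  show comm: "kantorovich \<mu> \<nu> = kantorovich \<nu> \<mu>" for \<mu> \<nu>
    unfolding kantorovich_def by (auto simp: abs_minus_commute)
  show nonneg: "0 \<le> kantorovich \<mu> \<nu>" for \<mu> \<nu>
  proof (cases "\<mu> \<in> P1 \<and> \<nu> \<in> P1")
    case True
    then have "\<bar>(LINT x|\<mu>. x) - (LINT x|\<nu>. x)\<bar> \<le> kantorovich \<mu> \<nu>"
      by (intro kantorovich_upper lipschitz_on_id) auto
    then show ?thesis by linarith
  qed (auto simp: kantorovich_def)
  have least: "kantorovich \<mu> \<nu> \<le> c"
    if "\<mu> \<in> P1" "\<nu> \<in> P1"
      "\<And>h :: real \<Rightarrow> real. 1-lipschitz_on UNIV h \<Longrightarrow> \<bar>(LINT x|\<mu>. h x) - (LINT x|\<nu>. h x)\<bar> \<le> c"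
    for \<mu> \<nu> c
    unfolding kantorovich_def using that lipschitz_ne by (auto intro!: cSUP_least)
  show "(kantorovich \<mu> \<nu> = 0) = (\<mu> = \<nu>)" if "\<mu> \<in> P1" "\<nu> \<in> P1" for \<mu> \<nu>
    using kantorovich_zero_imp_eq[OF that] least[OF that, of 0] nonneg[of \<mu> \<nu>] by auto
  show "kantorovich \<rho> \<nu> \<le> kantorovich \<rho> \<mu> + kantorovich \<mu> \<nu>"
    if "\<rho> \<in> P1" "\<mu> \<in> P1" "\<nu> \<in> P1" for \<rho> \<mu> \<nu>
  proof (rule least[OF that(1,3)])
    fix h :: "real \<Rightarrow> real" assume "1-lipschitz_on UNIV h"
    from kantorovich_upper[OF that(1,2) this] kantorovich_upper[OF that(2,3) this]
    show "\<bar>(LINT x|\<rho>. h x) - (LINT x|\<nu>. h x)\<bar> \<le> kantorovich \<rho> \<mu> + kantorovich \<mu> \<nu>" by linarith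
  qed
qed

definition borel_of_topology :: "'a topology \<Rightarrow> 'a measure" where
  "borel_of_topology X = sigma (topspace X) {U. openin X U}"

definition borel_P1 :: "real measure measure" where
  "borel_P1 = borel_of_topology (Metric_space.mtopology P1 kantorovich)"

lemma space_borel_P1: "space borel_P1 = P1"
  by (simp add: borel_P1_def borel_of_topology_def space_measure_of_conv
      Metric_space.topspace_mtopology[OF Metric_space_P1])


section \<open>The path space \<open>C([0,T]; \<real>)\<close>\<close>

text \<open>Paths are functions on \<open>{0..T}\<close>, extended by \<open>undefined\<close>, with the supremum metric.\<close>

definition path_space :: "real \<Rightarrow> (real \<Rightarrow> real) measure" where
  "path_space T = borel_of_topology (mtopology_of (cfunspace (top_of_set {0..T}) euclidean_metric))"

lemma space_path_space:
  "space (path_space T) = {f. f \<in> extensional {0..T} \<and> continuous_on {0..T} f}"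
  by (auto simp: path_space_def borel_of_topology_def space_measure_of_conv
      intro: compact_imp_bounded compact_continuous_image)

definition path_of :: "real \<Rightarrow> (real \<Rightarrow> 'a \<Rightarrow> real) \<Rightarrow> 'a \<Rightarrow> real \<Rightarrow> real" where
  "path_of T X \<omega> = (\<lambda>t\<in>{0..T}. X t \<omega>)"

definition path_law :: "real \<Rightarrow> 'a measure \<Rightarrow> (real \<Rightarrow> 'a \<Rightarrow> real) \<Rightarrow> (real \<Rightarrow> real) measure" where
  "path_law T M X = distr M (path_space T) (path_of T X)"

text \<open>\<open>C([0,T]; \<real>)\<close> is separable, so the product \<open>\<sigma>\<close>-algebra is the Borel \<open>\<sigma>\<close>-algebra of
  \<open>C([0,T]; \<real>) \<times> C([0,T]; \<real>)\<close>.\<close>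

definition joint_path_law ::
  "real \<Rightarrow> 'a measure \<Rightarrow> (real \<Rightarrow> 'a \<Rightarrow> real) \<Rightarrow> (real \<Rightarrow> 'a \<Rightarrow> real) \<Rightarrow>
    ((real \<Rightarrow> real) \<times> (real \<Rightarrow> real)) measure" where
  "joint_path_law T M X Y =
     distr M (path_space T \<Otimes>\<^sub>M path_space T) (\<lambda>\<omega>. (path_of T X \<omega>, path_of T Y \<omega>))"


section \<open>Weak solutions\<close>

text \<open>A filtration on \<open>[0,T]\<close> is given by \<open>F t\<close> for \<open>t \<in> {0..T}\<close>; only the \<open>\<sigma>\<close>-algebra of
  \<open>F t\<close> matters, not its measure. Values of \<open>F\<close> and of processes outside \<open>{0..T}\<close> are irrelevant.\<close>

definition usual_filtration :: "real \<Rightarrow> 'a measure \<Rightarrow> (real \<Rightarrow> 'a measure) \<Rightarrow> bool" where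
  "usual_filtration T M F \<longleftrightarrow>
     (\<forall>t\<in>{0..T}. subalgebra M (F t)) \<and>
     (\<forall>s\<in>{0..T}. \<forall>t\<in>{0..T}. s \<le> t \<longrightarrow> sets (F s) \<subseteq> sets (F t)) \<and>
     (\<forall>t\<in>{0..<T}. sets (F t) = (\<Inter>s\<in>{t<..T}. sets (F s))) \<and>
     null_sets M \<subseteq> sets (F 0)"

definition continuous_adapted ::
  "real \<Rightarrow> 'a measure \<Rightarrow> (real \<Rightarrow> 'a measure) \<Rightarrow> (real \<Rightarrow> 'a \<Rightarrow> real) \<Rightarrow> bool" where
  "continuous_adapted T M F X \<longleftrightarrow>
     (\<forall>t\<in>{0..T}. X t \<in> borel_measurable (F t)) \<and>
     (\<forall>\<omega>\<in>space M. continuous_on {0..T} (\<lambda>t. X t \<omega>))"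

definition brownian_motion ::
  "real \<Rightarrow> 'a measure \<Rightarrow> (real \<Rightarrow> 'a measure) \<Rightarrow> (real \<Rightarrow> 'a \<Rightarrow> real) \<Rightarrow> bool" where
  "brownian_motion T M F B \<longleftrightarrow>
     continuous_adapted T M F B \<and>
     (AE \<omega> in M. B 0 \<omega> = 0) \<and>
     (\<forall>s t. 0 \<le> s \<and> s < t \<and> t \<le> T \<longrightarrow>
        distributed M lborel (\<lambda>\<omega>. B t \<omega> - B s \<omega>) (normal_density 0 (sqrt (t - s))) \<and>
        prob_space.indep_set M (sets (F s))
          (sets (vimage_algebra (space M) (\<lambda>\<omega>. B t \<omega> - B s \<omega>) borel)))"

text \<open>The almost sure integrability of the drift is part of the meaning of the integral equation;
  it must be explicit since the integral of a non-integrable function is \<open>0\<close> here.\<close>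

definition weak_solution ::
  "real \<Rightarrow> (real \<Rightarrow> real \<Rightarrow> real measure \<Rightarrow> real) \<Rightarrow> real \<Rightarrow>
    'a measure \<Rightarrow> (real \<Rightarrow> 'a measure) \<Rightarrow> (real \<Rightarrow> 'a \<Rightarrow> real) \<Rightarrow> (real \<Rightarrow> 'a \<Rightarrow> real) \<Rightarrow> bool" where
  "weak_solution T b x M F B X \<longleftrightarrow>
     prob_space M \<and> complete_measure M \<and>
     usual_filtration T M F \<and>
     brownian_motion T M F B \<and>
     continuous_adapted T M F X \<and>
     (\<forall>t\<in>{0..T}. distr M borel (X t) \<in> P1) \<and>
     (AE \<omega> in M.
        set_integrable lborel {0..T} (\<lambda>s. b s (X s \<omega>) (distr M borel (X s))) \<and>
        (\<forall>t\<in>{0..T}.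
           X t \<omega> = x + (LINT s:{0..t}|lborel. b s (X s \<omega>) (distr M borel (X s))) + B t \<omega>))"

end

theory Submission
  imports Defs
begin

text \<open>Once the flow of its marginal laws is frozen, a weak solution \<open>X\<close> solves an ordinary equation
  with drift \<open>\<beta> s y = b s y (law of X s)\<close>. This drift has linear growth, and for such drifts the law of the
  solution is unique (\<open>sde_law_unique\<close>). The Brownian motion is a measurable functional of the
  solution path (\<open>joint_law_of_path_law\<close>), so that everything follows once the two flows of marginal
  laws are known to be equal (\<open>laws_coincide\<close>).

  To compare the flows, let \<open>k t\<close> be the Kantorovich distance of the laws at time \<open>t\<close>. A
  change of measure with density \<open>Z\<close> replaces the drift \<open>\<beta>2\<close> of the second solution by the drift
  \<open>\<beta>1\<close> of the first; by uniqueness \<open>X2\<close> then has the law of \<open>X1\<close>. Hence for a Lipschitz function \<open>h\<close>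
  the means of \<open>h (X1 t)\<close> and \<open>h (X2 t)\<close> differ by the mean of \<open>(Z - 1) (h (X2 t) - h x)\<close>, and since
  the second moment of \<open>Z\<close> is at most the exponential of the time integral of a bound for
  \<open>(\<beta>1 - \<beta>2)\<^sup>2\<close>, the Cauchy--Schwarz inequality yields
  \<open>(k t)\<^sup>2 \<le> c \<integral> (bound for (\<beta>1 - \<beta>2)\<^sup>2) ds\<close> over \<open>[0,t]\<close>
  (\<open>lipschitz_expectation_difference\<close>, \<open>gap2_integral_inequality\<close>). Osgood's argument then gives
  \<open>k = 0\<close> (\<open>osgood_uniqueness\<close>). The function \<open>\<theta>\<close> may oscillate, whereas this
  argument needs a monotone modulus: the Kantorovich space contains, for any two of its points,
  almost common neighbours at every larger distance, whence \<open>4 \<theta>\<close> evaluated at any larger distance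
  is also a modulus (\<open>modulus_at_larger_distance\<close>).

  The change of measure is constructed from Gaussian increments alone, without stochastic integrals. The
  drift is replaced by its averages over the preceding cells of a dyadic grid; for such step
  functions Girsanov's theorem is an iteration of the Cameron--Martin formula on the line. The
  densities have bounded second moments and, along a subsequence, converge almost surely, which suffices
  to carry the Gaussian law of the increments over to the limit (\<open>girsanov\<close>). Since a continuous
  process is determined by its values on the dyadic grids, it is enough to know the increments over
  dyadic cells (locale \<open>dyadic_bm\<close>). For a bounded drift that depends on the path of the solution,
  the density is a functional of that path, so that the law of the solution is an explicit measure
  (\<open>path_dependent_law_unique\<close>); drifts of linear growth are treated by stopping at the exit from a
  large ball.

  The marginal laws are only assumed to have finite first moments. A Baire category argument shows that
  these moments are bounded in time (\<open>bounded_by_Baire\<close>); continuity of the flow, measurability of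
  \<open>\<beta>\<close> and the bound on second moments follow.\<close>

section \<open>Measurable structure of the path space\<close>

text \<open>The dyadic grid of level \<open>n\<close> on \<open>[0,T]\<close>.\<close>

definition grid :: "real \<Rightarrow> nat \<Rightarrow> nat \<Rightarrow> real" where
  "grid T n k = T * real k / 2 ^ n"

lemma grid_0 [simp]: "grid T n 0 = 0" by (simp add: grid_def)

lemma grid_last [simp]: "grid T n (2 ^ n) = T" by (simp add: grid_def)

lemma grid_Suc: "grid T n (Suc k) = grid T n k + T / 2 ^ n"
  by (simp add: grid_def field_simps)

lemma grid_mono: "T \<ge> 0 \<Longrightarrow> j \<le> k \<Longrightarrow> grid T n j \<le> grid T n k"
  unfolding grid_def by (intro divide_right_mono mult_left_mono) auto

lemma grid_in: "T \<ge> 0 \<Longrightarrow> k \<le> 2 ^ n \<Longrightarrow> grid T n k \<in> {0..T}"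
  using grid_mono[of T 0 k n] grid_mono[of T k "2^n" n] by auto

lemma grid_refine: "grid T (n + p) (k * 2 ^ p) = grid T n k"
  by (simp add: grid_def power_add)

lemma grid_dense:
  assumes T: "T > 0" and t: "t \<in> {0..T}"
  obtains k where "\<And>n. k n \<le> 2 ^ n" "(\<lambda>n. grid T n (k n)) \<longlonglongrightarrow> t"
proof
  define k where "k n = nat \<lfloor>t / T * 2 ^ n\<rfloor>" for n :: nat
  have p: "0 \<le> t / T * 2 ^ n" for n :: nat using T t by auto
  have k: "real (k n) \<le> t / T * 2 ^ n" "t / T * 2 ^ n < real (k n) + 1" for n
    using p[of n] unfolding k_def by linarith+
  show "k n \<le> 2 ^ n" for n
  proof -
    have "t / T * 2 ^ n \<le> 1 * 2 ^ n" using T t by (intro mult_right_mono) auto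
    then have "real (k n) \<le> 2 ^ n" using k(1)[of n] by linarith
    then show ?thesis by simp
  qed
  have 1: "t - T / 2 ^ n \<le> grid T n (k n)" "grid T n (k n) \<le> t" for n
  proof -
    have "T * (t / T * 2 ^ n) \<le> T * (real (k n) + 1)" using k(2)[of n] T by (intro mult_left_mono) auto
    then have "t * 2 ^ n \<le> T * real (k n) + T" using T by (simp add: algebra_simps)
    then show "t - T / 2 ^ n \<le> grid T n (k n)" using pos_le_divide_eq[of "2 ^ n" "t" "T * real (k n) + T"] by (simp add: grid_def add_divide_distrib)
    have "T * real (k n) \<le> T * (t / T * 2 ^ n)" using k(1)[of n] T by (intro mult_left_mono) auto
    then show "grid T n (k n) \<le> t" using T by (simp add: grid_def divide_simps algebra_simps)
  qed
  have "(\<lambda>n. T * (1 / 2) ^ n) \<longlonglongrightarrow> T * 0"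
    by (intro tendsto_mult tendsto_const LIMSEQ_power_zero) auto
  then have 2: "(\<lambda>n. t - T / 2 ^ n) \<longlonglongrightarrow> t"
    using tendsto_diff[OF tendsto_const[of t]] by (fastforce simp: power_one_over)
  show "(\<lambda>n. grid T n (k n)) \<longlonglongrightarrow> t"
    by (rule tendsto_sandwich[OF _ _ 2 tendsto_const[of t]]) (use 1 in auto)
qed

lemma grid_continuous_limit:
  fixes g :: "real \<Rightarrow> real"
  assumes T: "T > 0" and t: "t \<in> {0..T}" and g: "continuous_on {0..T} g"
  obtains k where "\<And>n. k n \<le> 2 ^ n" "(\<lambda>n. g (grid T n (k n))) \<longlonglongrightarrow> g t"
proof -
  obtain k where k: "\<And>n. k n \<le> 2 ^ n" "(\<lambda>n. grid T n (k n)) \<longlonglongrightarrow> t"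
    using grid_dense[OF T t] by blast
  have "(\<lambda>n. g (grid T n (k n))) \<longlonglongrightarrow> g t"
    using g k t T grid_in[of T] unfolding continuous_on_sequentially by (auto simp: o_def)
  with k(1) that show ?thesis by blast
qed

lemma path_mem_iff: "w \<in> space (path_space T) \<longleftrightarrow> w \<in> extensional {0..T} \<and> continuous_on {0..T} w"
  by (simp add: space_path_space)

text \<open>Closed balls generate the topology as well as open ones; membership in a closed ball can be tested at
  countably many times.\<close>

lemma openin_path_iff:
  assumes "T > 0"
  shows "openin (mtopology_of (cfunspace (top_of_set {0..T}) euclidean_metric)) U \<longleftrightarrow>
    U \<subseteq> space (path_space T) \<and>
    (\<forall>f\<in>U. \<exists>r>0. \<forall>g\<in>space (path_space T). (\<forall>t\<in>{0..T}. \<bar>f t - g t\<bar> \<le> r) \<longrightarrow> g \<in> U)"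
proof -
  let ?m = "cfunspace (top_of_set {0..T}) (euclidean_metric :: real metric)"
  have sp: "mspace ?m = space (path_space T)"
    by (simp add: path_space_def borel_of_topology_def space_measure_of_conv)
  interpret MS: Metric_space "mspace ?m" "mdist ?m" by (rule Metric_space_mspace_mdist)
  have le: "mdist ?m f g \<le> a \<longleftrightarrow> (\<forall>t\<in>{0..T}. \<bar>f t - g t\<bar> \<le> a)"
    if "f \<in> mspace ?m" "g \<in> mspace ?m" for f g a
    using cfunspace_mdist_le[OF that] assms by (simp add: dist_real_def)
  have top: "mtopology_of ?m = MS.mtopology" by (simp add: mtopology_of_def)
  have 1: "(\<exists>r>0. MS.mball f r \<subseteq> U) \<longleftrightarrow>
     (\<exists>r>0. \<forall>g\<in>mspace ?m. (\<forall>t\<in>{0..T}. \<bar>f t - g t\<bar> \<le> r) \<longrightarrow> g \<in> U)"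
    if f: "f \<in> mspace ?m" for f
  proof
    assume "\<exists>r>0. MS.mball f r \<subseteq> U"
    then obtain r where r: "r > 0" "MS.mball f r \<subseteq> U" by auto
    have "g \<in> U" if "g \<in> mspace ?m" "\<forall>t\<in>{0..T}. \<bar>f t - g t\<bar> \<le> r / 2" for g
    proof -
      have "mdist ?m f g \<le> r / 2" using le[OF f that(1), of "r/2"] that(2) by blast
      then have "g \<in> MS.mball f r" unfolding MS.in_mball using f that(1) r(1) by linarith
      then show ?thesis using r(2) by blast
    qed
    then show "\<exists>r>0. \<forall>g\<in>mspace ?m. (\<forall>t\<in>{0..T}. \<bar>f t - g t\<bar> \<le> r) \<longrightarrow> g \<in> U"
      using r(1) by (intro exI[of _ "r/2"]) auto
  next
    assume "\<exists>r>0. \<forall>g\<in>mspace ?m. (\<forall>t\<in>{0..T}. \<bar>f t - g t\<bar> \<le> r) \<longrightarrow> g \<in> U"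
    then obtain r where r: "r > 0" "\<forall>g\<in>mspace ?m. (\<forall>t\<in>{0..T}. \<bar>f t - g t\<bar> \<le> r) \<longrightarrow> g \<in> U" by auto
    have "MS.mball f r \<subseteq> U"
    proof
      fix g assume g: "g \<in> MS.mball f r"
      then have "g \<in> mspace ?m" "mdist ?m f g \<le> r" unfolding MS.in_mball by auto
      then show "g \<in> U" using r(2) le[OF f] by blast
    qed
    with r(1) show "\<exists>r>0. MS.mball f r \<subseteq> U" by blast
  qed
  show ?thesis
  proof -
    have "openin (mtopology_of ?m) U \<longleftrightarrow> U \<subseteq> mspace ?m \<and> (\<forall>f\<in>U. \<exists>r>0. MS.mball f r \<subseteq> U)"
      unfolding top MS.openin_mtopology by (simp only: Ball_def)
    also have "\<dots> \<longleftrightarrow> U \<subseteq> mspace ?m \<and>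
      (\<forall>f\<in>U. \<exists>r>0. \<forall>g\<in>mspace ?m. (\<forall>t\<in>{0..T}. \<bar>f t - g t\<bar> \<le> r) \<longrightarrow> g \<in> U)"
    proof (cases "U \<subseteq> mspace ?m")
      case True
      have "(\<forall>f\<in>U. \<exists>r>0. MS.mball f r \<subseteq> U) \<longleftrightarrow>
        (\<forall>f\<in>U. \<exists>r>0. \<forall>g\<in>mspace ?m. (\<forall>t\<in>{0..T}. \<bar>f t - g t\<bar> \<le> r) \<longrightarrow> g \<in> U)"
      proof (rule ball_cong[OF refl])
        fix f assume "f \<in> U"
        with True have "f \<in> mspace ?m" by (rule set_mp)
        then show "(\<exists>r>0. MS.mball f r \<subseteq> U) =
         (\<exists>r>0. \<forall>g\<in>mspace ?m. (\<forall>t\<in>{0..T}. \<bar>f t - g t\<bar> \<le> r) \<longrightarrow> g \<in> U)" by (rule 1)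
      qed
      then show ?thesis by (simp only:)
    next
      case False then show ?thesis by (simp only: simp_thms)
    qed
    finally show ?thesis unfolding sp .
  qed
qed

lemma sets_path_space:
  "sets (path_space T) = sigma_sets (space (path_space T))
     {U. openin (mtopology_of (cfunspace (top_of_set {0..T}) euclidean_metric)) U}"
proof -
  have "{U. openin (mtopology_of (cfunspace (top_of_set {0..T}) (euclidean_metric::real metric))) U} \<subseteq> Pow (topspace (mtopology_of (cfunspace (top_of_set {0..T}) (euclidean_metric::real metric))))"
    using openin_subset by blast
  then show ?thesis unfolding path_space_def borel_of_topology_def
    by (simp add: space_measure_of_conv)
qed

lemma eval_measurable_path:
  assumes "T > 0" "t \<in> {0..T}"
  shows "(\<lambda>w. w t) \<in> borel_measurable (path_space T)"
proof (rule borel_measurableI)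
  fix S :: "real set" assume S: "open S"
  have "openin (mtopology_of (cfunspace (top_of_set {0..T}) euclidean_metric))
     ((\<lambda>w. w t) -` S \<inter> space (path_space T))"
    unfolding openin_path_iff[OF assms(1)]
  proof (intro conjI ballI)
    fix f assume f: "f \<in> (\<lambda>w. w t) -` S \<inter> space (path_space T)"
    with S obtain e where e: "e > 0" "\<forall>y. dist y (f t) < e \<longrightarrow> y \<in> S"
      by (auto simp: open_dist)
    show "\<exists>r>0. \<forall>g\<in>space (path_space T). (\<forall>t\<in>{0..T}. \<bar>f t - g t\<bar> \<le> r) \<longrightarrow>
            g \<in> (\<lambda>w. w t) -` S \<inter> space (path_space T)"
    proof (intro exI[of _ "e/2"] conjI ballI impI)
      fix g assume g: "g \<in> space (path_space T)" "\<forall>t\<in>{0..T}. \<bar>f t - g t\<bar> \<le> e/2"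
      then have "dist (g t) (f t) < e" using assms(2) e(1) by (auto simp: dist_real_def abs_minus_commute dest!: bspec[of _ _ t])
      then show "g \<in> (\<lambda>w. w t) -` S \<inter> space (path_space T)" using e g by auto
    qed (use e in auto)
  qed auto
  then show "(\<lambda>w. w t) -` S \<inter> space (path_space T) \<in> sets (path_space T)"
    unfolding sets_path_space by (auto intro: sigma_sets.Basic)
qed

text \<open>Bernstein polynomials with rational coefficients: a countable uniformly dense family of paths,
  which reduces the open sets of the path space to countably many balls.\<close>

definition bern :: "real \<Rightarrow> nat \<Rightarrow> rat list \<Rightarrow> real \<Rightarrow> real" where
  "bern T N qs t = (\<Sum>k\<le>N. of_rat (qs ! k) * Bernstein N k (t / T))"

lemma bern_dense:
  assumes T: "T > 0" and f: "continuous_on {0..T} f" and e: "e > 0"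
  shows "\<exists>N qs. \<forall>t\<in>{0..T}. \<bar>f t - bern T N qs t\<bar> \<le> e"
proof -
  have c: "continuous_on {0..1} (\<lambda>u. f (u * T))"
    by (rule continuous_on_compose2[OF f]) (use T in \<open>auto intro!: continuous_intros mult_left_le_one_le\<close>)
  obtain N where N: "\<And>x. x \<in> {0..1} \<Longrightarrow> \<bar>f (x * T) - (\<Sum>k\<le>N. f (k/N * T) * Bernstein N k x)\<bar> < e / 2"
    using Bernstein_Weierstrass[OF c, of "e/2"] e by auto
  have "\<exists>q :: rat. \<bar>f (k/N * T) - of_rat q\<bar> < e / 2" for k :: nat
  proof -
    obtain q where "f (k/N * T) < of_rat q" "of_rat q < f (k/N*T) + e/2"
      using of_rat_dense[of "f (k/N * T)" "f (k/N*T) + e/2"] e by auto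
    then show ?thesis by (intro exI[of _ q]) linarith
  qed
  then obtain q where q: "\<And>k::nat. \<bar>f (k/N * T) - of_rat (q k)\<bar> < e / 2" by metis
  have "\<bar>f t - bern T N (map q [0..<Suc N]) t\<bar> \<le> e" if t: "t \<in> {0..T}" for t
  proof -
    define x where "x = t / T"
    have x: "x \<in> {0..1}" "t = x * T" using t T by (auto simp: x_def)
    have "bern T N (map q [0..<Suc N]) t = (\<Sum>k\<le>N. of_rat (q k) * Bernstein N k x)"
      unfolding bern_def x_def by (intro sum.cong) (auto simp del: upt_Suc)
    moreover have "\<bar>(\<Sum>k\<le>N. f (k/N * T) * Bernstein N k x) - (\<Sum>k\<le>N. of_rat (q k) * Bernstein N k x)\<bar>
        \<le> (\<Sum>k\<le>N. e/2 * Bernstein N k x)"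
      unfolding sum_subtractf[symmetric] left_diff_distrib[symmetric]
    proof (rule order_trans[OF sum_abs sum_mono])
      fix k assume "k \<in> {..N}"
      then have "Bernstein N k x \<ge> 0" using x by (intro Bernstein_nonneg) auto
      then show "\<bar>(f (k/N * T) - of_rat (q k)) * Bernstein N k x\<bar> \<le> e/2 * Bernstein N k x"
        unfolding abs_mult using q[of k] by (simp only: abs_of_nonneg) (rule mult_right_mono, linarith)
    qed
    moreover have "(\<Sum>k\<le>N. e/2 * Bernstein N k x) = e/2"
      by (simp only: sum_distrib_left[symmetric] sum_Bernstein)
    ultimately show ?thesis using N[OF x(1)] unfolding x(2)[symmetric] by linarith
  qed
  then show ?thesis by blast
qed

lemma bern_continuous: "continuous_on A (bern T N qs)"
  unfolding bern_def Bernstein_def divide_inverse by (intro continuous_intros)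

text \<open>An open set is the union of the closed balls around rational Bernstein polynomials that it contains.
  By continuity, each such ball is described by the values of the path on the dyadic grids.\<close>

lemma measurable_path_spaceI:
  assumes T: "T > 0"
    and f: "\<And>\<omega>. \<omega> \<in> space M \<Longrightarrow> f \<omega> \<in> space (path_space T)"
    and ev: "\<And>t. t \<in> {0..T} \<Longrightarrow> (\<lambda>\<omega>. f \<omega> t) \<in> borel_measurable M"
  shows "f \<in> M \<rightarrow>\<^sub>M path_space T"
proof -
  let ?m = "cfunspace (top_of_set {0..T}) (euclidean_metric :: real metric)"
  have sp: "topspace (mtopology_of ?m) = space (path_space T)"
    by (simp add: path_space_def borel_of_topology_def space_measure_of_conv)
  have "f -` U \<inter> space M \<in> sets M" if U: "openin (mtopology_of ?m) U" for U
  proof -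
    define G where "G = {(N, qs, n). \<forall>h\<in>space (path_space T).
      (\<forall>t\<in>{0..T}. \<bar>h t - bern T N qs t\<bar> \<le> 1 / real (Suc n)) \<longrightarrow> h \<in> U}"
    define A where "A = (\<lambda>(N, qs, n). {\<omega>\<in>space M. \<forall>m. \<forall>k\<in>{..2 ^ m}.
      \<bar>f \<omega> (grid T m k) - bern T N qs (grid T m k)\<bar> \<le> 1 / real (Suc n)})"
    have A: "A p \<in> sets M" for p
    proof (cases p)
      case (fields N qs n)
      have "{\<omega>\<in>space M. \<bar>f \<omega> (grid T m k) - bern T N qs (grid T m k)\<bar> \<le> 1 / real (Suc n)} \<in> sets M"
        if "k \<le> 2 ^ m" for m k
      proof -
        have [measurable]: "(\<lambda>\<omega>. f \<omega> (grid T m k)) \<in> borel_measurable M"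
          using grid_in[of T] T that by (intro ev) auto
        show ?thesis by measurable
      qed
      then show ?thesis unfolding A_def fields prod.case
        by (intro sets.sets_Collect_countable_All sets.sets_Collect_finite_All) auto
    qed
    have Ai: "\<bar>f \<omega> t - bern T N qs t\<bar> \<le> 1 / real (Suc n)"
      if a: "\<omega> \<in> A (N, qs, n)" and t: "t \<in> {0..T}" for \<omega> N qs n t
    proof -
      have w: "\<omega> \<in> space M" using a by (auto simp: A_def)
      have c: "continuous_on {0..T} (\<lambda>t. \<bar>f \<omega> t - bern T N qs t\<bar>)"
        using f[OF w] by (intro continuous_intros bern_continuous) (auto simp: path_mem_iff)
      obtain k where k: "\<And>n. k n \<le> 2 ^ n"
          "(\<lambda>n. \<bar>f \<omega> (grid T n (k n)) - bern T N qs (grid T n (k n))\<bar>) \<longlonglongrightarrow> \<bar>f \<omega> t - bern T N qs t\<bar>"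
        using grid_continuous_limit[OF T t c] by blast
      show ?thesis
        by (rule LIMSEQ_le_const2[OF k(2)]) (use k(1) a in \<open>auto simp: A_def\<close>)
    qed
    have "f -` U \<inter> space M = (\<Union>p\<in>G. A p)"
    proof (intro equalityI subsetI)
      fix \<omega> assume w: "\<omega> \<in> f -` U \<inter> space M"
      then obtain r where r: "r > 0" "\<And>g. g\<in>space (path_space T) \<Longrightarrow> (\<And>t. t\<in>{0..T} \<Longrightarrow> \<bar>f \<omega> t - g t\<bar> \<le> r) \<Longrightarrow> g \<in> U"
        using U unfolding openin_path_iff[OF T] by (metis IntD1 vimageD)
      obtain n where n: "1 / real (Suc n) < r / 2" using r(1) nat_approx_posE[of "r/2"] by (metis half_gt_zero)
      have "continuous_on {0..T} (f \<omega>)" using f[of \<omega>] w by (auto simp: path_mem_iff)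
      then obtain N qs where b: "\<forall>t\<in>{0..T}. \<bar>f \<omega> t - bern T N qs t\<bar> \<le> 1 / real (Suc n)"
        using bern_dense[OF T, of "f \<omega>" "1 / real (Suc n)"] by force
      have "(N, qs, n) \<in> G" unfolding G_def
      proof (clarify, rule r(2))
        fix h t assume "h \<in> space (path_space T)" "\<forall>t\<in>{0..T}. \<bar>h t - bern T N qs t\<bar> \<le> 1 / real (Suc n)" "t \<in> {0..T}"
        then show "\<bar>f \<omega> t - h t\<bar> \<le> r"
          using b n by (auto dest!: bspec[of _ _ t] simp del: of_nat_Suc)
      qed
      moreover have "\<omega> \<in> A (N, qs, n)"
        using w b T by (auto simp: A_def simp del: of_nat_Suc intro!: b[rule_format] grid_in)
      ultimately show "\<omega> \<in> (\<Union>p\<in>G. A p)" by blast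
    next
      fix \<omega> assume "\<omega> \<in> (\<Union>p\<in>G. A p)"
      then obtain N qs n where p: "(N, qs, n) \<in> G" "\<omega> \<in> A (N, qs, n)" by auto
      then have w: "\<omega> \<in> space M" by (auto simp: A_def)
      show "\<omega> \<in> f -` U \<inter> space M"
        using p(1) f[OF w] Ai[OF p(2)] w unfolding G_def by auto
    qed
    also have "\<dots> \<in> sets M"
      by (intro sets.countable_UN'' A) auto
    finally show ?thesis .
  qed
  moreover have "{U. openin (mtopology_of ?m) U} \<subseteq> Pow (topspace (mtopology_of ?m))"
    using openin_subset by blast
  moreover have "f \<in> space M \<rightarrow> topspace (mtopology_of ?m)"
    unfolding sp using f by blast
  ultimately show ?thesis
    unfolding path_space_def borel_of_topology_def by (intro measurable_measure_of) blast+
qed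

lemma path_of_measurable:
  assumes T: "T > 0" and X: "\<And>t. t \<in> {0..T} \<Longrightarrow> X t \<in> borel_measurable N"
    and c: "\<And>\<omega>. \<omega> \<in> space N \<Longrightarrow> continuous_on {0..T} (\<lambda>t. X t \<omega>)"
  shows "path_of T X \<in> N \<rightarrow>\<^sub>M path_space T"
proof (rule measurable_path_spaceI[OF T])
  fix \<omega> assume "\<omega> \<in> space N"
  then have "continuous_on {0..T} (\<lambda>t. X t \<omega>)" by (rule c)
  then have "continuous_on {0..T} (\<lambda>t\<in>{0..T}. X t \<omega>)" by (rule continuous_on_eq) simp
  then show "path_of T X \<omega> \<in> space (path_space T)"
    unfolding path_mem_iff path_of_def by simp
next
  fix t assume "t \<in> {0..T}"
  then show "(\<lambda>\<omega>. path_of T X \<omega> t) \<in> borel_measurable N" using X by (simp add: path_of_def)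
qed

lemma path_of_apply: "t \<in> {0..T} \<Longrightarrow> path_of T X \<omega> t = X t \<omega>"
  by (simp add: path_of_def)

lemma path_of_cong: "(\<And>t. t \<in> {0..T} \<Longrightarrow> X t \<omega> = Y t \<omega>) \<Longrightarrow> path_of T X \<omega> = path_of T Y \<omega>"
  unfolding path_of_def by (rule restrict_ext)

text \<open>A continuous path is recovered from its values at the dyadic times, and any finite set of dyadic times
  lies on one grid, so that the cylinders over the grids determine the law.\<close>

lemma path_law_eqI:
  assumes T: "T > 0" and N: "prob_space N1" "prob_space N2"
    and s1: "sets N1 = sets (path_space T)" and s2: "sets N2 = sets (path_space T)"
    and eq: "\<And>n. distr N1 (PiM {..2 ^ n} (\<lambda>_. borel)) (\<lambda>w. \<lambda>k\<in>{..2 ^ n}. w (grid T n k)) =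
                 distr N2 (PiM {..2 ^ n} (\<lambda>_. borel)) (\<lambda>w. \<lambda>k\<in>{..2 ^ n}. w (grid T n k))"
  shows "N1 = N2"
proof -
  define D where "D = (\<Union>n. grid T n ` {..2 ^ n})"
  define ev where "ev w = restrict w D" for w :: "real \<Rightarrow> real"
  have D: "D \<subseteq> {0..T}" using grid_in[of T] T by (auto simp: D_def)
  have sp: "space N1 = space (path_space T)" "space N2 = space (path_space T)"
    using s1 s2 sets_eq_imp_space_eq by blast+
  have ev: "ev \<in> path_space T \<rightarrow>\<^sub>M PiM D (\<lambda>_. borel)"
    unfolding ev_def using D T by (intro measurable_restrict eval_measurable_path) auto
  have id: "(\<lambda>w. w) \<in> vimage_algebra (space (path_space T)) ev (PiM D (\<lambda>_. borel)) \<rightarrow>\<^sub>M path_space T"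
    (is "_ \<in> ?V \<rightarrow>\<^sub>M _")
  proof (rule measurable_path_spaceI[OF T])
    fix t assume t: "t \<in> {0..T}"
    obtain k where k: "\<And>n. k n \<le> 2 ^ n" "(\<lambda>n. grid T n (k n)) \<longlonglongrightarrow> t" using grid_dense[OF T t] by blast
    show "(\<lambda>w. w t) \<in> borel_measurable ?V"
    proof (rule borel_measurable_LIMSEQ_real)
      fix w assume "w \<in> space ?V"
      then have "continuous_on {0..T} w" by (simp add: path_mem_iff)
      then show "(\<lambda>n. w (grid T n (k n))) \<longlonglongrightarrow> w t"
        using k t T grid_in[of T] unfolding continuous_on_sequentially by (auto simp: o_def)
    next
      fix n
      have "grid T n (k n) \<in> D" using k by (auto simp: D_def)
      have "ev \<in> space (path_space T) \<rightarrow> space (PiM D (\<lambda>_. borel :: real measure))"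
        using ev[THEN measurable_space] by blast
      from measurable_vimage_algebra1[OF this]
      have "(\<lambda>w. ev w (grid T n (k n))) \<in> borel_measurable ?V"
        by (rule measurable_compose[OF _ measurable_component_singleton[OF \<open>grid T n (k n) \<in> D\<close>]])
      then show "(\<lambda>w. w (grid T n (k n))) \<in> borel_measurable ?V"
        using \<open>grid T n (k n) \<in> D\<close> by (simp add: ev_def)
    qed
  qed simp
  have PD: "distr N1 (PiM D (\<lambda>_. borel)) ev = distr N2 (PiM D (\<lambda>_. borel)) ev"
  proof (rule measure_eqI_PiM_infinite)
    fix A :: "real \<Rightarrow> real set" and J
    assume J: "finite J" "J \<subseteq> D" and A: "\<And>i. i \<in> J \<Longrightarrow> A i \<in> sets borel"
    have "\<exists>n. J \<subseteq> grid T n ` {..2 ^ n}"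
      using J
    proof (induction J)
      case (insert x J)
      then obtain n m j where n: "J \<subseteq> grid T n ` {..2 ^ n}" and m: "x = grid T m j" "j \<le> 2 ^ m"
        by (auto simp: D_def)
      have *: "grid T n i \<in> grid T (n + m) ` {..2 ^ (n + m)}" if "i \<le> 2 ^ n" for i n m
        unfolding grid_refine[of T n m i, symmetric]
        by (rule imageI) (use that in \<open>simp add: power_add\<close>)
      have "insert x J \<subseteq> grid T (n + m) ` {..2 ^ (n + m)}"
      proof
        fix y assume "y \<in> insert x J"
        then consider "y = x" | "y \<in> J" by blast
        then show "y \<in> grid T (n + m) ` {..2 ^ (n + m)}"
        proof cases
          case 1 then show ?thesis using *[of j m n] m by (simp add: add.commute)
        next
          case 2
          with n obtain i where "y = grid T n i" "i \<le> 2 ^ n" by blast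
          then show ?thesis using *[of i n m] by simp
        qed
      qed
      then show ?case by blast
    qed auto
    then obtain n where n: "J \<subseteq> grid T n ` {..2 ^ n}" by (elim exE)
    define E where "E = prod_emb {..2 ^ n} (\<lambda>_. borel :: real measure) {k\<in>{..2 ^ n}. grid T n k \<in> J}
       (Pi\<^sub>E {k\<in>{..2 ^ n}. grid T n k \<in> J} (\<lambda>k. A (grid T n k)))"
    have E: "E \<in> sets (PiM {..2 ^ n} (\<lambda>_. borel))"
      unfolding E_def using A by (intro sets_PiM_I) auto
    have pe: "ev -` prod_emb D (\<lambda>_. borel) J (Pi\<^sub>E J A) \<inter> space (path_space T) =
        (\<lambda>w. \<lambda>k\<in>{..2 ^ n}. w (grid T n k)) -` E \<inter> space (path_space T)"
    proof -
      have "(ev w \<in> prod_emb D (\<lambda>_. borel) J (Pi\<^sub>E J A)) = (\<forall>j\<in>J. w j \<in> A j)" for w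
        using J(2) by (auto simp: prod_emb_iff ev_def PiE_iff subset_iff)
      moreover have "((\<lambda>k\<in>{..2 ^ n}. w (grid T n k)) \<in> E) = (\<forall>k\<in>{..2 ^ n}. grid T n k \<in> J \<longrightarrow> w (grid T n k) \<in> A (grid T n k))" for w
        unfolding E_def by (auto simp: prod_emb_iff PiE_iff)
      moreover have "(\<forall>k\<in>{..2 ^ n}. grid T n k \<in> J \<longrightarrow> w (grid T n k) \<in> A (grid T n k)) = (\<forall>j\<in>J. w j \<in> A j)" for w
        using n by blast
      ultimately show ?thesis by blast
    qed
    have m: "(\<lambda>w. \<lambda>k\<in>{..2 ^ n}. w (grid T n k)) \<in> path_space T \<rightarrow>\<^sub>M PiM {..2 ^ n} (\<lambda>_. borel)"
      using grid_in[of T] T by (intro measurable_restrict eval_measurable_path) auto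
    have pm: "prod_emb D (\<lambda>_. borel) J (Pi\<^sub>E J A) \<in> sets (PiM D (\<lambda>_. borel :: real measure))"
      using A J by (intro sets_PiM_I) auto
    have "emeasure (distr Ni (PiM D (\<lambda>_. borel)) ev) (prod_emb D (\<lambda>_. borel) J (Pi\<^sub>E J A)) =
      emeasure (distr Ni (PiM {..2 ^ n} (\<lambda>_. borel)) (\<lambda>w. \<lambda>k\<in>{..2 ^ n}. w (grid T n k))) E"
      if Ni: "sets Ni = sets (path_space T)" for Ni
    proof -
      have evi: "ev \<in> Ni \<rightarrow>\<^sub>M PiM D (\<lambda>_. borel)"
        using ev unfolding measurable_cong_sets[OF Ni refl] .
      have mi: "(\<lambda>w. \<lambda>k\<in>{..2 ^ n}. w (grid T n k)) \<in> Ni \<rightarrow>\<^sub>M PiM {..2 ^ n} (\<lambda>_. borel)"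
        using m unfolding measurable_cong_sets[OF Ni refl] .
      show ?thesis
        unfolding emeasure_distr[OF evi pm] emeasure_distr[OF mi E] sets_eq_imp_space_eq[OF Ni] pe ..
    qed
    from this[OF s1] this[OF s2] eq[of n]
    show "emeasure (distr N1 (PiM D (\<lambda>_. borel)) ev) (prod_emb D (\<lambda>_. borel) J (Pi\<^sub>E J A)) =
      emeasure (distr N2 (PiM D (\<lambda>_. borel)) ev) (prod_emb D (\<lambda>_. borel) J (Pi\<^sub>E J A))" by simp
  next
    show "finite_measure (distr N1 (PiM D (\<lambda>_. borel)) ev)"
      using ev measurable_cong_sets[OF s1 refl]
      by (intro prob_space.finite_measure prob_space.prob_space_distr N) auto
  qed auto
  show ?thesis
  proof (rule measure_eqI)
    fix A assume "A \<in> sets N1"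
    then have "A \<in> sets (path_space T)" by (simp add: s1)
    from measurable_sets[OF id this] obtain E
      where E: "E \<in> sets (PiM D (\<lambda>_. borel))" "A \<inter> space (path_space T) = ev -` E \<inter> space (path_space T)"
      by (auto simp: sets_vimage_algebra2 ev[THEN measurable_space])
    moreover have "A \<subseteq> space (path_space T)" using \<open>A \<in> sets (path_space T)\<close> by (rule sets.sets_into_space)
    ultimately have A: "A = ev -` E \<inter> space (path_space T)" by blast
    have "emeasure Ni A = emeasure (distr Ni (PiM D (\<lambda>_. borel)) ev) E"
      if Ni: "sets Ni = sets (path_space T)" for Ni
    proof -
      have evi: "ev \<in> Ni \<rightarrow>\<^sub>M PiM D (\<lambda>_. borel)"
        using ev unfolding measurable_cong_sets[OF Ni refl] .
      show ?thesis
        unfolding emeasure_distr[OF evi E(1)] sets_eq_imp_space_eq[OF Ni] A[symmetric] ..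
    qed
    from this[OF s1] this[OF s2] PD show "emeasure N1 A = emeasure N2 A" by simp
  qed (simp add: s1 s2)
qed

section \<open>Centred Gaussian measures\<close>

definition gauss :: "real \<Rightarrow> real measure" where
  "gauss v = density lborel (\<lambda>z. ennreal (normal_density 0 (sqrt v) z))"

lemma sets_gauss [simp, measurable_cong]: "sets (gauss v) = sets borel"
  by (simp add: gauss_def)

lemma space_gauss [simp]: "space (gauss v) = UNIV"
  by (simp add: gauss_def)

lemma measurable_gauss [simp]: "measurable (gauss v) N = measurable borel N"
  by (rule measurable_cong_sets) simp_all

lemma prob_space_gauss: "v > 0 \<Longrightarrow> prob_space (gauss v)"
  unfolding gauss_def by (rule prob_space_normal_density) simp

lemma gauss_eq_std:
  assumes "v > 0"
  shows "gauss v = distr std_normal_distribution borel (\<lambda>x. sqrt v * x)"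
proof -
  interpret prob_space std_normal_distribution by (rule prob_space_normal_density) simp
  have "distributed std_normal_distribution lborel (\<lambda>x. x) std_normal_density"
    by (auto simp: distributed_def distr_id2)
  from normal_density_affine[OF this, of "sqrt v" 0] assms
  have "distributed std_normal_distribution lborel (\<lambda>x. 0 + sqrt v * x) (normal_density 0 (sqrt v))"
    by simp
  then have "distr std_normal_distribution lborel (\<lambda>x. 0 + sqrt v * x) = gauss v"
    unfolding gauss_def by (rule distributed_distr_eq_density)
  moreover have "distr std_normal_distribution lborel (\<lambda>x. 0 + sqrt v * x) = distr std_normal_distribution borel (\<lambda>x. sqrt v * x)"
    by (rule distr_cong) auto
  ultimately show ?thesis by simp
qed

lemma char_gauss:
  assumes "v > 0"
  shows "char (gauss v) \<theta> = complex_of_real (exp (- (\<theta>\<^sup>2 * v) / 2))"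
proof -
  have "char (gauss v) \<theta> = char std_normal_distribution (\<theta> * sqrt v)"
    unfolding gauss_eq_std[OF assms] char_def
    by (subst integral_distr) (auto simp: ac_simps)
  then show ?thesis using assms
    by (simp add: char_std_normal_distribution power_mult_distrib)
qed

lemma gauss_cos:
  assumes "v > 0"
  shows "(LINT z|gauss v. cos (\<phi> + \<theta> * z)) = exp (- (\<theta>\<^sup>2 * v) / 2) * cos \<phi>"
proof -
  interpret prob_space "gauss v" using assms by (rule prob_space_gauss)
  have i: "integrable (gauss v) (\<lambda>z. iexp (\<theta> * z))"
    by (rule integrable_const_bound[where B = 1]) (simp_all, measurable)
  have "(LINT z|gauss v. cos (\<phi> + \<theta> * z)) = (LINT z|gauss v. Re (iexp \<phi> * iexp (\<theta> * z)))"
    by (intro Bochner_Integration.integral_cong refl)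
      (simp add: exp_add[symmetric] Re_exp distrib_left[symmetric])
  also have "\<dots> = Re (LINT z|gauss v. iexp \<phi> * iexp (\<theta> * z))"
    using i by (intro integral_Re) auto
  also have "(LINT z|gauss v. iexp \<phi> * iexp (\<theta> * z)) = iexp \<phi> * char (gauss v) \<theta>"
    unfolding char_def by (rule integral_mult_right_zero)
  finally show ?thesis by (simp add: char_gauss[OF assms] Re_exp)
qed

text \<open>Adding the constant 1 makes the oscillating function nonnegative, so that it can be handled by
  nonnegative integrals; these together with the mass still determine the characteristic function.\<close>

lemma gauss_nn_cos:
  assumes v: "v > 0" and \<kappa>: "\<bar>\<kappa>\<bar> \<le> 1"
  shows "(\<integral>\<^sup>+z. ennreal (1 + \<kappa> * cos (\<phi> + \<theta> * z)) \<partial>gauss v) = ennreal (1 + \<kappa> * exp (- (\<theta>\<^sup>2 * v) / 2) * cos \<phi>)"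
proof -
  interpret prob_space "gauss v" using v by (rule prob_space_gauss)
  have b: "\<bar>\<kappa> * cos y\<bar> \<le> 1" for y
    using \<kappa> abs_cos_le_one[of y] by (simp add: abs_mult mult_le_one)
  have i: "integrable (gauss v) (\<lambda>z. cos (\<phi> + \<theta> * z))"
    by (rule integrable_const_bound[where B = 1]) (simp_all, measurable)
  have "(\<integral>\<^sup>+z. ennreal (1 + \<kappa> * cos (\<phi> + \<theta> * z)) \<partial>gauss v) = ennreal (LINT z|gauss v. 1 + \<kappa> * cos (\<phi> + \<theta> * z))"
  proof (rule nn_integral_eq_integral)
    show "integrable (gauss v) (\<lambda>z. 1 + \<kappa> * cos (\<phi> + \<theta> * z))"
      using i by (intro Bochner_Integration.integrable_add) auto
    show "AE z in gauss v. 0 \<le> 1 + \<kappa> * cos (\<phi> + \<theta> * z)"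
      using b by (intro AE_I2) (smt (verit))
  qed
  also have "(LINT z|gauss v. 1 + \<kappa> * cos (\<phi> + \<theta> * z)) = 1 + \<kappa> * (exp (- (\<theta>\<^sup>2 * v) / 2) * cos \<phi>)"
    using i prob_space by (simp add: gauss_cos[OF v])
  finally show ?thesis by (simp add: ac_simps)
qed

text \<open>The Cameron--Martin formula on the line, by completing the square.\<close>

lemma gauss_shift:
  assumes v: "v > 0" and [measurable]: "f \<in> borel_measurable borel"
  shows "(\<integral>\<^sup>+z. ennreal (exp (c * z - c\<^sup>2 * v / 2)) * f (z - c * v) \<partial>gauss v) = (\<integral>\<^sup>+z. f z \<partial>gauss v)"
proof -
  let ?n = "normal_density 0 (sqrt v)"
  have e: "?n z * exp (c * z - c\<^sup>2 * v / 2) = ?n (z - c * v)" for z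
  proof -
    have "- z\<^sup>2 / (2 * v) + (c * z - c\<^sup>2 * v / 2) = - (z - c * v)\<^sup>2 / (2 * v)"
      using v by (simp add: field_simps power2_eq_square)
    then show ?thesis using v by (simp add: normal_density_def exp_add[symmetric])
  qed
  have "(\<integral>\<^sup>+z. ennreal (exp (c * z - c\<^sup>2 * v / 2)) * f (z - c * v) \<partial>gauss v)
      = (\<integral>\<^sup>+z. ennreal (?n z) * (ennreal (exp (c * z - c\<^sup>2 * v / 2)) * f (z - c * v)) \<partial>lborel)"
    unfolding gauss_def by (subst nn_integral_density) auto
  also have "\<dots> = (\<integral>\<^sup>+z. ennreal (?n (- (c * v) + z)) * f (- (c * v) + z) \<partial>lborel)"
    by (intro nn_integral_cong) (simp add: mult.assoc[symmetric] ennreal_mult'[symmetric] e)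
  also have "\<dots> = (\<integral>\<^sup>+z. ennreal (?n z) * f z \<partial>lborel)"
  proof -
    have "(\<integral>\<^sup>+z. ennreal (?n z) * f z \<partial>lborel) = (\<integral>\<^sup>+z. ennreal (?n z) * f z \<partial>distr lborel borel ((+) (- (c * v))))"
      by (simp add: lborel_distr_plus)
    also have "\<dots> = (\<integral>\<^sup>+z. ennreal (?n (- (c * v) + z)) * f (- (c * v) + z) \<partial>lborel)"
      by (subst nn_integral_distr) auto
    finally show ?thesis by simp
  qed
  also have "\<dots> = (\<integral>\<^sup>+z. f z \<partial>gauss v)"
    unfolding gauss_def by (subst nn_integral_density) auto
  finally show ?thesis .
qed

lemma gauss_exp:
  assumes v: "v > 0"
  shows "(\<integral>\<^sup>+z. ennreal (exp (u * z)) \<partial>gauss v) = ennreal (exp (u\<^sup>2 * v / 2))"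
proof -
  interpret prob_space "gauss v" using v by (rule prob_space_gauss)
  have "(\<integral>\<^sup>+z. ennreal (exp (u * z)) \<partial>gauss v)
     = (\<integral>\<^sup>+z. ennreal (exp (u\<^sup>2 * v / 2)) * (ennreal (exp (u * z - u\<^sup>2 * v / 2)) * 1) \<partial>gauss v)"
    by (intro nn_integral_cong) (simp add: ennreal_mult'[symmetric] exp_add[symmetric])
  also have "\<dots> = ennreal (exp (u\<^sup>2 * v / 2)) * (\<integral>\<^sup>+z. 1 \<partial>gauss v)"
    unfolding gauss_shift[OF v borel_measurable_const, of u 1, symmetric] by (rule nn_integral_cmult) (simp, measurable)
  finally show ?thesis by (simp add: emeasure_space_1[simplified])
qed

lemma gauss_square:
  assumes v: "v > 0"
  shows "(\<integral>\<^sup>+z. ennreal ((a + b * z)\<^sup>2) \<partial>gauss v) = ennreal (a\<^sup>2 + b\<^sup>2 * v)"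
proof -
  interpret S: prob_space std_normal_distribution by (rule prob_space_normal_density) simp
  have d: "integrable std_normal_distribution (\<lambda>x. x ^ k :: real)" for k
    by (subst integrable_real_density) (use integrable_std_normal_moment[of k] in \<open>auto simp: \<close>)
  have m1: "(LINT x|std_normal_distribution. x) = 0"
    using integral_std_normal_moment_odd[of 0] by (subst integral_real_density) auto
  have m2: "(LINT x|std_normal_distribution. x\<^sup>2) = 1"
    using integral_std_normal_moment_even[of 1] by (subst integral_real_density) (auto simp: fact_numeral)
  have i1: "integrable std_normal_distribution (\<lambda>x. x :: real)" using d[of 1] by simp
  have "(\<integral>\<^sup>+z. ennreal ((a + b * z)\<^sup>2) \<partial>gauss v) = (\<integral>\<^sup>+z. ennreal ((a + b * (sqrt v * z))\<^sup>2) \<partial>std_normal_distribution)"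
    unfolding gauss_eq_std[OF v] by (subst nn_integral_distr) auto
  also have "\<dots> = (\<integral>\<^sup>+z. ennreal (a\<^sup>2 + 2 * a * b * sqrt v * z + b\<^sup>2 * v * z\<^sup>2) \<partial>std_normal_distribution)"
    using v by (intro nn_integral_cong arg_cong[where f = ennreal])
      (simp add: power2_eq_square algebra_simps flip: real_sqrt_mult)
  also have "\<dots> = ennreal (LINT z|std_normal_distribution. a\<^sup>2 + 2 * a * b * sqrt v * z + b\<^sup>2 * v * z\<^sup>2)"
  proof (rule nn_integral_eq_integral)
    show "integrable std_normal_distribution (\<lambda>z. a\<^sup>2 + 2 * a * b * sqrt v * z + b\<^sup>2 * v * z\<^sup>2)"
      using d[of 2] i1 by (intro Bochner_Integration.integrable_add integrable_mult_right) auto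
    have "a\<^sup>2 + 2 * a * b * sqrt v * z + b\<^sup>2 * v * z\<^sup>2 = (a + b * (sqrt v * z))\<^sup>2" for z
      using v by (simp add: power2_eq_square algebra_simps flip: real_sqrt_mult)
    then show "AE z in std_normal_distribution. 0 \<le> a\<^sup>2 + 2 * a * b * sqrt v * z + b\<^sup>2 * v * z\<^sup>2" by simp
  qed
  also have "(LINT z|std_normal_distribution. a\<^sup>2 + 2 * a * b * sqrt v * z + b\<^sup>2 * v * z\<^sup>2)
      = (LINT z|std_normal_distribution. a\<^sup>2) + (LINT z|std_normal_distribution. 2 * a * b * sqrt v * z)
        + (LINT z|std_normal_distribution. b\<^sup>2 * v * z\<^sup>2)"
    using d[of 2] i1 by (subst Bochner_Integration.integral_add | simp only: Bochner_Integration.integrable_add integrable_mult_right S.integrable_const refl)+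
  also have "\<dots> = a\<^sup>2 + b\<^sup>2 * v"
    using m1 m2 S.prob_space by simp
  finally show ?thesis .
qed

section \<open>Brownian motion on the dyadic grids\<close>

text \<open>Only the increments over the cells of the dyadic grids are controlled, so that a change of
  measure has to be analysed on the grids alone; by continuity of the paths the law of \<open>B\<close> is
  still that of Brownian motion.\<close>

locale dyadic_bm = prob_space M for M :: "'a measure" +
  fixes T :: real and F :: "real \<Rightarrow> 'a measure" and B :: "real \<Rightarrow> 'a \<Rightarrow> real"
  assumes T_pos: "T > 0"
    and subalg: "\<And>t. t \<in> {0..T} \<Longrightarrow> subalgebra M (F t)"
    and F_mono: "\<And>s t. 0 \<le> s \<Longrightarrow> s \<le> t \<Longrightarrow> t \<le> T \<Longrightarrow> sets (F s) \<subseteq> sets (F t)"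
    and B_adapted: "\<And>t. t \<in> {0..T} \<Longrightarrow> B t \<in> borel_measurable (F t)"
    and B_cont: "\<And>\<omega>. \<omega> \<in> space M \<Longrightarrow> continuous_on {0..T} (\<lambda>t. B t \<omega>)"
    and B_0: "AE \<omega> in M. B 0 \<omega> = 0"
    and incr: "\<And>n k A C. k < 2 ^ n \<Longrightarrow> A \<in> sets (F (grid T n k)) \<Longrightarrow> C \<in> sets borel \<Longrightarrow>
      prob (A \<inter> {\<omega>\<in>space M. B (grid T n (Suc k)) \<omega> - B (grid T n k) \<omega> \<in> C})
        = prob A * measure (gauss (T / 2 ^ n)) C"
begin

abbreviation dB :: "nat \<Rightarrow> nat \<Rightarrow> 'a \<Rightarrow> real" where
  "dB n k \<omega> \<equiv> B (grid T n (Suc k)) \<omega> - B (grid T n k) \<omega>"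

lemma step_pos: "T / 2 ^ n > 0" using T_pos by simp

lemma grid_mem: "k \<le> 2 ^ n \<Longrightarrow> grid T n k \<in> {0..T}"
  using grid_in[of T k n] T_pos by simp

lemma space_F: "t \<in> {0..T} \<Longrightarrow> space (F t) = space M"
  using subalg by (auto simp: subalgebra_def)

lemma F_measurable_mono:
  assumes "f \<in> F s \<rightarrow>\<^sub>M N" "0 \<le> s" "s \<le> t" "t \<le> T"
  shows "f \<in> F t \<rightarrow>\<^sub>M N"
  using measurable_mono[of N N "F s" "F t"] F_mono[OF assms(2-4)] space_F[of s] space_F[of t] assms
  by auto

lemma F_measurable_M: "f \<in> F t \<rightarrow>\<^sub>M N \<Longrightarrow> t \<in> {0..T} \<Longrightarrow> f \<in> M \<rightarrow>\<^sub>M N"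
  using measurable_from_subalg subalg by blast

lemma F_measurable_grid:
  assumes "f \<in> F (grid T n j) \<rightarrow>\<^sub>M N" "j \<le> k" "k \<le> 2 ^ n"
  shows "f \<in> F (grid T n k) \<rightarrow>\<^sub>M N"
  by (rule F_measurable_mono[OF assms(1)])
    (use assms grid_mem[of j n] grid_mem[of k n] grid_mono[of T j k n] T_pos in auto)

lemma B_grid_measurable: "j \<le> k \<Longrightarrow> k \<le> 2 ^ n \<Longrightarrow> B (grid T n j) \<in> borel_measurable (F (grid T n k))"
  by (rule F_measurable_grid[OF B_adapted]) (use grid_mem[of j n] in auto)

lemma dB_measurable_F: "k < m \<Longrightarrow> m \<le> 2 ^ n \<Longrightarrow> dB n k \<in> borel_measurable (F (grid T n m))"
  using B_grid_measurable[of k m n] B_grid_measurable[of "Suc k" m n] by auto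

lemma dB_measurable: "k < 2 ^ n \<Longrightarrow> dB n k \<in> borel_measurable M"
  using F_measurable_M[OF dB_measurable_F[of k "2^n" n]] T_pos by simp

text \<open>Independence of the past, from events to random variables \<open>V\<close>: measurable rectangles generate the
  product.\<close>

lemma incr_product:
  assumes k: "k < 2 ^ n" and V: "V \<in> F (grid T n k) \<rightarrow>\<^sub>M N"
  shows "distr M N V \<Otimes>\<^sub>M gauss (T / 2 ^ n) = distr M (N \<Otimes>\<^sub>M borel) (\<lambda>\<omega>. (V \<omega>, dB n k \<omega>))"
proof (rule pair_measure_eqI)
  have t: "grid T n k \<in> {0..T}" using k by (intro grid_mem) auto
  have V': "V \<in> M \<rightarrow>\<^sub>M N" by (rule F_measurable_M[OF V t])
  interpret R: prob_space "distr M N V"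
    using V' by (rule prob_space_distr)
  interpret N: prob_space "gauss (T / 2 ^ n)" using step_pos by (rule prob_space_gauss)
  show "sigma_finite_measure (distr M N V)" ..
  show "sigma_finite_measure (gauss (T / 2 ^ n))" ..
  show "sets (distr M N V \<Otimes>\<^sub>M gauss (T / 2 ^ n)) =
      sets (distr M (N \<Otimes>\<^sub>M borel) (\<lambda>\<omega>. (V \<omega>, dB n k \<omega>)))"
    unfolding sets_distr by (rule sets_pair_measure_cong) auto
  fix A C assume "A \<in> sets (distr M N V)" and C: "C \<in> sets (gauss (T / 2 ^ n))"
  then have A: "A \<in> sets N" by simp
  have C': "C \<in> sets borel" using C by simp
  have m: "(\<lambda>\<omega>. (V \<omega>, dB n k \<omega>)) \<in> M \<rightarrow>\<^sub>M N \<Otimes>\<^sub>M borel"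
    using V' dB_measurable[OF k] by (rule measurable_Pair)
  have A': "V -` A \<inter> space M \<in> sets (F (grid T n k))"
    using measurable_sets[OF V A] by (simp add: space_F[OF t])
  have "emeasure (distr M (N \<Otimes>\<^sub>M borel) (\<lambda>\<omega>. (V \<omega>, dB n k \<omega>))) (A \<times> C)
     = emeasure M ((\<lambda>\<omega>. (V \<omega>, dB n k \<omega>)) -` (A \<times> C) \<inter> space M)"
    using A C' by (intro emeasure_distr[OF m]) auto
  also have "(\<lambda>\<omega>. (V \<omega>, dB n k \<omega>)) -` (A \<times> C) \<inter> space M
     = (V -` A \<inter> space M) \<inter> {\<omega>\<in>space M. dB n k \<omega> \<in> C}"
    by auto
  also have "emeasure M \<dots> = ennreal (prob (V -` A \<inter> space M)) * ennreal (measure (gauss (T / 2 ^ n)) C)"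
    unfolding emeasure_eq_measure incr[OF k A' C'] by (simp add: ennreal_mult)
  finally show "emeasure (distr M N V) A * emeasure (gauss (T / 2 ^ n)) C =
      emeasure (distr M (N \<Otimes>\<^sub>M borel) (\<lambda>\<omega>. (V \<omega>, dB n k \<omega>))) (A \<times> C)"
    by (simp add: emeasure_distr[OF V' A] emeasure_eq_measure N.emeasure_eq_measure)
qed

text \<open>Conditioning on the past amounts to integrating the next increment out.\<close>

lemma nn_integral_incr:
  assumes k: "k < 2 ^ n" and f: "f \<in> borel_measurable (F (grid T n k) \<Otimes>\<^sub>M borel)"
  shows "(\<integral>\<^sup>+\<omega>. f (\<omega>, dB n k \<omega>) \<partial>M) = (\<integral>\<^sup>+\<omega>. \<integral>\<^sup>+z. f (\<omega>, z) \<partial>gauss (T / 2 ^ n) \<partial>M)"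
proof -
  let ?F = "F (grid T n k)"
  have t: "grid T n k \<in> {0..T}" using k by (intro grid_mem) auto
  interpret N: prob_space "gauss (T / 2 ^ n)" using step_pos by (rule prob_space_gauss)
  have i: "(\<lambda>\<omega>. \<omega>) \<in> M \<rightarrow>\<^sub>M ?F" by (rule F_measurable_M[OF _ t]) simp
  have m: "(\<lambda>\<omega>. (\<omega>, dB n k \<omega>)) \<in> M \<rightarrow>\<^sub>M ?F \<Otimes>\<^sub>M borel"
    using i dB_measurable[OF k] by (rule measurable_Pair)
  have s: "sets (distr M ?F (\<lambda>\<omega>. \<omega>) \<Otimes>\<^sub>M gauss (T / 2 ^ n)) = sets (?F \<Otimes>\<^sub>M borel)"
    by (rule sets_pair_measure_cong) auto
  have f': "f \<in> borel_measurable (distr M ?F (\<lambda>\<omega>. \<omega>) \<Otimes>\<^sub>M gauss (T / 2 ^ n))"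
    using f unfolding measurable_cong_sets[OF s refl] .
  have f'': "f \<in> borel_measurable (?F \<Otimes>\<^sub>M gauss (T / 2 ^ n))"
    using f by (simp cong: measurable_cong_sets)
  have "(\<integral>\<^sup>+\<omega>. f (\<omega>, dB n k \<omega>) \<partial>M) = (\<integral>\<^sup>+p. f p \<partial>distr M (?F \<Otimes>\<^sub>M borel) (\<lambda>\<omega>. (\<omega>, dB n k \<omega>)))"
    by (rule nn_integral_distr[OF m, symmetric]) (use f in simp)
  also have "\<dots> = (\<integral>\<^sup>+\<omega>. \<integral>\<^sup>+z. f (\<omega>, z) \<partial>gauss (T / 2 ^ n) \<partial>distr M ?F (\<lambda>\<omega>. \<omega>))"
    unfolding incr_product[OF k measurable_ident_sets[OF refl], symmetric]
    by (rule N.nn_integral_fst[OF f', symmetric])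
  also have "\<dots> = (\<integral>\<^sup>+\<omega>. \<integral>\<^sup>+z. f (\<omega>, z) \<partial>gauss (T / 2 ^ n) \<partial>M)"
    using N.borel_measurable_nn_integral_fst[OF f''] by (intro nn_integral_distr[OF i]) simp
  finally show ?thesis .
qed

end

text \<open>The law of the first \<open>m\<close> steps of the Gaussian random walk with variance \<open>v\<close> per step.\<close>

primrec bm_vec :: "real \<Rightarrow> nat \<Rightarrow> (nat \<Rightarrow> real) measure" where
  "bm_vec v 0 = return (PiM {..0} (\<lambda>_. borel)) (\<lambda>k\<in>{..0}. 0)"
| "bm_vec v (Suc m) = distr (bm_vec v m \<Otimes>\<^sub>M gauss v) (PiM {..Suc m} (\<lambda>_. borel))
    (\<lambda>(u, z). \<lambda>k\<in>{..Suc m}. if k \<le> m then u k else u m + z)"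

context dyadic_bm
begin

lemma B_vec_measurable:
  assumes "m \<le> 2 ^ n"
  shows "(\<lambda>\<omega>. \<lambda>k\<in>{..m}. B (grid T n k) \<omega>) \<in> F (grid T n m) \<rightarrow>\<^sub>M PiM {..m} (\<lambda>_. borel)"
  using B_grid_measurable[OF _ assms] by (intro measurable_restrict) auto

lemma B_grid_law:
  "m \<le> 2 ^ n \<Longrightarrow> distr M (PiM {..m} (\<lambda>_. borel)) (\<lambda>\<omega>. \<lambda>k\<in>{..m}. B (grid T n k) \<omega>) = bm_vec (T / 2 ^ n) m"
proof (induction m)
  case 0
  have "distr M (PiM {..0} (\<lambda>_. borel)) (\<lambda>\<omega>. \<lambda>k\<in>{..0}. B (grid T n k) \<omega>)
     = distr M (PiM {..0} (\<lambda>_. borel)) (\<lambda>\<omega>. \<lambda>k\<in>{..0::nat}. 0 :: real)"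
  proof (rule distr_cong_AE)
    show "AE \<omega> in M. (\<lambda>k\<in>{..0}. B (grid T n k) \<omega>) = (\<lambda>k\<in>{..0::nat}. 0)"
      using B_0 by eventually_elim (auto simp: fun_eq_iff)
    show "(\<lambda>\<omega>. \<lambda>k\<in>{..0}. B (grid T n k) \<omega>) \<in> M \<rightarrow>\<^sub>M PiM {..0} (\<lambda>_. borel)"
      using F_measurable_M[OF B_vec_measurable[of 0 n]] T_pos by simp
  qed auto
  also have "\<dots> = return (PiM {..0} (\<lambda>_. borel)) (\<lambda>k\<in>{..0}. 0)"
    by (rule distr_const) (simp add: space_PiM)
  finally show ?case unfolding bm_vec.simps .
next
  case (Suc m)
  let ?V = "\<lambda>\<omega>. \<lambda>k\<in>{..m}. B (grid T n k) \<omega>"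
  let ?g = "\<lambda>(u :: nat \<Rightarrow> real, z :: real). \<lambda>k\<in>{..Suc m}. if k \<le> m then u k else u m + z"
  have m: "m < 2 ^ n" "m \<le> 2 ^ n" using Suc.prems by auto
  have V: "?V \<in> F (grid T n m) \<rightarrow>\<^sub>M PiM {..m} (\<lambda>_. borel)" using m by (intro B_vec_measurable) auto
  have V': "?V \<in> M \<rightarrow>\<^sub>M PiM {..m} (\<lambda>_. borel)" by (rule F_measurable_M[OF V grid_mem[OF m(2)]])
  have g: "?g \<in> PiM {..m} (\<lambda>_. borel) \<Otimes>\<^sub>M borel \<rightarrow>\<^sub>M PiM {..Suc m} (\<lambda>_. borel)"
    unfolding split_beta'
  proof (rule measurable_restrict)
    fix k assume "k \<in> {..Suc m}"
    have 1: "(\<lambda>p :: (nat \<Rightarrow> real) \<times> real. fst p j) \<in> borel_measurable (PiM {..m} (\<lambda>_. borel) \<Otimes>\<^sub>M borel)" if "j \<le> m" for j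
      by (rule measurable_compose[OF measurable_fst measurable_component_singleton]) (use that in simp)
    show "(\<lambda>p :: (nat \<Rightarrow> real) \<times> real. if k \<le> m then fst p k else fst p m + snd p) \<in> borel_measurable (PiM {..m} (\<lambda>_. borel) \<Otimes>\<^sub>M borel)"
      using 1[of k] borel_measurable_add[OF 1[of m] measurable_snd] by (cases "k \<le> m") simp_all
  qed
  have p: "(\<lambda>\<omega>. (?V \<omega>, dB n m \<omega>)) \<in> M \<rightarrow>\<^sub>M PiM {..m} (\<lambda>_. borel) \<Otimes>\<^sub>M borel"
    using V' dB_measurable[OF m(1)] by (rule measurable_Pair)
  have "bm_vec (T / 2 ^ n) (Suc m) = distr (distr M (PiM {..m} (\<lambda>_. borel) \<Otimes>\<^sub>M borel) (\<lambda>\<omega>. (?V \<omega>, dB n m \<omega>))) (PiM {..Suc m} (\<lambda>_. borel)) ?g"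
    unfolding bm_vec.simps Suc.IH[OF m(2), symmetric] incr_product[OF m(1) V] ..
  also have "\<dots> = distr M (PiM {..Suc m} (\<lambda>_. borel)) (?g \<circ> (\<lambda>\<omega>. (?V \<omega>, dB n m \<omega>)))"
    by (rule distr_distr[OF g p])
  also have "?g \<circ> (\<lambda>\<omega>. (?V \<omega>, dB n m \<omega>)) = (\<lambda>\<omega>. \<lambda>k\<in>{..Suc m}. B (grid T n k) \<omega>)"
    by (auto simp: fun_eq_iff restrict_def not_le dest!: Suc_leI dest: le_antisym)
  finally show ?case by simp
qed

lemma B_measurable: "t \<in> {0..T} \<Longrightarrow> B t \<in> borel_measurable M"
  using F_measurable_M B_adapted by blast

lemma path_of_B_measurable: "path_of T B \<in> M \<rightarrow>\<^sub>M path_space T"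
  by (rule path_of_measurable[OF T_pos B_measurable B_cont])

lemma path_law_B_grid:
  "distr (path_law T M B) (PiM {..2 ^ n} (\<lambda>_. borel)) (\<lambda>w. \<lambda>k\<in>{..2 ^ n}. w (grid T n k)) = bm_vec (T / 2 ^ n) (2 ^ n)"
proof -
  have m: "(\<lambda>w. \<lambda>k\<in>{..2 ^ n}. w (grid T n k)) \<in> path_space T \<rightarrow>\<^sub>M PiM {..2 ^ n} (\<lambda>_. borel)"
    using grid_mem T_pos by (intro measurable_restrict eval_measurable_path) auto
  have "distr (path_law T M B) (PiM {..2 ^ n} (\<lambda>_. borel)) (\<lambda>w. \<lambda>k\<in>{..2 ^ n}. w (grid T n k))
    = distr M (PiM {..2 ^ n} (\<lambda>_. borel)) ((\<lambda>w. \<lambda>k\<in>{..2 ^ n}. w (grid T n k)) \<circ> path_of T B)"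
    unfolding path_law_def by (rule distr_distr[OF m path_of_B_measurable])
  also have "(\<lambda>w. \<lambda>k\<in>{..2 ^ n}. w (grid T n k)) \<circ> path_of T B = (\<lambda>\<omega>. \<lambda>k\<in>{..2 ^ n}. B (grid T n k) \<omega>)"
    using grid_mem by (force simp: fun_eq_iff path_of_def restrict_def)
  also have "distr M (PiM {..2 ^ n} (\<lambda>_. borel)) \<dots> = bm_vec (T / 2 ^ n) (2 ^ n)"
    by (rule B_grid_law) simp
  finally show ?thesis .
qed

end

lemma dyadic_bm_law_unique:
  assumes "dyadic_bm M1 T F1 B1" "dyadic_bm M2 T F2 B2"
  shows "path_law T M1 B1 = path_law T M2 B2"
proof -
  interpret b1: dyadic_bm M1 T F1 B1 by fact
  interpret b2: dyadic_bm M2 T F2 B2 by fact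
  show ?thesis
  proof (rule path_law_eqI[OF b1.T_pos])
    show "prob_space (path_law T M1 B1)" "prob_space (path_law T M2 B2)"
      unfolding path_law_def by (intro b1.prob_space_distr b1.path_of_B_measurable b2.prob_space_distr b2.path_of_B_measurable)+
  qed (simp_all add: b1.path_law_B_grid b2.path_law_B_grid, simp_all add: path_law_def)
qed

section \<open>Averages over the cells of a dyadic grid\<close>

lemma set_integrable_bounded:
  fixes f :: "real \<Rightarrow> real"
  assumes "f \<in> borel_measurable borel" "A \<in> sets borel" "A \<subseteq> {a..b}" "\<And>s. s \<in> A \<Longrightarrow> \<bar>f s\<bar> \<le> K"
  shows "set_integrable lborel A f"
  unfolding set_integrable_def
proof (rule integrableI_bounded_set_indicator[where B = K])
  have "emeasure lborel A \<le> emeasure lborel {a..b}" using assms by (intro emeasure_mono) auto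
  also have "\<dots> < \<infinity>" by (simp add: emeasure_lborel_Icc_eq)
  finally show "emeasure lborel A < \<infinity>" .
qed (use assms in auto)

text \<open>The index of the cell that contains \<open>s\<close>. The cells are open on the left; truncated subtraction puts
  the time 0, which lies in no cell, into the first one.\<close>

definition idx :: "real \<Rightarrow> nat \<Rightarrow> real \<Rightarrow> nat" where
  "idx T n s = nat \<lceil>s * 2 ^ n / T\<rceil> - 1"

abbreviation cell :: "real \<Rightarrow> nat \<Rightarrow> nat \<Rightarrow> real set" where
  "cell T n k \<equiv> {grid T n k <.. grid T n (Suc k)}"

lemma idx_measurable [measurable]: "idx T n \<in> measurable borel (count_space UNIV)"
  unfolding idx_def by measurable

lemma idx_cell:
  assumes "T > 0" "s \<in> cell T n k"
  shows "idx T n s = k"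
proof -
  have "real k < s * 2 ^ n / T" "s * 2 ^ n / T \<le> real k + 1"
    using assms by (auto simp: grid_def field_simps)
  then have "\<lceil>s * 2 ^ n / T\<rceil> = int k + 1" by (simp add: ceiling_eq_iff)
  then show ?thesis by (simp add: idx_def nat_add_distrib)
qed

lemma mem_cell_idx:
  assumes T: "T > 0" and s: "s \<in> {0<..T}"
  shows "idx T n s < 2 ^ n" "s \<in> cell T n (idx T n s)"
proof -
  define y where "y = s * 2 ^ n / T"
  have y: "0 < y" "y \<le> 2 ^ n" using s T by (auto simp: y_def field_simps)
  define k where "k = idx T n s"
  have "\<lceil>y\<rceil> \<ge> 1" using y by linarith
  then have k: "int k = \<lceil>y\<rceil> - 1" unfolding k_def idx_def y_def[symmetric] by linarith
  have k2: "real k < y" "y \<le> real k + 1"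
    using k ceiling_correct[of y] by linarith+
  have "real k < 2 ^ n" using k2 y by linarith
  then show "idx T n s < 2 ^ n" unfolding k_def[symmetric] by (metis of_nat_less_iff of_nat_numeral of_nat_power)
  have "s = T * y / 2 ^ n" using T by (simp add: y_def)
  moreover have "T * real k < T * y" "T * y \<le> T * (real k + 1)" using k2 T by (simp_all del: distrib_left)
  ultimately show "s \<in> cell T n (idx T n s)" unfolding k_def[symmetric]
    by (simp add: grid_def divide_strict_right_mono divide_right_mono add.commute)
qed

lemma idx_0: "idx T n 0 = 0" by (simp add: idx_def)

lemma idx_less: "T > 0 \<Longrightarrow> s \<in> {0..T} \<Longrightarrow> idx T n s < 2 ^ n"
  using mem_cell_idx(1)[of T s n] by (cases "s = 0") (auto simp: idx_0)

lemma cell_subset: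
  assumes "T > 0" "k < 2 ^ n"
  shows "cell T n k \<subseteq> {0..T}"
  using grid_in[of T k n] grid_in[of T "Suc k" n] assms by auto

lemma cell_length [simp]: "T > 0 \<Longrightarrow> measure lborel (cell T n k) = T / 2 ^ n"
  by (simp add: grid_Suc)

lemma idx_refine:
  assumes T: "T > 0" and s: "s \<in> {0..T}"
  shows "idx T n s = idx T (n + p) s div 2 ^ p"
proof (cases "s = 0")
  case False
  then have s': "s \<in> {0<..T}" using s by auto
  define k where "k = idx T (n + p) s"
  have k: "s \<in> cell T (n + p) k" unfolding k_def by (rule mem_cell_idx[OF T s'])
  have "k div 2 ^ p * 2 ^ p \<le> k" "Suc k \<le> Suc (k div 2 ^ p) * 2 ^ p"
    using dividend_less_div_times[of "2^p" k] by simp_all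
  then have "grid T n (k div 2 ^ p) \<le> grid T (n + p) k" "grid T (n + p) (Suc k) \<le> grid T n (Suc (k div 2 ^ p))"
    unfolding grid_refine[of T n p, symmetric] using T by (intro grid_mono; simp)+
  then have "s \<in> cell T n (k div 2 ^ p)" using k by auto
  then show ?thesis using idx_cell[OF T] k_def by blast
qed (simp add: idx_0)

lemma set_integral_diff_Icc:
  fixes f :: "real \<Rightarrow> real"
  assumes "set_integrable lborel {0..b} f" "0 \<le> a" "a \<le> b"
  shows "(LINT s:{0..b}|lborel. f s) = (LINT s:{0..a}|lborel. f s) + (LINT s:{a<..b}|lborel. f s)"
proof -
  have "{0..b} = {0..a} \<union> {a<..b}" using assms by auto
  moreover have "set_integrable lborel {0..a} f" "set_integrable lborel {a<..b} f"
    using assms by (auto intro!: set_integrable_subset[OF assms(1)])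
  ultimately show ?thesis by (simp add: set_integral_Un Int_def)
qed

lemma set_integral_cells:
  fixes f :: "real \<Rightarrow> real"
  assumes T: "T > 0" and f: "set_integrable lborel {0..T} f"
  shows "m \<le> 2 ^ n \<Longrightarrow> (LINT s:{0..grid T n m}|lborel. f s) = (\<Sum>k<m. LINT s:cell T n k|lborel. f s)"
proof (induction m)
  case 0
  have "(LINT s:{0..0}|lborel. f s) = 0"
    unfolding set_lebesgue_integral_def
    by (rule integral_eq_zero_AE) (use AE_lborel_singleton[of "0::real"] in eventually_elim, simp)
  then show ?case by simp
next
  case (Suc m)
  have m: "grid T n m \<in> {0..T}" "grid T n (Suc m) \<in> {0..T}" "grid T n m \<le> grid T n (Suc m)"
    using grid_in[of T m n] grid_in[of T "Suc m" n] grid_mono[of T m "Suc m" n] Suc.prems T by auto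
  have "set_integrable lborel {0..grid T n (Suc m)} f"
    using m by (intro set_integrable_subset[OF f]) auto
  from set_integral_diff_Icc[OF this, of "grid T n m"] m Suc show ?case by simp
qed

lemma set_integral_cells_T:
  fixes f :: "real \<Rightarrow> real"
  assumes T: "T > 0" and f: "set_integrable lborel {0..T} f"
  shows "(LINT s:{0..T}|lborel. f s) = (\<Sum>k<2^n. LINT s:cell T n k|lborel. f s)"
  using set_integral_cells[OF assms, of "2^n" n] by simp

lemma measurable_idx [measurable]: "(\<lambda>s. \<phi> (idx T n s)) \<in> borel_measurable borel"
  by (rule measurable_compose[OF idx_measurable]) simp

lemma set_integrable_idx:
  fixes \<phi> :: "nat \<Rightarrow> real"
  assumes T: "T > 0"
  shows "set_integrable lborel {0..T} (\<lambda>s. \<phi> (idx T n s))"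
proof (rule set_integrable_bounded[where K = "\<Sum>k<2^n. \<bar>\<phi> k\<bar>" and a = 0 and b = T])
  fix s assume "s \<in> {0..T}"
  then show "\<bar>\<phi> (idx T n s)\<bar> \<le> (\<Sum>k<2^n. \<bar>\<phi> k\<bar>)"
    using idx_less[OF T] by (intro member_le_sum) auto
qed auto

lemma sum_grid_integral:
  fixes \<phi> :: "nat \<Rightarrow> real"
  assumes T: "T > 0"
  shows "(\<Sum>k<2^n. \<phi> k * (T / 2 ^ n)) = (LINT s:{0..T}|lborel. \<phi> (idx T n s))"
proof -
  have "(LINT s:cell T n k|lborel. \<phi> (idx T n s)) = \<phi> k * (T / 2 ^ n)" for k
  proof -
    have "(LINT s:cell T n k|lborel. \<phi> (idx T n s)) = (LINT s:cell T n k|lborel. \<phi> k)"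
      by (rule set_lebesgue_integral_cong) (use idx_cell[OF T] in auto)
    then show ?thesis using T by (simp add: set_integral_const grid_Suc mult.commute)
  qed
  then show ?thesis using set_integral_cells_T[OF T set_integrable_idx[OF T], of \<phi> n n] by simp
qed

text \<open>The average over the preceding cell, so that it is known at the start of the present one.\<close>

definition cavg :: "(real \<Rightarrow> real) \<Rightarrow> real \<Rightarrow> nat \<Rightarrow> nat \<Rightarrow> real" where
  "cavg f T n k = (if k = 0 then 0 else (LINT s:cell T n (k - 1)|lborel. f s) / (T / 2 ^ n))"

context
  fixes f :: "real \<Rightarrow> real" and T K :: real
  assumes T: "T > 0" and f [measurable]: "f \<in> borel_measurable borel" and K: "\<And>s. \<bar>f s\<bar> \<le> K"
begin

lemma bounded_set_integrable: "A \<in> sets borel \<Longrightarrow> A \<subseteq> {a..b} \<Longrightarrow> set_integrable lborel A f"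
  using K f by (intro set_integrable_bounded) auto

lemma bounded_set_integrable_cell: "set_integrable lborel (cell T n k) f"
  by (rule bounded_set_integrable[where a = "grid T n k" and b = "grid T n (Suc k)"]) auto

lemma cavg_bound: "\<bar>cavg f T n k\<bar> \<le> K"
proof (cases k)
  case (Suc j)
  have "\<bar>LINT s:cell T n j|lborel. f s\<bar> \<le> (LINT s:cell T n j|lborel. \<bar>f s\<bar>)"
    using set_integral_norm_bound[OF bounded_set_integrable_cell] by simp
  also have "\<dots> \<le> (LINT s:cell T n j|lborel. K)"
    using K by (intro set_integral_mono set_integrable_abs bounded_set_integrable_cell)
       (auto intro!: set_integrable_bounded[where a = "grid T n j" and b = "grid T n (Suc j)" and K = K] order_trans[OF abs_ge_zero K])
  also have "\<dots> = K * (T / 2 ^ n)" using T by (simp add: set_integral_const grid_Suc mult.commute)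
  finally show ?thesis using Suc T by (simp add: cavg_def abs_mult field_simps)
qed (use K[of 0] in \<open>auto simp: cavg_def\<close>)

text \<open>Jensen's inequality: averaging does not increase the quadratic cost of a drift.\<close>

lemma cavg_square:
  "(cavg f T n (Suc k))\<^sup>2 * (T / 2 ^ n) \<le> (LINT s:cell T n k|lborel. (f s)\<^sup>2)"
proof -
  define c where "c = cavg f T n (Suc k)"
  have K2: "\<bar>(f s)\<^sup>2\<bar> \<le> K\<^sup>2" for s using power_mono[OF K abs_ge_zero, of s 2] by simp
  have i2: "set_integrable lborel (cell T n k) (\<lambda>s. (f s)\<^sup>2)"
    by (rule set_integrable_bounded[where a = "grid T n k" and b = "grid T n (Suc k)" and K = "K\<^sup>2"]) (use K2 in auto)
  have ic: "set_integrable lborel (cell T n k) (\<lambda>s. c\<^sup>2)"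
    by (rule set_integrable_bounded[where a = "grid T n k" and b = "grid T n (Suc k)" and K = "c\<^sup>2"]) auto
  have if1: "(LINT s:cell T n k|lborel. f s) = c * (T / 2 ^ n)"
    using T by (simp add: c_def cavg_def)
  have "0 \<le> (LINT s:cell T n k|lborel. (f s - c)\<^sup>2)"
    by (simp add: set_lebesgue_integral_def)
  also have "(LINT s:cell T n k|lborel. (f s - c)\<^sup>2) = (LINT s:cell T n k|lborel. ((f s)\<^sup>2 - 2 * c * f s) + c\<^sup>2)"
    by (simp add: power2_eq_square algebra_simps)
  also have "\<dots> = (LINT s:cell T n k|lborel. (f s)\<^sup>2) - 2 * c * (c * (T / 2 ^ n)) + c\<^sup>2 * (T / 2 ^ n)"
  proof -
    have "(LINT s:cell T n k|lborel. c\<^sup>2) = c\<^sup>2 * (T / 2 ^ n)"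
      using T by (simp add: set_integral_const grid_Suc mult.commute)
    then show ?thesis
      using i2 ic bounded_set_integrable_cell[of n k] if1 by (simp add: set_integral_add set_integral_diff)
  qed
  finally show ?thesis unfolding c_def[symmetric] by (simp add: power2_eq_square algebra_simps)
qed

text \<open>Averaging is a contraction in \<open>L\<^sup>1\<close>, so that its convergence has to be checked for continuous functions
  only.\<close>

lemma cavg_abs_sum:
  "(LINT s:{0..T}|lborel. \<bar>cavg f T n (idx T n s)\<bar>) \<le> (LINT s:{0..T}|lborel. \<bar>f s\<bar>)"
proof -
  have ia: "set_integrable lborel {0..T} (\<lambda>s. \<bar>f s\<bar>)"
    by (intro set_integrable_abs bounded_set_integrable[where a = 0 and b = T]) auto
  have 1: "\<bar>cavg f T n (Suc k)\<bar> * (T / 2 ^ n) \<le> (LINT s:cell T n k|lborel. \<bar>f s\<bar>)" for k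
    using set_integral_norm_bound[OF bounded_set_integrable_cell[of n k]] T by (simp add: cavg_def abs_mult)
  have nn: "0 \<le> (LINT s:cell T n k|lborel. \<bar>f s\<bar>)" for k by (simp add: set_lebesgue_integral_def)
  obtain N where N: "2 ^ n = Suc N" by (metis gr0_conv_Suc zero_less_numeral zero_less_power)
  have "(LINT s:{0..T}|lborel. \<bar>cavg f T n (idx T n s)\<bar>) = (\<Sum>k<2^n. \<bar>cavg f T n k\<bar> * (T / 2 ^ n))"
    using sum_grid_integral[OF T, of "\<lambda>k. \<bar>cavg f T n k\<bar>" n] by simp
  also have "\<dots> = (\<Sum>k<N. \<bar>cavg f T n (Suc k)\<bar> * (T / 2 ^ n))"
    unfolding N by (subst sum.lessThan_Suc_shift) (simp add: cavg_def)
  also have "\<dots> \<le> (\<Sum>k<N. LINT s:cell T n k|lborel. \<bar>f s\<bar>)"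
    using 1 by (intro sum_mono) auto
  also have "\<dots> \<le> (\<Sum>k<2^n. LINT s:cell T n k|lborel. \<bar>f s\<bar>)"
    using nn unfolding N by (intro sum_mono2) auto
  also have "\<dots> = (LINT s:{0..T}|lborel. \<bar>f s\<bar>)"
    by (rule set_integral_cells_T[OF T ia, symmetric])
  finally show ?thesis .
qed

lemma continuous_approx_L1:
  assumes e: "e > 0"
  obtains g where "continuous_on UNIV g" "\<And>s. \<bar>g s\<bar> \<le> K" "(LINT s:{0..T}|lborel. \<bar>f s - g s\<bar>) < e"
proof -
  have "f \<in> borel_measurable lebesgue" using f by (simp add: measurable_completion)
  then have "f measurable_on UNIV" by (rule lebesgue_measurable_imp_measurable_on) simp
  then obtain N g where N: "negligible N" and gc: "\<And>n. continuous_on UNIV (g n)"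
    and gl: "\<And>x. x \<notin> N \<Longrightarrow> (\<lambda>n. g n x) \<longlonglongrightarrow> f x"
    unfolding measurable_on_def by auto
  define h where "h n x = max (- K) (min K (g n x))" for n :: nat and x :: real
  have hc: "continuous_on UNIV (h n)" for n unfolding h_def by (intro continuous_intros gc)
  have [measurable]: "h n \<in> borel_measurable borel" for n by (rule borel_measurable_continuous_onI[OF hc])
  have K0: "K \<ge> 0" using K[of 0] by linarith
  have hb: "\<bar>h n x\<bar> \<le> K" for n x using K0 by (auto simp: h_def)
  have "(\<lambda>n. LINT s:{0..T}|lborel. \<bar>f s - h n s\<bar>) \<longlonglongrightarrow> (LINT s:{0..T}|lborel. 0)"
    unfolding set_lebesgue_integral_def
  proof (rule integral_dominated_convergence[where w = "\<lambda>s. indicator {0..T} s * (2 * K)"])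
    show "integrable lborel (\<lambda>s. indicator {0..T} s * (2 * K))"
      using set_integrable_bounded[of "\<lambda>_. 2 * K" "{0..T}" 0 T "\<bar>2 * K\<bar>"] by (simp add: set_integrable_def)
    have "AE x in lborel. x \<notin> N"
    proof -
      have "N \<in> null_sets lebesgue" using N by (simp add: negligible_iff_null_sets)
      then have "AE x in lebesgue. x \<notin> N" by (rule AE_not_in)
      then show ?thesis by (simp add: AE_completion_iff)
    qed
    then show "AE x in lborel. (\<lambda>i. indicator {0..T} x *\<^sub>R \<bar>f x - h i x\<bar>) \<longlonglongrightarrow> indicator {0..T} x *\<^sub>R 0"
    proof eventually_elim
      case (elim x)
      have "(\<lambda>i. h i x) \<longlonglongrightarrow> max (- K) (min K (f x))"
        unfolding h_def by (intro tendsto_intros gl elim)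
      moreover have "max (- K) (min K (f x)) = f x" using K[of x] by auto
      ultimately have "(\<lambda>i. \<bar>f x - h i x\<bar>) \<longlonglongrightarrow> \<bar>f x - f x\<bar>" by (intro tendsto_intros) simp
      then show ?case by (intro tendsto_scaleR tendsto_const) simp
    qed
    show "AE x in lborel. norm (indicator {0..T} x *\<^sub>R \<bar>f x - h i x\<bar>) \<le> indicator {0..T} x * (2 * K)" for i
    proof (intro AE_I2)
      fix x show "norm (indicator {0..T} x *\<^sub>R \<bar>f x - h i x\<bar>) \<le> indicator {0..T} x * (2 * K)"
        using K[of x] hb[of i x] by (auto simp: indicator_def)
    qed
  qed auto
  then have "(\<lambda>n. LINT s:{0..T}|lborel. \<bar>f s - h n s\<bar>) \<longlonglongrightarrow> 0" by simp
  then have "eventually (\<lambda>n. (LINT s:{0..T}|lborel. \<bar>f s - h n s\<bar>) < e) sequentially"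
    using e by (rule order_tendstoD(2))
  then obtain n where "(LINT s:{0..T}|lborel. \<bar>f s - h n s\<bar>) < e" by (auto simp: eventually_sequentially)
  with hc hb that show ?thesis by blast
qed

lemma cavg_continuous:
  assumes c: "continuous_on UNIV f" and s: "s \<in> {0<..T}"
  shows "(\<lambda>n. cavg f T n (idx T n s)) \<longlonglongrightarrow> f s"
proof (rule LIMSEQ_I)
  fix e :: real assume e: "e > 0"
  obtain d where d: "d > 0" "\<And>u. \<bar>u - s\<bar> < d \<Longrightarrow> \<bar>f u - f s\<bar> < e / 2"
    using c e unfolding continuous_on_iff by (metis UNIV_I dist_real_def half_gt_zero)
  have "(\<lambda>n. T * (1 / 2) ^ n) \<longlonglongrightarrow> T * 0" by (intro tendsto_intros LIMSEQ_power_zero) auto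
  moreover have "0 < min (d / 2) s" using d s by auto
  ultimately have "eventually (\<lambda>n. T * (1 / 2) ^ n < min (d / 2) s) sequentially"
    by (intro order_tendstoD(2)) auto
  then obtain N where N: "\<And>n. n \<ge> N \<Longrightarrow> T / 2 ^ n < min (d / 2) s"
    by (auto simp: eventually_sequentially power_one_over)
  show "\<exists>N. \<forall>n\<ge>N. norm (cavg f T n (idx T n s) - f s) < e"
  proof (intro exI allI impI)
    fix n assume n: "n \<ge> N"
    define k where "k = idx T n s"
    have sk: "s \<in> cell T n k" unfolding k_def by (rule mem_cell_idx[OF T s])
    have "k \<noteq> 0"
    proof
      assume "k = 0"
      then have "s \<le> T / 2 ^ n" using sk by (simp add: grid_def)
      then show False using N[OF n] by simp
    qed
    then obtain j where j: "k = Suc j" by (cases k) auto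
    have near: "\<bar>f u - f s\<bar> < e / 2" if "u \<in> cell T n j" for u
    proof (rule d(2))
      have "grid T n j < u" "u \<le> grid T n j + T / 2 ^ n" "grid T n j + T / 2 ^ n < s"
        "s \<le> grid T n j + T / 2 ^ n + T / 2 ^ n"
        using that sk unfolding j grid_Suc greaterThanAtMost_iff by blast+
      then show "\<bar>u - s\<bar> < d" using N[OF n] by linarith
    qed
    have i: "set_integrable lborel (cell T n j) (\<lambda>u. f u - f s)"
      by (rule set_integrable_bounded[where a = "grid T n j" and b = "grid T n (Suc j)" and K = "e/2"])
        (use near in \<open>auto intro: less_imp_le\<close>)
    have ic: "set_integrable lborel (cell T n j) (\<lambda>u. x)" for x :: real
      by (rule set_integrable_bounded[where a = "grid T n j" and b = "grid T n (Suc j)" and K = "\<bar>x\<bar>"]) auto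
    have "(LINT u:cell T n j|lborel. f u - f s) = (LINT u:cell T n j|lborel. f u) - (LINT u:cell T n j|lborel. f s)"
      by (rule set_integral_diff(2)[OF bounded_set_integrable_cell ic])
    also have "(LINT u:cell T n j|lborel. f s) = f s * (T / 2 ^ n)"
      using T by (simp add: set_integral_const grid_Suc mult.commute)
    finally have 0: "(LINT u:cell T n j|lborel. f u - f s) = (LINT u:cell T n j|lborel. f u) - f s * (T / 2 ^ n)" .
    have 1: "(cavg f T n k - f s) * (T / 2 ^ n) = (LINT u:cell T n j|lborel. f u - f s)"
      unfolding 0 using T by (simp add: cavg_def j field_simps)
    have "\<bar>LINT u:cell T n j|lborel. f u - f s\<bar> \<le> (LINT u:cell T n j|lborel. \<bar>f u - f s\<bar>)"
      using set_integral_norm_bound[OF i] by simp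
    also have "\<dots> \<le> (LINT u:cell T n j|lborel. e / 2)"
      by (intro set_integral_mono set_integrable_abs i ic) (use near in \<open>auto intro: less_imp_le\<close>)
    also have "\<dots> = e / 2 * (T / 2 ^ n)" using T by (simp add: set_integral_const grid_Suc mult.commute)
    finally have "\<bar>cavg f T n k - f s\<bar> * (T / 2 ^ n) \<le> e / 2 * (T / 2 ^ n)"
      unfolding 1[symmetric] using T by (simp add: abs_mult)
    moreover have "T / 2 ^ n > 0" using T by simp
    ultimately have "\<bar>cavg f T n k - f s\<bar> \<le> e / 2" by (rule mult_right_le_imp_le)
    then show "norm (cavg f T n (idx T n s) - f s) < e" using e by (simp add: k_def)
  qed
qed

end

lemma cavg_diff:
  assumes "T > 0" "f \<in> borel_measurable borel" "g \<in> borel_measurable borel"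
    "\<And>s. \<bar>f s\<bar> \<le> K" "\<And>s. \<bar>g s\<bar> \<le> K"
  shows "cavg (\<lambda>s. f s - g s) T n k = cavg f T n k - cavg g T n k"
proof (cases k)
  case (Suc j)
  have "(LINT s:cell T n j|lborel. f s - g s) = (LINT s:cell T n j|lborel. f s) - (LINT s:cell T n j|lborel. g s)"
    using assms by (intro set_integral_diff(2) bounded_set_integrable_cell) auto
  then show ?thesis using Suc by (simp add: cavg_def diff_divide_distrib left_diff_distrib)
qed (simp add: cavg_def)

lemma cavg_tendsto_L1:
  assumes T: "T > 0" and f [measurable]: "f \<in> borel_measurable borel" and K: "\<And>s. \<bar>f s\<bar> \<le> K"
  shows "(\<lambda>n. LINT s:{0..T}|lborel. \<bar>cavg f T n (idx T n s) - f s\<bar>) \<longlonglongrightarrow> 0"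
proof (rule LIMSEQ_I)
  fix e :: real assume e: "e > 0"
  obtain g where gc: "continuous_on UNIV g" and gK: "\<And>s. \<bar>g s\<bar> \<le> K"
    and fg: "(LINT s:{0..T}|lborel. \<bar>f s - g s\<bar>) < e / 3"
    using continuous_approx_L1[OF T f K, of "e/3"] e by auto
  have gm [measurable]: "g \<in> borel_measurable borel" by (rule borel_measurable_continuous_onI[OF gc])
  have [measurable]: "(\<lambda>s. cavg h T n (idx T n s)) \<in> borel_measurable borel" for h n by (rule measurable_idx)
  have d2: "\<bar>f s - g s\<bar> \<le> 2 * K" for s using K[of s] gK[of s] by linarith
  have K0: "K \<ge> 0" using K[of 0] by linarith
  have bi: "set_integrable lborel {0..T} h" if "h \<in> borel_measurable borel" "\<And>s. \<bar>h s\<bar> \<le> 2 * K" for h :: "real \<Rightarrow> real"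
    using that by (intro set_integrable_bounded[where a = 0 and b = T and K = "2 * K"]) auto
  have cb: "\<bar>cavg g T n k\<bar> \<le> K" "\<bar>cavg f T n k\<bar> \<le> K" for n k
    using cavg_bound[OF T gm gK] cavg_bound[OF T f K] by auto
  have "(\<lambda>n. LINT s:{0..T}|lborel. \<bar>cavg g T n (idx T n s) - g s\<bar>) \<longlonglongrightarrow> (LINT s:{0..T}|lborel. 0)"
    unfolding set_lebesgue_integral_def
  proof (rule integral_dominated_convergence[where w = "\<lambda>s. indicator {0..T} s * (2 * K)"])
    show "integrable lborel (\<lambda>s. indicator {0..T} s * (2 * K))"
      using set_integrable_bounded[of "\<lambda>_. 2 * K" "{0..T}" 0 T "\<bar>2 * K\<bar>"] by (simp add: set_integrable_def)
    have "AE x in lborel. x \<noteq> (0 :: real)" by (rule AE_lborel_singleton)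
    then show "AE x in lborel. (\<lambda>i. indicator {0..T} x *\<^sub>R \<bar>cavg g T i (idx T i x) - g x\<bar>) \<longlonglongrightarrow> indicator {0..T} x *\<^sub>R 0"
    proof eventually_elim
      case (elim x)
      show ?case
      proof (cases "x \<in> {0..T}")
        case True
        then have "(\<lambda>i. \<bar>cavg g T i (idx T i x) - g x\<bar>) \<longlonglongrightarrow> \<bar>g x - g x\<bar>"
          using elim by (intro tendsto_intros cavg_continuous[OF T gm gK gc]) auto
        then show ?thesis by (intro tendsto_scaleR tendsto_const) simp
      qed simp
    qed
    show "AE x in lborel. norm (indicator {0..T} x *\<^sub>R \<bar>cavg g T i (idx T i x) - g x\<bar>) \<le> indicator {0..T} x * (2 * K)" for i
    proof (intro AE_I2)
      fix x show "norm (indicator {0..T} x *\<^sub>R \<bar>cavg g T i (idx T i x) - g x\<bar>) \<le> indicator {0..T} x * (2 * K)"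
        using gK[of x] cb(1)[of i "idx T i x"] by (auto simp: indicator_def)
    qed
  qed auto
  then have "(\<lambda>n. LINT s:{0..T}|lborel. \<bar>cavg g T n (idx T n s) - g s\<bar>) \<longlonglongrightarrow> 0" by simp
  then have "eventually (\<lambda>n. (LINT s:{0..T}|lborel. \<bar>cavg g T n (idx T n s) - g s\<bar>) < e / 3) sequentially"
    using e by (intro order_tendstoD(2)) auto
  then obtain N where N: "\<And>n. n \<ge> N \<Longrightarrow> (LINT s:{0..T}|lborel. \<bar>cavg g T n (idx T n s) - g s\<bar>) < e / 3"
    by (auto simp: eventually_sequentially)
  show "\<exists>N. \<forall>n\<ge>N. norm ((LINT s:{0..T}|lborel. \<bar>cavg f T n (idx T n s) - f s\<bar>) - 0) < e"
  proof (intro exI allI impI)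
    fix n assume n: "n \<ge> N"
    let ?a = "\<lambda>s. cavg f T n (idx T n s)" and ?b = "\<lambda>s. cavg g T n (idx T n s)"
    have i1: "set_integrable lborel {0..T} (\<lambda>s. \<bar>?a s - ?b s\<bar>)"
      by (rule set_integrable_idx[OF T])
    have ab: "\<bar>?b s - g s\<bar> \<le> 2 * K" "\<bar>?a s - f s\<bar> \<le> 2 * K" for s
      using cb[of n "idx T n s"] gK[of s] K[of s] by linarith+
    have i2: "set_integrable lborel {0..T} (\<lambda>s. \<bar>?b s - g s\<bar>)" "set_integrable lborel {0..T} (\<lambda>s. \<bar>f s - g s\<bar>)"
      "set_integrable lborel {0..T} (\<lambda>s. \<bar>?a s - f s\<bar>)"
      by (rule bi; use ab d2 in simp)+
    have "(LINT s:{0..T}|lborel. \<bar>?a s - f s\<bar>) \<le> (LINT s:{0..T}|lborel. (\<bar>?a s - ?b s\<bar> + \<bar>?b s - g s\<bar>) + \<bar>f s - g s\<bar>)"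
      by (intro set_integral_mono set_integral_add(1) i1 i2) linarith
    also have "\<dots> = (LINT s:{0..T}|lborel. \<bar>?a s - ?b s\<bar>) + (LINT s:{0..T}|lborel. \<bar>?b s - g s\<bar>) + (LINT s:{0..T}|lborel. \<bar>f s - g s\<bar>)"
      by (simp add: set_integral_add i1 i2)
    also have "(LINT s:{0..T}|lborel. \<bar>?a s - ?b s\<bar>) \<le> (LINT s:{0..T}|lborel. \<bar>f s - g s\<bar>)"
      using cavg_abs_sum[OF T, of "\<lambda>s. f s - g s" "2 * K" n] d2 by (simp add: cavg_diff[OF T f gm K gK])
    finally have "(LINT s:{0..T}|lborel. \<bar>?a s - f s\<bar>) < e"
      using N[OF n] fg by linarith
    moreover have "0 \<le> (LINT s:{0..T}|lborel. \<bar>?a s - f s\<bar>)" by (simp add: set_lebesgue_integral_def)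
    ultimately show "norm ((LINT s:{0..T}|lborel. \<bar>?a s - f s\<bar>) - 0) < e" by simp
  qed
qed

section \<open>Girsanov's theorem for step functions\<close>

context dyadic_bm
begin

text \<open>One step of the change of measure: under the tilted measure the increment minus its drift
  is again an independent Gaussian.\<close>

lemma nn_integral_tilted_incr:
  assumes k: "k < 2 ^ n" and c [measurable]: "c \<in> borel_measurable (F (grid T n k))"
    and H [measurable]: "H \<in> borel_measurable (F (grid T n k))"
    and f [measurable]: "f \<in> borel_measurable (F (grid T n k) \<Otimes>\<^sub>M borel)"
  shows "(\<integral>\<^sup>+\<omega>. H \<omega> * ennreal (exp (c \<omega> * dB n k \<omega> - (c \<omega>)\<^sup>2 * (T / 2 ^ n) / 2)) *
            f (\<omega>, dB n k \<omega> - c \<omega> * (T / 2 ^ n)) \<partial>M)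
       = (\<integral>\<^sup>+\<omega>. H \<omega> * (\<integral>\<^sup>+z. f (\<omega>, z) \<partial>gauss (T / 2 ^ n)) \<partial>M)"
proof -
  let ?v = "T / 2 ^ n" and ?F = "F (grid T n k)"
  have sp: "space ?F = space M" using k by (intro space_F grid_mem) auto
  let ?g = "\<lambda>(\<omega>, z). H \<omega> * ennreal (exp (c \<omega> * z - (c \<omega>)\<^sup>2 * ?v / 2)) * f (\<omega>, z - c \<omega> * ?v)"
  have [measurable]: "(\<lambda>(\<omega>, z). f (\<omega>, z - c \<omega> * ?v)) \<in> borel_measurable (?F \<Otimes>\<^sub>M borel)"
  proof -
    have "(\<lambda>p. (fst p, snd p - c (fst p) * ?v)) \<in> ?F \<Otimes>\<^sub>M borel \<rightarrow>\<^sub>M ?F \<Otimes>\<^sub>M borel" by measurable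
    from measurable_compose[OF this f] show ?thesis by (simp add: split_beta')
  qed
  have g: "?g \<in> borel_measurable (?F \<Otimes>\<^sub>M borel)" by measurable
  have "(\<integral>\<^sup>+\<omega>. ?g (\<omega>, dB n k \<omega>) \<partial>M) = (\<integral>\<^sup>+\<omega>. \<integral>\<^sup>+z. ?g (\<omega>, z) \<partial>gauss ?v \<partial>M)"
    by (rule nn_integral_incr[OF k g])
  also have "\<dots> = (\<integral>\<^sup>+\<omega>. H \<omega> * (\<integral>\<^sup>+z. f (\<omega>, z) \<partial>gauss ?v) \<partial>M)"
  proof (rule nn_integral_cong)
    fix \<omega> assume "\<omega> \<in> space M"
    then have w: "\<omega> \<in> space ?F" by (simp add: sp)
    have [measurable]: "(\<lambda>z. f (\<omega>, z)) \<in> borel_measurable borel"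
      by (rule measurable_compose[OF measurable_Pair1'[OF w] f])
    have "(\<integral>\<^sup>+z. ?g (\<omega>, z) \<partial>gauss ?v)
       = (\<integral>\<^sup>+z. H \<omega> * (ennreal (exp (c \<omega> * z - (c \<omega>)\<^sup>2 * ?v / 2)) * f (\<omega>, z - c \<omega> * ?v)) \<partial>gauss ?v)"
      by (simp add: mult.assoc)
    also have "\<dots> = H \<omega> * (\<integral>\<^sup>+z. ennreal (exp (c \<omega> * z - (c \<omega>)\<^sup>2 * ?v / 2)) * f (\<omega>, z - c \<omega> * ?v) \<partial>gauss ?v)"
      by (rule nn_integral_cmult) simp
    also have "\<dots> = H \<omega> * (\<integral>\<^sup>+z. f (\<omega>, z) \<partial>gauss ?v)"
      by (subst gauss_shift[OF step_pos]) auto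
    finally show "(\<integral>\<^sup>+z. ?g (\<omega>, z) \<partial>gauss ?v) = H \<omega> * (\<integral>\<^sup>+z. f (\<omega>, z) \<partial>gauss ?v)" .
  qed
  finally show ?thesis by simp
qed

text \<open>The discrete Ito isometry.\<close>

lemma nn_integral_square_sum_incr:
  assumes d: "\<And>k. k < 2 ^ n \<Longrightarrow> d k \<in> borel_measurable (F (grid T n k))"
  shows "m \<le> 2 ^ n \<Longrightarrow> (\<integral>\<^sup>+\<omega>. ennreal ((\<Sum>k<m. d k \<omega> * dB n k \<omega>)\<^sup>2) \<partial>M)
     = (\<integral>\<^sup>+\<omega>. ennreal (\<Sum>k<m. (d k \<omega>)\<^sup>2 * (T / 2 ^ n)) \<partial>M)"
proof (induction m)
  case (Suc m)
  let ?v = "T / 2 ^ n" and ?F = "F (grid T n m)"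
  let ?S = "\<lambda>\<omega>. \<Sum>k<m. d k \<omega> * dB n k \<omega>"
  have m: "m < 2 ^ n" "m \<le> 2 ^ n" using Suc.prems by auto
  have S [measurable]: "?S \<in> borel_measurable ?F"
  proof (intro borel_measurable_sum borel_measurable_times)
    fix k assume "k \<in> {..<m}"
    then show "d k \<in> borel_measurable ?F" "dB n k \<in> borel_measurable ?F"
      using m by (auto intro!: dB_measurable_F F_measurable_grid[OF d, of k])
  qed
  have dm [measurable]: "d m \<in> borel_measurable ?F" using d m by auto
  have M: "d k \<in> borel_measurable M" if "k < 2 ^ n" for k
    using that by (intro F_measurable_M[OF d] grid_mem) auto
  have "?S \<in> borel_measurable M" by (rule F_measurable_M[OF S grid_mem[OF m(2)]])
  note [measurable] = this M[OF m(1)]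
  have sm [measurable]: "(\<lambda>\<omega>. \<Sum>k<m. (d k \<omega>)\<^sup>2 * ?v) \<in> borel_measurable M"
    using M m by (intro borel_measurable_sum) auto
  have "(\<integral>\<^sup>+\<omega>. ennreal ((\<Sum>k<Suc m. d k \<omega> * dB n k \<omega>)\<^sup>2) \<partial>M)
     = (\<integral>\<^sup>+\<omega>. (\<lambda>(\<omega>, z). ennreal ((?S \<omega> + d m \<omega> * z)\<^sup>2)) (\<omega>, dB n m \<omega>) \<partial>M)" by simp
  also have "\<dots> = (\<integral>\<^sup>+\<omega>. \<integral>\<^sup>+z. (\<lambda>(\<omega>, z). ennreal ((?S \<omega> + d m \<omega> * z)\<^sup>2)) (\<omega>, z) \<partial>gauss ?v \<partial>M)"
    by (rule nn_integral_incr[OF m(1)]) measurable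
  also have "\<dots> = (\<integral>\<^sup>+\<omega>. ennreal ((?S \<omega>)\<^sup>2) + ennreal ((d m \<omega>)\<^sup>2 * ?v) \<partial>M)"
    using T_pos by (simp add: gauss_square)
  also have "\<dots> = (\<integral>\<^sup>+\<omega>. ennreal ((?S \<omega>)\<^sup>2) \<partial>M) + (\<integral>\<^sup>+\<omega>. ennreal ((d m \<omega>)\<^sup>2 * ?v) \<partial>M)"
    by (rule nn_integral_add) measurable
  also have "\<dots> = (\<integral>\<^sup>+\<omega>. ennreal (\<Sum>k<m. (d k \<omega>)\<^sup>2 * ?v) \<partial>M) + (\<integral>\<^sup>+\<omega>. ennreal ((d m \<omega>)\<^sup>2 * ?v) \<partial>M)"
    by (simp only: Suc.IH[OF m(2)])
  also have "\<dots> = (\<integral>\<^sup>+\<omega>. ennreal (\<Sum>k<m. (d k \<omega>)\<^sup>2 * ?v) + ennreal ((d m \<omega>)\<^sup>2 * ?v) \<partial>M)"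
    by (rule nn_integral_add[symmetric]) measurable
  also have "\<dots> = (\<integral>\<^sup>+\<omega>. ennreal (\<Sum>k<Suc m. (d k \<omega>)\<^sup>2 * ?v) \<partial>M)"
    using T_pos by (intro nn_integral_cong) (simp add: sum_nonneg)
  finally show ?case .
qed simp

text \<open>Rewriting a sum over the coarse grid as one over the fine grid makes the two comparable by the
  isometry.\<close>

lemma sum_incr_refine:
  "(\<Sum>k<2^n. a k * dB n k \<omega>) = (\<Sum>k<2^(n+p). a (k div 2 ^ p) * dB (n + p) k \<omega>)"
proof -
  have "(\<Sum>k<2^(n+p). a (k div 2 ^ p) * dB (n + p) k \<omega>)
     = (\<Sum>i<2^n. \<Sum>k=i * 2^p..<i * 2^p + 2^p. a (k div 2 ^ p) * dB (n + p) k \<omega>)"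
    by (simp add: power_add sum.nat_group)
  also have "\<dots> = (\<Sum>i<2^n. a i * dB n i \<omega>)"
  proof (rule sum.cong[OF refl])
    fix i
    have "(\<Sum>k=i * 2^p..<i * 2^p + 2^p. a (k div 2 ^ p) * dB (n + p) k \<omega>)
       = (\<Sum>k=i * 2^p..<i * 2^p + 2^p. a i * dB (n + p) k \<omega>)"
    proof (rule sum.cong[OF refl])
      fix k assume "k \<in> {i * 2^p..<i * 2^p + 2^p}"
      then have "k div 2 ^ p = i" by (intro div_nat_eqI) (auto simp: mult.commute)
      then show "a (k div 2 ^ p) * dB (n + p) k \<omega> = a i * dB (n + p) k \<omega>" by simp
    qed
    also have "\<dots> = a i * (B (grid T (n + p) (i * 2^p + 2^p)) \<omega> - B (grid T (n + p) (i * 2^p)) \<omega>)"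
      by (simp add: sum_distrib_left[symmetric] sum_Suc_diff'[of _ _ "\<lambda>k. B (grid T (n + p) k) \<omega>"])
    also have "\<dots> = a i * dB n i \<omega>"
      using grid_refine[of T n p "Suc i"] grid_refine[of T n p i] by (simp add: add.commute)
    finally show "(\<Sum>k=i * 2^p..<i * 2^p + 2^p. a (k div 2 ^ p) * dB (n + p) k \<omega>) = a i * dB n i \<omega>" .
  qed
  finally show ?thesis by simp
qed

end

text \<open>Adaptedness is imposed on the integrated drift: only differences of the latter enter the averages
  over the cells.\<close>

locale bounded_drift = dyadic_bm M T F B
  for M :: "'a measure" and T F B +
  fixes \<gamma> :: "real \<Rightarrow> 'a \<Rightarrow> real" and K :: real
  assumes \<gamma>_joint [measurable]: "(\<lambda>(s, \<omega>). \<gamma> s \<omega>) \<in> borel_measurable (borel \<Otimes>\<^sub>M M)"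
    and \<gamma>_bound: "\<And>s \<omega>. \<omega> \<in> space M \<Longrightarrow> \<bar>\<gamma> s \<omega>\<bar> \<le> K"
    and \<gamma>_adapted: "\<And>t. t \<in> {0..T} \<Longrightarrow> (\<lambda>\<omega>. LINT s:{0..t}|lborel. \<gamma> s \<omega>) \<in> borel_measurable (F t)"
begin

definition drift :: "real \<Rightarrow> 'a \<Rightarrow> real" where
  "drift t \<omega> = (LINT s:{0..t}|lborel. \<gamma> s \<omega>)"

definition coef :: "nat \<Rightarrow> nat \<Rightarrow> 'a \<Rightarrow> real" where
  "coef n k \<omega> = cavg (\<lambda>s. \<gamma> s \<omega>) T n k"

definition logdens :: "nat \<Rightarrow> nat \<Rightarrow> 'a \<Rightarrow> real" where
  "logdens n m \<omega> = (\<Sum>k<m. coef n k \<omega> * dB n k \<omega> - (coef n k \<omega>)\<^sup>2 * (T / 2 ^ n) / 2)"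

lemma \<gamma>_borel: "\<omega> \<in> space M \<Longrightarrow> (\<lambda>s. \<gamma> s \<omega>) \<in> borel_measurable borel"
  using measurable_compose[OF measurable_Pair2' \<gamma>_joint] by simp

lemma K_nonneg: "K \<ge> 0"
  using \<gamma>_bound not_empty by (meson abs_ge_zero all_not_in_conv order_trans)

lemma \<gamma>_integrable:
  "\<omega> \<in> space M \<Longrightarrow> A \<in> sets borel \<Longrightarrow> A \<subseteq> {a..b} \<Longrightarrow> set_integrable lborel A (\<lambda>s. \<gamma> s \<omega>)"
  using \<gamma>_borel \<gamma>_bound by (intro set_integrable_bounded) auto

lemma drift_diff:
  assumes w: "\<omega> \<in> space M" and s: "0 \<le> s" "s \<le> t"
  shows "drift t \<omega> - drift s \<omega> = (LINT u:{s<..t}|lborel. \<gamma> u \<omega>)"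
  unfolding drift_def using set_integral_diff_Icc[OF \<gamma>_integrable[OF w, of "{0..t}" 0 t] s] by simp

lemma drift_lipschitz:
  assumes w: "\<omega> \<in> space M" and s: "0 \<le> s" "s \<le> t"
  shows "\<bar>drift t \<omega> - drift s \<omega>\<bar> \<le> K * (t - s)"
proof -
  have i: "set_integrable lborel {s<..t} (\<lambda>u. \<gamma> u \<omega>)"
    by (rule \<gamma>_integrable[OF w, of _ s t]) auto
  have "\<bar>LINT u:{s<..t}|lborel. \<gamma> u \<omega>\<bar> \<le> (LINT u:{s<..t}|lborel. \<bar>\<gamma> u \<omega>\<bar>)"
    using set_integral_norm_bound[OF i] by simp
  also have "\<dots> \<le> (LINT u:{s<..t}|lborel. K)"
    using \<gamma>_bound[OF w] K_nonneg
    by (intro set_integral_mono set_integrable_abs i set_integrable_bounded[where a = s and b = t and K = K]) auto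
  also have "\<dots> = K * (t - s)" using s by (simp add: set_integral_const mult.commute)
  finally show ?thesis unfolding drift_diff[OF assms] .
qed

lemma drift_continuous:
  assumes w: "\<omega> \<in> space M"
  shows "continuous_on {0..T} (\<lambda>t. drift t \<omega>)"
proof (rule lipschitz_on_continuous_on)
  show "K-lipschitz_on {0..T} (\<lambda>t. drift t \<omega>)"
  proof (rule lipschitz_onI)
    fix s t assume st: "s \<in> {0..T}" "t \<in> {0..T}"
    show "dist (drift s \<omega>) (drift t \<omega>) \<le> K * dist s t"
      using drift_lipschitz[OF w, of s t] drift_lipschitz[OF w, of t s] st
      by (cases "s \<le> t") (auto simp: dist_real_def abs_minus_commute)
  qed (rule K_nonneg)
qed

lemma coef_0 [simp]: "coef n 0 \<omega> = 0"
  by (simp add: coef_def cavg_def)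

lemma coef_Suc:
  assumes "\<omega> \<in> space M"
  shows "coef n (Suc k) \<omega> * (T / 2 ^ n) = drift (grid T n (Suc k)) \<omega> - drift (grid T n k) \<omega>"
proof -
  have "0 \<le> grid T n k" "grid T n k \<le> grid T n (Suc k)"
    using T_pos grid_mono[of T 0 k n] grid_mono[of T k "Suc k" n] by auto
  from drift_diff[OF assms this] show ?thesis using T_pos by (simp add: coef_def cavg_def)
qed

lemma drift_adapted: "t \<in> {0..T} \<Longrightarrow> drift t \<in> borel_measurable (F t)"
  using \<gamma>_adapted by (simp add: drift_def[abs_def])

lemma coef_measurable:
  assumes k: "k \<le> 2 ^ n"
  shows "coef n k \<in> borel_measurable (F (grid T n k))"
proof (cases k)
  case 0 then show ?thesis by (simp add: coef_def[abs_def] cavg_def)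
next
  case (Suc j)
  have sp: "space (F (grid T n k)) = space M" using k by (intro space_F grid_mem)
  have [measurable]: "drift (grid T n k) \<in> borel_measurable (F (grid T n k))"
    "drift (grid T n j) \<in> borel_measurable (F (grid T n k))"
    using drift_adapted[OF grid_mem[OF k]] F_measurable_grid[OF drift_adapted[OF grid_mem[of j n]], of k] k Suc by auto
  have "(\<lambda>\<omega>. (drift (grid T n k) \<omega> - drift (grid T n j) \<omega>) / (T / 2 ^ n)) \<in> borel_measurable (F (grid T n k))"
    by measurable
  then show ?thesis
    by (rule measurable_cong[THEN iffD1, rotated])
      (use coef_Suc[of _ n j] T_pos Suc sp in \<open>simp add: field_simps\<close>)
qed

lemma coef_measurable_M: "k \<le> 2 ^ n \<Longrightarrow> coef n k \<in> borel_measurable M"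
  by (rule F_measurable_M[OF coef_measurable grid_mem])

lemma coef_bound: "\<omega> \<in> space M \<Longrightarrow> \<bar>coef n k \<omega>\<bar> \<le> K"
  unfolding coef_def using T_pos \<gamma>_borel \<gamma>_bound by (intro cavg_bound) auto

lemma logdens_Suc:
  "logdens n (Suc m) \<omega> = logdens n m \<omega> + (coef n m \<omega> * dB n m \<omega> - (coef n m \<omega>)\<^sup>2 * (T / 2 ^ n) / 2)"
  by (simp add: logdens_def)

lemma logdens_measurable:
  assumes m: "m \<le> 2 ^ n"
  shows "logdens n m \<in> borel_measurable (F (grid T n m))"
  unfolding logdens_def
proof (rule borel_measurable_sum)
  fix k assume k: "k \<in> {..<m}"
  have [measurable]: "coef n k \<in> borel_measurable (F (grid T n m))" "dB n k \<in> borel_measurable (F (grid T n m))"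
    using k m by (auto intro!: dB_measurable_F F_measurable_grid[OF coef_measurable, of k])
  show "(\<lambda>\<omega>. coef n k \<omega> * dB n k \<omega> - (coef n k \<omega>)\<^sup>2 * (T / 2 ^ n) / 2) \<in> borel_measurable (F (grid T n m))"
    by measurable
qed

lemma logdens_measurable_M: "m \<le> 2 ^ n \<Longrightarrow> logdens n m \<in> borel_measurable M"
  by (rule F_measurable_M[OF logdens_measurable grid_mem])

lemma logdens_0 [simp]: "logdens n 0 \<omega> = 0" by (simp add: logdens_def)

text \<open>The exponentials form a martingale.\<close>

lemma nn_integral_logdens:
  assumes jk: "j \<le> k" "k \<le> 2 ^ n" and H: "H \<in> borel_measurable (F (grid T n j))"
  shows "(\<integral>\<^sup>+\<omega>. H \<omega> * ennreal (exp (logdens n k \<omega>)) \<partial>M) = (\<integral>\<^sup>+\<omega>. H \<omega> * ennreal (exp (logdens n j \<omega>)) \<partial>M)"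
  using jk
proof (induction k rule: dec_induct)
  case (step k)
  have k: "k < 2 ^ n" using step by auto
  interpret N: prob_space "gauss (T / 2 ^ n)" using step_pos by (rule prob_space_gauss)
  have [measurable]: "H \<in> borel_measurable (F (grid T n k))"
    using F_measurable_grid[OF H, of k] step by auto
  have [measurable]: "logdens n k \<in> borel_measurable (F (grid T n k))" using k by (intro logdens_measurable) auto
  have [measurable]: "coef n k \<in> borel_measurable (F (grid T n k))" using k by (intro coef_measurable) auto
  have "(\<integral>\<^sup>+\<omega>. H \<omega> * ennreal (exp (logdens n (Suc k) \<omega>)) \<partial>M)
    = (\<integral>\<^sup>+\<omega>. (H \<omega> * ennreal (exp (logdens n k \<omega>))) *
        ennreal (exp (coef n k \<omega> * dB n k \<omega> - (coef n k \<omega>)\<^sup>2 * (T / 2 ^ n) / 2)) * (\<lambda>_. 1) (\<omega>, dB n k \<omega> - coef n k \<omega> * (T / 2 ^ n)) \<partial>M)"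
    by (simp add: logdens_Suc exp_add ennreal_mult mult.assoc)
  also have "\<dots> = (\<integral>\<^sup>+\<omega>. (H \<omega> * ennreal (exp (logdens n k \<omega>))) * (\<integral>\<^sup>+z. 1 \<partial>gauss (T / 2 ^ n)) \<partial>M)"
    by (rule nn_integral_tilted_incr[OF k]) measurable
  also have "\<dots> = (\<integral>\<^sup>+\<omega>. H \<omega> * ennreal (exp (logdens n k \<omega>)) \<partial>M)"
    using N.emeasure_space_1 by simp
  finally show ?case using step by simp
qed simp

text \<open>Under the exponential density the recentred increments are Gaussian and independent of the
  past; the factor \<open>\<kappa>\<close> makes the statement amenable to induction on the number of steps.\<close>

lemma nn_integral_logdens_cos:
  assumes jk: "j \<le> k" "k \<le> 2 ^ n" and H: "H \<in> borel_measurable (F (grid T n j))" and \<kappa>: "\<bar>\<kappa>\<bar> \<le> 1"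
  shows "(\<integral>\<^sup>+\<omega>. H \<omega> * ennreal (exp (logdens n k \<omega>)) *
            ennreal (1 + \<kappa> * cos (\<phi> + \<theta> * (\<Sum>i=j..<k. dB n i \<omega> - coef n i \<omega> * (T / 2 ^ n)))) \<partial>M)
    = (\<integral>\<^sup>+\<omega>. H \<omega> * ennreal (exp (logdens n j \<omega>)) *
            ennreal (1 + \<kappa> * exp (- (\<theta>\<^sup>2 * (real (k - j) * (T / 2 ^ n))) / 2) * cos \<phi>) \<partial>M)"
  using jk \<kappa>
proof (induction k arbitrary: \<kappa> rule: dec_induct)
  case (step k)
  let ?v = "T / 2 ^ n"
  let ?S = "\<lambda>k \<omega>. \<Sum>i=j..<k. dB n i \<omega> - coef n i \<omega> * ?v"
  have k: "k < 2 ^ n" using step by auto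
  have [measurable]: "H \<in> borel_measurable (F (grid T n k))"
    using F_measurable_grid[OF H, of k] step by auto
  have [measurable]: "logdens n k \<in> borel_measurable (F (grid T n k))" using k by (intro logdens_measurable) auto
  have [measurable]: "coef n k \<in> borel_measurable (F (grid T n k))" using k by (intro coef_measurable) auto
  have [measurable]: "?S k \<in> borel_measurable (F (grid T n k))"
  proof (rule borel_measurable_sum)
    fix i assume i: "i \<in> {j..<k}"
    have [measurable]: "coef n i \<in> borel_measurable (F (grid T n k))" "dB n i \<in> borel_measurable (F (grid T n k))"
      using i k by (auto intro!: dB_measurable_F F_measurable_grid[OF coef_measurable, of i])
    show "(\<lambda>\<omega>. dB n i \<omega> - coef n i \<omega> * ?v) \<in> borel_measurable (F (grid T n k))" by measurable
  qed
  have S: "?S (Suc k) \<omega> = ?S k \<omega> + (dB n k \<omega> - coef n k \<omega> * ?v)" for \<omega>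
    using step by (simp add: sum.atLeastLessThan_Suc)
  let ?f = "\<lambda>(\<omega>, z). ennreal (1 + \<kappa> * cos ((\<phi> + \<theta> * ?S k \<omega>) + \<theta> * z))"
  let ?e = "exp (- (\<theta>\<^sup>2 * ?v) / 2)"
  have e: "\<bar>\<kappa> * ?e\<bar> \<le> 1"
  proof -
    have "?e \<le> 1" using T_pos by simp
    then show ?thesis using step.prems(2) by (simp add: abs_mult mult_le_one)
  qed
  have "(\<integral>\<^sup>+\<omega>. H \<omega> * ennreal (exp (logdens n (Suc k) \<omega>)) * ennreal (1 + \<kappa> * cos (\<phi> + \<theta> * ?S (Suc k) \<omega>)) \<partial>M)
    = (\<integral>\<^sup>+\<omega>. (H \<omega> * ennreal (exp (logdens n k \<omega>))) *
        ennreal (exp (coef n k \<omega> * dB n k \<omega> - (coef n k \<omega>)\<^sup>2 * ?v / 2)) * ?f (\<omega>, dB n k \<omega> - coef n k \<omega> * ?v) \<partial>M)"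
    unfolding S by (intro nn_integral_cong) (simp add: logdens_Suc exp_add ennreal_mult mult.assoc distrib_left add.assoc)
  also have "\<dots> = (\<integral>\<^sup>+\<omega>. (H \<omega> * ennreal (exp (logdens n k \<omega>))) * (\<integral>\<^sup>+z. ?f (\<omega>, z) \<partial>gauss ?v) \<partial>M)"
    by (rule nn_integral_tilted_incr[OF k]) measurable
  also have "\<dots> = (\<integral>\<^sup>+\<omega>. H \<omega> * ennreal (exp (logdens n k \<omega>)) * ennreal (1 + (\<kappa> * ?e) * cos (\<phi> + \<theta> * ?S k \<omega>)) \<partial>M)"
    using gauss_nn_cos[OF step_pos step.prems(2)] by simp
  also have "\<dots> = (\<integral>\<^sup>+\<omega>. H \<omega> * ennreal (exp (logdens n j \<omega>)) *
            ennreal (1 + (\<kappa> * ?e) * exp (- (\<theta>\<^sup>2 * (real (k - j) * ?v)) / 2) * cos \<phi>) \<partial>M)"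
    using step.prems e by (intro step.IH) auto
  also have "(\<kappa> * ?e) * exp (- (\<theta>\<^sup>2 * (real (k - j) * ?v)) / 2) = \<kappa> * exp (- (\<theta>\<^sup>2 * (real (Suc k - j) * ?v)) / 2)"
    using step by (simp add: exp_add[symmetric] Suc_diff_le distrib_right distrib_left add_divide_distrib)
  finally show ?case .
qed simp

text \<open>Given the past, one step contributes the factor \<open>exp (c\<^sup>2 v)\<close>, where \<open>c\<close> is the coefficient and \<open>v\<close> the
  variance of the increment.\<close>

lemma nn_integral_logdens_square:
  assumes \<delta>: "\<And>k \<omega>. k < 2 ^ n \<Longrightarrow> \<omega> \<in> space M \<Longrightarrow> (coef n k \<omega>)\<^sup>2 * (T / 2 ^ n) \<le> \<delta> k"
  shows "m \<le> 2 ^ n \<Longrightarrow> (\<integral>\<^sup>+\<omega>. ennreal ((exp (logdens n m \<omega>))\<^sup>2) \<partial>M) \<le> ennreal (exp (\<Sum>k<m. \<delta> k))"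
proof (induction m)
  case (Suc m)
  let ?v = "T / 2 ^ n"
  have m: "m < 2 ^ n" "m \<le> 2 ^ n" using Suc.prems by auto
  have [measurable]: "logdens n m \<in> borel_measurable (F (grid T n m))" using m by (intro logdens_measurable) auto
  have [measurable]: "coef n m \<in> borel_measurable (F (grid T n m))" using m by (intro coef_measurable) auto
  have [measurable]: "logdens n m \<in> borel_measurable M" using m by (intro logdens_measurable_M)
  have "(\<integral>\<^sup>+\<omega>. ennreal ((exp (logdens n (Suc m) \<omega>))\<^sup>2) \<partial>M)
     = (\<integral>\<^sup>+\<omega>. (\<lambda>(\<omega>, z). ennreal (exp (2 * logdens n m \<omega> - (coef n m \<omega>)\<^sup>2 * ?v)) * ennreal (exp (2 * coef n m \<omega> * z))) (\<omega>, dB n m \<omega>) \<partial>M)"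
    by (intro nn_integral_cong)
      (simp add: logdens_Suc exp_double[symmetric] ennreal_mult[symmetric] exp_add[symmetric] algebra_simps)
  also have "\<dots> = (\<integral>\<^sup>+\<omega>. \<integral>\<^sup>+z. (\<lambda>(\<omega>, z). ennreal (exp (2 * logdens n m \<omega> - (coef n m \<omega>)\<^sup>2 * ?v)) * ennreal (exp (2 * coef n m \<omega> * z))) (\<omega>, z) \<partial>gauss ?v \<partial>M)"
    by (rule nn_integral_incr[OF m(1)]) measurable
  also have "\<dots> = (\<integral>\<^sup>+\<omega>. ennreal (exp (2 * logdens n m \<omega> - (coef n m \<omega>)\<^sup>2 * ?v)) * ennreal (exp ((2 * coef n m \<omega>)\<^sup>2 * ?v / 2)) \<partial>M)"
    by (simp add: nn_integral_cmult gauss_exp[OF step_pos])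
  also have "\<dots> \<le> (\<integral>\<^sup>+\<omega>. ennreal (exp (\<delta> m)) * ennreal ((exp (logdens n m \<omega>))\<^sup>2) \<partial>M)"
  proof (rule nn_integral_mono)
    fix \<omega> assume w: "\<omega> \<in> space M"
    have "2 * logdens n m \<omega> - (coef n m \<omega>)\<^sup>2 * ?v + (2 * coef n m \<omega>)\<^sup>2 * ?v / 2 = 2 * logdens n m \<omega> + (coef n m \<omega>)\<^sup>2 * ?v"
      by (simp add: power_mult_distrib)
    also have "\<dots> \<le> \<delta> m + 2 * logdens n m \<omega>" using \<delta>[OF m(1) w] by simp
    finally show "ennreal (exp (2 * logdens n m \<omega> - (coef n m \<omega>)\<^sup>2 * ?v)) * ennreal (exp ((2 * coef n m \<omega>)\<^sup>2 * ?v / 2))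
      \<le> ennreal (exp (\<delta> m)) * ennreal ((exp (logdens n m \<omega>))\<^sup>2)"
      by (simp add: ennreal_mult[symmetric] exp_add[symmetric] exp_double[symmetric])
  qed
  also have "\<dots> = ennreal (exp (\<delta> m)) * (\<integral>\<^sup>+\<omega>. ennreal ((exp (logdens n m \<omega>))\<^sup>2) \<partial>M)"
    by (rule nn_integral_cmult) measurable
  also have "\<dots> \<le> ennreal (exp (\<delta> m)) * ennreal (exp (\<Sum>k<m. \<delta> k))"
    by (rule mult_left_mono[OF Suc.IH[OF m(2)]]) simp
  also have "\<dots> = ennreal (exp (\<Sum>k<Suc m. \<delta> k))"
    by (simp add: ennreal_mult[symmetric] exp_add[symmetric] add.commute)
  finally show ?case .
qed (simp add: emeasure_space_1)

end

section \<open>Two limit principles and a criterion for independence\<close>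

lemma integrable_of_square:
  fixes Z :: "'a \<Rightarrow> real"
  assumes "prob_space M" and [measurable]: "Z \<in> borel_measurable M" and "(\<integral>\<^sup>+\<omega>. ennreal ((Z \<omega>)\<^sup>2) \<partial>M) \<le> ennreal c"
  shows "integrable M Z" "integrable M (\<lambda>\<omega>. (Z \<omega>)\<^sup>2)"
proof -
  interpret prob_space M by fact
  have "(\<integral>\<^sup>+\<omega>. ennreal ((Z \<omega>)\<^sup>2) \<partial>M) < \<infinity>" using assms(3) by (rule order_le_less_trans) simp
  then show i: "integrable M (\<lambda>\<omega>. (Z \<omega>)\<^sup>2)" by (intro integrableI_bounded) auto
  have z: "\<bar>z\<bar> \<le> \<bar>1 + z\<^sup>2\<bar>" for z :: real
  proof -
    have "0 \<le> (\<bar>z\<bar> - 1)\<^sup>2" by simp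
    also have "(\<bar>z\<bar> - 1)\<^sup>2 = z\<^sup>2 - 2 * \<bar>z\<bar> + 1" by (simp add: power2_diff)
    finally show ?thesis by linarith
  qed
  show "integrable M Z"
  proof (rule Bochner_Integration.integrable_bound[of M "\<lambda>\<omega>. 1 + (Z \<omega>)\<^sup>2"])
    show "integrable M (\<lambda>\<omega>. 1 + (Z \<omega>)\<^sup>2)" using i by (intro Bochner_Integration.integrable_add) auto
  qed (use z in \<open>auto simp: real_norm_def\<close>)
qed

text \<open>Bounded second moments imply uniform integrability; the tails are cut off at a high level \<open>a\<close>.\<close>

lemma tendsto_integral_L2_bounded:
  fixes Y :: "nat \<Rightarrow> 'a \<Rightarrow> real"
  assumes "prob_space M"
    and Y [measurable]: "\<And>j. Y j \<in> borel_measurable M" and Z [measurable]: "Z \<in> borel_measurable M"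
    and lim: "AE \<omega> in M. (\<lambda>j. Y j \<omega>) \<longlonglongrightarrow> Z \<omega>"
    and bnd: "\<And>j. (\<integral>\<^sup>+\<omega>. ennreal ((Y j \<omega>)\<^sup>2) \<partial>M) \<le> ennreal c"
  shows "(\<integral>\<^sup>+\<omega>. ennreal ((Z \<omega>)\<^sup>2) \<partial>M) \<le> ennreal c"
    and "(\<lambda>j. LINT \<omega>|M. Y j \<omega>) \<longlonglongrightarrow> (LINT \<omega>|M. Z \<omega>)"
proof -
  interpret prob_space M by fact
  have "(\<integral>\<^sup>+\<omega>. ennreal ((Z \<omega>)\<^sup>2) \<partial>M) = (\<integral>\<^sup>+\<omega>. liminf (\<lambda>j. ennreal ((Y j \<omega>)\<^sup>2)) \<partial>M)"
  proof (rule nn_integral_cong_AE)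
    show "AE \<omega> in M. ennreal ((Z \<omega>)\<^sup>2) = liminf (\<lambda>j. ennreal ((Y j \<omega>)\<^sup>2))"
      using lim
    proof eventually_elim
      case (elim \<omega>)
      then have "(\<lambda>j. ennreal ((Y j \<omega>)\<^sup>2)) \<longlonglongrightarrow> ennreal ((Z \<omega>)\<^sup>2)"
        by (intro tendsto_ennrealI tendsto_power)
      then show ?case using lim_imp_Liminf[OF sequentially_bot] by metis
    qed
  qed
  also have "\<dots> \<le> liminf (\<lambda>j. \<integral>\<^sup>+\<omega>. ennreal ((Y j \<omega>)\<^sup>2) \<partial>M)"
    by (rule nn_integral_liminf) measurable
  also have "\<dots> \<le> ennreal c"
    using bnd by (intro order_trans[OF Liminf_mono Liminf_const[THEN eq_refl]]) auto
  finally show Z2: "(\<integral>\<^sup>+\<omega>. ennreal ((Z \<omega>)\<^sup>2) \<partial>M) \<le> ennreal c" .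
  note iZ = integrable_of_square[OF \<open>prob_space M\<close> Z Z2]
  note iY = integrable_of_square[OF \<open>prob_space M\<close> Y bnd]
  define c' where "c' = max c 0"
  have c': "ennreal c = ennreal c'" "c' \<ge> 0" by (auto simp: c'_def ennreal_neg max_def)
  have le: "(LINT \<omega>|M. (X \<omega>)\<^sup>2) \<le> c'" if "integrable M (\<lambda>\<omega>. (X \<omega>)\<^sup>2)" "(\<integral>\<^sup>+\<omega>. ennreal ((X \<omega>)\<^sup>2) \<partial>M) \<le> ennreal c" for X
    using that c' nn_integral_eq_integral[OF that(1)] by simp
  show "(\<lambda>j. LINT \<omega>|M. Y j \<omega>) \<longlonglongrightarrow> (LINT \<omega>|M. Z \<omega>)"
  proof (rule LIMSEQ_I)
    fix e :: real assume e: "e > 0"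
    define a where "a = (8 * c' + 1) / e"
    have a: "a > 0" using e c' by (simp add: a_def)
    have ac: "4 * c' / a \<le> e / 2"
    proof -
      have "8 * c' \<le> (8 * c' + 1) / e * e" using e by simp
      then show ?thesis using a e unfolding a_def[symmetric] by (simp add: field_simps)
    qed
    let ?W = "\<lambda>j \<omega>. Y j \<omega> - Z \<omega>"
    have W2: "(?W j \<omega>)\<^sup>2 \<le> 2 * (Y j \<omega>)\<^sup>2 + 2 * (Z \<omega>)\<^sup>2" for j \<omega>
      using zero_le_power2[of "Y j \<omega> + Z \<omega>"] by (simp add: power2_eq_square algebra_simps)
    have iW2: "integrable M (\<lambda>\<omega>. (?W j \<omega>)\<^sup>2)" for j
    proof (rule Bochner_Integration.integrable_bound)
      show "integrable M (\<lambda>\<omega>. 2 * (Y j \<omega>)\<^sup>2 + 2 * (Z \<omega>)\<^sup>2)"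
        using iY(2)[of j] iZ(2) by auto
      show "AE \<omega> in M. norm ((?W j \<omega>)\<^sup>2) \<le> norm (2 * (Y j \<omega>)\<^sup>2 + 2 * (Z \<omega>)\<^sup>2)"
        using W2 by (intro AE_I2) (smt (verit) real_norm_def zero_le_power2)
    qed measurable
    have EW2: "(LINT \<omega>|M. (?W j \<omega>)\<^sup>2) \<le> 4 * c'" for j
    proof -
      have "(LINT \<omega>|M. (?W j \<omega>)\<^sup>2) \<le> (LINT \<omega>|M. 2 * (Y j \<omega>)\<^sup>2 + 2 * (Z \<omega>)\<^sup>2)"
        using iW2 iY(2)[of j] iZ(2) W2 by (intro integral_mono) auto
      also have "\<dots> = 2 * (LINT \<omega>|M. (Y j \<omega>)\<^sup>2) + 2 * (LINT \<omega>|M. (Z \<omega>)\<^sup>2)"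
        using iY(2)[of j] iZ(2) by simp
      finally show ?thesis using le[OF iY(2)[of j] bnd[of j]] le[OF iZ(2) Z2] by linarith
    qed
    have imin: "integrable M (\<lambda>\<omega>. min \<bar>?W j \<omega>\<bar> a)" for j
      using a by (intro integrable_const_bound[where B = a]) auto
    have "(\<lambda>j. LINT \<omega>|M. min \<bar>?W j \<omega>\<bar> a) \<longlonglongrightarrow> (LINT \<omega>|M. 0)"
    proof (rule integral_dominated_convergence[where w = "\<lambda>_. a"])
      show "AE \<omega> in M. (\<lambda>j. min \<bar>?W j \<omega>\<bar> a) \<longlonglongrightarrow> 0"
        using lim
      proof eventually_elim
        case (elim \<omega>)
        then have "(\<lambda>j. min \<bar>?W j \<omega>\<bar> a) \<longlonglongrightarrow> min \<bar>Z \<omega> - Z \<omega>\<bar> a" by (intro tendsto_intros)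
        then show ?case using a by simp
      qed
    qed (use a in auto)
    then have "eventually (\<lambda>j. (LINT \<omega>|M. min \<bar>?W j \<omega>\<bar> a) < e / 2) sequentially"
      using e by (intro order_tendstoD(2)) auto
    then obtain N where N: "\<And>j. j \<ge> N \<Longrightarrow> (LINT \<omega>|M. min \<bar>?W j \<omega>\<bar> a) < e / 2"
      by (auto simp: eventually_sequentially)
    show "\<exists>N. \<forall>j\<ge>N. norm ((LINT \<omega>|M. Y j \<omega>) - (LINT \<omega>|M. Z \<omega>)) < e"
    proof (intro exI allI impI)
      fix j assume j: "j \<ge> N"
      have pt: "\<bar>?W j \<omega>\<bar> \<le> min \<bar>?W j \<omega>\<bar> a + (?W j \<omega>)\<^sup>2 / a" for \<omega>
      proof (cases "\<bar>?W j \<omega>\<bar> \<le> a")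
        case False
        then have "\<bar>?W j \<omega>\<bar> * a \<le> \<bar>?W j \<omega>\<bar> * \<bar>?W j \<omega>\<bar>" by (intro mult_left_mono) auto
        then have "\<bar>?W j \<omega>\<bar> \<le> (?W j \<omega>)\<^sup>2 / a" using a by (simp add: pos_le_divide_eq power2_eq_square)
        then show ?thesis using a by simp
      qed (use a in auto)
      have "\<bar>(LINT \<omega>|M. Y j \<omega>) - (LINT \<omega>|M. Z \<omega>)\<bar> = \<bar>LINT \<omega>|M. ?W j \<omega>\<bar>"
        using iY(1)[of j] iZ(1) by simp
      also have "\<dots> \<le> (LINT \<omega>|M. \<bar>?W j \<omega>\<bar>)" by (rule integral_abs_bound)
      also have "\<dots> \<le> (LINT \<omega>|M. min \<bar>?W j \<omega>\<bar> a + (?W j \<omega>)\<^sup>2 / a)"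
        using iY(1)[of j] iZ(1) imin[of j] iW2[of j] pt by (intro integral_mono) auto
      also have "\<dots> = (LINT \<omega>|M. min \<bar>?W j \<omega>\<bar> a) + (LINT \<omega>|M. (?W j \<omega>)\<^sup>2) / a"
        using imin[of j] iW2[of j] by simp
      also have "(LINT \<omega>|M. (?W j \<omega>)\<^sup>2) / a \<le> 4 * c' / a" using EW2[of j] a by (intro divide_right_mono) auto
      finally show "norm ((LINT \<omega>|M. Y j \<omega>) - (LINT \<omega>|M. Z \<omega>)) < e" using N[OF j] ac by simp
    qed
  qed
qed

text \<open>The sum of the absolute increments has finite mean, hence is finite almost surely.\<close>

lemma AE_convergent_of_summable_increments:
  fixes Y :: "nat \<Rightarrow> 'a \<Rightarrow> real"
  assumes [measurable]: "\<And>j. Y j \<in> borel_measurable M"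
    and b: "\<And>j. (\<integral>\<^sup>+\<omega>. ennreal \<bar>Y (Suc j) \<omega> - Y j \<omega>\<bar> \<partial>M) \<le> ennreal (a j)" and a: "summable a" "\<And>j. a j \<ge> 0"
  shows "AE \<omega> in M. convergent (\<lambda>j. Y j \<omega>)"
proof -
  have "(\<integral>\<^sup>+\<omega>. (\<Sum>j. ennreal \<bar>Y (Suc j) \<omega> - Y j \<omega>\<bar>) \<partial>M) = (\<Sum>j. \<integral>\<^sup>+\<omega>. ennreal \<bar>Y (Suc j) \<omega> - Y j \<omega>\<bar> \<partial>M)"
    by (rule nn_integral_suminf) measurable
  also have "\<dots> \<le> (\<Sum>j. ennreal (a j))" using b by (intro suminf_le) auto
  also have "\<dots> = ennreal (\<Sum>j. a j)" using a by (intro suminf_ennreal2) auto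
  finally have "(\<integral>\<^sup>+\<omega>. (\<Sum>j. ennreal \<bar>Y (Suc j) \<omega> - Y j \<omega>\<bar>) \<partial>M) \<noteq> \<infinity>"
    by (metis ennreal_neq_top infinity_ennreal_def neq_top_trans)
  then have "AE \<omega> in M. (\<Sum>j. ennreal \<bar>Y (Suc j) \<omega> - Y j \<omega>\<bar>) \<noteq> \<infinity>"
    by (intro nn_integral_PInf_AE) auto
  then show ?thesis
  proof eventually_elim
    case (elim \<omega>)
    then have "summable (\<lambda>j. \<bar>Y (Suc j) \<omega> - Y j \<omega>\<bar>)"
      by (intro summable_suminf_not_top) auto
    then have "summable (\<lambda>j. Y (Suc j) \<omega> - Y j \<omega>)" by (rule summable_rabs_cancel)
    then have "convergent (\<lambda>n. \<Sum>j<n. Y (Suc j) \<omega> - Y j \<omega>)" by (simp add: summable_iff_convergent)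
    then have "convergent (\<lambda>n. Y n \<omega> - Y 0 \<omega>)"
      unfolding sum_lessThan_telescope[of "\<lambda>j. Y j \<omega>"] .
    from convergent_add[OF this convergent_const[of "Y 0 \<omega>"]] show ?case by simp
  qed
qed

text \<open>The phases \<open>0\<close> and \<open>- \<pi> / 2\<close> yield the real and the imaginary part of the characteristic function of
  \<open>Y\<close> conditioned on \<open>A\<close>, and Levy's uniqueness theorem applies.\<close>

lemma indep_gauss_of_cos:
  assumes "prob_space Q" and A [measurable]: "A \<in> sets Q" and Y [measurable]: "Y \<in> borel_measurable Q" and v: "v > 0"
    and c: "\<And>\<theta> \<phi>. (LINT \<omega>|Q. indicator A \<omega> * cos (\<phi> + \<theta> * Y \<omega>)) = measure Q A * (exp (- (\<theta>\<^sup>2 * v) / 2) * cos \<phi>)"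
    and C: "C \<in> sets borel"
  shows "measure Q (A \<inter> {\<omega>\<in>space Q. Y \<omega> \<in> C}) = measure Q A * measure (gauss v) C"
proof -
  interpret prob_space Q by fact
  define a where "a = measure Q A"
  have AC: "A \<inter> {\<omega>\<in>space Q. Y \<omega> \<in> C} \<in> sets Q"
    using C by measurable
  show ?thesis
  proof (cases "a = 0")
    case True
    have "measure Q (A \<inter> {\<omega>\<in>space Q. Y \<omega> \<in> C}) \<le> a"
      unfolding a_def by (intro finite_measure_mono) auto
    then show ?thesis using True measure_nonneg[of Q] unfolding a_def by (simp add: order_antisym)
  next
    case False
    then have a: "a > 0" unfolding a_def by (simp add: zero_less_measure_iff)
    define g where "g \<omega> = indicator A \<omega> / a" for \<omega>
    have [measurable]: "g \<in> borel_measurable Q" unfolding g_def by measurable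
    have g0: "g \<omega> \<ge> 0" for \<omega> using a by (simp add: g_def)
    define N where "N = distr (density Q (\<lambda>\<omega>. ennreal (g \<omega>))) borel Y"
    have Nset: "emeasure N E = ennreal (measure Q (A \<inter> {\<omega>\<in>space Q. Y \<omega> \<in> E}) / a)" if [measurable]: "E \<in> sets borel" for E
    proof -
      have "emeasure N E = (\<integral>\<^sup>+\<omega>. ennreal (g \<omega>) * indicator (Y -` E \<inter> space Q) \<omega> \<partial>Q)"
        unfolding N_def using that by (simp add: emeasure_distr emeasure_density)
      also have "\<dots> = (\<integral>\<^sup>+\<omega>. ennreal (1 / a) * indicator (A \<inter> {\<omega>\<in>space Q. Y \<omega> \<in> E}) \<omega> \<partial>Q)"
        by (intro nn_integral_cong) (auto simp: g_def indicator_def)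
      also have "\<dots> = ennreal (1 / a) * emeasure Q (A \<inter> {\<omega>\<in>space Q. Y \<omega> \<in> E})"
        by (rule nn_integral_cmult_indicator) measurable
      also have "\<dots> = ennreal (measure Q (A \<inter> {\<omega>\<in>space Q. Y \<omega> \<in> E}) / a)"
        using a by (simp add: emeasure_eq_measure ennreal_mult[symmetric])
      finally show ?thesis .
    qed
    have N: "real_distribution N"
    proof -
      have A': "A \<inter> {\<omega>\<in>space Q. Y \<omega> \<in> UNIV} = A" using sets.sets_into_space[OF A] by auto
      have UNIV_borel: "(UNIV :: real set) \<in> sets borel" by simp
      have sp: "space N = UNIV" by (simp add: N_def)
      have "emeasure N (space N) = 1" unfolding sp Nset[OF UNIV_borel] A' a_def[symmetric]
        using a by simp
      then have "prob_space N" by (rule prob_spaceI)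
      then show ?thesis by (simp add: real_distribution_def real_distribution_axioms_def N_def)
    qed
    have G: "real_distribution (gauss v)"
      using prob_space_gauss[OF v] by (simp add: real_distribution_def real_distribution_axioms_def)
    have cs: "cos (- (pi / 2) + u) = sin u" for u :: real unfolding cos_add by simp
    have "char N = char (gauss v)"
    proof
      fix \<theta>
      have i: "integrable Q (\<lambda>\<omega>. g \<omega> *\<^sub>R iexp (\<theta> * Y \<omega>))"
        by (rule integrable_const_bound[where B = "1 / a"]) (use a in \<open>auto simp: g_def indicator_def\<close>)
      have ch: "char N \<theta> = (LINT \<omega>|Q. g \<omega> *\<^sub>R iexp (\<theta> * Y \<omega>))"
        unfolding char_def N_def using g0
        by (subst integral_distr) (auto simp: integral_density)
      have "Re (char N \<theta>) = (LINT \<omega>|Q. indicator A \<omega> * cos (0 + \<theta> * Y \<omega>)) / a"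
        unfolding ch integral_Re[OF i, symmetric]
        by (subst integral_divide_zero[symmetric]) (intro Bochner_Integration.integral_cong refl, simp add: g_def Re_exp)
      moreover have "Im (char N \<theta>) = (LINT \<omega>|Q. indicator A \<omega> * cos (- (pi / 2) + \<theta> * Y \<omega>)) / a"
        unfolding ch integral_Im[OF i, symmetric]
        by (subst integral_divide_zero[symmetric]) (intro Bochner_Integration.integral_cong refl, simp only: cs, simp add: g_def Im_exp)
      ultimately show "char N \<theta> = char (gauss v) \<theta>"
        using a unfolding c a_def[symmetric] char_gauss[OF v] by (intro complex_eqI) auto
    qed
    then have "N = gauss v" by (rule Levy_uniqueness[OF N G])
    then have "ennreal (measure (gauss v) C) = ennreal (measure Q (A \<inter> {\<omega>\<in>space Q. Y \<omega> \<in> C}) / a)"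
      using Nset[OF C] real_distribution.axioms(1)[OF G] by (simp add: prob_space.finite_measure finite_measure.emeasure_eq_measure)
    then have "measure (gauss v) C = measure Q (A \<inter> {\<omega>\<in>space Q. Y \<omega> \<in> C}) / a"
      using a by simp
    then show ?thesis using a by (simp add: a_def)
  qed
qed

section \<open>Girsanov's theorem for bounded drifts\<close>

context bounded_drift
begin

text \<open>The mean distance in \<open>L\<^sup>1\<close> between the drift and its discretisation.\<close>

definition err :: "nat \<Rightarrow> ennreal" where
  "err n = (\<integral>\<^sup>+\<omega>. ennreal (LINT s:{0..T}|lborel. \<bar>coef n (idx T n s) \<omega> - \<gamma> s \<omega>\<bar>) \<partial>M)"

lemma coef_idx_joint:
  "(\<lambda>(\<omega>, s). indicator {0..T} s * coef n (idx T n s) \<omega>) \<in> borel_measurable (M \<Otimes>\<^sub>M borel)"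
proof -
  have "(\<lambda>p. if idx T n (snd p) \<le> 2 ^ n then coef n (idx T n (snd p)) (fst p) else 0) \<in> borel_measurable (M \<Otimes>\<^sub>M borel)"
  proof (rule measurable_compose_countable[where g = "\<lambda>p. idx T n (snd p)" and f = "\<lambda>i p. if i \<le> 2 ^ n then coef n i (fst p) else 0"])
    fix i
    show "(\<lambda>p. if i \<le> 2 ^ n then coef n i (fst p) else 0) \<in> borel_measurable (M \<Otimes>\<^sub>M (borel :: real measure))"
      using coef_measurable_M[of i n] by (cases "i \<le> 2 ^ n") simp_all
  qed measurable
  moreover have "(\<lambda>p. indicator {0..T} (snd p) :: real) \<in> borel_measurable (M \<Otimes>\<^sub>M borel)" by measurable
  ultimately have "(\<lambda>p. indicator {0..T} (snd p) * (if idx T n (snd p) \<le> 2 ^ n then coef n (idx T n (snd p)) (fst p) else 0)) \<in> borel_measurable (M \<Otimes>\<^sub>M borel)"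
    by (intro borel_measurable_times)
  moreover have "(\<lambda>p. indicator {0..T} (snd p) * (if idx T n (snd p) \<le> 2 ^ n then coef n (idx T n (snd p)) (fst p) else 0))
    = (\<lambda>(\<omega>, s). indicator {0..T} s * coef n (idx T n s) \<omega>)"
    using idx_less[OF T_pos] by (auto simp: fun_eq_iff indicator_def dest: less_imp_le)
  ultimately show ?thesis by simp
qed

lemma L1_error_measurable [measurable]:
  "(\<lambda>\<omega>. LINT s:{0..T}|lborel. \<bar>coef n (idx T n s) \<omega> - \<gamma> s \<omega>\<bar>) \<in> borel_measurable M"
proof -
  have [measurable]: "(\<lambda>(\<omega>, s). \<gamma> s \<omega>) \<in> borel_measurable (M \<Otimes>\<^sub>M borel)"
    using measurable_compose[OF measurable_Pair[OF measurable_snd measurable_fst] \<gamma>_joint]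
    by (simp add: split_beta')
  note coef_idx_joint[measurable]
  have "(\<lambda>(\<omega>, s). indicator {0..T} s *\<^sub>R \<bar>indicator {0..T} s * coef n (idx T n s) \<omega> - \<gamma> s \<omega>\<bar>) \<in> borel_measurable (M \<Otimes>\<^sub>M lborel)"
    by measurable
  from lborel.borel_measurable_lebesgue_integral[OF this]
  have "(\<lambda>\<omega>. LINT s|lborel. indicator {0..T} s *\<^sub>R \<bar>indicator {0..T} s * coef n (idx T n s) \<omega> - \<gamma> s \<omega>\<bar>) \<in> borel_measurable M" .
  moreover have "(LINT s|lborel. indicator {0..T} s *\<^sub>R \<bar>indicator {0..T} s * coef n (idx T n s) \<omega> - \<gamma> s \<omega>\<bar>)
    = (LINT s:{0..T}|lborel. \<bar>coef n (idx T n s) \<omega> - \<gamma> s \<omega>\<bar>)" for \<omega>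
    unfolding set_lebesgue_integral_def by (intro Bochner_Integration.integral_cong refl) (simp add: indicator_def)
  ultimately show ?thesis by (simp only:)
qed

lemma L1_error_integrable:
  assumes w: "\<omega> \<in> space M"
  shows "set_integrable lborel {0..T} (\<lambda>s. \<bar>coef n (idx T n s) \<omega> - \<gamma> s \<omega>\<bar>)"
proof (rule set_integrable_bounded[where a = 0 and b = T and K = "2 * K"])
  note [measurable] = \<gamma>_borel[OF w]
  have [measurable]: "(\<lambda>s. coef n (idx T n s) \<omega>) \<in> borel_measurable borel" by (rule measurable_idx)
  show "(\<lambda>s. \<bar>coef n (idx T n s) \<omega> - \<gamma> s \<omega>\<bar>) \<in> borel_measurable borel" by measurable
  fix s
  show "\<bar>\<bar>coef n (idx T n s) \<omega> - \<gamma> s \<omega>\<bar>\<bar> \<le> 2 * K"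
    using coef_bound[OF w, of n "idx T n s"] \<gamma>_bound[OF w, of s] by linarith
qed auto

lemma L1_error_nonneg: "0 \<le> (LINT s:{0..T}|lborel. \<bar>coef n (idx T n s) \<omega> - \<gamma> s \<omega>\<bar>)"
  by (simp add: set_lebesgue_integral_def)

lemma err_tendsto: "err \<longlonglongrightarrow> 0"
proof -
  have "(\<lambda>n. \<integral>\<^sup>+\<omega>. ennreal (LINT s:{0..T}|lborel. \<bar>coef n (idx T n s) \<omega> - \<gamma> s \<omega>\<bar>) \<partial>M) \<longlonglongrightarrow> (\<integral>\<^sup>+\<omega>. 0 \<partial>M)"
  proof (rule nn_integral_dominated_convergence[where w = "\<lambda>_. ennreal (2 * K * T)"])
    show "AE \<omega> in M. ennreal (LINT s:{0..T}|lborel. \<bar>coef n (idx T n s) \<omega> - \<gamma> s \<omega>\<bar>) \<le> ennreal (2 * K * T)" for n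
    proof (intro AE_I2 ennreal_leI)
      fix \<omega> assume w: "\<omega> \<in> space M"
      have "(LINT s:{0..T}|lborel. \<bar>coef n (idx T n s) \<omega> - \<gamma> s \<omega>\<bar>) \<le> (LINT s:{0..T}|lborel. 2 * K)"
      proof (rule set_integral_mono[OF L1_error_integrable[OF w]])
        show "set_integrable lborel {0..T} (\<lambda>s. 2 * K)"
          by (rule set_integrable_bounded[where a = 0 and b = T and K = "\<bar>2 * K\<bar>"]) auto
        show "\<bar>coef n (idx T n s) \<omega> - \<gamma> s \<omega>\<bar> \<le> 2 * K" for s
          using coef_bound[OF w, of n "idx T n s"] \<gamma>_bound[OF w, of s] by linarith
      qed
      also have "\<dots> = 2 * K * T" using T_pos by (simp add: set_integral_const)
      finally show "(LINT s:{0..T}|lborel. \<bar>coef n (idx T n s) \<omega> - \<gamma> s \<omega>\<bar>) \<le> 2 * K * T" .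
    qed
    show "AE \<omega> in M. (\<lambda>n. ennreal (LINT s:{0..T}|lborel. \<bar>coef n (idx T n s) \<omega> - \<gamma> s \<omega>\<bar>)) \<longlonglongrightarrow> 0"
    proof (rule AE_I2)
      fix \<omega> assume w: "\<omega> \<in> space M"
      have "(\<lambda>n. LINT s:{0..T}|lborel. \<bar>coef n (idx T n s) \<omega> - \<gamma> s \<omega>\<bar>) \<longlonglongrightarrow> 0"
        unfolding coef_def by (rule cavg_tendsto_L1[OF T_pos \<gamma>_borel[OF w] \<gamma>_bound[OF w]])
      from tendsto_ennrealI[OF this]
      show "(\<lambda>n. ennreal (LINT s:{0..T}|lborel. \<bar>coef n (idx T n s) \<omega> - \<gamma> s \<omega>\<bar>)) \<longlonglongrightarrow> 0" by simp
    qed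
    show "(\<integral>\<^sup>+\<omega>. ennreal (2 * K * T) \<partial>M) < \<infinity>" by (simp add: emeasure_space_1)
  qed measurable
  then show ?thesis by (simp add: err_def[abs_def])
qed

text \<open>On the finer grid the difference of the stochastic integrals is a single sum \<open>I\<close> over increments, whose
  second moment is given by the isometry; as the coefficients are bounded, it is at most linear in the
  errors. Young's inequality with the free weight \<open>c\<close> passes from \<open>I\<^sup>2\<close> to \<open>\<bar>I\<bar>\<close>.\<close>

lemma logdens_increment:
  fixes n p :: nat and c :: real
  assumes c: "c > 0"
  defines "m \<equiv> n + p"
  shows "(\<integral>\<^sup>+\<omega>. ennreal \<bar>logdens m (2 ^ m) \<omega> - logdens n (2 ^ n) \<omega>\<bar> \<partial>M)
     \<le> ennreal (K * c + K) * (err m + err n) + ennreal (1 / (2 * c))"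
proof -
  let ?a = "\<lambda>s \<omega>. coef m (idx T m s) \<omega>" and ?b = "\<lambda>s \<omega>. coef n (idx T n s) \<omega>"
  let ?D = "\<lambda>n \<omega>. LINT s:{0..T}|lborel. \<bar>coef n (idx T n s) \<omega> - \<gamma> s \<omega>\<bar>"
  define d where "d k \<omega> = coef m k \<omega> - coef n (k div 2 ^ p) \<omega>" for k \<omega>
  define I where "I \<omega> = (\<Sum>k<2^m. d k \<omega> * dB m k \<omega>)" for \<omega>
  have kd: "k div 2 ^ p < 2 ^ n" if "k < 2 ^ m" for k :: nat
    using that by (simp add: m_def power_add less_mult_imp_div_less)
  have d_meas: "d k \<in> borel_measurable (F (grid T m k))" if k: "k < 2 ^ m" for k
  proof -
    have "grid T n (k div 2 ^ p) = grid T m (k div 2 ^ p * 2 ^ p)" by (simp add: m_def grid_refine)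
    then have "coef n (k div 2 ^ p) \<in> borel_measurable (F (grid T m (k div 2 ^ p * 2 ^ p)))"
      using coef_measurable[of "k div 2^p" n] kd[OF k] by simp
    then have [measurable]: "coef n (k div 2 ^ p) \<in> borel_measurable (F (grid T m k))"
      by (rule F_measurable_grid) (use k in auto)
    have [measurable]: "coef m k \<in> borel_measurable (F (grid T m k))" using k by (intro coef_measurable) auto
    show ?thesis unfolding d_def by measurable
  qed
  have d_M [measurable]: "d k \<in> borel_measurable M" if "k < 2 ^ m" for k
    by (rule F_measurable_M[OF d_meas[OF that] grid_mem]) (use that in auto)
  have I_M [measurable]: "I \<in> borel_measurable M"
    unfolding I_def using d_M dB_measurable by (intro borel_measurable_sum borel_measurable_times) auto
  have lm [measurable]: "logdens k (2 ^ k) \<in> borel_measurable M" for k by (rule logdens_measurable_M) simp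
  have err_sum: "err m + err n = (\<integral>\<^sup>+\<omega>. ennreal (?D m \<omega> + ?D n \<omega>) \<partial>M)"
    unfolding err_def
    by (subst nn_integral_add[symmetric]) (auto simp: ennreal_plus[OF L1_error_nonneg L1_error_nonneg])
  have sI: "set_integrable lborel {0..T} (\<lambda>s. ?a s \<omega> - ?b s \<omega>)"
      "set_integrable lborel {0..T} (\<lambda>s. ?a s \<omega>)" "set_integrable lborel {0..T} (\<lambda>s. ?b s \<omega>)"
      "set_integrable lborel {0..T} (\<lambda>s. (?a s \<omega>)\<^sup>2)" "set_integrable lborel {0..T} (\<lambda>s. (?b s \<omega>)\<^sup>2)" for \<omega>
    using set_integrable_idx[OF T_pos, of "\<lambda>k. coef m k \<omega>" m] set_integrable_idx[OF T_pos, of "\<lambda>k. coef n k \<omega>" n]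
      set_integrable_idx[OF T_pos, of "\<lambda>k. (coef m k \<omega>)\<^sup>2" m] set_integrable_idx[OF T_pos, of "\<lambda>k. (coef n k \<omega>)\<^sup>2" n]
    by auto
  have dsum: "(\<Sum>k<2^m. (d k \<omega>)\<^sup>2 * (T / 2 ^ m)) = (LINT s:{0..T}|lborel. (?a s \<omega> - ?b s \<omega>)\<^sup>2)" for \<omega>
  proof -
    have "(\<Sum>k<2^m. (d k \<omega>)\<^sup>2 * (T / 2 ^ m)) = (LINT s:{0..T}|lborel. (d (idx T m s) \<omega>)\<^sup>2)"
      by (rule sum_grid_integral[OF T_pos, of "\<lambda>k. (d k \<omega>)\<^sup>2" m])
    also have "\<dots> = (LINT s:{0..T}|lborel. (?a s \<omega> - ?b s \<omega>)\<^sup>2)"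
      by (rule set_lebesgue_integral_cong) (use idx_refine[OF T_pos, of _ n p] in \<open>auto simp: d_def m_def\<close>)
    finally show ?thesis .
  qed
  have d2: "set_integrable lborel {0..T} (\<lambda>s. (?a s \<omega> - ?b s \<omega>)\<^sup>2)" for \<omega>
  proof -
    have "set_integrable lborel {0..T} (\<lambda>s. (d (idx T m s) \<omega>)\<^sup>2)"
      by (rule set_integrable_idx[OF T_pos, of "\<lambda>k. (d k \<omega>)\<^sup>2" m])
    moreover have "(\<lambda>s. indicator {0..T} s *\<^sub>R (d (idx T m s) \<omega>)\<^sup>2) = (\<lambda>s. indicator {0..T} s *\<^sub>R (?a s \<omega> - ?b s \<omega>)\<^sup>2)"
      using idx_refine[OF T_pos, of _ n p] by (auto simp: fun_eq_iff d_def m_def indicator_def)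
    ultimately show ?thesis by (simp add: set_integrable_def)
  qed
  have ab: "(LINT s:{0..T}|lborel. \<bar>?a s \<omega> - ?b s \<omega>\<bar>) \<le> ?D m \<omega> + ?D n \<omega>" if w: "\<omega> \<in> space M" for \<omega>
  proof -
    have "(LINT s:{0..T}|lborel. \<bar>?a s \<omega> - ?b s \<omega>\<bar>) \<le> (LINT s:{0..T}|lborel. \<bar>?a s \<omega> - \<gamma> s \<omega>\<bar> + \<bar>?b s \<omega> - \<gamma> s \<omega>\<bar>)"
      by (intro set_integral_mono set_integral_add(1) set_integrable_abs[OF sI(1)] L1_error_integrable[OF w]) linarith
    also have "\<dots> = ?D m \<omega> + ?D n \<omega>" by (intro set_integral_add(2) L1_error_integrable[OF w])
    finally show ?thesis .
  qed
  have d2le: "(LINT s:{0..T}|lborel. (?a s \<omega> - ?b s \<omega>)\<^sup>2) \<le> 2 * K * (?D m \<omega> + ?D n \<omega>)" if w: "\<omega> \<in> space M" for \<omega>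
  proof -
    have "(LINT s:{0..T}|lborel. (?a s \<omega> - ?b s \<omega>)\<^sup>2) \<le> (LINT s:{0..T}|lborel. 2 * K * \<bar>?a s \<omega> - ?b s \<omega>\<bar>)"
    proof (rule set_integral_mono[OF d2])
      show "set_integrable lborel {0..T} (\<lambda>s. 2 * K * \<bar>?a s \<omega> - ?b s \<omega>\<bar>)"
        using set_integrable_abs[OF sI(1)] by simp
      fix s
      have "\<bar>?a s \<omega> - ?b s \<omega>\<bar> \<le> 2 * K"
        using coef_bound[OF w, of m "idx T m s"] coef_bound[OF w, of n "idx T n s"] by linarith
      then have "\<bar>?a s \<omega> - ?b s \<omega>\<bar> * \<bar>?a s \<omega> - ?b s \<omega>\<bar> \<le> 2 * K * \<bar>?a s \<omega> - ?b s \<omega>\<bar>"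
        by (rule mult_right_mono) simp
      then show "(?a s \<omega> - ?b s \<omega>)\<^sup>2 \<le> 2 * K * \<bar>?a s \<omega> - ?b s \<omega>\<bar>"
        by (simp add: power2_eq_square abs_mult[symmetric])
    qed
    also have "\<dots> = 2 * K * (LINT s:{0..T}|lborel. \<bar>?a s \<omega> - ?b s \<omega>\<bar>)" by simp
    also have "\<dots> \<le> 2 * K * (?D m \<omega> + ?D n \<omega>)" using ab[OF w] K_nonneg by (intro mult_left_mono) auto
    finally show ?thesis .
  qed
  have I2: "(\<integral>\<^sup>+\<omega>. ennreal ((I \<omega>)\<^sup>2) \<partial>M) \<le> ennreal (2 * K) * (err m + err n)"
  proof -
    have "(\<integral>\<^sup>+\<omega>. ennreal ((I \<omega>)\<^sup>2) \<partial>M) = (\<integral>\<^sup>+\<omega>. ennreal (\<Sum>k<2^m. (d k \<omega>)\<^sup>2 * (T / 2 ^ m)) \<partial>M)"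
      unfolding I_def by (rule nn_integral_square_sum_incr[OF d_meas]) auto
    also have "\<dots> \<le> (\<integral>\<^sup>+\<omega>. ennreal (2 * K) * ennreal (?D m \<omega> + ?D n \<omega>) \<partial>M)"
    proof (rule nn_integral_mono)
      fix \<omega> assume w: "\<omega> \<in> space M"
      have "ennreal (2 * K) * ennreal (?D m \<omega> + ?D n \<omega>) = ennreal (2 * K * (?D m \<omega> + ?D n \<omega>))"
        using K_nonneg by (intro ennreal_mult'[symmetric]) simp
      then show "ennreal (\<Sum>k<2^m. (d k \<omega>)\<^sup>2 * (T / 2 ^ m)) \<le> ennreal (2 * K) * ennreal (?D m \<omega> + ?D n \<omega>)"
        using ennreal_leI[OF d2le[OF w]] by (simp only: dsum)
    qed
    also have "\<dots> = ennreal (2 * K) * (err m + err n)"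
      unfolding err_sum by (rule nn_integral_cmult) measurable
    finally show ?thesis .
  qed
  have pt: "\<bar>logdens m (2 ^ m) \<omega> - logdens n (2 ^ n) \<omega>\<bar>
     \<le> c / 2 * (I \<omega>)\<^sup>2 + 1 / (2 * c) + K * (?D m \<omega> + ?D n \<omega>)" if w: "\<omega> \<in> space M" for \<omega>
  proof -
    have V: "(\<Sum>k<2^n. (coef n k \<omega>)\<^sup>2 * (T / 2 ^ n) / 2) = (LINT s:{0..T}|lborel. (coef n (idx T n s) \<omega>)\<^sup>2) / 2" for n
      using sum_grid_integral[OF T_pos, of "\<lambda>k. (coef n k \<omega>)\<^sup>2" n] by (simp only: sum_divide_distrib[symmetric])
    have l: "logdens n (2 ^ n) \<omega> = (\<Sum>k<2^n. coef n k \<omega> * dB n k \<omega>) - (LINT s:{0..T}|lborel. (coef n (idx T n s) \<omega>)\<^sup>2) / 2" for n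
      unfolding logdens_def sum_subtractf V ..
    have "(\<Sum>k<2^n. coef n k \<omega> * dB n k \<omega>) = (\<Sum>k<2^m. coef n (k div 2 ^ p) \<omega> * dB m k \<omega>)"
      using sum_incr_refine[of "\<lambda>k. coef n k \<omega>" n \<omega> p] by (simp add: m_def)
    then have 1: "logdens m (2 ^ m) \<omega> - logdens n (2 ^ n) \<omega>
      = I \<omega> - ((LINT s:{0..T}|lborel. (?a s \<omega>)\<^sup>2) - (LINT s:{0..T}|lborel. (?b s \<omega>)\<^sup>2)) / 2"
      unfolding l I_def d_def by (simp add: sum_subtractf left_diff_distrib diff_divide_distrib)
    have "\<bar>(LINT s:{0..T}|lborel. (?a s \<omega>)\<^sup>2) - (LINT s:{0..T}|lborel. (?b s \<omega>)\<^sup>2)\<bar>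
       = \<bar>LINT s:{0..T}|lborel. (?a s \<omega>)\<^sup>2 - (?b s \<omega>)\<^sup>2\<bar>"
      using sI(4,5)[of \<omega>] by (simp add: set_integral_diff)
    also have "\<dots> \<le> (LINT s:{0..T}|lborel. \<bar>(?a s \<omega>)\<^sup>2 - (?b s \<omega>)\<^sup>2\<bar>)"
      using set_integral_norm_bound[OF set_integral_diff(1)[OF sI(4,5)[of \<omega>]]] by simp
    also have "\<dots> \<le> (LINT s:{0..T}|lborel. 2 * K * \<bar>?a s \<omega> - ?b s \<omega>\<bar>)"
    proof (rule set_integral_mono)
      show "set_integrable lborel {0..T} (\<lambda>s. \<bar>(?a s \<omega>)\<^sup>2 - (?b s \<omega>)\<^sup>2\<bar>)"
        by (rule set_integrable_abs[OF set_integral_diff(1)[OF sI(4,5)[of \<omega>]]])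
      show "set_integrable lborel {0..T} (\<lambda>s. 2 * K * \<bar>?a s \<omega> - ?b s \<omega>\<bar>)"
        using set_integrable_abs[OF sI(1)] by simp
      fix s
      have "\<bar>?a s \<omega> + ?b s \<omega>\<bar> \<le> 2 * K"
        using coef_bound[OF w, of m "idx T m s"] coef_bound[OF w, of n "idx T n s"] by linarith
      then have "\<bar>?a s \<omega> + ?b s \<omega>\<bar> * \<bar>?a s \<omega> - ?b s \<omega>\<bar> \<le> 2 * K * \<bar>?a s \<omega> - ?b s \<omega>\<bar>"
        by (rule mult_right_mono) simp
      then show "\<bar>(?a s \<omega>)\<^sup>2 - (?b s \<omega>)\<^sup>2\<bar> \<le> 2 * K * \<bar>?a s \<omega> - ?b s \<omega>\<bar>"
        unfolding abs_mult[symmetric] by (simp add: power2_eq_square algebra_simps)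
    qed
    also have "\<dots> = 2 * K * (LINT s:{0..T}|lborel. \<bar>?a s \<omega> - ?b s \<omega>\<bar>)" by simp
    also have "\<dots> \<le> 2 * K * (?D m \<omega> + ?D n \<omega>)" using ab[OF w] K_nonneg by (intro mult_left_mono) auto
    finally have 2: "\<bar>(LINT s:{0..T}|lborel. (?a s \<omega>)\<^sup>2) - (LINT s:{0..T}|lborel. (?b s \<omega>)\<^sup>2)\<bar> / 2 \<le> K * (?D m \<omega> + ?D n \<omega>)"
      by simp
    have "0 \<le> (c * \<bar>I \<omega>\<bar> - 1)\<^sup>2 / (2 * c)" using c by simp
    also have "\<dots> = c / 2 * (I \<omega>)\<^sup>2 + 1 / (2 * c) - \<bar>I \<omega>\<bar>"
      using c by (simp add: power2_diff power_mult_distrib field_simps power2_eq_square)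
    finally have 3: "\<bar>I \<omega>\<bar> \<le> c / 2 * (I \<omega>)\<^sup>2 + 1 / (2 * c)" by linarith
    have "\<bar>logdens m (2 ^ m) \<omega> - logdens n (2 ^ n) \<omega>\<bar>
      \<le> \<bar>I \<omega>\<bar> + \<bar>(LINT s:{0..T}|lborel. (?a s \<omega>)\<^sup>2) - (LINT s:{0..T}|lborel. (?b s \<omega>)\<^sup>2)\<bar> / 2"
      unfolding 1 by (rule order_trans[OF abs_triangle_ineq4]) simp
    also have "\<dots> \<le> c / 2 * (I \<omega>)\<^sup>2 + 1 / (2 * c) + K * (?D m \<omega> + ?D n \<omega>)"
      by (rule add_mono[OF 3 2])
    finally show ?thesis .
  qed
  have "(\<integral>\<^sup>+\<omega>. ennreal \<bar>logdens m (2 ^ m) \<omega> - logdens n (2 ^ n) \<omega>\<bar> \<partial>M)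
    \<le> (\<integral>\<^sup>+\<omega>. (ennreal (c / 2) * ennreal ((I \<omega>)\<^sup>2) + ennreal (1 / (2 * c))) + ennreal K * ennreal (?D m \<omega> + ?D n \<omega>) \<partial>M)"
  proof (rule nn_integral_mono)
    fix \<omega> assume w: "\<omega> \<in> space M"
    have "0 \<le> K * (?D m \<omega> + ?D n \<omega>)" using K_nonneg L1_error_nonneg[of m \<omega>] L1_error_nonneg[of n \<omega>] by simp
    then show "ennreal \<bar>logdens m (2 ^ m) \<omega> - logdens n (2 ^ n) \<omega>\<bar>
       \<le> (ennreal (c / 2) * ennreal ((I \<omega>)\<^sup>2) + ennreal (1 / (2 * c))) + ennreal K * ennreal (?D m \<omega> + ?D n \<omega>)"
      using pt[OF w] c K_nonneg
      by (simp add: ennreal_mult'[symmetric] ennreal_plus[symmetric] ennreal_leI del: ennreal_plus)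
  qed
  also have "\<dots> = ennreal (c / 2) * (\<integral>\<^sup>+\<omega>. ennreal ((I \<omega>)\<^sup>2) \<partial>M) + ennreal (1 / (2 * c)) + ennreal K * (err m + err n)"
    unfolding err_sum by (subst nn_integral_add; (subst nn_integral_add)?; simp add: nn_integral_cmult emeasure_space_1)
  also have "\<dots> \<le> ennreal (c / 2) * (ennreal (2 * K) * (err m + err n)) + ennreal (1 / (2 * c)) + ennreal K * (err m + err n)"
    by (intro add_mono mult_left_mono I2) auto
  also have "\<dots> = ennreal (K * c + K) * (err m + err n) + ennreal (1 / (2 * c))"
  proof -
    have "ennreal (c / 2) * ennreal (2 * K) = ennreal (K * c)" using c K_nonneg by (simp add: ennreal_mult[symmetric] mult.commute)
    then have "ennreal (c / 2) * (ennreal (2 * K) * (err m + err n)) = ennreal (K * c) * (err m + err n)"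
      by (simp add: mult.assoc[symmetric])
    moreover have "ennreal (K * c + K) * (err m + err n) = ennreal (K * c) * (err m + err n) + ennreal K * (err m + err n)"
      using c K_nonneg by (subst ennreal_plus) (auto simp: distrib_right)
    ultimately show ?thesis by (simp add: ac_simps)
  qed
  finally show ?thesis .
qed

definition loglim :: "(nat \<Rightarrow> nat) \<Rightarrow> 'a \<Rightarrow> real" where
  "loglim r \<omega> = lim (\<lambda>j. logdens (r j) (2 ^ r j) \<omega>)"

definition dens :: "(nat \<Rightarrow> nat) \<Rightarrow> 'a \<Rightarrow> real" where
  "dens r \<omega> = exp (loglim r \<omega>)"

lemma logdens_full_measurable [measurable]: "logdens n (2 ^ n) \<in> borel_measurable M"
  by (rule logdens_measurable_M) simp

lemma dens_measurable [measurable]: "dens r \<in> borel_measurable M"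
  unfolding dens_def[abs_def] loglim_def[abs_def]
  by (intro borel_measurable_exp[THEN measurable_compose[rotated]] borel_measurable_lim_metric) measurable

lemma dens_pos: "dens r \<omega> > 0" by (simp add: dens_def)

text \<open>The coefficient on a cell averages the drift over the preceding cell, so that the sum of the costs omits
  the last cell only.\<close>

lemma second_moment_step:
  fixes D :: "real \<Rightarrow> real"
  assumes D: "D \<in> borel_measurable borel" "\<And>s. \<bar>D s\<bar> \<le> K'"
    and le: "\<And>s \<omega>. \<omega> \<in> space M \<Longrightarrow> s \<in> {0..T} \<Longrightarrow> \<bar>\<gamma> s \<omega>\<bar> \<le> D s"
  shows "(\<integral>\<^sup>+\<omega>. ennreal ((exp (logdens n (2 ^ n) \<omega>))\<^sup>2) \<partial>M) \<le> ennreal (exp (LINT s:{0..T}|lborel. (D s)\<^sup>2))"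
proof -
  define \<delta> where "\<delta> k = (if k = 0 then 0 else LINT s:cell T n (k - 1)|lborel. (D s)\<^sup>2)" for k :: nat
  have D2: "\<bar>(D s)\<^sup>2\<bar> \<le> K'\<^sup>2" for s using power_mono[OF D(2) abs_ge_zero, of s 2] by simp
  have iD: "set_integrable lborel A (\<lambda>s. (D s)\<^sup>2)" if "A \<in> sets borel" "A \<subseteq> {a..b}" for A a b
    using D D2 that by (intro set_integrable_bounded) auto
  have "(\<integral>\<^sup>+\<omega>. ennreal ((exp (logdens n (2 ^ n) \<omega>))\<^sup>2) \<partial>M) \<le> ennreal (exp (\<Sum>k<2^n. \<delta> k))"
  proof (rule nn_integral_logdens_square)
    fix k \<omega> assume k: "k < (2::nat) ^ n" and w: "\<omega> \<in> space M"
    show "(coef n k \<omega>)\<^sup>2 * (T / 2 ^ n) \<le> \<delta> k"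
    proof (cases k)
      case (Suc i)
      have sub: "cell T n i \<subseteq> {0..T}" using k Suc T_pos by (intro cell_subset) auto
      have "(coef n (Suc i) \<omega>)\<^sup>2 * (T / 2 ^ n) \<le> (LINT s:cell T n i|lborel. (\<gamma> s \<omega>)\<^sup>2)"
        unfolding coef_def by (rule cavg_square[OF T_pos \<gamma>_borel[OF w] \<gamma>_bound[OF w]])
      also have "\<dots> \<le> (LINT s:cell T n i|lborel. (D s)\<^sup>2)"
      proof (rule set_integral_mono)
        show "set_integrable lborel (cell T n i) (\<lambda>s. (\<gamma> s \<omega>)\<^sup>2)"
        proof (rule set_integrable_bounded[OF _ _ sub, where K = "K\<^sup>2"])
          show "\<bar>(\<gamma> s \<omega>)\<^sup>2\<bar> \<le> K\<^sup>2" for s using power_mono[OF \<gamma>_bound[OF w] abs_ge_zero, of s 2] by simp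
        qed (use \<gamma>_borel[OF w] in auto)
        show "set_integrable lborel (cell T n i) (\<lambda>s. (D s)\<^sup>2)" using sub by (intro iD) auto
        fix s assume "s \<in> cell T n i"
        then have "\<bar>\<gamma> s \<omega>\<bar> \<le> D s" using le[OF w] sub by blast
        from power_mono[OF this abs_ge_zero, of 2] show "(\<gamma> s \<omega>)\<^sup>2 \<le> (D s)\<^sup>2" by simp
      qed
      finally show ?thesis using Suc by (simp add: \<delta>_def)
    qed (simp add: \<delta>_def)
  qed simp
  also have "(\<Sum>k<2^n. \<delta> k) \<le> (LINT s:{0..T}|lborel. (D s)\<^sup>2)"
  proof -
    obtain N where N: "2 ^ n = Suc N" by (metis gr0_conv_Suc zero_less_numeral zero_less_power)
    have "(\<Sum>k<2^n. \<delta> k) = (\<Sum>k<N. LINT s:cell T n k|lborel. (D s)\<^sup>2)"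
      unfolding N by (subst sum.lessThan_Suc_shift) (simp add: \<delta>_def)
    also have "\<dots> \<le> (\<Sum>k<2^n. LINT s:cell T n k|lborel. (D s)\<^sup>2)"
      unfolding N by (intro sum_mono2) (auto simp: set_lebesgue_integral_def)
    also have "\<dots> = (LINT s:{0..T}|lborel. (D s)\<^sup>2)"
      by (rule set_integral_cells_T[OF T_pos iD, symmetric]) auto
    finally show ?thesis .
  qed
  finally show ?thesis by simp
qed

text \<open>Along a subsequence with geometrically small errors the logarithmic densities converge almost surely.\<close>

context
  fixes r :: "nat \<Rightarrow> nat"
  assumes r: "strict_mono r" and err_r: "\<And>j. err (r j) \<le> ennreal ((1 / 4) ^ j)"
begin

lemma logdens_AE_tendsto: "AE \<omega> in M. (\<lambda>j. logdens (r j) (2 ^ r j) \<omega>) \<longlonglongrightarrow> loglim r \<omega>"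
proof -
  have "AE \<omega> in M. convergent (\<lambda>j. logdens (r j) (2 ^ r j) \<omega>)"
  proof (rule AE_convergent_of_summable_increments[where a = "\<lambda>j. (4 * K + 1) * (1 / 2) ^ j"])
    fix j
    define p where "p = r (Suc j) - r j"
    have p: "r (Suc j) = r j + p" using r by (simp add: p_def strict_mono_leD)
    have e: "err (r (Suc j)) + err (r j) \<le> ennreal (2 * (1 / 4) ^ j)"
    proof -
      have "err (r (Suc j)) \<le> ennreal ((1 / 4) ^ j)"
        by (rule order_trans[OF err_r ennreal_leI]) simp
      then have "err (r (Suc j)) + err (r j) \<le> ennreal ((1 / 4) ^ j) + ennreal ((1 / 4) ^ j)"
        by (rule add_mono[OF _ err_r])
      also have "\<dots> = ennreal (2 * (1 / 4) ^ j)" by (simp flip: ennreal_plus)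
      finally show ?thesis .
    qed
    \<comment> \<open>the weight \<open>2 ^ j\<close> balances the errors of order \<open>4 ^ - j\<close> against the remainder \<open>1 / (2 c)\<close>\<close>
    have "(\<integral>\<^sup>+\<omega>. ennreal \<bar>logdens (r (Suc j)) (2 ^ r (Suc j)) \<omega> - logdens (r j) (2 ^ r j) \<omega>\<bar> \<partial>M)
       \<le> ennreal (K * 2 ^ j + K) * (err (r (Suc j)) + err (r j)) + ennreal (1 / (2 * 2 ^ j))"
      using logdens_increment[of "2 ^ j" "r j" p] by (simp add: p)
    also have "\<dots> \<le> ennreal (K * 2 ^ j + K) * ennreal (2 * (1 / 4) ^ j) + ennreal (1 / (2 * 2 ^ j))"
      by (intro add_mono mult_left_mono e) auto
    also have "\<dots> = ennreal ((K * 2 ^ j + K) * (2 * (1 / 4) ^ j) + 1 / (2 * 2 ^ j))"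
      using K_nonneg by (simp add: ennreal_mult'[symmetric] ennreal_plus[symmetric] del: ennreal_plus)
    also have "\<dots> \<le> ennreal ((4 * K + 1) * (1 / 2) ^ j)"
    proof (rule ennreal_leI)
      have q: "(1 / 4 :: real) ^ j = (1 / 2) ^ j * (1 / 2) ^ j" "(2 :: real) ^ j * (1 / 2) ^ j = 1"
        by (simp_all add: power_mult_distrib[symmetric])
      have h: "(1 / 2 :: real) ^ j \<le> 1" "(1 / 2 :: real) ^ j > 0" by (simp_all add: power_le_one)
      have "(K * 2 ^ j + K) * (2 * (1 / 4) ^ j) + 1 / (2 * 2 ^ j)
         = 2 * K * (1 / 2) ^ j * (2 ^ j * (1 / 2) ^ j) + 2 * K * (1 / 2) ^ j * (1 / 2) ^ j + (1 / 2) ^ j / 2"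
      proof -
        have "(K * t + K) * (2 * (u * u)) + u / 2 = 2 * K * u * (t * u) + 2 * K * u * u + u / 2" for t u :: real
          by (simp add: algebra_simps)
        moreover have "1 / (2 * 2 ^ j) = (1 / 2 :: real) ^ j / 2" by (simp add: power_one_over)
        ultimately show ?thesis unfolding q(1) by (simp only:)
      qed
      also have "\<dots> \<le> 2 * K * (1 / 2) ^ j + 2 * K * (1 / 2) ^ j * 1 + (1 / 2) ^ j"
        unfolding q(2) using h K_nonneg by (intro add_mono mult_left_mono) auto
      also have "\<dots> = (4 * K + 1) * (1 / 2) ^ j" by (simp add: algebra_simps)
      finally show "(K * 2 ^ j + K) * (2 * (1 / 4) ^ j) + 1 / (2 * 2 ^ j) \<le> (4 * K + 1) * (1 / 2) ^ j" .
    qed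
    finally show "(\<integral>\<^sup>+\<omega>. ennreal \<bar>logdens (r (Suc j)) (2 ^ r (Suc j)) \<omega> - logdens (r j) (2 ^ r j) \<omega>\<bar> \<partial>M) \<le> ennreal ((4 * K + 1) * (1 / 2) ^ j)" .
  qed (use K_nonneg in \<open>auto intro!: summable_mult summable_geometric\<close>)
  then show ?thesis
    by eventually_elim (simp add: loglim_def convergent_LIMSEQ_iff)
qed

lemma dens_AE_tendsto: "AE \<omega> in M. (\<lambda>j. exp (logdens (r j) (2 ^ r j) \<omega>)) \<longlonglongrightarrow> dens r \<omega>"
  using logdens_AE_tendsto unfolding dens_def by eventually_elim (rule tendsto_exp)

lemma dens_second_moment:
  fixes D :: "real \<Rightarrow> real"
  assumes "D \<in> borel_measurable borel" "\<And>s. \<bar>D s\<bar> \<le> K'"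
    and "\<And>s \<omega>. \<omega> \<in> space M \<Longrightarrow> s \<in> {0..T} \<Longrightarrow> \<bar>\<gamma> s \<omega>\<bar> \<le> D s"
  shows "(\<integral>\<^sup>+\<omega>. ennreal ((dens r \<omega>)\<^sup>2) \<partial>M) \<le> ennreal (exp (LINT s:{0..T}|lborel. (D s)\<^sup>2))"
  by (rule tendsto_integral_L2_bounded(1)[OF prob_space_axioms _ _ dens_AE_tendsto])
    (use second_moment_step[OF assms] in auto)

lemma dens_integral_tendsto:
  assumes h [measurable]: "\<And>j. h j \<in> borel_measurable M" and g [measurable]: "g \<in> borel_measurable M"
    and b: "\<And>j \<omega>. \<bar>h j \<omega>\<bar> \<le> 1" and l: "\<And>\<omega>. \<omega> \<in> space M \<Longrightarrow> (\<lambda>j. h j \<omega>) \<longlonglongrightarrow> g \<omega>"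
  shows "(\<lambda>j. LINT \<omega>|M. exp (logdens (r j) (2 ^ r j) \<omega>) * h j \<omega>) \<longlonglongrightarrow> (LINT \<omega>|M. dens r \<omega> * g \<omega>)"
proof (rule tendsto_integral_L2_bounded(2)[OF prob_space_axioms])
  show "AE \<omega> in M. (\<lambda>j. exp (logdens (r j) (2 ^ r j) \<omega>) * h j \<omega>) \<longlonglongrightarrow> dens r \<omega> * g \<omega>"
    using dens_AE_tendsto AE_space by eventually_elim (intro tendsto_mult l)
  fix j
  have "(\<integral>\<^sup>+\<omega>. ennreal ((exp (logdens (r j) (2 ^ r j) \<omega>) * h j \<omega>)\<^sup>2) \<partial>M) \<le> (\<integral>\<^sup>+\<omega>. ennreal ((exp (logdens (r j) (2 ^ r j) \<omega>))\<^sup>2) \<partial>M)"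
  proof (intro nn_integral_mono ennreal_leI)
    fix \<omega>
    have "(h j \<omega>)\<^sup>2 \<le> 1" using power_mono[OF b abs_ge_zero, of j \<omega> 2] by simp
    then show "(exp (logdens (r j) (2 ^ r j) \<omega>) * h j \<omega>)\<^sup>2 \<le> (exp (logdens (r j) (2 ^ r j) \<omega>))\<^sup>2"
      unfolding power_mult_distrib by (intro mult_right_le_one_le) auto
  qed
  also have "\<dots> \<le> ennreal (exp (LINT s:{0..T}|lborel. K\<^sup>2))"
    by (rule second_moment_step[of "\<lambda>_. K" K]) (use K_nonneg \<gamma>_bound in auto)
  finally show "(\<integral>\<^sup>+\<omega>. ennreal ((exp (logdens (r j) (2 ^ r j) \<omega>) * h j \<omega>)\<^sup>2) \<partial>M) \<le> ennreal (exp (LINT s:{0..T}|lborel. K\<^sup>2))" .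
qed measurable

lemma dens_integrable: "integrable M (dens r)"
  by (rule integrable_of_square(1)[OF prob_space_axioms dens_measurable dens_second_moment[of "\<lambda>_. K" K]])
    (use K_nonneg \<gamma>_bound in auto)

lemma logdens_integral:
  assumes "A \<in> sets (F (grid T n k))" "k \<le> 2 ^ n"
  shows "(\<integral>\<^sup>+\<omega>. indicator A \<omega> * ennreal (exp (logdens n (2 ^ n) \<omega>)) \<partial>M) = (\<integral>\<^sup>+\<omega>. indicator A \<omega> * ennreal (exp (logdens n k \<omega>)) \<partial>M)"
  using assms by (intro nn_integral_logdens) auto

lemma dens_integral_1: "(LINT \<omega>|M. dens r \<omega>) = 1"
proof -
  have "(LINT \<omega>|M. exp (logdens n (2 ^ n) \<omega>)) = 1" for n
  proof -
    have "(\<integral>\<^sup>+\<omega>. 1 * ennreal (exp (logdens n (2 ^ n) \<omega>)) \<partial>M) = (\<integral>\<^sup>+\<omega>. 1 * ennreal (exp (logdens n 0 \<omega>)) \<partial>M)"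
      by (rule nn_integral_logdens) auto
    then have "(\<integral>\<^sup>+\<omega>. ennreal (exp (logdens n (2 ^ n) \<omega>)) \<partial>M) = 1" by (simp add: emeasure_space_1)
    then show ?thesis by (subst integral_eq_nn_integral) auto
  qed
  then have "(\<lambda>j. 1) \<longlonglongrightarrow> (LINT \<omega>|M. dens r \<omega> * 1)"
    using dens_integral_tendsto[of "\<lambda>_ _. 1" "\<lambda>_. 1"] by simp
  from LIMSEQ_unique[OF this tendsto_const] show ?thesis by simp
qed

lemma prob_space_dens: "prob_space (density M (\<lambda>\<omega>. ennreal (dens r \<omega>)))"
proof (rule prob_spaceI)
  have "(\<integral>\<^sup>+\<omega>. ennreal (dens r \<omega>) \<partial>M) = ennreal (LINT \<omega>|M. dens r \<omega>)"
    using dens_integrable dens_pos by (intro nn_integral_eq_integral) (auto intro: less_imp_le)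
  then show "emeasure (density M (\<lambda>\<omega>. ennreal (dens r \<omega>))) (space (density M (\<lambda>\<omega>. ennreal (dens r \<omega>)))) = 1"
    by (simp add: emeasure_density dens_integral_1 cong: nn_integral_cong)
qed

text \<open>On each finer grid the identity is exact for the recentred discrete increments. These converge to the
  increment of the recentred process, and the bound on the second moments allows passing to the limit
  under the integral.\<close>

lemma dens_cos:
  assumes k: "k < 2 ^ n" and A: "A \<in> sets (F (grid T n k))"
  shows "(LINT \<omega>|M. dens r \<omega> * (indicator A \<omega> * cos (\<phi> + \<theta> * (dB n k \<omega> - (drift (grid T n (Suc k)) \<omega> - drift (grid T n k) \<omega>)))))
     = (LINT \<omega>|M. dens r \<omega> * indicator A \<omega>) * (exp (- (\<theta>\<^sup>2 * (T / 2 ^ n)) / 2) * cos \<phi>)"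
proof -
  have AM [measurable]: "A \<in> sets M"
    using subalg[OF grid_mem[of k n]] A k by (auto simp: subalgebra_def)
  define S where "S m \<omega> = (\<Sum>i=k * 2 ^ (m - n)..<Suc k * 2 ^ (m - n). dB m i \<omega> - coef m i \<omega> * (T / 2 ^ m))" for m \<omega>
  define S' where "S' \<omega> = dB n k \<omega> - (drift (grid T n (Suc k)) \<omega> - drift (grid T n k) \<omega>)" for \<omega>
  define e where "e = exp (- (\<theta>\<^sup>2 * (T / 2 ^ n)) / 2)"
  have kk: "Suc k * 2 ^ (m - n) \<le> 2 ^ m" "k * 2 ^ (m - n) \<le> 2 ^ m" if "n \<le> m" for m
  proof -
    have "(2::nat) ^ m = 2 ^ n * 2 ^ (m - n)" using that by (simp add: power_add[symmetric])
    then show "Suc k * 2 ^ (m - n) \<le> 2 ^ m" using k by (simp only:) (intro mult_right_mono, auto)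
    then show "k * 2 ^ (m - n) \<le> 2 ^ m" by (simp add: order_trans)
  qed
  have dM: "drift t \<in> borel_measurable M" if "t \<in> {0..T}" for t
    using F_measurable_M[OF drift_adapted[OF that] that] .
  have [measurable]: "S' \<in> borel_measurable M"
    unfolding S'_def using dM grid_mem[of k n] grid_mem[of "Suc k" n] k
    by (intro borel_measurable_diff[OF dB_measurable[OF k] borel_measurable_diff]) auto
  have S_meas [measurable]: "S m \<in> borel_measurable M" if "n \<le> m" for m
    unfolding S_def using kk[OF that] by (intro borel_measurable_sum borel_measurable_diff dB_measurable borel_measurable_times coef_measurable_M) auto
  \<comment> \<open>on every finer grid the tilted increment is exactly Gaussian and independent of \<open>A\<close>\<close>
  have step: "(LINT \<omega>|M. exp (logdens m (2 ^ m) \<omega>) * (indicator A \<omega> * cos (\<phi> + \<theta> * S m \<omega>)))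
     = (LINT \<omega>|M. exp (logdens m (2 ^ m) \<omega>) * indicator A \<omega>) * (e * cos \<phi>)" if m: "n \<le> m" for m
  proof -
    let ?j = "k * 2 ^ (m - n)" and ?k = "Suc k * 2 ^ (m - n)"
    have gj: "grid T m ?j = grid T n k" using grid_refine[of T n "m - n" k] m by simp
    have Aj: "A \<in> sets (F (grid T m ?j))" using A by (simp add: gj)
    have jk: "?j \<le> ?k" by simp
    have Sk: "S m \<in> borel_measurable (F (grid T m ?k))"
      unfolding S_def
    proof (rule borel_measurable_sum)
      fix i assume i: "i \<in> {?j..<?k}"
      have [measurable]: "coef m i \<in> borel_measurable (F (grid T m ?k))" "dB m i \<in> borel_measurable (F (grid T m ?k))"
        using i kk(1)[OF m] by (auto intro!: dB_measurable_F F_measurable_grid[OF coef_measurable, of i])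
      show "(\<lambda>\<omega>. dB m i \<omega> - coef m i \<omega> * (T / 2 ^ m)) \<in> borel_measurable (F (grid T m ?k))" by measurable
    qed
    have iA: "(indicator A :: 'a \<Rightarrow> ennreal) \<in> borel_measurable (F (grid T m ?j))" using Aj by simp
    have iAk: "(indicator A :: 'a \<Rightarrow> ennreal) \<in> borel_measurable (F (grid T m ?k))"
      by (rule F_measurable_grid[OF iA jk kk(1)[OF m]])
    have H: "(\<lambda>\<omega>. indicator A \<omega> * ennreal (1 + 1 * cos (\<phi> + \<theta> * S m \<omega>))) \<in> borel_measurable (F (grid T m ?k))"
      using iAk Sk by measurable
    have ge: "0 \<le> 1 + cos y" for y :: real using cos_ge_minus_one[of y] by linarith
    have ge2: "0 \<le> 1 + e * cos \<phi>"
    proof -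
      have "\<bar>e * cos \<phi>\<bar> \<le> 1" using T_pos by (simp add: e_def abs_mult mult_le_one)
      then show ?thesis by linarith
    qed
    have len: "real (?k - ?j) * (T / 2 ^ m) = T / 2 ^ n"
    proof -
      have "(2::real) ^ m = 2 ^ n * 2 ^ (m - n)" using m by (simp add: power_add[symmetric])
      then show ?thesis by simp
    qed
    have "(\<integral>\<^sup>+\<omega>. (indicator A \<omega> * ennreal (1 + 1 * cos (\<phi> + \<theta> * S m \<omega>))) * ennreal (exp (logdens m (2 ^ m) \<omega>)) \<partial>M)
       = (\<integral>\<^sup>+\<omega>. (indicator A \<omega> * ennreal (1 + 1 * cos (\<phi> + \<theta> * S m \<omega>))) * ennreal (exp (logdens m ?k \<omega>)) \<partial>M)"
      by (rule nn_integral_logdens[OF kk(1)[OF m] _ H]) simp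
    also have "\<dots> = (\<integral>\<^sup>+\<omega>. indicator A \<omega> * ennreal (exp (logdens m ?k \<omega>)) * ennreal (1 + 1 * cos (\<phi> + \<theta> * S m \<omega>)) \<partial>M)"
      by (simp add: ac_simps)
    also have "\<dots> = (\<integral>\<^sup>+\<omega>. indicator A \<omega> * ennreal (exp (logdens m ?j \<omega>)) * ennreal (1 + 1 * e * cos \<phi>) \<partial>M)"
      unfolding S_def using nn_integral_logdens_cos[OF jk kk(1)[OF m] iA, of 1 \<phi> \<theta>] unfolding len e_def by simp
    also have "\<dots> = (\<integral>\<^sup>+\<omega>. indicator A \<omega> * ennreal (exp (logdens m ?j \<omega>)) \<partial>M) * ennreal (1 + e * cos \<phi>)"
      using logdens_measurable_M[OF kk(2)[OF m]] by (simp add: nn_integral_multc)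
    also have "(\<integral>\<^sup>+\<omega>. indicator A \<omega> * ennreal (exp (logdens m ?j \<omega>)) \<partial>M) = (\<integral>\<^sup>+\<omega>. indicator A \<omega> * ennreal (exp (logdens m (2 ^ m) \<omega>)) \<partial>M)"
      by (rule logdens_integral[OF Aj kk(2)[OF m], symmetric])
    finally have nn: "(\<integral>\<^sup>+\<omega>. (indicator A \<omega> * ennreal (1 + cos (\<phi> + \<theta> * S m \<omega>))) * ennreal (exp (logdens m (2 ^ m) \<omega>)) \<partial>M)
       = (\<integral>\<^sup>+\<omega>. indicator A \<omega> * ennreal (exp (logdens m (2 ^ m) \<omega>)) \<partial>M) * ennreal (1 + e * cos \<phi>)" by simp
    have iL: "integrable M (\<lambda>\<omega>. exp (logdens m (2 ^ m) \<omega>))"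
      by (rule integrable_of_square(1)[OF prob_space_axioms _ second_moment_step[of "\<lambda>_. K" K]])
        (use K_nonneg \<gamma>_bound in auto)
    have iLh: "integrable M (\<lambda>\<omega>. exp (logdens m (2 ^ m) \<omega>) * h \<omega>)"
      if "h \<in> borel_measurable M" "\<And>\<omega>. \<bar>h \<omega>\<bar> \<le> 1" for h
      using that by (intro Bochner_Integration.integrable_bound[OF iL]) (auto simp: abs_mult mult_left_le)
    have i1: "integrable M (\<lambda>\<omega>. exp (logdens m (2 ^ m) \<omega>) * indicator A \<omega>)"
      by (rule iLh) auto
    have i2: "integrable M (\<lambda>\<omega>. exp (logdens m (2 ^ m) \<omega>) * (indicator A \<omega> * cos (\<phi> + \<theta> * S m \<omega>)))"
      using S_meas[OF m] by (intro iLh) (auto simp: indicator_def)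
    have "(\<integral>\<^sup>+\<omega>. (indicator A \<omega> * ennreal (1 + cos (\<phi> + \<theta> * S m \<omega>))) * ennreal (exp (logdens m (2 ^ m) \<omega>)) \<partial>M)
       = (\<integral>\<^sup>+\<omega>. ennreal (exp (logdens m (2 ^ m) \<omega>) * indicator A \<omega> + exp (logdens m (2 ^ m) \<omega>) * (indicator A \<omega> * cos (\<phi> + \<theta> * S m \<omega>))) \<partial>M)"
      by (intro nn_integral_cong) (auto simp: indicator_def ennreal_mult'[symmetric] ge algebra_simps)
    also have "\<dots> = ennreal (LINT \<omega>|M. exp (logdens m (2 ^ m) \<omega>) * indicator A \<omega> + exp (logdens m (2 ^ m) \<omega>) * (indicator A \<omega> * cos (\<phi> + \<theta> * S m \<omega>)))"
    proof (rule nn_integral_eq_integral)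
      show "AE \<omega> in M. 0 \<le> exp (logdens m (2 ^ m) \<omega>) * indicator A \<omega> + exp (logdens m (2 ^ m) \<omega>) * (indicator A \<omega> * cos (\<phi> + \<theta> * S m \<omega>))"
      proof (intro AE_I2)
        fix \<omega>
        have "0 \<le> exp (logdens m (2 ^ m) \<omega>) * indicator A \<omega> * (1 + cos (\<phi> + \<theta> * S m \<omega>))"
          using ge by (intro mult_nonneg_nonneg) auto
        then show "0 \<le> exp (logdens m (2 ^ m) \<omega>) * indicator A \<omega> + exp (logdens m (2 ^ m) \<omega>) * (indicator A \<omega> * cos (\<phi> + \<theta> * S m \<omega>))"
          by (simp add: algebra_simps)
      qed
    qed (use i1 i2 in auto)
    finally have l: "(\<integral>\<^sup>+\<omega>. (indicator A \<omega> * ennreal (1 + cos (\<phi> + \<theta> * S m \<omega>))) * ennreal (exp (logdens m (2 ^ m) \<omega>)) \<partial>M)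
      = ennreal ((LINT \<omega>|M. exp (logdens m (2 ^ m) \<omega>) * indicator A \<omega>) + (LINT \<omega>|M. exp (logdens m (2 ^ m) \<omega>) * (indicator A \<omega> * cos (\<phi> + \<theta> * S m \<omega>))))"
      using i1 i2 by simp
    have "(\<integral>\<^sup>+\<omega>. indicator A \<omega> * ennreal (exp (logdens m (2 ^ m) \<omega>)) \<partial>M) = (\<integral>\<^sup>+\<omega>. ennreal (exp (logdens m (2 ^ m) \<omega>) * indicator A \<omega>) \<partial>M)"
      by (intro nn_integral_cong) (auto simp: indicator_def)
    also have "\<dots> = ennreal (LINT \<omega>|M. exp (logdens m (2 ^ m) \<omega>) * indicator A \<omega>)"
      using i1 by (intro nn_integral_eq_integral) auto
    finally have rr: "(\<integral>\<^sup>+\<omega>. indicator A \<omega> * ennreal (exp (logdens m (2 ^ m) \<omega>)) \<partial>M) * ennreal (1 + e * cos \<phi>)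
       = ennreal ((LINT \<omega>|M. exp (logdens m (2 ^ m) \<omega>) * indicator A \<omega>) * (1 + e * cos \<phi>))"
      using ge2 by (simp add: ennreal_mult'')
    have "0 \<le> (LINT \<omega>|M. exp (logdens m (2 ^ m) \<omega>) * indicator A \<omega>) + (LINT \<omega>|M. exp (logdens m (2 ^ m) \<omega>) * (indicator A \<omega> * cos (\<phi> + \<theta> * S m \<omega>)))"
      unfolding Bochner_Integration.integral_add[OF i1 i2, symmetric]
    proof (rule integral_nonneg_AE, intro AE_I2)
      fix \<omega>
      have "0 \<le> exp (logdens m (2 ^ m) \<omega>) * indicator A \<omega> * (1 + cos (\<phi> + \<theta> * S m \<omega>))"
        using ge by (intro mult_nonneg_nonneg) auto
      then show "0 \<le> exp (logdens m (2 ^ m) \<omega>) * indicator A \<omega> + exp (logdens m (2 ^ m) \<omega>) * (indicator A \<omega> * cos (\<phi> + \<theta> * S m \<omega>))"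
        by (simp add: algebra_simps)
    qed
    moreover have "0 \<le> (LINT \<omega>|M. exp (logdens m (2 ^ m) \<omega>) * indicator A \<omega>) * (1 + e * cos \<phi>)"
      using ge2 by (intro mult_nonneg_nonneg integral_nonneg_AE) auto
    ultimately have "(LINT \<omega>|M. exp (logdens m (2 ^ m) \<omega>) * indicator A \<omega>) + (LINT \<omega>|M. exp (logdens m (2 ^ m) \<omega>) * (indicator A \<omega> * cos (\<phi> + \<theta> * S m \<omega>)))
       = (LINT \<omega>|M. exp (logdens m (2 ^ m) \<omega>) * indicator A \<omega>) * (1 + e * cos \<phi>)"
      using nn unfolding l rr by (simp add: ennreal_inj)
    then show ?thesis by (simp add: algebra_simps)
  qed
  have r_ge: "j \<le> r j" for j using r by (rule strict_mono_imp_increasing)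
  define h where "h j \<omega> = (if n \<le> r j then indicator A \<omega> * cos (\<phi> + \<theta> * S (r j) \<omega>) else 0)" for j \<omega>
  have Slim: "(\<lambda>j. S (r j) \<omega>) \<longlonglongrightarrow> S' \<omega>" if w: "\<omega> \<in> space M" for \<omega>
  proof -
    \<comment> \<open>the averages lag one cell behind, so that the accumulated drift is displaced by one cell at either end\<close>
    have bound: "\<bar>S m \<omega> - S' \<omega>\<bar> \<le> 2 * (K * (T / 2 ^ m))" if m: "n \<le> m" for m
    proof -
      let ?j = "k * 2 ^ (m - n)" and ?k = "Suc k * 2 ^ (m - n)"
      have gj: "grid T m ?j = grid T n k" "grid T m ?k = grid T n (Suc k)"
        using grid_refine[of T n "m - n" k] grid_refine[of T n "m - n" "Suc k"] m by auto
      define J where "J i = (case i of 0 \<Rightarrow> drift 0 \<omega> | Suc l \<Rightarrow> drift (grid T m l) \<omega>)" for i :: nat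
      have c: "coef m i \<omega> * (T / 2 ^ m) = J (Suc i) - J i" for i
        using coef_Suc[OF w, of m] by (cases i) (auto simp: J_def)
      have near: "\<bar>drift (grid T m i) \<omega> - J i\<bar> \<le> K * (T / 2 ^ m)" for i
      proof (cases i)
        case (Suc l)
        have "grid T m l \<ge> 0" using T_pos grid_mono[of T 0 l m] by auto
        then show ?thesis using drift_lipschitz[OF w, of "grid T m l" "grid T m (Suc l)"] T_pos Suc
          by (simp add: J_def grid_Suc)
      qed (use K_nonneg T_pos in \<open>simp add: J_def\<close>)
      have "S m \<omega> = (\<Sum>i=?j..<?k. B (grid T m (Suc i)) \<omega> - B (grid T m i) \<omega>) - (\<Sum>i=?j..<?k. J (Suc i) - J i)"
        unfolding S_def c sum_subtractf ..
      also have "\<dots> = dB n k \<omega> - (J ?k - J ?j)"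
      proof -
        have jk: "?j \<le> ?k" by simp
        show ?thesis
          unfolding sum_Suc_diff'[OF jk, of "\<lambda>i. B (grid T m i) \<omega>"] sum_Suc_diff'[OF jk, of J] gj ..
      qed
      finally have "S m \<omega> - S' \<omega> = (drift (grid T m ?k) \<omega> - J ?k) - (drift (grid T m ?j) \<omega> - J ?j)"
        unfolding S'_def gj by (simp only: diff_diff_eq2 diff_add_eq algebra_simps)
      then show ?thesis using near[of ?k] near[of ?j] by linarith
    qed
    have "(\<lambda>j. 2 * (K * (T / 2 ^ r j))) \<longlonglongrightarrow> 0"
    proof -
      have "(\<lambda>m. 2 * K * T * (1 / 2) ^ m) \<longlonglongrightarrow> 2 * K * T * 0"
        by (intro tendsto_intros LIMSEQ_power_zero) auto
      from LIMSEQ_subseq_LIMSEQ[OF this r] show ?thesis by (simp add: o_def power_one_over mult.assoc)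
    qed
    then have "(\<lambda>j. S (r j) \<omega> - S' \<omega>) \<longlonglongrightarrow> 0"
    proof (rule Lim_null_comparison[rotated])
      show "\<forall>\<^sub>F j in sequentially. norm (S (r j) \<omega> - S' \<omega>) \<le> 2 * (K * (T / 2 ^ r j))"
        using eventually_ge_at_top[of n] by eventually_elim (use bound r_ge in \<open>auto intro: order_trans\<close>)
    qed
    from tendsto_add[OF this tendsto_const[of "S' \<omega>"]] show ?thesis by simp
  qed
  have L1: "(\<lambda>j. LINT \<omega>|M. exp (logdens (r j) (2 ^ r j) \<omega>) * h j \<omega>) \<longlonglongrightarrow> (LINT \<omega>|M. dens r \<omega> * (indicator A \<omega> * cos (\<phi> + \<theta> * S' \<omega>)))"
  proof (rule dens_integral_tendsto)
    show "h j \<in> borel_measurable M" for j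
      unfolding h_def[abs_def] using S_meas[of "r j"] by (cases "n \<le> r j") auto
    show "\<bar>h j \<omega>\<bar> \<le> 1" for j \<omega> by (auto simp: h_def indicator_def)
    fix \<omega> assume w: "\<omega> \<in> space M"
    have "(\<lambda>j. indicator A \<omega> * cos (\<phi> + \<theta> * S (r j) \<omega>)) \<longlonglongrightarrow> indicator A \<omega> * cos (\<phi> + \<theta> * S' \<omega>)"
      by (intro tendsto_intros Slim[OF w])
    then show "(\<lambda>j. h j \<omega>) \<longlonglongrightarrow> indicator A \<omega> * cos (\<phi> + \<theta> * S' \<omega>)"
    proof (rule Lim_transform_eventually)
      show "\<forall>\<^sub>F j in sequentially. indicator A \<omega> * cos (\<phi> + \<theta> * S (r j) \<omega>) = h j \<omega>"
        using eventually_ge_at_top[of n]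
      proof eventually_elim
        case (elim j)
        then have "n \<le> r j" using r_ge[of j] by simp
        then show ?case by (simp add: h_def)
      qed
    qed
  qed measurable
  have L2: "(\<lambda>j. (LINT \<omega>|M. exp (logdens (r j) (2 ^ r j) \<omega>) * indicator A \<omega>) * (e * cos \<phi>)) \<longlonglongrightarrow> (LINT \<omega>|M. dens r \<omega> * indicator A \<omega>) * (e * cos \<phi>)"
    by (intro tendsto_mult tendsto_const dens_integral_tendsto[of "\<lambda>_. indicator A" "indicator A"]) auto
  have L3: "\<forall>\<^sub>F j in sequentially. (LINT \<omega>|M. exp (logdens (r j) (2 ^ r j) \<omega>) * h j \<omega>) = (LINT \<omega>|M. exp (logdens (r j) (2 ^ r j) \<omega>) * indicator A \<omega>) * (e * cos \<phi>)"
    using eventually_ge_at_top[of n]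
  proof eventually_elim
    case (elim j)
    then have "n \<le> r j" using r_ge[of j] by simp
    then show ?case using step[of "r j"] by (simp add: h_def)
  qed
  have "(LINT \<omega>|M. dens r \<omega> * (indicator A \<omega> * cos (\<phi> + \<theta> * S' \<omega>))) = (LINT \<omega>|M. dens r \<omega> * indicator A \<omega>) * (e * cos \<phi>)"
    by (rule LIMSEQ_unique[OF Lim_transform_eventually[OF L1 L3] L2])
  then show ?thesis by (simp add: S'_def e_def)
qed

text \<open>The cosines of all frequencies and phases determine the joint law of the past and the next increment.\<close>

theorem girsanov: "dyadic_bm (density M (\<lambda>\<omega>. ennreal (dens r \<omega>))) T F (\<lambda>t \<omega>. B t \<omega> - drift t \<omega>)"
proof -
  let ?Q = "density M (\<lambda>\<omega>. ennreal (dens r \<omega>))"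
  interpret Q: prob_space ?Q by (rule prob_space_dens)
  have drM: "drift t \<in> borel_measurable M" if "t \<in> {0..T}" for t
    using F_measurable_M[OF drift_adapted[OF that] that] .
  have int: "(LINT \<omega>|?Q. f \<omega>) = (LINT \<omega>|M. dens r \<omega> * f \<omega>)" if "f \<in> borel_measurable M" for f :: "'a \<Rightarrow> real"
    using that dens_pos by (subst integral_density) (auto intro: less_imp_le)
  show ?thesis
  proof
    show "T > 0" by (rule T_pos)
    fix t assume t: "t \<in> {0..T}"
    show "subalgebra ?Q (F t)" using subalg[OF t] by (simp add: subalgebra_def)
    show "(\<lambda>\<omega>. B t \<omega> - drift t \<omega>) \<in> borel_measurable (F t)"
      using B_adapted[OF t] drift_adapted[OF t] by measurable
  next
    fix s t assume "0 \<le> s" "s \<le> t" "t \<le> T"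
    then show "sets (F s) \<subseteq> sets (F t)" by (rule F_mono)
  next
    fix \<omega> assume "\<omega> \<in> space ?Q"
    then have w: "\<omega> \<in> space M" by simp
    then show "continuous_on {0..T} (\<lambda>t. B t \<omega> - drift t \<omega>)"
      by (intro continuous_on_diff B_cont drift_continuous)
  next
    have d0: "drift 0 \<omega> = 0" for \<omega>
      unfolding drift_def set_lebesgue_integral_def
      by (rule integral_eq_zero_AE) (use AE_lborel_singleton[of "0::real"] in eventually_elim, simp)
    have "AE \<omega> in M. B 0 \<omega> - drift 0 \<omega> = 0"
      using B_0 by eventually_elim (simp add: d0)
    then show "AE \<omega> in ?Q. B 0 \<omega> - drift 0 \<omega> = 0"
      by (auto simp: AE_density)
  next
    fix n k A C assume k: "k < (2::nat) ^ n" and A: "A \<in> sets (F (grid T n k))" and C: "C \<in> sets (borel :: real measure)"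
    let ?Y = "\<lambda>\<omega>. dB n k \<omega> - (drift (grid T n (Suc k)) \<omega> - drift (grid T n k) \<omega>)"
    have AM [measurable]: "A \<in> sets M"
      using subalg[OF grid_mem[of k n]] A k by (auto simp: subalgebra_def)
    have Y [measurable]: "?Y \<in> borel_measurable M"
      using k by (intro borel_measurable_diff[OF dB_measurable[OF k] borel_measurable_diff] drM grid_mem) auto
    have QA: "Q.prob A = (LINT \<omega>|M. dens r \<omega> * indicator A \<omega>)"
    proof -
      have "A \<inter> space M = A" using sets.sets_into_space[OF AM] by blast
      then have "(LINT \<omega>|?Q. indicator A \<omega> :: real) = Q.prob A" by simp
      then show ?thesis using int[of "indicator A"] by simp
    qed
    have "Q.prob (A \<inter> {\<omega>\<in>space ?Q. ?Y \<omega> \<in> C}) = Q.prob A * measure (gauss (T / 2 ^ n)) C"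
    proof (rule indep_gauss_of_cos[OF Q.prob_space_axioms _ _ step_pos _ C])
      fix \<theta> \<phi>
      show "(LINT \<omega>|?Q. indicator A \<omega> * cos (\<phi> + \<theta> * ?Y \<omega>)) = Q.prob A * (exp (- (\<theta>\<^sup>2 * (T / 2 ^ n)) / 2) * cos \<phi>)"
        unfolding QA by (subst int) (simp_all add: dens_cos[OF k A], measurable)
    qed auto
    moreover have "?Y \<omega> = (B (grid T n (Suc k)) \<omega> - drift (grid T n (Suc k)) \<omega>) - (B (grid T n k) \<omega> - drift (grid T n k) \<omega>)" for \<omega>
      by simp
    ultimately show "Q.prob (A \<inter> {\<omega>\<in>space ?Q. (B (grid T n (Suc k)) \<omega> - drift (grid T n (Suc k)) \<omega>) - (B (grid T n k) \<omega> - drift (grid T n k) \<omega>) \<in> C}) =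
      Q.prob A * measure (gauss (T / 2 ^ n)) C" by simp
  qed
qed

end

end

section \<open>Drifts that are functionals of the path\<close>

lemma grid_idx_tendsto:
  assumes T: "T > 0" and s: "s \<in> {0..T}"
  shows "(\<lambda>n. grid T n (idx T n s)) \<longlonglongrightarrow> s"
proof (cases "s = 0")
  case False
  then have s': "s \<in> {0<..T}" using s by auto
  have 1: "s - T / 2 ^ n \<le> grid T n (idx T n s)" "grid T n (idx T n s) \<le> s" for n
    using mem_cell_idx(2)[OF T s', of n] by (auto simp: grid_Suc)
  have "(\<lambda>n. s - T * (1 / 2) ^ n) \<longlonglongrightarrow> s - T * 0"
    by (intro tendsto_intros LIMSEQ_power_zero) auto
  then have "(\<lambda>n. s - T / 2 ^ n) \<longlonglongrightarrow> s" by (simp add: power_one_over)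
  then show ?thesis
    by (rule tendsto_sandwich[OF _ _ _ tendsto_const[of s], rotated 2]) (use 1 in auto)
qed (simp add: idx_0)

text \<open>Evaluation at a random time is the limit of evaluations at grid points.\<close>

lemma eval_joint_measurable:
  assumes T: "T > 0" and f: "f \<in> borel_measurable N" "\<And>p. p \<in> space N \<Longrightarrow> f p \<in> {0..T}"
    and h: "h \<in> N \<rightarrow>\<^sub>M path_space T"
  shows "(\<lambda>p. h p (f p)) \<in> borel_measurable N"
proof (rule borel_measurable_LIMSEQ_real)
  fix p assume p: "p \<in> space N"
  have "h p \<in> space (path_space T)" using h p by (rule measurable_space)
  then have "continuous_on {0..T} (h p)" by (simp add: path_mem_iff)
  moreover have "grid T n (idx T n (f p)) \<in> {0..T}" for n
    using idx_less[OF T f(2)[OF p]] T by (intro grid_in) (auto intro: less_imp_le)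
  ultimately show "(\<lambda>n. h p (grid T n (idx T n (f p)))) \<longlonglongrightarrow> h p (f p)"
    using grid_idx_tendsto[OF T f(2)[OF p]] f(2)[OF p]
    unfolding continuous_on_sequentially by (auto simp: o_def)
next
  fix n
  have "(\<lambda>p. if idx T n (f p) \<le> 2 ^ n then h p (grid T n (idx T n (f p))) else 0) \<in> borel_measurable N"
  proof (rule measurable_compose_countable[where g = "\<lambda>p. idx T n (f p)" and f = "\<lambda>i p. if i \<le> 2 ^ n then h p (grid T n i) else 0"])
    fix i
    show "(\<lambda>p. if i \<le> 2 ^ n then h p (grid T n i) else 0) \<in> borel_measurable N"
      using measurable_compose[OF h eval_measurable_path[OF T grid_in[of T i n]]] T by (cases "i \<le> 2 ^ n") auto
  qed (use f in measurable)
  then show "(\<lambda>p. h p (grid T n (idx T n (f p)))) \<in> borel_measurable N"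
    by (rule measurable_cong[THEN iffD1, rotated]) (use idx_less[OF T f(2)] in \<open>auto dest: less_imp_le\<close>)
qed

locale path_drift =
  fixes T K :: real and g :: "real \<Rightarrow> (real \<Rightarrow> real) \<Rightarrow> real"
  assumes horizon: "T > 0"
    and joint: "(\<lambda>(s, w). g s w) \<in> borel_measurable (borel \<Otimes>\<^sub>M path_space T)"
    and bound: "\<And>s w. w \<in> space (path_space T) \<Longrightarrow> \<bar>g s w\<bar> \<le> K"
    and nonanticipating: "\<And>s w w'. s \<in> {0..T} \<Longrightarrow> w \<in> space (path_space T) \<Longrightarrow> w' \<in> space (path_space T) \<Longrightarrow>
      (\<And>u. u \<in> {0..s} \<Longrightarrow> w u = w' u) \<Longrightarrow> g s w = g s w'"
begin

lemma measurable_compose_drift: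
  assumes "f \<in> borel_measurable N" "h \<in> N \<rightarrow>\<^sub>M path_space T"
  shows "(\<lambda>p. g (f p) (h p)) \<in> borel_measurable N"
  using measurable_compose[OF measurable_Pair[OF assms] joint] by simp

lemma set_integral_measurable:
  assumes h: "h \<in> N \<rightarrow>\<^sub>M path_space T" and A: "A \<in> sets borel"
  shows "(\<lambda>\<omega>. LINT s:A|lborel. g s (h \<omega>)) \<in> borel_measurable N"
proof -
  note [measurable] = A measurable_compose_drift[OF measurable_snd measurable_compose[OF measurable_fst h]]
  have "(\<lambda>(\<omega>, s). indicator A s *\<^sub>R g s (h \<omega>)) \<in> borel_measurable (N \<Otimes>\<^sub>M lborel)" by measurable
  from lborel.borel_measurable_lebesgue_integral[OF this] show ?thesis
    unfolding set_lebesgue_integral_def .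
qed

text \<open>Stopping the process at time \<open>t\<close> does not change the drift up to \<open>t\<close>, and the stopped path is
  measurable with respect to \<open>F t\<close>.\<close>

lemma bounded_drift:
  assumes "dyadic_bm M T F B" and Y: "continuous_adapted T M F Y"
  shows "bounded_drift M T F B (\<lambda>s \<omega>. g s (path_of T Y \<omega>)) K"
proof -
  interpret dyadic_bm M T F B by fact
  have Ya: "Y t \<in> borel_measurable (F t)" if "t \<in> {0..T}" for t using Y that by (simp add: continuous_adapted_def)
  have Yc: "continuous_on {0..T} (\<lambda>t. Y t \<omega>)" if "\<omega> \<in> space M" for \<omega> using Y that by (simp add: continuous_adapted_def)
  have pm: "path_of T Y \<in> M \<rightarrow>\<^sub>M path_space T"
    using F_measurable_M[OF Ya] Yc by (intro path_of_measurable T_pos) auto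
  show ?thesis
  proof
    show "(\<lambda>(s, \<omega>). g s (path_of T Y \<omega>)) \<in> borel_measurable (borel \<Otimes>\<^sub>M M)"
      using measurable_compose_drift[OF measurable_fst measurable_compose[OF measurable_snd pm]]
      by (simp add: split_beta')
    show "\<bar>g s (path_of T Y \<omega>)\<bar> \<le> K" if "\<omega> \<in> space M" for s \<omega>
      using measurable_space[OF pm that] by (rule bound)
    fix t assume t: "t \<in> {0..T}"
    define S where "S u = Y (min u t)" for u
    have sp: "space (F t) = space M" using t by (rule space_F)
    have S: "path_of T S \<in> F t \<rightarrow>\<^sub>M path_space T"
    proof (rule path_of_measurable[OF horizon])
      fix u assume "u \<in> {0..T}"
      then show "S u \<in> borel_measurable (F t)" unfolding S_def
        using t by (intro F_measurable_mono[OF Ya, of "min u t" t]) auto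
    next
      fix \<omega> assume "\<omega> \<in> space (F t)"
      then show "continuous_on {0..T} (\<lambda>u. S u \<omega>)" unfolding S_def sp
        using t by (intro continuous_on_compose2[OF Yc[of \<omega>]] continuous_intros) auto
    qed
    have "(LINT s:{0..t}|lborel. g s (path_of T Y \<omega>)) = (LINT s:{0..t}|lborel. g s (path_of T S \<omega>))" if w: "\<omega> \<in> space M" for \<omega>
    proof (rule set_lebesgue_integral_cong)
      show "\<forall>s. s \<in> {0..t} \<longrightarrow> g s (path_of T Y \<omega>) = g s (path_of T S \<omega>)"
      proof (intro allI impI)
        fix s assume s: "s \<in> {0..t}"
        show "g s (path_of T Y \<omega>) = g s (path_of T S \<omega>)"
        proof (rule nonanticipating)
          show "path_of T Y \<omega> \<in> space (path_space T)" using pm w by (rule measurable_space)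
          show "path_of T S \<omega> \<in> space (path_space T)" using S w by (intro measurable_space[OF S]) (simp add: sp)
          show "path_of T Y \<omega> u = path_of T S \<omega> u" if "u \<in> {0..s}" for u
            using that s t by (simp add: path_of_def S_def min_def)
        qed (use s t in auto)
      qed
    qed simp
    moreover have I: "{0..t} \<in> sets borel" by simp
    ultimately show "(\<lambda>\<omega>. LINT s:{0..t}|lborel. g s (path_of T Y \<omega>)) \<in> borel_measurable (F t)"
      by (intro measurable_cong[THEN iffD2, OF _ set_integral_measurable[OF S I]]) (simp_all add: sp)
  qed
qed

end

text \<open>The limiting density depends on the subsequence; for a comparison of two solutions it has to be the
  same for both.\<close>

lemma common_subsequence:
  fixes e1 e2 :: "nat \<Rightarrow> ennreal"
  assumes "e1 \<longlonglongrightarrow> 0" "e2 \<longlonglongrightarrow> 0"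
  obtains r where "strict_mono r" "\<And>j. e1 (r j) \<le> ennreal ((1 / 4) ^ j)" "\<And>j. e2 (r j) \<le> ennreal ((1 / 4) ^ j)"
proof -
  have "\<exists>N. \<forall>n\<ge>N. e1 n \<le> ennreal ((1 / 4) ^ j) \<and> e2 n \<le> ennreal ((1 / 4) ^ j)" for j
  proof -
    have p: "(0::ennreal) < ennreal ((1 / 4) ^ j)" by simp
    have "\<forall>\<^sub>F n in sequentially. e1 n < ennreal ((1 / 4) ^ j) \<and> e2 n < ennreal ((1 / 4) ^ j)"
      using order_tendstoD(2)[OF assms(1) p] order_tendstoD(2)[OF assms(2) p] by eventually_elim simp
    then show ?thesis unfolding eventually_sequentially by (meson less_imp_le)
  qed
  then obtain N where N: "\<And>j n. n \<ge> N j \<Longrightarrow> e1 n \<le> ennreal ((1 / 4) ^ j) \<and> e2 n \<le> ennreal ((1 / 4) ^ j)" by metis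
  define r where "r = rec_nat (N 0) (\<lambda>j m. max (Suc m) (N (Suc j)))"
  have r: "r 0 = N 0" "r (Suc j) = max (Suc (r j)) (N (Suc j))" for j by (simp_all add: r_def)
  have "strict_mono r" unfolding strict_mono_Suc_iff r(2) by (simp add: less_max_iff_disj)
  moreover have "r j \<ge> N j" for j by (cases j) (simp_all add: r)
  ultimately show ?thesis using that N by blast
qed

section \<open>Uniqueness in law for bounded path-dependent drifts\<close>

context path_drift
begin

definition path_coef :: "nat \<Rightarrow> nat \<Rightarrow> (real \<Rightarrow> real) \<Rightarrow> real" where
  "path_coef n k w = cavg (\<lambda>s. - g s w) T n k"

text \<open>The logarithm of the discretised density as a functional of the solution path alone: the driving noise is
  the path minus its accumulated drift. The coefficients carry a minus sign because this change of
  measure removes the drift.\<close>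

definition path_logdens :: "nat \<Rightarrow> (real \<Rightarrow> real) \<Rightarrow> real" where
  "path_logdens n w = (\<Sum>k<2^n. path_coef n k w *
      ((w (grid T n (Suc k)) - (LINT s:{0..grid T n (Suc k)}|lborel. g s w)) - (w (grid T n k) - (LINT s:{0..grid T n k}|lborel. g s w)))
      - (path_coef n k w)\<^sup>2 * (T / 2 ^ n) / 2)"

definition path_dens :: "(nat \<Rightarrow> nat) \<Rightarrow> (real \<Rightarrow> real) \<Rightarrow> real" where
  "path_dens r w = exp (lim (\<lambda>j. path_logdens (r j) w))"

lemma path_logdens_measurable: "path_logdens n \<in> borel_measurable (path_space T)"
proof -
  have id: "(\<lambda>w. w) \<in> path_space T \<rightarrow>\<^sub>M path_space T" by simp
  have c [measurable]: "path_coef n k \<in> borel_measurable (path_space T)" for k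
  proof -
    have "(\<lambda>w. LINT s:cell T n (k - 1)|lborel. - g s w) = (\<lambda>w. - (LINT s:cell T n (k - 1)|lborel. g s w))"
      by (simp add: set_lebesgue_integral_def)
    then have "(\<lambda>w. LINT s:cell T n (k - 1)|lborel. - g s w) \<in> borel_measurable (path_space T)"
      using set_integral_measurable[OF id, of "cell T n (k - 1)"] by simp
    then show ?thesis unfolding path_coef_def[abs_def] cavg_def by (cases "k = 0") simp_all
  qed
  have [measurable]: "(\<lambda>w. LINT s:{0..t}|lborel. g s w) \<in> borel_measurable (path_space T)" for t
    by (rule set_integral_measurable[OF id]) simp
  show ?thesis unfolding path_logdens_def[abs_def]
  proof (rule borel_measurable_sum)
    fix k assume k: "k \<in> {..<(2::nat) ^ n}"
    have [measurable]: "(\<lambda>w. w (grid T n k)) \<in> borel_measurable (path_space T)" "(\<lambda>w. w (grid T n (Suc k))) \<in> borel_measurable (path_space T)"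
      using k horizon by (auto intro!: eval_measurable_path grid_in)
    show "(\<lambda>w. path_coef n k w *
      ((w (grid T n (Suc k)) - (LINT s:{0..grid T n (Suc k)}|lborel. g s w)) - (w (grid T n k) - (LINT s:{0..grid T n k}|lborel. g s w)))
      - (path_coef n k w)\<^sup>2 * (T / 2 ^ n) / 2) \<in> borel_measurable (path_space T)" by measurable
  qed
qed

lemma path_dens_measurable: "path_dens r \<in> borel_measurable (path_space T)"
  unfolding path_dens_def[abs_def]
  by (intro borel_measurable_exp[THEN measurable_compose[rotated]] borel_measurable_lim_metric path_logdens_measurable)

lemma uminus_drift: "path_drift T K (\<lambda>s w. - g s w)"
proof
  show "(\<lambda>(s, w). - g s w) \<in> borel_measurable (borel \<Otimes>\<^sub>M path_space T)"
    using borel_measurable_uminus[OF joint] by (simp add: split_beta')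
  fix s w w' assume "s \<in> {0..T}" "w \<in> space (path_space T)" "w' \<in> space (path_space T)" "\<And>u. u \<in> {0..s} \<Longrightarrow> w u = w' u"
  then show "- g s w = - g s w'" using nonanticipating[of s w w'] by simp
qed (use horizon bound in auto)

text \<open>Girsanov's theorem turns the law of a solution into the law of Brownian motion; the density
  of the inverse change of measure depends on the solution path only.\<close>

lemma path_law_solution:
  assumes bm: "dyadic_bm M T F B" and Y: "continuous_adapted T M F Y"
    and eq: "AE \<omega> in M. \<forall>t\<in>{0..T}. Y t \<omega> = B t \<omega> + (LINT s:{0..t}|lborel. g s (path_of T Y \<omega>))"
    and r: "strict_mono r" "\<And>j. bounded_drift.err M T (\<lambda>s \<omega>. - g s (path_of T Y \<omega>)) (r j) \<le> ennreal ((1 / 4) ^ j)"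
  obtains Q B' where "dyadic_bm Q T F B'"
    "path_law T M Y = density (path_law T Q B') (\<lambda>w. ennreal (1 / path_dens r w))"
proof -
  interpret bounded_drift M T F B "\<lambda>s \<omega>. - g s (path_of T Y \<omega>)" K
    by (rule path_drift.bounded_drift[OF uminus_drift bm Y])
  let ?Q = "density M (\<lambda>\<omega>. ennreal (dens r \<omega>))" and ?B = "\<lambda>t \<omega>. B t \<omega> - drift t \<omega>"
  have Q: "dyadic_bm ?Q T F ?B" using r by (rule girsanov)
  interpret Q: dyadic_bm ?Q T F ?B by (rule Q)
  have Ya: "Y t \<in> borel_measurable (F t)" if "t \<in> {0..T}" for t using Y that by (simp add: continuous_adapted_def)
  have Yc: "continuous_on {0..T} (\<lambda>t. Y t \<omega>)" if "\<omega> \<in> space M" for \<omega> using Y that by (simp add: continuous_adapted_def)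
  have pm: "path_of T Y \<in> M \<rightarrow>\<^sub>M path_space T"
    using F_measurable_M[OF Ya] Yc by (intro path_of_measurable T_pos) auto
  have dr: "drift t \<omega> = - (LINT s:{0..t}|lborel. g s (path_of T Y \<omega>))" for t \<omega>
    by (simp add: drift_def set_lebesgue_integral_def)
  have lawQ: "path_law T ?Q ?B = distr ?Q (path_space T) (path_of T Y)"
    unfolding path_law_def
  proof (rule distr_cong_AE)
    show "AE \<omega> in ?Q. path_of T ?B \<omega> = path_of T Y \<omega>"
    proof -
      have "AE \<omega> in M. path_of T ?B \<omega> = path_of T Y \<omega>"
        using eq by eventually_elim (rule path_of_cong, simp add: dr)
      then show ?thesis by (auto simp: AE_density)
    qed
    show "path_of T ?B \<in> ?Q \<rightarrow>\<^sub>M path_space T" by (rule Q.path_of_B_measurable)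
  qed (use pm in auto)
  have AEd: "AE \<omega> in M. dens r \<omega> = path_dens r (path_of T Y \<omega>)"
    using eq AE_space
  proof eventually_elim
    case (elim \<omega>)
    let ?w = "path_of T Y \<omega>"
    have b: "B t \<omega> = ?w t - (LINT s:{0..t}|lborel. g s ?w)" if "t \<in> {0..T}" for t
      using elim that by (simp add: path_of_apply)
    have "logdens n (2 ^ n) \<omega> = path_logdens n ?w" for n
      unfolding logdens_def path_logdens_def
    proof (rule sum.cong[OF refl])
      fix k assume "k \<in> {..<(2::nat) ^ n}"
      then have "grid T n k \<in> {0..T}" "grid T n (Suc k) \<in> {0..T}"
        using grid_mem[of k n] grid_mem[of "Suc k" n] by (simp_all add: Suc_le_eq)
      then show "coef n k \<omega> * dB n k \<omega> - (coef n k \<omega>)\<^sup>2 * (T / 2 ^ n) / 2 = path_coef n k ?w *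
        ((?w (grid T n (Suc k)) - (LINT s:{0..grid T n (Suc k)}|lborel. g s ?w)) - (?w (grid T n k) - (LINT s:{0..grid T n k}|lborel. g s ?w)))
        - (path_coef n k ?w)\<^sup>2 * (T / 2 ^ n) / 2"
        by (simp only: coef_def path_coef_def b)
    qed
    then show ?case by (simp add: dens_def loglim_def path_dens_def)
  qed
  have "path_law T M Y = density (path_law T ?Q ?B) (\<lambda>w. ennreal (1 / path_dens r w))"
  proof (rule measure_eqI)
    fix E assume "E \<in> sets (path_law T M Y)"
    then have E: "E \<in> sets (path_space T)" by (simp add: path_law_def)
    note [measurable] = path_dens_measurable pm E
    have "emeasure (density (path_law T ?Q ?B) (\<lambda>w. ennreal (1 / path_dens r w))) E
      = (\<integral>\<^sup>+w. ennreal (1 / path_dens r w) * indicator E w \<partial>distr ?Q (path_space T) (path_of T Y))"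
      unfolding lawQ by (subst emeasure_density) auto
    also have "\<dots> = (\<integral>\<^sup>+\<omega>. ennreal (1 / path_dens r (path_of T Y \<omega>)) * indicator E (path_of T Y \<omega>) \<partial>?Q)"
      by (subst nn_integral_distr) auto
    also have "\<dots> = (\<integral>\<^sup>+\<omega>. ennreal (dens r \<omega>) * (ennreal (1 / path_dens r (path_of T Y \<omega>)) * indicator E (path_of T Y \<omega>)) \<partial>M)"
      by (subst nn_integral_density) auto
    also have "\<dots> = (\<integral>\<^sup>+\<omega>. indicator (path_of T Y -` E \<inter> space M) \<omega> \<partial>M)"
    proof (rule nn_integral_cong_AE)
      show "AE \<omega> in M. ennreal (dens r \<omega>) * (ennreal (1 / path_dens r (path_of T Y \<omega>)) * indicator E (path_of T Y \<omega>))
        = indicator (path_of T Y -` E \<inter> space M) \<omega>"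
        using AEd AE_space
      proof eventually_elim
        case (elim \<omega>)
        then have "ennreal (dens r \<omega>) * ennreal (1 / path_dens r (path_of T Y \<omega>)) = 1"
          using dens_pos[of r \<omega>] by (simp add: ennreal_mult'[symmetric])
        then show ?case using elim by (simp add: mult.assoc[symmetric] indicator_def)
      qed
    qed
    also have "\<dots> = emeasure (path_law T M Y) E"
      unfolding path_law_def by (simp add: emeasure_distr)
    finally show "emeasure (path_law T M Y) E = emeasure (density (path_law T ?Q ?B) (\<lambda>w. ennreal (1 / path_dens r w))) E" ..
  qed (simp add: path_law_def)
  with Q that show ?thesis by blast
qed

text \<open>Both laws have the same density with respect to the law of Brownian motion.\<close>

theorem path_dependent_law_unique:
  assumes bm1: "dyadic_bm M1 T F1 B1" and Y1: "continuous_adapted T M1 F1 Y1"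
    and eq1: "AE \<omega> in M1. \<forall>t\<in>{0..T}. Y1 t \<omega> = B1 t \<omega> + (LINT s:{0..t}|lborel. g s (path_of T Y1 \<omega>))"
    and bm2: "dyadic_bm M2 T F2 B2" and Y2: "continuous_adapted T M2 F2 Y2"
    and eq2: "AE \<omega> in M2. \<forall>t\<in>{0..T}. Y2 t \<omega> = B2 t \<omega> + (LINT s:{0..t}|lborel. g s (path_of T Y2 \<omega>))"
  shows "path_law T M1 Y1 = path_law T M2 Y2"
proof -
  interpret d1: bounded_drift M1 T F1 B1 "\<lambda>s \<omega>. - g s (path_of T Y1 \<omega>)" K
    by (rule path_drift.bounded_drift[OF uminus_drift bm1 Y1])
  interpret d2: bounded_drift M2 T F2 B2 "\<lambda>s \<omega>. - g s (path_of T Y2 \<omega>)" K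
    by (rule path_drift.bounded_drift[OF uminus_drift bm2 Y2])
  obtain r where r: "strict_mono r" "\<And>j. d1.err (r j) \<le> ennreal ((1 / 4) ^ j)" "\<And>j. d2.err (r j) \<le> ennreal ((1 / 4) ^ j)"
    using common_subsequence[OF d1.err_tendsto d2.err_tendsto] by blast
  obtain Q1 B1' where 1: "dyadic_bm Q1 T F1 B1'"
    "path_law T M1 Y1 = density (path_law T Q1 B1') (\<lambda>w. ennreal (1 / path_dens r w))"
    using path_law_solution[OF bm1 Y1 eq1 r(1,2)] by blast
  obtain Q2 B2' where 2: "dyadic_bm Q2 T F2 B2'"
    "path_law T M2 Y2 = density (path_law T Q2 B2') (\<lambda>w. ennreal (1 / path_dens r w))"
    using path_law_solution[OF bm2 Y2 eq2 r(1,3)] by blast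
  show ?thesis unfolding 1(2) 2(2) dyadic_bm_law_unique[OF 1(1) 2(1)] ..
qed

end

section \<open>Uniqueness in law for drifts of linear growth\<close>

text \<open>Whether a path has stayed in the open ball of radius \<open>R\<close> up to time \<open>s\<close>, expressed by countably
  many evaluations.\<close>

definition alive :: "real \<Rightarrow> real \<Rightarrow> (real \<Rightarrow> real) \<Rightarrow> bool" where
  "alive R s w \<longleftrightarrow> (\<exists>c :: rat. of_rat c < R \<and> (\<forall>n. \<forall>k. k \<le> 2 ^ n \<longrightarrow> \<bar>w (grid s n k)\<bar> \<le> of_rat c))"

lemma alive_iff:
  assumes s: "s \<ge> 0" and w: "continuous_on {0..s} w"
  shows "alive R s w \<longleftrightarrow> (\<forall>u\<in>{0..s}. \<bar>w u\<bar> < R)"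
proof
  assume "alive R s w"
  then obtain c :: rat where c: "of_rat c < R" "\<And>n k. k \<le> 2 ^ n \<Longrightarrow> \<bar>w (grid s n k)\<bar> \<le> of_rat c"
    by (auto simp: alive_def)
  show "\<forall>u\<in>{0..s}. \<bar>w u\<bar> < R"
  proof
    fix u assume u: "u \<in> {0..s}"
    show "\<bar>w u\<bar> < R"
    proof (cases "s = 0")
      case True
      then show ?thesis using u c(2)[of 0 0] c(1) by simp
    next
      case False
      then have s': "s > 0" using s by simp
      have "continuous_on {0..s} (\<lambda>u. \<bar>w u\<bar>)" using w by (intro continuous_intros)
      from grid_continuous_limit[OF s' u this]
      obtain k where k: "\<And>n. k n \<le> 2 ^ n" "(\<lambda>n. \<bar>w (grid s n (k n))\<bar>) \<longlonglongrightarrow> \<bar>w u\<bar>" by blast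
      have "\<bar>w u\<bar> \<le> of_rat c" by (rule LIMSEQ_le_const2[OF k(2)]) (use c(2) k(1) in auto)
      then show ?thesis using c(1) by linarith
    qed
  qed
next
  assume R: "\<forall>u\<in>{0..s}. \<bar>w u\<bar> < R"
  have "continuous_on {0..s} (\<lambda>u. \<bar>w u\<bar>)" using w by (intro continuous_intros)
  then obtain m where m: "m \<in> {0..s}" "\<And>u. u \<in> {0..s} \<Longrightarrow> \<bar>w u\<bar> \<le> \<bar>w m\<bar>"
    using continuous_attains_sup[of "{0..s}" "\<lambda>u. \<bar>w u\<bar>"] s by auto
  obtain c :: rat where c: "\<bar>w m\<bar> < of_rat c" "of_rat c < R" using R m(1) of_rat_dense by blast
  show "alive R s w" unfolding alive_def
  proof (intro exI[of _ c] conjI allI impI)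
    fix n k :: nat assume "k \<le> 2 ^ n"
    then have "grid s n k \<in> {0..s}" using s by (intro grid_in) auto
    then show "\<bar>w (grid s n k)\<bar> \<le> of_rat c" using m(2) c(1) by force
  qed (rule c(2))
qed

lemma alive_cong:
  assumes s: "s \<ge> 0" and w: "\<And>u. u \<in> {0..s} \<Longrightarrow> w u = w' u"
  shows "alive R s w \<longleftrightarrow> alive R s w'"
proof -
  have "w (grid s n k) = w' (grid s n k)" if "k \<le> 2 ^ n" for n k
    using that s by (intro w grid_in)
  then show ?thesis by (auto simp: alive_def)
qed

lemma alive_measurable:
  assumes T: "T > 0" and f: "f \<in> borel_measurable N" and h: "h \<in> N \<rightarrow>\<^sub>M path_space T"
  shows "Measurable.pred N (\<lambda>p. f p \<in> {0..T} \<and> alive R (f p) (h p))"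
proof -
  define c where "c s = max 0 (min T s)" for s
  have [measurable]: "c \<in> borel_measurable borel" unfolding c_def by measurable
  note [measurable] = f
  have g: "(\<lambda>p. h p (grid (c (f p)) n k)) \<in> borel_measurable N" if k: "k \<le> 2 ^ n" for n k
  proof (rule eval_joint_measurable[OF T _ _ h])
    show "(\<lambda>p. grid (c (f p)) n k) \<in> borel_measurable N" unfolding grid_def by measurable
    fix p
    have "0 \<le> c (f p)" "c (f p) \<le> T" using T by (auto simp: c_def)
    then show "grid (c (f p)) n k \<in> {0..T}" using grid_in[of "c (f p)" k n] k by auto
  qed
  have P0: "Measurable.pred N (\<lambda>p. k \<le> 2 ^ n \<longrightarrow> \<bar>h p (grid (c (f p)) n k)\<bar> \<le> of_rat q)" for n k :: nat and q :: rat
  proof (cases "k \<le> 2 ^ n")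
    case True
    note [measurable] = g[OF True]
    have "Measurable.pred N (\<lambda>p. \<bar>h p (grid (c (f p)) n k)\<bar> \<le> of_rat q)" by measurable
    with True show ?thesis by simp
  qed simp
  have P1: "Measurable.pred N (\<lambda>p. \<forall>n k. k \<le> 2 ^ n \<longrightarrow> \<bar>h p (grid (c (f p)) n k)\<bar> \<le> of_rat q)" for q :: rat
    by (intro pred_intros_countable P0)
  have P2: "Measurable.pred N (\<lambda>p. of_rat q < R \<and> (\<forall>n k. k \<le> 2 ^ n \<longrightarrow> \<bar>h p (grid (c (f p)) n k)\<bar> \<le> of_rat q))" for q :: rat
    by (rule pred_intros_logic(3)[OF _ P1]) simp
  have P3: "Measurable.pred N (\<lambda>p. alive R (c (f p)) (h p))"
    unfolding alive_def by (intro pred_intros_countable P2)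
  have P4: "Measurable.pred N (\<lambda>p. f p \<in> {0..T})" by measurable
  have "Measurable.pred N (\<lambda>p. f p \<in> {0..T} \<and> alive R (c (f p)) (h p))"
    by (rule pred_intros_logic(3)[OF P4 P3])
  moreover have "(f p \<in> {0..T} \<and> alive R (c (f p)) (h p)) = (f p \<in> {0..T} \<and> alive R (f p) (h p))" for p
    by (auto simp: c_def)
  ultimately show ?thesis by (simp only:)
qed

text \<open>Switching the drift off at the exit from the ball makes it bounded; it becomes a functional of the path.\<close>

definition stopped_drift :: "real \<Rightarrow> real \<Rightarrow> (real \<Rightarrow> real \<Rightarrow> real) \<Rightarrow> real \<Rightarrow> (real \<Rightarrow> real) \<Rightarrow> real" where
  "stopped_drift T R \<beta> s w = (if s \<in> {0..T} \<and> alive R s w then \<beta> s (w s) else 0)"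

definition shift_path :: "real \<Rightarrow> real \<Rightarrow> (real \<Rightarrow> real) \<Rightarrow> real \<Rightarrow> real" where
  "shift_path T x w = (\<lambda>t\<in>{0..T}. x + w t)"

lemma shift_path_measurable:
  assumes T: "T > 0"
  shows "shift_path T x \<in> path_space T \<rightarrow>\<^sub>M path_space T"
proof (rule measurable_path_spaceI[OF T])
  fix w assume "w \<in> space (path_space T)"
  then have "continuous_on {0..T} (\<lambda>t. x + w t)" by (intro continuous_intros) (simp add: path_mem_iff)
  then have "continuous_on {0..T} (\<lambda>t\<in>{0..T}. x + w t)" by (rule continuous_on_eq) simp
  then show "shift_path T x w \<in> space (path_space T)" by (simp add: path_mem_iff shift_path_def)
next
  fix t assume "t \<in> {0..T}"
  then show "(\<lambda>w. shift_path T x w t) \<in> borel_measurable (path_space T)"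
    using eval_measurable_path[OF T] by (simp add: shift_path_def)
qed

lemma stopped_path_drift:
  assumes T: "T > 0" and \<beta> [measurable]: "(\<lambda>(s, y). \<beta> s y) \<in> borel_measurable (borel \<Otimes>\<^sub>M borel)"
    and C: "C \<ge> 0" and R: "R > 0" and growth: "\<And>s y. s \<in> {0..T} \<Longrightarrow> \<bar>\<beta> s y\<bar> \<le> C * (1 + \<bar>y\<bar>)"
  shows "path_drift T (C * (1 + R)) (\<lambda>s w. stopped_drift T R \<beta> s (shift_path T x w))"
proof
  show "T > 0" by fact
  let ?N = "borel \<Otimes>\<^sub>M path_space T"
  have h: "(\<lambda>p. shift_path T x (snd p)) \<in> ?N \<rightarrow>\<^sub>M path_space T"
    using measurable_compose[OF measurable_snd shift_path_measurable[OF T]] .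
  have [measurable]: "Measurable.pred ?N (\<lambda>p. fst p \<in> {0..T} \<and> alive R (fst p) (shift_path T x (snd p)))"
    by (rule alive_measurable[OF T _ h]) simp
  have e [measurable]: "(\<lambda>p. shift_path T x (snd p) (max 0 (min T (fst p)))) \<in> borel_measurable ?N"
    by (rule eval_joint_measurable[OF T _ _ h]) (use T in auto)
  have "(\<lambda>p. if fst p \<in> {0..T} \<and> alive R (fst p) (shift_path T x (snd p))
      then \<beta> (fst p) (shift_path T x (snd p) (max 0 (min T (fst p)))) else 0) \<in> borel_measurable ?N"
    by measurable
  moreover have "(\<lambda>p. if fst p \<in> {0..T} \<and> alive R (fst p) (shift_path T x (snd p))
      then \<beta> (fst p) (shift_path T x (snd p) (max 0 (min T (fst p)))) else 0)
     = (\<lambda>(s, w). stopped_drift T R \<beta> s (shift_path T x w))"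
    by (auto simp: fun_eq_iff stopped_drift_def min_def max_def)
  ultimately show "(\<lambda>(s, w). stopped_drift T R \<beta> s (shift_path T x w)) \<in> borel_measurable ?N" by (simp only:)
next
  fix s w assume w: "w \<in> space (path_space T)"
  let ?w = "shift_path T x w"
  have c: "continuous_on {0..T} ?w" using measurable_space[OF shift_path_measurable[OF T] w] by (simp add: path_mem_iff)
  show "\<bar>stopped_drift T R \<beta> s ?w\<bar> \<le> C * (1 + R)"
  proof (cases "s \<in> {0..T} \<and> alive R s ?w")
    case True
    then have "continuous_on {0..s} ?w" by (intro continuous_on_subset[OF c]) auto
    then have "\<bar>?w s\<bar> < R" using True alive_iff[of s ?w R] by auto
    then have "C * (1 + \<bar>?w s\<bar>) \<le> C * (1 + R)" using C by (intro mult_left_mono) auto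
    then show ?thesis using True growth[of s "?w s"] by (simp add: stopped_drift_def)
  qed (use C R in \<open>auto simp: stopped_drift_def\<close>)
next
  fix s :: real and w w' :: "real \<Rightarrow> real" assume s: "s \<in> {0..T}" and ww: "\<And>u. u \<in> {0..s} \<Longrightarrow> w u = w' u"
  have u: "shift_path T x w u = shift_path T x w' u" if "u \<in> {0..s}" for u
    using ww[OF that] by (simp add: shift_path_def)
  have "alive R s (shift_path T x w) = alive R s (shift_path T x w')"
    using s by (intro alive_cong u) auto
  then show "stopped_drift T R \<beta> s (shift_path T x w) = stopped_drift T R \<beta> s (shift_path T x w')"
    using u[of s] s by (simp add: stopped_drift_def)
qed

lemma shift_path_0: "w \<in> space (path_space T) \<Longrightarrow> shift_path T 0 w = w"
  by (auto simp: shift_path_def path_mem_iff extensional_def fun_eq_iff)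

text \<open>The drift is a function of time and space, and the noise is controlled on the dyadic grids: a change of
  measure as in Girsanov's theorem leads to an equation of the same form.\<close>

definition sde_solution ::
  "real \<Rightarrow> (real \<Rightarrow> real \<Rightarrow> real) \<Rightarrow> real \<Rightarrow> 'a measure \<Rightarrow> (real \<Rightarrow> 'a measure) \<Rightarrow> (real \<Rightarrow> 'a \<Rightarrow> real) \<Rightarrow> (real \<Rightarrow> 'a \<Rightarrow> real) \<Rightarrow> bool" where
  "sde_solution T \<beta> x M F B X \<longleftrightarrow> dyadic_bm M T F B \<and> continuous_adapted T M F X \<and>
     (AE \<omega> in M. \<forall>t\<in>{0..T}. X t \<omega> = x + (LINT s:{0..t}|lborel. \<beta> s (X s \<omega>)) + B t \<omega>)"

definition stopped_process :: "real \<Rightarrow> real \<Rightarrow> (real \<Rightarrow> real \<Rightarrow> real) \<Rightarrow> (real \<Rightarrow> 'a \<Rightarrow> real) \<Rightarrow> (real \<Rightarrow> 'a \<Rightarrow> real) \<Rightarrow> real \<Rightarrow> 'a \<Rightarrow> real" where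
  "stopped_process T R \<beta> B X t \<omega> = B t \<omega> + (LINT s:{0..t}|lborel. stopped_drift T R \<beta> s (path_of T X \<omega>))"

lemma set_integral_cong_except_point:
  fixes f g :: "real \<Rightarrow> real"
  assumes "\<And>s. s \<in> A \<Longrightarrow> s \<noteq> c \<Longrightarrow> f s = g s"
  shows "(LINT s:A|lborel. f s) = (LINT s:A|lborel. g s)"
proof -
  have "set_lebesgue_integral lborel A f = set_lebesgue_integral lborel (A - {c}) f" for f :: "real \<Rightarrow> real"
    by (rule set_integral_discrete_difference[where X = "{c}"]) auto
  moreover have "set_lebesgue_integral lborel (A - {c}) f = set_lebesgue_integral lborel (A - {c}) g"
    unfolding set_lebesgue_integral_def using assms by (intro Bochner_Integration.integral_cong) (auto simp: indicator_def)
  ultimately show ?thesis by metis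
qed

text \<open>Before the exit from the ball both processes are moved by the same drift, and by continuity they still
  correspond at the exit time; hence neither can leave the ball before the other.\<close>

lemma stopped_process_path:
  assumes T: "T > 0" and c: "continuous_on {0..T} (\<lambda>t. X t \<omega>)"
    and eq: "\<And>t. t \<in> {0..T} \<Longrightarrow> X t \<omega> = x + (LINT s:{0..t}|lborel. \<beta> s (X s \<omega>)) + B t \<omega>"
    and cY: "continuous_on {0..T} (\<lambda>t. stopped_process T R \<beta> B X t \<omega>)"
    and s: "s \<in> {0..T}"
  defines "Y \<equiv> stopped_process T R \<beta> B X"
  shows "alive R s (path_of T X \<omega>) \<longleftrightarrow> alive R s (shift_path T x (path_of T Y \<omega>))"
    and "alive R s (path_of T X \<omega>) \<Longrightarrow> X s \<omega> = x + Y s \<omega>"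
proof -
  have px: "path_of T X \<omega> u = X u \<omega>" "shift_path T x (path_of T Y \<omega>) u = x + Y u \<omega>" if "u \<in> {0..T}" for u
    using that by (simp_all add: path_of_def shift_path_def)
  have al: "alive R u (path_of T X \<omega>) \<longleftrightarrow> (\<forall>v\<in>{0..u}. \<bar>X v \<omega>\<bar> < R)" if u: "u \<in> {0..T}" for u
  proof -
    have "continuous_on {0..u} (\<lambda>t. X t \<omega>)" using u by (intro continuous_on_subset[OF c]) auto
    then have "continuous_on {0..u} (path_of T X \<omega>)" by (rule continuous_on_eq) (use u px in auto)
    from alive_iff[OF _ this] show ?thesis using u px by auto
  qed
  have al': "alive R u (shift_path T x (path_of T Y \<omega>)) \<longleftrightarrow> (\<forall>v\<in>{0..u}. \<bar>x + Y v \<omega>\<bar> < R)" if u: "u \<in> {0..T}" for u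
  proof -
    have "continuous_on {0..u} (\<lambda>t. x + Y t \<omega>)" unfolding Y_def using u
      by (intro continuous_intros continuous_on_subset[OF cY]) auto
    then have "continuous_on {0..u} (shift_path T x (path_of T Y \<omega>))" by (rule continuous_on_eq) (use u px in auto)
    from alive_iff[OF _ this] show ?thesis using u px by auto
  qed
  have before: "X u \<omega> = x + Y u \<omega>" if u: "u \<in> {0..T}" and a: "\<And>v. v \<in> {0..<u} \<Longrightarrow> \<bar>X v \<omega>\<bar> < R" for u
  proof -
    have "(LINT s:{0..u}|lborel. stopped_drift T R \<beta> s (path_of T X \<omega>)) = (LINT s:{0..u}|lborel. \<beta> s (X s \<omega>))"
    proof (rule set_integral_cong_except_point[where c = u])
      fix v assume "v \<in> {0..u}" "v \<noteq> u"
      then have v: "v \<in> {0..T}" "v < u" using u by auto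
      then have "alive R v (path_of T X \<omega>)" using al[OF v(1)] a by auto
      then show "stopped_drift T R \<beta> v (path_of T X \<omega>) = \<beta> v (X v \<omega>)"
        using v by (simp add: stopped_drift_def px)
    qed
    then show ?thesis using eq[OF u] by (simp add: Y_def stopped_process_def)
  qed
  show 1: "X s \<omega> = x + Y s \<omega>" if "alive R s (path_of T X \<omega>)"
    using that al[OF s] by (intro before[OF s]) auto
  show "alive R s (path_of T X \<omega>) \<longleftrightarrow> alive R s (shift_path T x (path_of T Y \<omega>))"
  proof
    assume a: "alive R s (path_of T X \<omega>)"
    show "alive R s (shift_path T x (path_of T Y \<omega>))" unfolding al'[OF s]
    proof
      fix v assume v: "v \<in> {0..s}"
      then have vT: "v \<in> {0..T}" using s by auto
      have "X v \<omega> = x + Y v \<omega>" using a al[OF s] v by (intro before[OF vT]) auto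
      moreover have "\<bar>X v \<omega>\<bar> < R" using a al[OF s] v by blast
      ultimately show "\<bar>x + Y v \<omega>\<bar> < R" by simp
    qed
  next
    assume a: "alive R s (shift_path T x (path_of T Y \<omega>))"
    show "alive R s (path_of T X \<omega>)"
    proof (rule ccontr)
      assume n: "\<not> alive R s (path_of T X \<omega>)"
      \<comment> \<open>at the first exit both processes still agree, although the stopped one has not left the ball\<close>
      define E where "E = {v\<in>{0..s}. R \<le> \<bar>X v \<omega>\<bar>}"
      have ne: "E \<noteq> {}" using n al[OF s] by (auto simp: E_def not_less)
      have cs: "continuous_on {0..s} (\<lambda>v. \<bar>X v \<omega>\<bar>)"
        using s by (intro continuous_intros continuous_on_subset[OF c]) auto
      have "closed E" unfolding E_def
        using continuous_on_closed_Collect_le[OF continuous_on_const cs] by simp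
      moreover have bb: "bdd_below E" by (auto simp: E_def)
      ultimately have I: "Inf E \<in> E" using ne by (intro closed_contains_Inf)
      then have IT: "Inf E \<in> {0..T}" using s by (auto simp: E_def)
      have "X (Inf E) \<omega> = x + Y (Inf E) \<omega>"
      proof (rule before[OF IT])
        fix v assume v: "v \<in> {0..<Inf E}"
        then have "v \<notin> E" using cInf_lower[OF _ bb, of v] by auto
        moreover have "v \<in> {0..s}" using v I by (auto simp: E_def)
        ultimately show "\<bar>X v \<omega>\<bar> < R" by (auto simp: E_def)
      qed
      moreover have "\<bar>x + Y (Inf E) \<omega>\<bar> < R" using a al'[OF s] I by (auto simp: E_def)
      ultimately show False using I by (auto simp: E_def)
    qed
  qed
qed

lemma sde_solution_stopped:
  assumes sol: "sde_solution T \<beta> x M F B X"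
    and \<beta>: "(\<lambda>(s, y). \<beta> s y) \<in> borel_measurable (borel \<Otimes>\<^sub>M borel)"
    and C: "C \<ge> 0" and R: "R > 0" and growth: "\<And>s y. s \<in> {0..T} \<Longrightarrow> \<bar>\<beta> s y\<bar> \<le> C * (1 + \<bar>y\<bar>)"
  defines "Y \<equiv> stopped_process T R \<beta> B X"
  shows "continuous_adapted T M F Y"
    and "AE \<omega> in M. \<forall>t\<in>{0..T}. Y t \<omega> = B t \<omega> + (LINT s:{0..t}|lborel. stopped_drift T R \<beta> s (shift_path T x (path_of T Y \<omega>)))"
    and "AE \<omega> in M. (alive R T (path_of T X \<omega>) \<longleftrightarrow> alive R T (shift_path T x (path_of T Y \<omega>)))
      \<and> (alive R T (path_of T X \<omega>) \<longrightarrow> path_of T X \<omega> = shift_path T x (path_of T Y \<omega>))"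
proof -
  have bm: "dyadic_bm M T F B" and X: "continuous_adapted T M F X"
    and eq: "AE \<omega> in M. \<forall>t\<in>{0..T}. X t \<omega> = x + (LINT s:{0..t}|lborel. \<beta> s (X s \<omega>)) + B t \<omega>"
    using sol by (auto simp: sde_solution_def)
  interpret dyadic_bm M T F B by fact
  have Xc: "continuous_on {0..T} (\<lambda>t. X t \<omega>)" if "\<omega> \<in> space M" for \<omega> using X that by (simp add: continuous_adapted_def)
  have pX: "path_of T X \<omega> \<in> space (path_space T)" if "\<omega> \<in> space M" for \<omega>
    using Xc[OF that] continuous_on_eq[OF Xc[OF that], of "\<lambda>t\<in>{0..T}. X t \<omega>"] by (simp add: path_mem_iff path_of_def)
  interpret G: path_drift T "C * (1 + R)" "\<lambda>s w. stopped_drift T R \<beta> s (shift_path T 0 w)"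
    by (rule stopped_path_drift[OF T_pos \<beta> C R growth])
  interpret D: bounded_drift M T F B "\<lambda>s \<omega>. stopped_drift T R \<beta> s (shift_path T 0 (path_of T X \<omega>))" "C * (1 + R)"
    by (rule G.bounded_drift[OF bm X])
  have Y: "Y t \<omega> = B t \<omega> + D.drift t \<omega>" if "\<omega> \<in> space M" for t \<omega>
    using pX[OF that] by (simp add: Y_def stopped_process_def D.drift_def shift_path_0)
  have Yc: "continuous_on {0..T} (\<lambda>t. Y t \<omega>)" if w: "\<omega> \<in> space M" for \<omega>
    unfolding Y[OF w] by (intro continuous_intros B_cont[OF w] D.drift_continuous[OF w])
  show "continuous_adapted T M F Y"
    unfolding continuous_adapted_def
  proof (intro conjI ballI)
    fix t assume t: "t \<in> {0..T}"
    have "(\<lambda>\<omega>. B t \<omega> + D.drift t \<omega>) \<in> borel_measurable (F t)"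
      using B_adapted[OF t] D.drift_adapted[OF t] by measurable
    then show "Y t \<in> borel_measurable (F t)"
      by (rule measurable_cong[THEN iffD1, rotated]) (simp add: space_F[OF t] Y)
  qed (rule Yc)
  have key: "AE \<omega> in M. \<forall>s\<in>{0..T}. (alive R s (path_of T X \<omega>) \<longleftrightarrow> alive R s (shift_path T x (path_of T Y \<omega>)))
      \<and> (alive R s (path_of T X \<omega>) \<longrightarrow> X s \<omega> = x + Y s \<omega>)"
    using eq AE_space
  proof eventually_elim
    case (elim \<omega>)
    show ?case
    proof (intro ballI)
      fix s assume s: "s \<in> {0..T}"
      have Yc': "continuous_on {0..T} (\<lambda>t. stopped_process T R \<beta> B X t \<omega>)"
        using Yc[OF elim(2)] by (simp add: Y_def)
      from stopped_process_path[OF T_pos Xc[OF elim(2)] _ Yc' s, of x]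
      show "(alive R s (path_of T X \<omega>) \<longleftrightarrow> alive R s (shift_path T x (path_of T Y \<omega>)))
        \<and> (alive R s (path_of T X \<omega>) \<longrightarrow> X s \<omega> = x + Y s \<omega>)" using elim(1) unfolding Y_def by blast
    qed
  qed
  show "AE \<omega> in M. \<forall>t\<in>{0..T}. Y t \<omega> = B t \<omega> + (LINT s:{0..t}|lborel. stopped_drift T R \<beta> s (shift_path T x (path_of T Y \<omega>)))"
    using key
  proof eventually_elim
    case (elim \<omega>)
    show ?case
    proof
      fix t assume t: "t \<in> {0..T}"
      have "(LINT s:{0..t}|lborel. stopped_drift T R \<beta> s (path_of T X \<omega>)) = (LINT s:{0..t}|lborel. stopped_drift T R \<beta> s (shift_path T x (path_of T Y \<omega>)))"
      proof (rule set_integral_cong_except_point)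
        fix s assume "s \<in> {0..t}"
        then have s: "s \<in> {0..T}" using t by auto
        show "stopped_drift T R \<beta> s (path_of T X \<omega>) = stopped_drift T R \<beta> s (shift_path T x (path_of T Y \<omega>))"
          using bspec[OF elim s] s by (auto simp: stopped_drift_def path_of_apply shift_path_def)
      qed
      then show "Y t \<omega> = B t \<omega> + (LINT s:{0..t}|lborel. stopped_drift T R \<beta> s (shift_path T x (path_of T Y \<omega>)))"
        by (simp add: Y_def stopped_process_def)
    qed
  qed
  show "AE \<omega> in M. (alive R T (path_of T X \<omega>) \<longleftrightarrow> alive R T (shift_path T x (path_of T Y \<omega>)))
      \<and> (alive R T (path_of T X \<omega>) \<longrightarrow> path_of T X \<omega> = shift_path T x (path_of T Y \<omega>))"
    using key AE_space
  proof eventually_elim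
    case (elim \<omega>)
    have TT: "T \<in> {0..T}" using T_pos by simp
    have "path_of T X \<omega> = shift_path T x (path_of T Y \<omega>)" if a: "alive R T (path_of T X \<omega>)"
    proof -
      have px: "continuous_on {0..T} (path_of T X \<omega>)" using pX[OF elim(2)] by (simp add: path_mem_iff)
      have "X s \<omega> = x + Y s \<omega>" if s: "s \<in> {0..T}" for s
      proof -
        have "continuous_on {0..s} (path_of T X \<omega>)" using s by (intro continuous_on_subset[OF px]) auto
        then have "alive R s (path_of T X \<omega>)"
          using a alive_iff[OF _ px, of R] alive_iff[of s "path_of T X \<omega>" R] s T_pos by auto
        then show ?thesis using elim(1) s by blast
      qed
      then show ?thesis by (auto simp: path_of_def shift_path_def fun_eq_iff)
    qed
    then show ?case using bspec[OF elim(1) TT] by blast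
  qed
qed

lemma alive_T_measurable:
  assumes T: "T > 0"
  shows "Measurable.pred (path_space T) (\<lambda>w. alive R T w)"
  using alive_measurable[OF T, of "\<lambda>_. T" "path_space T" "\<lambda>w. w" R] T by simp

text \<open>On the event that the ball is not left, the solution is the shifted stopped process.\<close>

lemma emeasure_path_law_alive:
  assumes sol: "sde_solution T \<beta> x M F B X"
    and \<beta>: "(\<lambda>(s, y). \<beta> s y) \<in> borel_measurable (borel \<Otimes>\<^sub>M borel)"
    and C: "C \<ge> 0" and R: "R > 0" and growth: "\<And>s y. s \<in> {0..T} \<Longrightarrow> \<bar>\<beta> s y\<bar> \<le> C * (1 + \<bar>y\<bar>)"
    and E [measurable]: "E \<in> sets (path_space T)"
  shows "emeasure (path_law T M X) {w\<in>space (path_space T). w \<in> E \<and> alive R T w}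
    = emeasure (path_law T M (stopped_process T R \<beta> B X))
        {w\<in>space (path_space T). shift_path T x w \<in> E \<and> alive R T (shift_path T x w)}"
    (is "emeasure _ ?S = emeasure _ ?S'")
proof -
  let ?Y = "stopped_process T R \<beta> B X"
  have bm: "dyadic_bm M T F B" and X: "continuous_adapted T M F X" using sol by (auto simp: sde_solution_def)
  interpret dyadic_bm M T F B by fact
  note [measurable] = alive_T_measurable[OF T_pos] shift_path_measurable[OF T_pos]
  have Y: "continuous_adapted T M F ?Y"
    by (rule sde_solution_stopped(1)[OF sol \<beta> C R growth])
  have p: "path_of T Z \<in> M \<rightarrow>\<^sub>M path_space T" if z: "continuous_adapted T M F Z" for Z
  proof (rule path_of_measurable[OF T_pos])
    fix t assume t: "t \<in> {0..T}"
    show "Z t \<in> borel_measurable M"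
      by (rule F_measurable_M[OF _ t]) (use z t in \<open>simp add: continuous_adapted_def\<close>)
  qed (use z in \<open>simp add: continuous_adapted_def\<close>)
  note [measurable] = p[OF X] p[OF Y]
  have ae: "AE \<omega> in M. (alive R T (path_of T X \<omega>) \<longleftrightarrow> alive R T (shift_path T x (path_of T ?Y \<omega>)))
      \<and> (alive R T (path_of T X \<omega>) \<longrightarrow> path_of T X \<omega> = shift_path T x (path_of T ?Y \<omega>))"
    by (rule sde_solution_stopped(3)[OF sol \<beta> C R growth])
  have "emeasure (path_law T M X) ?S = emeasure M (path_of T X -` ?S \<inter> space M)"
    unfolding path_law_def by (rule emeasure_distr) measurable
  also have "\<dots> = emeasure M (path_of T ?Y -` ?S' \<inter> space M)"
  proof (rule emeasure_eq_AE)
    show "AE \<omega> in M. \<omega> \<in> path_of T X -` ?S \<inter> space M \<longleftrightarrow> \<omega> \<in> path_of T ?Y -` ?S' \<inter> space M"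
      using ae AE_space
    proof eventually_elim
      case (elim \<omega>)
      then show ?case
        using measurable_space[OF p[OF X] elim(2)] measurable_space[OF p[OF Y] elim(2)] by auto
    qed
  qed measurable
  also have "\<dots> = emeasure (path_law T M ?Y) ?S'"
    unfolding path_law_def by (rule emeasure_distr[symmetric]) measurable
  finally show ?thesis .
qed

text \<open>The stopped processes solve an equation with bounded path-dependent drift, hence agree in law. As a continuous
  path stays in some ball, letting the radius grow exhausts the path space.\<close>

theorem sde_law_unique:
  assumes sol1: "sde_solution T \<beta> x M1 F1 B1 X1" and sol2: "sde_solution T \<beta> x M2 F2 B2 X2"
    and \<beta>: "(\<lambda>(s, y). \<beta> s y) \<in> borel_measurable (borel \<Otimes>\<^sub>M borel)"
    and C: "C \<ge> 0" and growth: "\<And>s y. s \<in> {0..T} \<Longrightarrow> \<bar>\<beta> s y\<bar> \<le> C * (1 + \<bar>y\<bar>)"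
  shows "path_law T M1 X1 = path_law T M2 X2"
proof (rule measure_eqI)
  show "sets (path_law T M1 X1) = sets (path_law T M2 X2)" by (simp add: path_law_def)
  have bm: "dyadic_bm M1 T F1 B1" "dyadic_bm M2 T F2 B2" using sol1 sol2 by (auto simp: sde_solution_def)
  then have T: "T > 0" by (simp add: dyadic_bm_def dyadic_bm_axioms_def)
  fix E assume "E \<in> sets (path_law T M1 X1)"
  then have E [measurable]: "E \<in> sets (path_space T)" by (simp add: path_law_def)
  note [measurable] = alive_T_measurable[OF T] shift_path_measurable[OF T]
  define S where "S n = {w\<in>space (path_space T). w \<in> E \<and> alive (real (Suc n)) T w}" for n
  define S' where "S' n = {w\<in>space (path_space T). shift_path T x w \<in> E \<and> alive (real (Suc n)) T (shift_path T x w)}" for n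
  have S [measurable]: "S n \<in> sets (path_space T)" for n unfolding S_def by measurable
  have S' [measurable]: "S' n \<in> sets (path_space T)" for n unfolding S'_def by measurable
  have UN: "(\<Union>n. S n) = E"
  proof (intro equalityI subsetI)
    fix w assume w: "w \<in> E"
    then have ws: "w \<in> space (path_space T)" using sets.sets_into_space[OF E] by blast
    then have c: "continuous_on {0..T} w" by (simp add: path_mem_iff)
    have "compact (w ` {0..T})" by (intro compact_continuous_image c compact_Icc)
    then obtain b where b: "\<And>u. u \<in> {0..T} \<Longrightarrow> \<bar>w u\<bar> \<le> b"
      using compact_imp_bounded bounded_real by (metis imageI)
    obtain n where n: "b < real n" using reals_Archimedean2 by blast
    have "\<bar>w u\<bar> < real (Suc n)" if "u \<in> {0..T}" for u using b[OF that] n by simp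
    then have "alive (real (Suc n)) T w" using alive_iff[OF _ c, of "real (Suc n)"] T by (simp del: of_nat_Suc)
    then show "w \<in> (\<Union>n. S n)" using w ws by (auto simp: S_def)
  qed (auto simp: S_def)
  have inc: "incseq S"
  proof (rule incseq_SucI)
    fix n show "S n \<subseteq> S (Suc n)"
    proof -
      have "of_rat c < real (Suc (Suc n))" if "of_rat c < real (Suc n)" for c using that by simp
      then have "alive (real (Suc n)) T w \<Longrightarrow> alive (real (Suc (Suc n))) T w" for w
        unfolding alive_def by blast
      then show ?thesis unfolding S_def by blast
    qed
  qed
  have step1: "emeasure (path_law T M1 X1) (S n) = emeasure (path_law T M1 (stopped_process T (real (Suc n)) \<beta> B1 X1)) (S' n)" for n
    unfolding S_def S'_def by (rule emeasure_path_law_alive[OF sol1 \<beta> C _ growth E]) auto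
  have step2: "emeasure (path_law T M2 X2) (S n) = emeasure (path_law T M2 (stopped_process T (real (Suc n)) \<beta> B2 X2)) (S' n)" for n
    unfolding S_def S'_def by (rule emeasure_path_law_alive[OF sol2 \<beta> C _ growth E]) auto
  have eqn: "emeasure (path_law T M1 X1) (S n) = emeasure (path_law T M2 X2) (S n)" for n
  proof -
    interpret G: path_drift T "C * (1 + real (Suc n))" "\<lambda>s w. stopped_drift T (real (Suc n)) \<beta> s (shift_path T x w)"
      by (rule stopped_path_drift[OF T \<beta> C _ growth]) auto
    have "path_law T M1 (stopped_process T (real (Suc n)) \<beta> B1 X1) = path_law T M2 (stopped_process T (real (Suc n)) \<beta> B2 X2)"
      by (rule G.path_dependent_law_unique[OF bm(1) sde_solution_stopped(1)[OF sol1 \<beta> C _ growth]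
            sde_solution_stopped(2)[OF sol1 \<beta> C _ growth] bm(2) sde_solution_stopped(1)[OF sol2 \<beta> C _ growth]
            sde_solution_stopped(2)[OF sol2 \<beta> C _ growth]]) simp_all
    then show ?thesis unfolding step1 step2 by simp
  qed
  have lim1: "(SUP n. emeasure (path_law T M1 X1) (S n)) = emeasure (path_law T M1 X1) E"
    unfolding UN[symmetric] by (rule SUP_emeasure_incseq[OF _ inc]) (auto simp: path_law_def)
  have lim2: "(SUP n. emeasure (path_law T M2 X2) (S n)) = emeasure (path_law T M2 X2) E"
    unfolding UN[symmetric] by (rule SUP_emeasure_incseq[OF _ inc]) (auto simp: path_law_def)
  show "emeasure (path_law T M1 X1) E = emeasure (path_law T M2 X2) E"
    unfolding lim1[symmetric] lim2[symmetric] eqn ..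
qed

section \<open>Moments of a weak solution\<close>

lemma bdd_above_image_of_locally:
  fixes m :: "real \<Rightarrow> real"
  assumes "p \<le> q" and loc: "\<And>t. t \<in> {p..q} \<Longrightarrow> \<exists>e>0. bdd_above (m ` ({p..q} \<inter> {t - e<..<t + e}))"
  shows "bdd_above (m ` {p..q})"
proof -
  have "bdd_above (m ` ({p..q} \<inter> {p..q}))"
    using \<open>p \<le> q\<close>
  proof (rule Bolzano[where P = "\<lambda>u v. bdd_above (m ` ({p..q} \<inter> {u..v}))"])
    fix u v w assume "bdd_above (m ` ({p..q} \<inter> {u..v}))" "bdd_above (m ` ({p..q} \<inter> {v..w}))" "u \<le> v" "v \<le> w"
    then have "bdd_above (m ` ({p..q} \<inter> {u..v}) \<union> m ` ({p..q} \<inter> {v..w}))" by simp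
    then show "bdd_above (m ` ({p..q} \<inter> {u..w}))"
    proof (rule bdd_above_mono)
      have "{p..q} \<inter> {u..w} \<subseteq> ({p..q} \<inter> {u..v}) \<union> ({p..q} \<inter> {v..w})" by auto
      then show "m ` ({p..q} \<inter> {u..w}) \<subseteq> m ` ({p..q} \<inter> {u..v}) \<union> m ` ({p..q} \<inter> {v..w})"
        unfolding image_Un[symmetric] by (rule image_mono)
    qed
  next
    fix x assume "p \<le> x" "x \<le> q"
    then obtain e where e: "e > 0" "bdd_above (m ` ({p..q} \<inter> {x - e<..<x + e}))" using loc[of x] by auto
    show "\<exists>d>0. \<forall>a b. a \<le> x \<and> x \<le> b \<and> b - a < d \<longrightarrow> bdd_above (m ` ({p..q} \<inter> {a..b}))"
      by (intro exI[of _ e] conjI allI impI e(1) bdd_above_mono[OF e(2)] image_mono) auto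
  qed
  then show ?thesis by simp
qed

text \<open>If the set of points without a bounded neighbourhood is not empty, then by Baire's theorem \<open>m\<close> is bounded on a
  portion of it; the assumption \<open>est\<close> carries this bound over to a neighbourhood of the portion, which
  is a contradiction.\<close>

lemma bounded_by_Baire:
  fixes m :: "real \<Rightarrow> real"
  assumes ab: "a \<le> b" and \<delta>: "\<delta> > 0" and c: "c \<ge> 0" and m0: "\<And>t. m t \<ge> 0"
    and lsc: "\<And>k. closed {t\<in>{a..b}. m t \<le> k}"
    and est: "\<And>l u s t. a \<le> l \<Longrightarrow> l \<le> u \<Longrightarrow> u \<le> b \<Longrightarrow> u - l \<le> \<delta> \<Longrightarrow> bdd_above (m ` {l..u}) \<Longrightarrow>
        s \<in> {l..u} \<Longrightarrow> t \<in> {l..u} \<Longrightarrow> m t \<le> 2 * (m s + c)"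
  shows "bdd_above (m ` {a..b})"
proof -
  define good where "good t \<longleftrightarrow> (\<exists>e>0. bdd_above (m ` ({a..b} \<inter> {t - e<..<t + e})))" for t
  \<comment> \<open>the closed set of points without a bounded neighbourhood\<close>
  define N where "N = {t\<in>{a..b}. \<not> good t}"
  have og: "open {t. good t}"
  proof (rule openI)
    fix t assume "t \<in> {t. good t}"
    then obtain e where e: "e > 0" "bdd_above (m ` ({a..b} \<inter> {t - e<..<t + e}))" by (auto simp: good_def)
    have "good s" if "s \<in> ball t (e/2)" for s
    proof -
      have d: "\<bar>t - s\<bar> < e / 2" using that by (simp add: dist_real_def)
      have "{s - e/2<..<s + e/2} \<subseteq> {t - e<..<t + e}"
      proof
        fix x assume "x \<in> {s - e/2<..<s + e/2}"
        then have "s - e/2 < x" "x < s + e/2" by auto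
        then have "t - e < x" "x < t + e" using d by linarith+
        then show "x \<in> {t - e<..<t + e}" by simp
      qed
      then have "m ` ({a..b} \<inter> {s - e/2<..<s + e/2}) \<subseteq> m ` ({a..b} \<inter> {t - e<..<t + e})" by blast
      from bdd_above_mono[OF e(2) this] show ?thesis
        unfolding good_def using e(1) by (intro exI[of _ "e/2"]) auto
    qed
    then show "\<exists>T>0. ball t T \<subseteq> {t. good t}" using e(1) by (intro exI[of _ "e/2"]) auto
  qed
  have N_eq: "N = {a..b} - {t. good t}" by (auto simp: N_def)
  have cN: "closed N" unfolding N_eq using og by (intro closed_Diff) auto
  have "N = {}"
  proof (rule ccontr)
    assume ne: "N \<noteq> {}"
    define U where "U k = N - {t\<in>{a..b}. m t \<le> real k}" for k :: nat
    have ope: "openin (top_of_set N) (U k)" for k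
    proof -
      have "U k = N \<inter> - {t\<in>{a..b}. m t \<le> real k}" by (auto simp: U_def)
      then show ?thesis using lsc[of "real k"] by (auto simp: openin_open open_Compl)
    qed
    have "\<not> (\<forall>k. N \<subseteq> closure (U k))"
    proof
      assume d: "\<forall>k. N \<subseteq> closure (U k)"
      have "N \<subseteq> closure (\<Inter>(range U))"
        by (rule Baire[OF cN]) (use ope d in auto)
      moreover have "\<Inter>(range U) = {}"
      proof -
        have "\<exists>k. t \<notin> U k" for t
        proof -
          obtain k :: nat where "m t \<le> real k" using real_arch_simple by blast
          then show ?thesis by (auto simp: U_def N_def)
        qed
        then show ?thesis by auto
      qed
      ultimately show False using ne by simp
    qed
    then obtain k t0 where t0: "t0 \<in> N" "t0 \<notin> closure (U k)" by auto
    then obtain e where e: "e > 0" "\<And>t. \<bar>t - t0\<bar> < e \<Longrightarrow> t \<notin> U k"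
      unfolding closure_approachable by (auto simp: dist_real_def)
    define \<epsilon> where "\<epsilon> = min (e / 2) \<delta>"
    have \<epsilon>: "\<epsilon> > 0" "\<epsilon> \<le> e / 2" "\<epsilon> \<le> \<delta>" using e \<delta> by (auto simp: \<epsilon>_def)
    have Nk: "m t \<le> real k" if "t \<in> N" "\<bar>t - t0\<bar> < e" for t
      using e(2)[OF that(2)] that(1) by (auto simp: U_def N_def)
    have "m s \<le> 2 * (real k + c)" if s: "s \<in> {a..b}" "\<bar>s - t0\<bar> < \<epsilon>" for s
    proof -
      \<comment> \<open>between \<open>s\<close> and the nearest point \<open>r\<close> of \<open>N\<close> the function is locally bounded, so that \<open>est\<close> applies up to \<open>r\<close>\<close>
      define r where "r = closest_point N s"
      have r: "r \<in> N" unfolding r_def by (rule closest_point_in_set[OF cN ne])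
      have rmin: "\<bar>s - r\<bar> \<le> \<bar>s - v\<bar>" if "v \<in> N" for v
        using closest_point_le[OF cN that, of s] by (simp add: r_def dist_real_def)
      have rs: "\<bar>s - r\<bar> < \<epsilon>" using rmin[OF t0(1)] s(2) by linarith
      have mr: "m r \<le> real k" by (rule Nk[OF r]) (use rs s(2) \<epsilon> in linarith)
      have rab: "r \<in> {a..b}" using r by (simp add: N_def)
      have bound: "m v \<le> 2 * (m s + c)" if v: "v \<in> {min r s..max r s}" "v \<noteq> r" for v
      proof -
        have vab: "v \<in> {a..b}" using v rab s by auto
        have g: "good w" if w: "w \<in> {min v s..max v s}" for w
        proof (rule ccontr)
          assume "\<not> good w"
          moreover have "w \<in> {a..b}" using w vab s by auto
          ultimately have "w \<in> N" by (simp add: N_def)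
          then show False using rmin[of w] w v by (auto simp: min_def max_def split: if_splits)
        qed
        have "bdd_above (m ` {min v s..max v s})"
        proof (rule bdd_above_image_of_locally)
          fix w assume "w \<in> {min v s..max v s}"
          from g[OF this] obtain e' where "e' > 0" "bdd_above (m ` ({a..b} \<inter> {w - e'<..<w + e'}))"
            unfolding good_def by blast
          then show "\<exists>e'>0. bdd_above (m ` ({min v s..max v s} \<inter> {w - e'<..<w + e'}))"
            using vab s by (intro exI[of _ e'] conjI) (auto elim!: bdd_above_mono intro!: image_mono)
        qed simp
        then show ?thesis
          by (intro est[of "min v s" "max v s"]) (use vab s v rs \<epsilon> in \<open>auto simp: min_def max_def split: if_splits\<close>)
      qed
      have "bdd_above (m ` {min r s..max r s})"
        by (intro bdd_aboveI2[where M = "max (m r) (2 * (m s + c))"]) (use bound in \<open>force simp: le_max_iff_disj\<close>)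
      then have "m s \<le> 2 * (m r + c)"
        by (intro est[of "min r s" "max r s"]) (use rab s rs \<epsilon> in \<open>auto simp: min_def max_def split: if_splits\<close>)
      also have "\<dots> \<le> 2 * (real k + c)" using mr by simp
      finally show ?thesis .
    qed
    then have "bdd_above (m ` ({a..b} \<inter> {t0 - \<epsilon><..<t0 + \<epsilon>}))"
      by (intro bdd_aboveI2[where M = "2 * (real k + c)"]) (auto simp: abs_less_iff)
    then have "good t0" using \<epsilon>(1) by (auto simp: good_def)
    then show False using t0(1) by (simp add: N_def)
  qed
  then show ?thesis
    by (intro bdd_above_image_of_locally[OF ab]) (auto simp: N_def good_def)
qed

lemma gronwall:
  fixes y a :: "real \<Rightarrow> real"
  assumes T: "t \<ge> 0" and C: "C \<ge> 0" and y: "continuous_on {0..t} y" and a: "continuous_on {0..t} a" "\<And>s. s \<in> {0..t} \<Longrightarrow> a s \<ge> 0"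
    and le: "\<And>s. s \<in> {0..t} \<Longrightarrow> y s \<le> a s + C * integral {0..s} y"
  shows "integral {0..t} y \<le> exp (C * t) * integral {0..t} a"
proof -
  define v where "v s = integral {0..s} y" for s
  define w where "w s = integral {0..s} a" for s
  define g where "g s = w s - exp (- C * s) * v s" for s
  have dv: "(v has_real_derivative y s) (at s within {0..t})" if "s \<in> {0..t}" for s
    unfolding v_def using integral_has_real_derivative[OF y that] .
  have dw: "(w has_real_derivative a s) (at s within {0..t})" if "s \<in> {0..t}" for s
    unfolding w_def using integral_has_real_derivative[OF a(1) that] .
  have dg: "(g has_real_derivative a s - exp (- C * s) * (y s - C * v s)) (at s within {0..t})" if s: "s \<in> {0..t}" for s
    unfolding g_def by (rule derivative_eq_intros dv[OF s] dw[OF s] refl)+ (simp add: algebra_simps)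
  have "g 0 \<le> g t"
  proof (rule DERIV_nonneg_imp_increasing_open[where f = g and a = 0 and b = t])
    fix s assume s: "0 < s" "s < t"
    show "\<exists>z. (g has_real_derivative z) (at s) \<and> 0 \<le> z"
    proof (intro exI[of _ "a s - exp (- C * s) * (y s - C * v s)"] conjI)
      have s': "s \<in> {0..t}" using s by auto
      show "DERIV g s :> a s - exp (- C * s) * (y s - C * v s)"
        using dg[OF s'] s by (simp add: at_within_Icc_at)
      have "exp (- C * s) * (y s - C * v s) \<le> exp (- C * s) * a s"
        using le[OF s'] by (intro mult_left_mono) (auto simp: v_def)
      also have "\<dots> \<le> 1 * a s" using C s a(2)[OF s'] by (intro mult_right_mono) auto
      finally show "0 \<le> a s - exp (- C * s) * (y s - C * v s)" by simp
    qed
  next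
    show "continuous_on {0..t} g"
      unfolding continuous_on_eq_continuous_within using dg DERIV_continuous by blast
  qed (use T in simp)
  then have "exp (- C * t) * v t \<le> w t" by (simp add: g_def v_def w_def)
  then have "exp (C * t) * (exp (- C * t) * v t) \<le> exp (C * t) * w t" by (intro mult_left_mono) auto
  then show ?thesis by (simp add: v_def w_def mult.assoc[symmetric] exp_add[symmetric])
qed

lemma kantorovich_least:
  assumes "\<mu> \<in> P1" "\<nu> \<in> P1"
    "\<And>h :: real \<Rightarrow> real. 1-lipschitz_on UNIV h \<Longrightarrow> \<bar>(LINT x|\<mu>. h x) - (LINT x|\<nu>. h x)\<bar> \<le> c"
  shows "kantorovich \<mu> \<nu> \<le> c"
  unfolding kantorovich_def using assms lipschitz_ne by (auto intro!: cSUP_least)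

lemma return_P1: "return borel (x :: real) \<in> P1"
  by (simp add: P1_def prob_space_return integrable_iff_bounded nn_integral_return)

lemma kantorovich_return_0:
  assumes "\<mu> \<in> P1"
  shows "kantorovich \<mu> (return borel 0) \<le> (LINT y|\<mu>. \<bar>y\<bar>)"
proof (rule kantorovich_least[OF assms return_P1])
  fix h :: "real \<Rightarrow> real" assume h: "1-lipschitz_on UNIV h"
  have "h \<in> borel_measurable borel"
    using lipschitz_on_continuous_on[OF h] by (rule borel_measurable_continuous_onI)
  then have "(LINT x|return borel 0. h x) = h 0" by (simp add: integral_return)
  then show "\<bar>(LINT x|\<mu>. h x) - (LINT x|return borel 0. h x)\<bar> \<le> (LINT y|\<mu>. \<bar>y\<bar>)"
    using lipschitz_integrable_P1(2)[OF assms h] by simp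
qed

text \<open>A coupling bounds the distance by its transport cost.\<close>

lemma kantorovich_coupling:
  assumes "prob_space M" and X [measurable]: "X \<in> borel_measurable M" and Y [measurable]: "Y \<in> borel_measurable M"
    and P: "distr M borel X \<in> P1" "distr M borel Y \<in> P1" and i: "(\<integral>\<^sup>+\<omega>. ennreal \<bar>X \<omega> - Y \<omega>\<bar> \<partial>M) \<le> ennreal c" and c: "c \<ge> 0"
  shows "kantorovich (distr M borel X) (distr M borel Y) \<le> c"
proof (rule kantorovich_least[OF P])
  interpret prob_space M by fact
  fix h :: "real \<Rightarrow> real" assume h: "1-lipschitz_on UNIV h"
  have [measurable]: "h \<in> borel_measurable borel"
    using lipschitz_on_continuous_on[OF h] by (rule borel_measurable_continuous_onI)
  have iX: "integrable M (\<lambda>\<omega>. h (X \<omega>))" "integrable M (\<lambda>\<omega>. h (Y \<omega>))"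
    using lipschitz_integrable_P1(1)[OF P(1) h] lipschitz_integrable_P1(1)[OF P(2) h] by (simp_all add: integrable_distr_eq)
  have "ennreal \<bar>LINT \<omega>|M. h (X \<omega>) - h (Y \<omega>)\<bar> \<le> (\<integral>\<^sup>+\<omega>. ennreal \<bar>h (X \<omega>) - h (Y \<omega>)\<bar> \<partial>M)"
    using integral_norm_bound_ennreal[OF Bochner_Integration.integrable_diff[OF iX]] by simp
  also have "\<dots> \<le> (\<integral>\<^sup>+\<omega>. ennreal \<bar>X \<omega> - Y \<omega>\<bar> \<partial>M)"
    using lipschitz_onD[OF h] by (intro nn_integral_mono ennreal_leI) (simp add: dist_real_def)
  also have "\<dots> \<le> ennreal c" by (rule i)
  finally have "\<bar>LINT \<omega>|M. h (X \<omega>) - h (Y \<omega>)\<bar> \<le> c" using c by simp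
  then show "\<bar>(LINT x|distr M borel X. h x) - (LINT x|distr M borel Y. h x)\<bar> \<le> c"
    using iX by (simp add: integral_distr)
qed

locale growth_solution =
  fixes T C x :: real and b :: "real \<Rightarrow> real \<Rightarrow> real measure \<Rightarrow> real"
    and M :: "'a measure" and F :: "real \<Rightarrow> 'a measure" and B X :: "real \<Rightarrow> 'a \<Rightarrow> real"
  assumes T: "T > 0" and C: "C > 0" and sol: "weak_solution T b x M F B X"
    and growth: "\<And>t y \<mu>. t \<in> {0..T} \<Longrightarrow> \<mu> \<in> P1 \<Longrightarrow> \<bar>b t y \<mu>\<bar> \<le> C * (1 + \<bar>y\<bar> + kantorovich \<mu> (return borel 0))"
begin

definition law :: "real \<Rightarrow> real measure" where "law t = distr M borel (X t)"

definition mean_abs :: "real \<Rightarrow> real" where "mean_abs t = (LINT \<omega>|M. \<bar>X t \<omega>\<bar>)"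

sublocale prob_space M
  using sol by (simp add: weak_solution_def)

lemma subalgebra_F: "t \<in> {0..T} \<Longrightarrow> subalgebra M (F t)"
  using sol by (simp add: weak_solution_def usual_filtration_def)

lemma X_adapted: "continuous_adapted T M F X" and B_adapted: "continuous_adapted T M F B"
  using sol by (auto simp: weak_solution_def brownian_motion_def)

lemma X_meas: "t \<in> {0..T} \<Longrightarrow> X t \<in> borel_measurable M"
  using X_adapted unfolding continuous_adapted_def by (blast intro: measurable_from_subalg[OF subalgebra_F])

lemma B_meas: "t \<in> {0..T} \<Longrightarrow> B t \<in> borel_measurable M"
  using B_adapted unfolding continuous_adapted_def by (blast intro: measurable_from_subalg[OF subalgebra_F])

lemma X_cont: "\<omega> \<in> space M \<Longrightarrow> continuous_on {0..T} (\<lambda>t. X t \<omega>)"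
  using X_adapted by (auto simp: continuous_adapted_def)

lemma B_cont: "\<omega> \<in> space M \<Longrightarrow> continuous_on {0..T} (\<lambda>t. B t \<omega>)"
  using B_adapted by (auto simp: continuous_adapted_def)

lemma law_P1: "t \<in> {0..T} \<Longrightarrow> law t \<in> P1"
  using sol by (simp add: weak_solution_def law_def)

lemma X_integrable:
  assumes t: "t \<in> {0..T}"
  shows "integrable M (X t)"
proof (rule integrable_norm_cancel[OF _ X_meas[OF t]])
  have "integrable (distr M borel (X t)) (\<lambda>y. \<bar>y\<bar>)" using P1D(4)[OF law_P1[OF t]] by (simp add: law_def)
  then show "integrable M (\<lambda>\<omega>. norm (X t \<omega>))" using X_meas[OF t] by (subst (asm) integrable_distr_eq) auto
qed

lemma mean_abs_nonneg: "mean_abs t \<ge> 0" by (simp add: mean_abs_def)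

lemma nn_mean_abs: "t \<in> {0..T} \<Longrightarrow> (\<integral>\<^sup>+\<omega>. ennreal \<bar>X t \<omega>\<bar> \<partial>M) = ennreal (mean_abs t)"
  unfolding mean_abs_def using X_integrable by (intro nn_integral_eq_integral) auto

lemma kantorovich_law_0: "t \<in> {0..T} \<Longrightarrow> kantorovich (law t) (return borel 0) \<le> mean_abs t"
  using kantorovich_return_0[OF law_P1] X_meas by (simp add: law_def mean_abs_def integral_distr)

lemma b_bound: "s \<in> {0..T} \<Longrightarrow> \<bar>b s y (law s)\<bar> \<le> C * (1 + \<bar>y\<bar> + mean_abs s)"
  using growth[OF _ law_P1, of s s y] kantorovich_law_0[of s] C
  by (smt (verit, best) mult_left_mono)

lemma equation:
  "AE \<omega> in M. set_integrable lborel {0..T} (\<lambda>s. b s (X s \<omega>) (law s)) \<and>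
        (\<forall>t\<in>{0..T}. X t \<omega> = x + (LINT s:{0..t}|lborel. b s (X s \<omega>) (law s)) + B t \<omega>)"
  using sol by (simp add: weak_solution_def law_def)

lemma B_increment:
  assumes "0 \<le> s" "s < t" "t \<le> T"
  shows "distr M borel (\<lambda>\<omega>. B t \<omega> - B s \<omega>) = gauss (t - s)"
proof -
  have "distributed M lborel (\<lambda>\<omega>. B t \<omega> - B s \<omega>) (normal_density 0 (sqrt (t - s)))"
    using sol assms by (simp add: weak_solution_def brownian_motion_def)
  then have "distr M lborel (\<lambda>\<omega>. B t \<omega> - B s \<omega>) = gauss (t - s)"
    unfolding gauss_def by (rule distributed_distr_eq_density)
  moreover have "distr M lborel (\<lambda>\<omega>. B t \<omega> - B s \<omega>) = distr M borel (\<lambda>\<omega>. B t \<omega> - B s \<omega>)"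
    by (rule distr_cong) auto
  ultimately show ?thesis by simp
qed

lemma B_increment_square:
  assumes "0 \<le> s" "s \<le> t" "t \<le> T"
  shows "(\<integral>\<^sup>+\<omega>. ennreal ((B t \<omega> - B s \<omega>)\<^sup>2) \<partial>M) = ennreal (t - s)"
proof (cases "s = t")
  case False
  have "B t \<in> borel_measurable M" "B s \<in> borel_measurable M" using assms by (auto intro: B_meas)
  note [measurable] = this
  have "(\<integral>\<^sup>+\<omega>. ennreal ((B t \<omega> - B s \<omega>)\<^sup>2) \<partial>M) = (\<integral>\<^sup>+z. ennreal ((0 + 1 * z)\<^sup>2) \<partial>distr M borel (\<lambda>\<omega>. B t \<omega> - B s \<omega>))"
    by (subst nn_integral_distr) auto
  also have "\<dots> = ennreal (0\<^sup>2 + 1\<^sup>2 * (t - s))"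
    using B_increment[of s t] gauss_square[of "t - s" 0 1] False assms by simp
  finally show ?thesis by simp
qed simp

lemma B_increment_abs:
  assumes "0 \<le> s" "s \<le> t" "t \<le> T"
  shows "(\<integral>\<^sup>+\<omega>. ennreal \<bar>B t \<omega> - B s \<omega>\<bar> \<partial>M) \<le> ennreal (sqrt (t - s))"
proof (cases "s = t")
  case False
  define e where "e = sqrt (t - s)"
  have e: "e > 0" "e * e = t - s" using False assms by (auto simp: e_def)
  have "B t \<in> borel_measurable M" "B s \<in> borel_measurable M" using assms by (auto intro: B_meas)
  note [measurable] = this
  \<comment> \<open>Young's inequality, with the standard deviation as weight\<close>
  have pt: "\<bar>z\<bar> \<le> e / 2 + 1 / (2 * e) * z\<^sup>2" for z :: real
  proof -
    have "0 \<le> (\<bar>z\<bar> - e)\<^sup>2 / (2 * e)" using e by simp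
    also have "\<dots> = e / 2 + 1 / (2 * e) * z\<^sup>2 - \<bar>z\<bar>"
      using e(1) by (simp add: power2_diff field_simps power2_eq_square)
    finally show ?thesis by simp
  qed
  have "(\<integral>\<^sup>+\<omega>. ennreal \<bar>B t \<omega> - B s \<omega>\<bar> \<partial>M) \<le> (\<integral>\<^sup>+\<omega>. ennreal (e / 2) + ennreal (1 / (2 * e)) * ennreal ((B t \<omega> - B s \<omega>)\<^sup>2) \<partial>M)"
    using e pt by (intro nn_integral_mono) (simp add: ennreal_mult'[symmetric] ennreal_plus[symmetric] ennreal_leI del: ennreal_plus)
  also have "\<dots> = ennreal (e / 2) + ennreal (1 / (2 * e)) * ennreal (t - s)"
    by (subst nn_integral_add) (auto simp: nn_integral_cmult B_increment_square[OF assms] emeasure_space_1)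
  also have "\<dots> = ennreal (e / 2 + 1 / (2 * e) * (e * e))"
    unfolding e(2)[symmetric] using e(1) by (simp add: ennreal_mult'[symmetric] ennreal_plus[symmetric] del: ennreal_plus)
  also have "e / 2 + 1 / (2 * e) * (e * e) = e" using e(1) by (simp add: field_simps)
  finally show ?thesis by (simp add: e_def)
qed simp

text \<open>The horizon varies because solutions are compared at every time \<open>t\<close>, on the grids of \<open>[0,t]\<close>.\<close>

lemma dyadic_bm_horizon:
  assumes t: "0 < t" "t \<le> T"
  shows "dyadic_bm M t F B"
proof
  show "t > 0" by fact
  show "subalgebra M (F s)" if "s \<in> {0..t}" for s using that t by (intro subalgebra_F) auto
  show "sets (F r) \<subseteq> sets (F s)" if "0 \<le> r" "r \<le> s" "s \<le> t" for r s
    using sol that t by (auto simp: weak_solution_def usual_filtration_def)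
  show "B s \<in> borel_measurable (F s)" if "s \<in> {0..t}" for s
    using B_adapted that t by (auto simp: continuous_adapted_def)
  show "continuous_on {0..t} (\<lambda>s. B s \<omega>)" if "\<omega> \<in> space M" for \<omega>
    using B_cont[OF that] by (rule continuous_on_subset) (use t in auto)
  show "AE \<omega> in M. B 0 \<omega> = 0" using sol by (simp add: weak_solution_def brownian_motion_def)
  fix n k :: nat and A and C :: "real set"
  assume k: "k < 2 ^ n" and A: "A \<in> sets (F (grid t n k))" and C: "C \<in> sets borel"
  have g: "0 \<le> grid t n k" "grid t n k < grid t n (Suc k)" "grid t n (Suc k) \<le> T"
    using grid_in[of t k n] grid_in[of t "Suc k" n] k t by (auto simp: grid_Suc)
  let ?Y = "\<lambda>\<omega>. B (grid t n (Suc k)) \<omega> - B (grid t n k) \<omega>"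
  have Ym [measurable]: "?Y \<in> borel_measurable M"
    using g by (intro borel_measurable_diff B_meas) auto
  have ind: "indep_set (sets (F (grid t n k))) (sets (vimage_algebra (space M) ?Y borel))"
    using sol g by (simp add: weak_solution_def brownian_motion_def)
  have "?Y -` C \<inter> space M \<in> sets (vimage_algebra (space M) ?Y borel)"
    using C by (rule in_vimage_algebra)
  moreover have e: "?Y -` C \<inter> space M = {\<omega>\<in>space M. ?Y \<omega> \<in> C}" by auto
  ultimately have "prob (A \<inter> {\<omega>\<in>space M. ?Y \<omega> \<in> C}) = prob A * prob {\<omega>\<in>space M. ?Y \<omega> \<in> C}"
    using indep_setD[OF ind A] by simp
  also have "prob {\<omega>\<in>space M. ?Y \<omega> \<in> C} = measure (distr M borel ?Y) C"
    using C by (simp add: measure_distr e)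
  also have "distr M borel ?Y = gauss (t / 2 ^ n)"
    using B_increment[OF g] by (simp add: grid_Suc)
  finally show "prob (A \<inter> {\<omega>\<in>space M. ?Y \<omega> \<in> C}) = prob A * measure (gauss (t / 2 ^ n)) C" .
qed

lemma path_X_measurable: "path_of T X \<in> M \<rightarrow>\<^sub>M path_space T"
  by (rule path_of_measurable[OF T X_meas X_cont])

lemma X_joint: "(\<lambda>p. X (max 0 (min T (snd p))) (fst p)) \<in> borel_measurable (M \<Otimes>\<^sub>M borel)"
proof -
  have "(\<lambda>p. path_of T X (fst p) (max 0 (min T (snd p)))) \<in> borel_measurable (M \<Otimes>\<^sub>M borel)"
    by (rule eval_joint_measurable[OF T _ _ measurable_compose[OF measurable_fst path_X_measurable]]) (use T in auto)
  then show ?thesis using T by (simp add: path_of_def)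
qed

text \<open>The bound \<open>S\<close> enters the drift twice, through the space variable and through the distance of the marginal
  law from the Dirac measure at 0.\<close>

lemma mean_increment:
  assumes st: "0 \<le> s" "s \<le> t" "t \<le> T" and S: "S \<ge> 0" "\<And>r. r \<in> {s..t} \<Longrightarrow> mean_abs r \<le> S"
  shows "(\<integral>\<^sup>+\<omega>. ennreal \<bar>X t \<omega> - X s \<omega>\<bar> \<partial>M) \<le> ennreal (C * (1 + 2 * S) * (t - s) + sqrt (t - s))"
proof -
  let ?c = "\<lambda>r. max 0 (min T r)"
  let ?g = "\<lambda>\<omega> r. ennreal (C * (1 + S + \<bar>X (?c r) \<omega>\<bar>)) * indicator {s..t} r"
  have "B t \<in> borel_measurable M" "B s \<in> borel_measurable M" using st by (auto intro: B_meas)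
  note [measurable] = this X_joint
  have g [measurable]: "(\<lambda>p. ?g (fst p) (snd p)) \<in> borel_measurable (M \<Otimes>\<^sub>M lborel)"
  proof -
    have "(\<lambda>p. ?g (fst p) (snd p)) \<in> borel_measurable (M \<Otimes>\<^sub>M borel)" by measurable
    then show ?thesis by simp
  qed
  have gm [measurable]: "(\<lambda>\<omega>. \<integral>\<^sup>+r. ?g \<omega> r \<partial>lborel) \<in> borel_measurable M"
    using lborel.borel_measurable_nn_integral_fst[OF g] by simp
  have "(\<integral>\<^sup>+\<omega>. ennreal \<bar>X t \<omega> - X s \<omega>\<bar> \<partial>M) \<le> (\<integral>\<^sup>+\<omega>. (\<integral>\<^sup>+r. ?g \<omega> r \<partial>lborel) + ennreal \<bar>B t \<omega> - B s \<omega>\<bar> \<partial>M)"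
  proof (rule nn_integral_mono_AE)
    show "AE \<omega> in M. ennreal \<bar>X t \<omega> - X s \<omega>\<bar> \<le> (\<integral>\<^sup>+r. ?g \<omega> r \<partial>lborel) + ennreal \<bar>B t \<omega> - B s \<omega>\<bar>"
      using equation
    proof eventually_elim
      case (elim \<omega>)
      let ?f = "\<lambda>r. b r (X r \<omega>) (law r)"
      have i: "set_integrable lborel {0..t} ?f" using elim st by (auto intro: set_integrable_subset)
      have ist: "set_integrable lborel {s<..t} ?f" using st by (intro set_integrable_subset[OF i]) auto
      have "X t \<omega> - X s \<omega> = (LINT r:{s<..t}|lborel. ?f r) + (B t \<omega> - B s \<omega>)"
        using elim st set_integral_diff_Icc[OF i st(1,2)] by auto
      then have "\<bar>X t \<omega> - X s \<omega>\<bar> \<le> \<bar>LINT r:{s<..t}|lborel. ?f r\<bar> + \<bar>B t \<omega> - B s \<omega>\<bar>" by linarith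
      then have "ennreal \<bar>X t \<omega> - X s \<omega>\<bar> \<le> ennreal \<bar>LINT r:{s<..t}|lborel. ?f r\<bar> + ennreal \<bar>B t \<omega> - B s \<omega>\<bar>"
        by (simp add: ennreal_leI ennreal_plus[symmetric] del: ennreal_plus)
      also have "ennreal \<bar>LINT r:{s<..t}|lborel. ?f r\<bar> \<le> (\<integral>\<^sup>+r. ennreal (norm (indicator {s<..t} r *\<^sub>R ?f r)) \<partial>lborel)"
        unfolding set_lebesgue_integral_def real_norm_def[symmetric]
        using ist by (intro integral_norm_bound_ennreal) (simp add: set_integrable_def)
      also have "\<dots> \<le> (\<integral>\<^sup>+r. ?g \<omega> r \<partial>lborel)"
      proof (rule nn_integral_mono)
        fix r
        show "ennreal (norm (indicator {s<..t} r *\<^sub>R ?f r)) \<le> ?g \<omega> r"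
        proof (cases "r \<in> {s<..t}")
          case True
          then have r: "r \<in> {0..T}" "r \<in> {s..t}" "?c r = r" using st by auto
          have "\<bar>?f r\<bar> \<le> C * (1 + \<bar>X r \<omega>\<bar> + mean_abs r)" by (rule b_bound[OF r(1)])
          also have "\<dots> \<le> C * (1 + S + \<bar>X r \<omega>\<bar>)" using C S(2)[OF r(2)] by (intro mult_left_mono) auto
          finally show ?thesis using True r by (simp add: ennreal_leI)
        qed simp
      qed
      finally show ?case by (simp add: add_right_mono)
    qed
  qed
  also have "\<dots> = (\<integral>\<^sup>+\<omega>. (\<integral>\<^sup>+r. ?g \<omega> r \<partial>lborel) \<partial>M) + (\<integral>\<^sup>+\<omega>. ennreal \<bar>B t \<omega> - B s \<omega>\<bar> \<partial>M)"
    by (rule nn_integral_add) measurable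
  also have "(\<integral>\<^sup>+\<omega>. (\<integral>\<^sup>+r. ?g \<omega> r \<partial>lborel) \<partial>M) = (\<integral>\<^sup>+r. (\<integral>\<^sup>+\<omega>. ?g \<omega> r \<partial>M) \<partial>lborel)"
  proof -
    interpret P: pair_sigma_finite M lborel ..
    show ?thesis using P.Fubini'[of ?g] g by (simp add: split_beta')
  qed
  also have "\<dots> \<le> (\<integral>\<^sup>+r. ennreal (C * (1 + 2 * S)) * indicator {s..t} r \<partial>lborel)"
  proof (rule nn_integral_mono)
    fix r
    show "(\<integral>\<^sup>+\<omega>. ?g \<omega> r \<partial>M) \<le> ennreal (C * (1 + 2 * S)) * indicator {s..t} r"
    proof (cases "r \<in> {s..t}")
      case True
      then have r: "r \<in> {0..T}" "?c r = r" using st by auto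
      note [measurable] = X_meas[OF r(1)]
      have "(\<integral>\<^sup>+\<omega>. ?g \<omega> r \<partial>M) = (\<integral>\<^sup>+\<omega>. ennreal (C * (1 + S)) + ennreal C * ennreal \<bar>X r \<omega>\<bar> \<partial>M)"
        using True r C S by (intro nn_integral_cong)
          (simp add: ennreal_mult'[symmetric] ennreal_plus[symmetric] distrib_left del: ennreal_plus)
      also have "\<dots> = ennreal (C * (1 + S)) + ennreal C * ennreal (mean_abs r)"
        by (subst nn_integral_add) (auto simp: nn_integral_cmult nn_mean_abs[OF r(1)] emeasure_space_1)
      also have "\<dots> = ennreal (C * (1 + S) + C * mean_abs r)"
        using C S mean_abs_nonneg[of r] by (simp add: ennreal_mult'[symmetric] ennreal_plus[symmetric] del: ennreal_plus)
      also have "\<dots> \<le> ennreal (C * (1 + 2 * S))"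
      proof (rule ennreal_leI)
        have "C * mean_abs r \<le> C * S" using S(2)[OF True] C by (intro mult_left_mono) auto
        then show "C * (1 + S) + C * mean_abs r \<le> C * (1 + 2 * S)" by (simp add: algebra_simps)
      qed
      finally show ?thesis using True by simp
    qed simp
  qed
  also have "\<dots> = ennreal (C * (1 + 2 * S)) * ennreal (t - s)"
    using st by (subst nn_integral_cmult_indicator) auto
  also have "\<dots> + (\<integral>\<^sup>+\<omega>. ennreal \<bar>B t \<omega> - B s \<omega>\<bar> \<partial>M) \<le> ennreal (C * (1 + 2 * S)) * ennreal (t - s) + ennreal (sqrt (t - s))"
    by (intro add_left_mono B_increment_abs st)
  also have "\<dots> = ennreal (C * (1 + 2 * S) * (t - s) + sqrt (t - s))"
    using C S st by (simp add: ennreal_mult'[symmetric] ennreal_plus[symmetric] del: ennreal_plus)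
  finally show ?thesis by (simp add: add_right_mono)
qed

lemma mean_increment_sym:
  assumes st: "s \<in> {0..T}" "t \<in> {0..T}" and S: "S \<ge> 0" "\<And>r. r \<in> {min s t..max s t} \<Longrightarrow> mean_abs r \<le> S"
  shows "(\<integral>\<^sup>+\<omega>. ennreal \<bar>X t \<omega> - X s \<omega>\<bar> \<partial>M) \<le> ennreal (C * (1 + 2 * S) * \<bar>t - s\<bar> + sqrt \<bar>t - s\<bar>)"
proof (cases "s \<le> t")
  case True
  then show ?thesis using mean_increment[of s t S] st S by simp
next
  case False
  then show ?thesis using mean_increment[of t s S] st S by (simp add: abs_minus_commute)
qed

text \<open>Lower semicontinuity is Fatou's lemma. On an interval of length \<open>1 / (4 C)\<close> the drift moves the first
  moment by at most half of its supremum plus a constant; if the supremum is finite, it can be absorbed.\<close>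

lemma mean_abs_bounded: "\<exists>S\<ge>0. \<forall>t\<in>{0..T}. mean_abs t \<le> S"
proof -
  define \<delta> where "\<delta> = 1 / (4 * C)"
  have \<delta>: "\<delta> > 0" "C * \<delta> = 1 / 4" using C by (auto simp: \<delta>_def)
  define c where "c = 1 / 4 + sqrt \<delta>"
  have c0: "c \<ge> 0" using \<delta> by (simp add: c_def)
  have "bdd_above (mean_abs ` {0..T})"
  proof (rule bounded_by_Baire[OF _ \<delta>(1) c0 mean_abs_nonneg])
    show "0 \<le> T" using T by simp
    fix k
    show "closed {t\<in>{0..T}. mean_abs t \<le> k}"
      unfolding closed_sequential_limits
    proof (intro allI impI, elim conjE)
      fix u l assume u: "\<forall>n. u n \<in> {t\<in>{0..T}. mean_abs t \<le> k}" and lim: "u \<longlonglongrightarrow> l"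
      have l: "l \<in> {0..T}" using closed_sequentially[OF closed_atLeastAtMost _ lim] u by blast
      have k0: "k \<ge> 0" using u mean_abs_nonneg[of "u 0"] by (auto intro: order_trans)
      have "(\<integral>\<^sup>+\<omega>. ennreal \<bar>X l \<omega>\<bar> \<partial>M) = (\<integral>\<^sup>+\<omega>. liminf (\<lambda>n. ennreal \<bar>X (u n) \<omega>\<bar>) \<partial>M)"
      proof (rule nn_integral_cong)
        fix \<omega> assume w: "\<omega> \<in> space M"
        have "(\<lambda>n. X (u n) \<omega>) \<longlonglongrightarrow> X l \<omega>"
          using X_cont[OF w] u l lim unfolding continuous_on_sequentially by (auto simp: o_def)
        then have "(\<lambda>n. ennreal \<bar>X (u n) \<omega>\<bar>) \<longlonglongrightarrow> ennreal \<bar>X l \<omega>\<bar>" by (intro tendsto_ennrealI tendsto_rabs)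
        then show "ennreal \<bar>X l \<omega>\<bar> = liminf (\<lambda>n. ennreal \<bar>X (u n) \<omega>\<bar>)"
          using lim_imp_Liminf[OF sequentially_bot] by metis
      qed
      also have "\<dots> \<le> liminf (\<lambda>n. \<integral>\<^sup>+\<omega>. ennreal \<bar>X (u n) \<omega>\<bar> \<partial>M)"
      proof (rule nn_integral_liminf)
        fix n
        have [measurable]: "X (u n) \<in> borel_measurable M" using u by (intro X_meas) auto
        show "(\<lambda>\<omega>. ennreal \<bar>X (u n) \<omega>\<bar>) \<in> borel_measurable M" by measurable
      qed
      also have "\<dots> \<le> ennreal k"
      proof (rule order_trans[OF Liminf_mono Liminf_const[THEN eq_refl]])
        show "\<forall>\<^sub>F n in sequentially. (\<integral>\<^sup>+\<omega>. ennreal \<bar>X (u n) \<omega>\<bar> \<partial>M) \<le> ennreal k"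
          using u by (intro always_eventually allI) (auto simp: nn_mean_abs intro: ennreal_leI)
      qed simp
      finally show "l \<in> {t\<in>{0..T}. mean_abs t \<le> k}" using l k0 by (simp add: nn_mean_abs)
    qed
  next
    fix l u s t assume lu: "0 \<le> l" "l \<le> u" "u \<le> T" "u - l \<le> \<delta>" and bd: "bdd_above (mean_abs ` {l..u})"
      and s: "s \<in> {l..u}" and t: "t \<in> {l..u}"
    define S where "S = (SUP r\<in>{l..u}. mean_abs r)"
    have S: "mean_abs r \<le> S" if "r \<in> {l..u}" for r unfolding S_def by (rule cSUP_upper[OF that bd])
    have S0: "S \<ge> 0" using S[OF s] mean_abs_nonneg[of s] by linarith
    have "mean_abs r \<le> mean_abs s + c + S / 2" if r: "r \<in> {l..u}" for r
    proof -
      have rs: "r \<in> {0..T}" "s \<in> {0..T}" using r s lu by auto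
      have d: "\<bar>r - s\<bar> \<le> \<delta>" using r s lu by auto
      have ii: "integrable M (\<lambda>\<omega>. X r \<omega> - X s \<omega>)" using X_integrable rs by auto
      have "ennreal (LINT \<omega>|M. \<bar>X r \<omega> - X s \<omega>\<bar>) = (\<integral>\<^sup>+\<omega>. ennreal \<bar>X r \<omega> - X s \<omega>\<bar> \<partial>M)"
        using ii by (intro nn_integral_eq_integral[symmetric]) auto
      also have "\<dots> \<le> ennreal (C * (1 + 2 * S) * \<bar>r - s\<bar> + sqrt \<bar>r - s\<bar>)"
        using rs S0 by (intro mean_increment_sym S) (use r s in \<open>auto simp: min_def max_def split: if_splits\<close>)
      finally have 0: "ennreal (LINT \<omega>|M. \<bar>X r \<omega> - X s \<omega>\<bar>) \<le> ennreal (C * (1 + 2 * S) * \<bar>r - s\<bar> + sqrt \<bar>r - s\<bar>)" .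
      have "(LINT \<omega>|M. \<bar>X r \<omega> - X s \<omega>\<bar>) \<le> C * (1 + 2 * S) * \<bar>r - s\<bar> + sqrt \<bar>r - s\<bar>"
        by (rule ennreal_le_iff[THEN iffD1, OF _ 0]) (use C S0 in simp)
      also have "\<dots> \<le> C * (1 + 2 * S) * \<delta> + sqrt \<delta>"
        using d C S0 by (intro add_mono mult_left_mono) auto
      also have "C * (1 + 2 * S) * \<delta> = (C * \<delta>) * (1 + 2 * S)" by simp
      also have "\<dots> + sqrt \<delta> = c + S / 2" by (simp add: \<delta>(2) c_def)
      finally have 1: "(LINT \<omega>|M. \<bar>X r \<omega> - X s \<omega>\<bar>) \<le> c + S / 2" .
      have "mean_abs r \<le> (LINT \<omega>|M. \<bar>X s \<omega>\<bar> + \<bar>X r \<omega> - X s \<omega>\<bar>)"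
        unfolding mean_abs_def using X_integrable rs ii by (intro integral_mono) auto
      also have "\<dots> = mean_abs s + (LINT \<omega>|M. \<bar>X r \<omega> - X s \<omega>\<bar>)"
        unfolding mean_abs_def using X_integrable rs ii by simp
      finally show ?thesis using 1 by linarith
    qed
    then have "S \<le> mean_abs s + c + S / 2" unfolding S_def using s by (intro cSUP_least) auto
    then have "S / 2 \<le> mean_abs s + c" by (simp add: field_simps)
    then show "mean_abs t \<le> 2 * (mean_abs s + c)" using S[OF t] by (simp add: field_simps)
  qed
  then obtain S where "\<forall>t\<in>{0..T}. mean_abs t \<le> S" unfolding bdd_above_def by blast
  then show ?thesis by (intro exI[of _ "max S 0"]) (auto simp: le_max_iff_disj)
qed

end

section \<open>The flow of marginal laws\<close>

lemma flow_drift_measurable: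
  fixes T :: real and b :: "real \<Rightarrow> real \<Rightarrow> real measure \<Rightarrow> real"
  assumes T: "T > 0"
    and b: "(\<lambda>(t, y, \<mu>). b t y \<mu>) \<in> borel_measurable (restrict_space borel {0..T} \<Otimes>\<^sub>M borel \<Otimes>\<^sub>M borel_P1)"
    and \<nu>: "\<nu> \<in> restrict_space borel {0..T} \<rightarrow>\<^sub>M borel_P1"
  shows "(\<lambda>(s, y). if s \<in> {0..T} then b s y (\<nu> s) else (0 :: real)) \<in> borel_measurable (borel \<Otimes>\<^sub>M borel)"
proof -
  let ?c = "\<lambda>s :: real. max 0 (min T s)"
  have c: "(\<lambda>p :: real \<times> real. ?c (fst p)) \<in> borel \<Otimes>\<^sub>M borel \<rightarrow>\<^sub>M restrict_space borel {0..T}"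
    using T by (intro measurable_restrict_space2) auto
  have "(\<lambda>p :: real \<times> real. (?c (fst p), snd p, \<nu> (?c (fst p)))) \<in> borel \<Otimes>\<^sub>M borel \<rightarrow>\<^sub>M restrict_space borel {0..T} \<Otimes>\<^sub>M borel \<Otimes>\<^sub>M borel_P1"
    by (intro measurable_Pair c measurable_snd measurable_compose[OF c \<nu>])
  from measurable_compose[OF this b]
  have "(\<lambda>p. b (?c (fst p)) (snd p) (\<nu> (?c (fst p)))) \<in> borel_measurable (borel \<Otimes>\<^sub>M borel)" by simp
  moreover have "Measurable.pred (borel \<Otimes>\<^sub>M borel) (\<lambda>p :: real \<times> real. fst p \<in> {0..T})" by measurable
  ultimately have "(\<lambda>p. if fst p \<in> {0..T} then b (?c (fst p)) (snd p) (\<nu> (?c (fst p))) else 0) \<in> borel_measurable (borel \<Otimes>\<^sub>M borel)"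
    by (intro measurable_If) (auto simp: pred_def)
  moreover have "(\<lambda>p. if fst p \<in> {0..T} then b (?c (fst p)) (snd p) (\<nu> (?c (fst p))) else 0)
     = (\<lambda>(s :: real, y :: real). if s \<in> {0..T} then b s y (\<nu> s) else 0)"
    by (auto simp: fun_eq_iff)
  ultimately show ?thesis by (simp only:)
qed

lemma measurable_borel_P1I:
  assumes P: "\<And>s. s \<in> A \<Longrightarrow> \<nu> s \<in> P1"
    and c: "\<And>s e. s \<in> A \<Longrightarrow> e > 0 \<Longrightarrow> \<exists>d>0. \<forall>t\<in>A. \<bar>t - s\<bar> < d \<longrightarrow> kantorovich (\<nu> s) (\<nu> t) < e"
  shows "\<nu> \<in> restrict_space borel (A :: real set) \<rightarrow>\<^sub>M borel_P1"
proof -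
  interpret MS: Metric_space P1 kantorovich by (rule Metric_space_P1)
  have "\<nu> -` U \<inter> space (restrict_space borel A) \<in> sets (restrict_space borel A)" if U: "openin MS.mtopology U" for U
  proof -
    have "openin (top_of_set A) (\<nu> -` U \<inter> A)"
      unfolding openin_euclidean_subtopology_iff
    proof (intro conjI ballI)
      fix s assume s: "s \<in> \<nu> -` U \<inter> A"
      then obtain r where r: "r > 0" "MS.mball (\<nu> s) r \<subseteq> U" using U by (auto simp: MS.openin_mtopology)
      obtain d where d: "d > 0" "\<And>t. t \<in> A \<Longrightarrow> \<bar>t - s\<bar> < d \<Longrightarrow> kantorovich (\<nu> s) (\<nu> t) < r"
        using c[of s r] s r(1) by blast
      show "\<exists>e>0. \<forall>t\<in>A. dist t s < e \<longrightarrow> t \<in> \<nu> -` U \<inter> A"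
        using d r(2) P s by (intro exI[of _ d]) (auto simp: dist_real_def subset_iff MS.in_mball)
    qed auto
    then obtain V where "open V" "\<nu> -` U \<inter> A = A \<inter> V" by (auto simp: openin_open)
    then show ?thesis by (auto simp: sets_restrict_space space_restrict_space)
  qed
  then show ?thesis
    unfolding borel_P1_def borel_of_topology_def
    by (intro measurable_measure_of) (use P in \<open>auto simp: space_restrict_space MS.openin_mtopology\<close>)
qed

context growth_solution
begin

definition mean_bound :: real where
  "mean_bound = (SOME S. S \<ge> 0 \<and> (\<forall>t\<in>{0..T}. mean_abs t \<le> S))"

lemma mean_bound: "mean_bound \<ge> 0" "t \<in> {0..T} \<Longrightarrow> mean_abs t \<le> mean_bound"
  using someI_ex[OF mean_abs_bounded[unfolded Bex_def Ball_def], folded mean_bound_def]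
  unfolding mean_bound_def[symmetric] by (auto simp: mean_bound_def Ball_def)

lemma law_modulus:
  assumes st: "s \<in> {0..T}" "t \<in> {0..T}"
  shows "kantorovich (law s) (law t) \<le> C * (1 + 2 * mean_bound) * \<bar>t - s\<bar> + sqrt \<bar>t - s\<bar>"
  unfolding law_def
proof (rule kantorovich_coupling[OF prob_space_axioms])
  show "(\<integral>\<^sup>+\<omega>. ennreal \<bar>X s \<omega> - X t \<omega>\<bar> \<partial>M) \<le> ennreal (C * (1 + 2 * mean_bound) * \<bar>t - s\<bar> + sqrt \<bar>t - s\<bar>)"
  proof -
    have "mean_abs r \<le> mean_bound" if "r \<in> {min s t..max s t}" for r
      using that st by (intro mean_bound(2)) (auto simp: min_def max_def split: if_splits)
    from mean_increment_sym[OF st mean_bound(1) this] show ?thesis by (simp add: abs_minus_commute)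
  qed
  show "distr M borel (X s) \<in> P1" "distr M borel (X t) \<in> P1" using law_P1 st by (auto simp: law_def)
qed (use st C mean_bound(1) X_meas in auto)

lemma law_continuous:
  assumes s: "s \<in> {0..T}" and e: "e > 0"
  shows "\<exists>d>0. \<forall>t\<in>{0..T}. \<bar>t - s\<bar> < d \<longrightarrow> kantorovich (law s) (law t) < e"
proof -
  let ?f = "\<lambda>u. C * (1 + 2 * mean_bound) * u + sqrt u"
  have "(?f \<longlongrightarrow> ?f 0) (at 0)" by (intro tendsto_intros)
  then have "eventually (\<lambda>u. ?f u < e) (at 0)" using e by (intro order_tendstoD(2)) auto
  then obtain d where d: "d > 0" "\<And>u. u \<noteq> 0 \<Longrightarrow> \<bar>u\<bar> < d \<Longrightarrow> ?f u < e"
    by (auto simp: eventually_at dist_real_def)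
  show ?thesis
  proof (intro exI conjI ballI impI)
    fix t assume t: "t \<in> {0..T}" "\<bar>t - s\<bar> < d"
    have "?f \<bar>t - s\<bar> < e" using d(2)[of "\<bar>t - s\<bar>"] t e by (cases "t = s") auto
    then show "kantorovich (law s) (law t) < e" using law_modulus[OF s t(1)] by linarith
  qed (rule d(1))
qed

lemma law_measurable: "law \<in> restrict_space borel {0..T} \<rightarrow>\<^sub>M borel_P1"
  using law_P1 law_continuous by (rule measurable_borel_P1I)

definition beta :: "real \<Rightarrow> real \<Rightarrow> real" where
  "beta s y = (if s \<in> {0..T} then b s y (law s) else 0)"

lemma beta_growth: "\<bar>beta s y\<bar> \<le> C * (1 + mean_bound) * (1 + \<bar>y\<bar>)"
proof (cases "s \<in> {0..T}")
  case True
  have "\<bar>beta s y\<bar> \<le> C * (1 + \<bar>y\<bar> + mean_bound)"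
    using b_bound[OF True, of y] mean_bound(2)[OF True] C True
    by (simp add: beta_def) (smt (verit) mult_left_mono)
  also have "\<dots> \<le> C * ((1 + mean_bound) * (1 + \<bar>y\<bar>))"
    using C mean_bound(1) by (intro mult_left_mono) (auto simp: algebra_simps)
  finally show ?thesis by (simp add: mult.assoc)
next
  case False
  then have "beta s y = 0" unfolding beta_def by (rule if_not_P)
  then show ?thesis using C mean_bound(1) by simp
qed

lemma beta_equation:
  "AE \<omega> in M. \<forall>t\<in>{0..T}. X t \<omega> = x + (LINT s:{0..t}|lborel. beta s (X s \<omega>)) + B t \<omega>"
  using equation
proof eventually_elim
  case (elim \<omega>)
  show ?case
  proof
    fix t assume t: "t \<in> {0..T}"
    have "(LINT s:{0..t}|lborel. beta s (X s \<omega>)) = (LINT s:{0..t}|lborel. b s (X s \<omega>) (law s))"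
      by (rule set_lebesgue_integral_cong) (use t in \<open>auto simp: beta_def\<close>)
    then show "X t \<omega> = x + (LINT s:{0..t}|lborel. beta s (X s \<omega>)) + B t \<omega>" using elim t by simp
  qed
qed

lemma X_adapted_horizon:
  assumes "t \<le> T"
  shows "continuous_adapted t M F X"
  using X_adapted assms unfolding continuous_adapted_def
  by (auto intro: continuous_on_subset[where s = "{0..T}"])

lemma sde_solution_horizon:
  assumes "0 < t" "t \<le> T"
  shows "sde_solution t beta x M F B X"
  unfolding sde_solution_def
proof (intro conjI dyadic_bm_horizon assms X_adapted_horizon)
  show "AE \<omega> in M. \<forall>u\<in>{0..t}. X u \<omega> = x + (LINT s:{0..u}|lborel. beta s (X s \<omega>)) + B u \<omega>"
    using beta_equation by eventually_elim (use assms in auto)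
qed

lemma B_joint: "(\<lambda>p. B (max 0 (min T (snd p))) (fst p)) \<in> borel_measurable (M \<Otimes>\<^sub>M borel)"
proof -
  have p: "path_of T B \<in> M \<rightarrow>\<^sub>M path_space T" by (rule path_of_measurable[OF T B_meas B_cont])
  have "(\<lambda>p. path_of T B (fst p) (max 0 (min T (snd p)))) \<in> borel_measurable (M \<Otimes>\<^sub>M borel)"
    by (rule eval_joint_measurable[OF T _ _ measurable_compose[OF measurable_fst p]]) (use T in auto)
  then show ?thesis using T by (simp add: path_of_def)
qed

text \<open>Gronwall's inequality along each path bounds the solution by the Brownian path and its time integral,
  which are square integrable.\<close>

lemma second_moment: "\<exists>c\<ge>0. \<forall>t\<in>{0..T}. (\<integral>\<^sup>+\<omega>. ennreal ((X t \<omega> - x)\<^sup>2) \<partial>M) \<le> ennreal c"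
proof -
  let ?c = "\<lambda>r. max 0 (min T r)"
  define A where "A = \<bar>x\<bar> + C * (1 + mean_bound) * T"
  define a where "a \<omega> r = A + \<bar>B (?c r) \<omega>\<bar>" for \<omega> r
  define L where "L = C * exp (C * T)"
  have A0: "A \<ge> 0" using C T mean_bound(1) by (simp add: A_def)
  have L0: "L \<ge> 0" using C by (simp add: L_def)
  have a0: "a \<omega> r \<ge> 0" for \<omega> r using A0 by (simp add: a_def)
  have am [measurable]: "(\<lambda>p. a (fst p) (snd p)) \<in> borel_measurable (M \<Otimes>\<^sub>M borel)"
    unfolding a_def using B_joint by measurable
  have aml [measurable]: "(\<lambda>p. ennreal ((a (fst p) (snd p))\<^sup>2) * indicator {0..T} (snd p)) \<in> borel_measurable (M \<Otimes>\<^sub>M lborel)"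
  proof -
    have "(\<lambda>p. ennreal ((a (fst p) (snd p))\<^sup>2) * indicator {0..T} (snd p)) \<in> borel_measurable (M \<Otimes>\<^sub>M borel)" by measurable
    then show ?thesis by simp
  qed
  have path: "AE \<omega> in M. \<forall>t\<in>{0..T}. \<bar>X t \<omega>\<bar> \<le> a \<omega> t + L * integral {0..T} (a \<omega>)"
    using equation AE_space
  proof eventually_elim
    case (elim \<omega>)
    have w: "\<omega> \<in> space M" by fact
    let ?f = "\<lambda>r. b r (X r \<omega>) (law r)"
    have yc: "continuous_on {0..T} (\<lambda>r. \<bar>X r \<omega>\<bar>)" by (intro continuous_intros X_cont[OF w])
    have ac: "continuous_on {0..T} (a \<omega>)"
    proof -
      have "continuous_on {0..T} (\<lambda>r. A + \<bar>B r \<omega>\<bar>)" by (intro continuous_intros B_cont[OF w])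
      then show ?thesis by (rule continuous_on_eq) (auto simp: a_def)
    qed
    have le: "\<bar>X s \<omega>\<bar> \<le> a \<omega> s + C * integral {0..s} (\<lambda>r. \<bar>X r \<omega>\<bar>)" if s: "s \<in> {0..T}" for s
    proof -
      have i: "set_integrable lborel {0..s} ?f" using elim s by (auto intro: set_integrable_subset)
      have iy: "set_integrable lborel {0..s} (\<lambda>r. \<bar>X r \<omega>\<bar>)"
        using s by (intro borel_integrable_atLeastAtMost' continuous_on_subset[OF yc]) auto
      have ik: "set_integrable lborel {0..s} (\<lambda>r. C * (1 + mean_bound))"
        by (intro borel_integrable_atLeastAtMost' continuous_on_const)
      have "\<bar>LINT r:{0..s}|lborel. ?f r\<bar> \<le> (LINT r:{0..s}|lborel. \<bar>?f r\<bar>)"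
        using set_integral_norm_bound[OF i] by simp
      also have "\<dots> \<le> (LINT r:{0..s}|lborel. C * (1 + mean_bound) + C * \<bar>X r \<omega>\<bar>)"
      proof (rule set_integral_mono)
        show "set_integrable lborel {0..s} (\<lambda>r. \<bar>?f r\<bar>)" by (rule set_integrable_abs[OF i])
        show "set_integrable lborel {0..s} (\<lambda>r. C * (1 + mean_bound) + C * \<bar>X r \<omega>\<bar>)"
          using ik iy by (intro set_integral_add(1)) auto
        fix r assume "r \<in> {0..s}"
        then have r: "r \<in> {0..T}" using s by auto
        have "\<bar>?f r\<bar> \<le> C * (1 + \<bar>X r \<omega>\<bar> + mean_abs r)" by (rule b_bound[OF r])
        also have "\<dots> \<le> C * (1 + \<bar>X r \<omega>\<bar> + mean_bound)" using C mean_bound(2)[OF r] by (intro mult_left_mono) auto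
        finally show "\<bar>?f r\<bar> \<le> C * (1 + mean_bound) + C * \<bar>X r \<omega>\<bar>" by (simp add: algebra_simps)
      qed
      also have "\<dots> = (LINT r:{0..s}|lborel. C * (1 + mean_bound)) + (LINT r:{0..s}|lborel. C * \<bar>X r \<omega>\<bar>)"
        using ik iy by (intro set_integral_add(2)) auto
      also have "(LINT r:{0..s}|lborel. C * (1 + mean_bound)) = C * (1 + mean_bound) * s"
        using s by (simp add: set_integral_const)
      also have "(LINT r:{0..s}|lborel. C * \<bar>X r \<omega>\<bar>) = C * integral {0..s} (\<lambda>r. \<bar>X r \<omega>\<bar>)"
        using set_borel_integral_eq_integral(2)[OF iy] by simp
      also have "C * (1 + mean_bound) * s \<le> C * (1 + mean_bound) * T"
        using s C mean_bound(1) by (intro mult_left_mono) auto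
      finally have "\<bar>LINT r:{0..s}|lborel. ?f r\<bar> \<le> C * (1 + mean_bound) * T + C * integral {0..s} (\<lambda>r. \<bar>X r \<omega>\<bar>)"
        by simp
      moreover have "X s \<omega> = x + (LINT r:{0..s}|lborel. ?f r) + B s \<omega>" using elim s by blast
      moreover have "a \<omega> s = \<bar>x\<bar> + C * (1 + mean_bound) * T + \<bar>B s \<omega>\<bar>" using s by (simp add: a_def A_def)
      ultimately show ?thesis by linarith
    qed
    show ?case
    proof
      fix t assume t: "t \<in> {0..T}"
      have "integral {0..t} (\<lambda>r. \<bar>X r \<omega>\<bar>) \<le> exp (C * t) * integral {0..t} (a \<omega>)"
        by (rule gronwall) (use t C a0 le in \<open>auto intro: continuous_on_subset[OF yc] continuous_on_subset[OF ac]\<close>)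
      also have "\<dots> \<le> exp (C * T) * integral {0..T} (a \<omega>)"
      proof (rule mult_mono)
        show "integral {0..t} (a \<omega>) \<le> integral {0..T} (a \<omega>)"
          using t a0 by (intro integral_subset_le integrable_continuous_interval continuous_on_subset[OF ac]) auto
        show "0 \<le> integral {0..t} (a \<omega>)" using a0 t
          by (intro integral_nonneg integrable_continuous_interval continuous_on_subset[OF ac]) auto
      qed (use t C in auto)
      finally have "C * integral {0..t} (\<lambda>r. \<bar>X r \<omega>\<bar>) \<le> C * (exp (C * T) * integral {0..T} (a \<omega>))"
        using C by (intro mult_left_mono) auto
      then show "\<bar>X t \<omega>\<bar> \<le> a \<omega> t + L * integral {0..T} (a \<omega>)"
        using le[OF t] by (simp add: L_def mult.assoc)
    qed
  qed
  have Ea: "(\<integral>\<^sup>+\<omega>. ennreal ((a \<omega> r)\<^sup>2) \<partial>M) \<le> ennreal (2 * A\<^sup>2 + 2 * T)" for r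
  proof -
    have r: "?c r \<in> {0..T}" using T by auto
    note [measurable] = B_meas[OF r]
    have "AE \<omega> in M. B 0 \<omega> = 0" using sol by (simp add: weak_solution_def brownian_motion_def)
    then have "(\<integral>\<^sup>+\<omega>. ennreal ((B (?c r) \<omega>)\<^sup>2) \<partial>M) = (\<integral>\<^sup>+\<omega>. ennreal ((B (?c r) \<omega> - B 0 \<omega>)\<^sup>2) \<partial>M)"
      by (intro nn_integral_cong_AE) (auto elim!: eventually_mono)
    also have "\<dots> \<le> ennreal T" using B_increment_square[of 0 "?c r"] r by (simp add: ennreal_leI)
    finally have BB: "(\<integral>\<^sup>+\<omega>. ennreal ((B (?c r) \<omega>)\<^sup>2) \<partial>M) \<le> ennreal T" .
    have sq: "(u + v)\<^sup>2 \<le> 2 * u\<^sup>2 + 2 * v\<^sup>2" for u v :: real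
      using zero_le_power2[of "u - v"] by (simp add: power2_eq_square algebra_simps)
    have "(\<integral>\<^sup>+\<omega>. ennreal ((a \<omega> r)\<^sup>2) \<partial>M) \<le> (\<integral>\<^sup>+\<omega>. ennreal (2 * A\<^sup>2) + ennreal 2 * ennreal ((B (?c r) \<omega>)\<^sup>2) \<partial>M)"
      using sq[of A "\<bar>B (?c r) \<omega>\<bar>" for \<omega>]
      by (intro nn_integral_mono) (simp add: a_def ennreal_mult'[symmetric] ennreal_plus[symmetric] ennreal_leI del: ennreal_plus ennreal_numeral)
    also have "\<dots> = ennreal (2 * A\<^sup>2) + ennreal 2 * (\<integral>\<^sup>+\<omega>. ennreal ((B (?c r) \<omega>)\<^sup>2) \<partial>M)"
      by (subst nn_integral_add) (auto simp: nn_integral_cmult emeasure_space_1)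
    also have "\<dots> \<le> ennreal (2 * A\<^sup>2) + ennreal 2 * ennreal T"
      by (intro add_left_mono mult_left_mono BB) auto
    also have "\<dots> = ennreal (2 * A\<^sup>2 + 2 * T)"
      using T by (simp add: ennreal_mult'[symmetric] ennreal_plus[symmetric] del: ennreal_plus ennreal_numeral)
    finally show ?thesis .
  qed
  define G where "G \<omega> = (\<integral>\<^sup>+r. ennreal ((a \<omega> r)\<^sup>2) * indicator {0..T} r \<partial>lborel)" for \<omega>
  have Gm [measurable]: "G \<in> borel_measurable M"
    unfolding G_def using lborel.borel_measurable_nn_integral_fst[OF aml] by simp
  have EG: "(\<integral>\<^sup>+\<omega>. G \<omega> \<partial>M) \<le> ennreal ((2 * A\<^sup>2 + 2 * T) * T)"
  proof -
    interpret P: pair_sigma_finite M lborel ..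
    have "(\<integral>\<^sup>+\<omega>. G \<omega> \<partial>M) = (\<integral>\<^sup>+r. (\<integral>\<^sup>+\<omega>. ennreal ((a \<omega> r)\<^sup>2) * indicator {0..T} r \<partial>M) \<partial>lborel)"
      unfolding G_def using P.Fubini'[of "\<lambda>\<omega> r. ennreal ((a \<omega> r)\<^sup>2) * indicator {0..T} r"] aml by (simp add: split_beta')
    also have "\<dots> \<le> (\<integral>\<^sup>+r. ennreal (2 * A\<^sup>2 + 2 * T) * indicator {0..T} r \<partial>lborel)"
    proof (rule nn_integral_mono)
      fix r show "(\<integral>\<^sup>+\<omega>. ennreal ((a \<omega> r)\<^sup>2) * indicator {0..T} r \<partial>M) \<le> ennreal (2 * A\<^sup>2 + 2 * T) * indicator {0..T} r"
        using Ea[of r] by (cases "r \<in> {0..T}") auto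
    qed
    also have "\<dots> = ennreal (2 * A\<^sup>2 + 2 * T) * ennreal T"
      using T by (subst nn_integral_cmult_indicator) auto
    also have "\<dots> = ennreal ((2 * A\<^sup>2 + 2 * T) * T)" using T by (intro ennreal_mult'[symmetric]) simp
    finally show ?thesis .
  qed
  have CS: "ennreal ((integral {0..T} (a \<omega>))\<^sup>2) \<le> ennreal T * G \<omega>" if w: "\<omega> \<in> space M" for \<omega>
  proof -
    have ac: "continuous_on {0..T} (a \<omega>)"
    proof -
      have "continuous_on {0..T} (\<lambda>r. A + \<bar>B r \<omega>\<bar>)" by (intro continuous_intros B_cont[OF w])
      then show ?thesis by (rule continuous_on_eq) (auto simp: a_def)
    qed
    have ia: "set_integrable lborel {0..T} (a \<omega>)" by (rule borel_integrable_atLeastAtMost'[OF ac])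
    have [measurable]: "a \<omega> \<in> borel_measurable borel"
      using measurable_compose[OF measurable_Pair1'[OF w] am] by simp
    have "ennreal (integral {0..T} (a \<omega>)) = ennreal (LINT r|lborel. indicator {0..T} r * a \<omega> r)"
      using set_borel_integral_eq_integral(2)[OF ia] by (simp add: set_lebesgue_integral_def)
    also have "\<dots> = (\<integral>\<^sup>+r. ennreal (indicator {0..T} r * a \<omega> r) \<partial>lborel)"
      using ia a0 by (intro nn_integral_eq_integral[symmetric]) (auto simp: set_integrable_def)
    also have "\<dots> = (\<integral>\<^sup>+r. (ennreal (a \<omega> r) * indicator {0..T} r) * indicator {0..T} r \<partial>lborel)"
      by (intro nn_integral_cong) (auto simp: indicator_def)
    finally have "ennreal ((integral {0..T} (a \<omega>))\<^sup>2) = (\<integral>\<^sup>+r. (ennreal (a \<omega> r) * indicator {0..T} r) * indicator {0..T} r \<partial>lborel)\<^sup>2"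
      using a0 integral_nonneg[OF integrable_continuous_interval[OF ac]] by (simp add: ennreal_power[symmetric])
    also have "\<dots> \<le> (\<integral>\<^sup>+r. (ennreal (a \<omega> r) * indicator {0..T} r)\<^sup>2 \<partial>lborel) * (\<integral>\<^sup>+r. (indicator {0..T} r)\<^sup>2 \<partial>lborel)"
      by (rule Cauchy_Schwarz_nn_integral) measurable
    also have "(\<integral>\<^sup>+r. (ennreal (a \<omega> r) * indicator {0..T} r)\<^sup>2 \<partial>lborel) = G \<omega>"
      unfolding G_def using a0 by (intro nn_integral_cong) (auto simp: indicator_def ennreal_power)
    also have "(\<integral>\<^sup>+r. (indicator {0..T} r :: ennreal)\<^sup>2 \<partial>lborel) = (\<integral>\<^sup>+r. indicator {0..T} r \<partial>lborel)"
      by (intro nn_integral_cong) (auto simp: indicator_def)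
    also have "\<dots> = ennreal T" using T by simp
    finally show ?thesis by (simp add: mult.commute)
  qed
  define c where "c = 2 * (2 * (2 * A\<^sup>2 + 2 * T) + 2 * L\<^sup>2 * T * ((2 * A\<^sup>2 + 2 * T) * T)) + 2 * x\<^sup>2"
  have c0: "c \<ge> 0" using T by (simp add: c_def)
  have "(\<integral>\<^sup>+\<omega>. ennreal ((X t \<omega> - x)\<^sup>2) \<partial>M) \<le> ennreal c" if t: "t \<in> {0..T}" for t
  proof -
    have [measurable]: "(\<lambda>\<omega>. a \<omega> t) \<in> borel_measurable M"
      using B_meas[OF t] t by (simp add: a_def)
    have "(\<integral>\<^sup>+\<omega>. ennreal ((X t \<omega> - x)\<^sup>2) \<partial>M)
      \<le> (\<integral>\<^sup>+\<omega>. ennreal 4 * ennreal ((a \<omega> t)\<^sup>2) + ennreal (4 * L\<^sup>2 * T) * G \<omega> + ennreal (2 * x\<^sup>2) \<partial>M)"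
    proof (rule nn_integral_mono_AE)
      show "AE \<omega> in M. ennreal ((X t \<omega> - x)\<^sup>2) \<le> ennreal 4 * ennreal ((a \<omega> t)\<^sup>2) + ennreal (4 * L\<^sup>2 * T) * G \<omega> + ennreal (2 * x\<^sup>2)"
        using path AE_space
      proof eventually_elim
        case (elim \<omega>)
        let ?I = "integral {0..T} (a \<omega>)"
        have sq: "(u + v)\<^sup>2 \<le> 2 * u\<^sup>2 + 2 * v\<^sup>2" for u v :: real
          using zero_le_power2[of "u - v"] by (simp add: power2_eq_square algebra_simps)
        have "\<bar>X t \<omega>\<bar> \<le> a \<omega> t + L * ?I" using elim t by blast
        from power_mono[OF this abs_ge_zero, of 2] have "(X t \<omega>)\<^sup>2 \<le> (a \<omega> t + L * ?I)\<^sup>2" by simp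
        also have "\<dots> \<le> 2 * (a \<omega> t)\<^sup>2 + 2 * (L * ?I)\<^sup>2" by (rule sq)
        finally have "2 * (X t \<omega>)\<^sup>2 \<le> 4 * (a \<omega> t)\<^sup>2 + 4 * (L\<^sup>2 * ?I\<^sup>2)" by (simp add: power_mult_distrib)
        moreover have "(X t \<omega> - x)\<^sup>2 \<le> 2 * (X t \<omega>)\<^sup>2 + 2 * x\<^sup>2" using sq[of "X t \<omega>" "- x"] by simp
        ultimately have "(X t \<omega> - x)\<^sup>2 \<le> 4 * (a \<omega> t)\<^sup>2 + 4 * L\<^sup>2 * ?I\<^sup>2 + 2 * x\<^sup>2" by simp
        then have "ennreal ((X t \<omega> - x)\<^sup>2) \<le> ennreal (4 * (a \<omega> t)\<^sup>2 + 4 * L\<^sup>2 * ?I\<^sup>2 + 2 * x\<^sup>2)" by (rule ennreal_leI)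
        also have "\<dots> = ennreal 4 * ennreal ((a \<omega> t)\<^sup>2) + ennreal (4 * L\<^sup>2) * ennreal (?I\<^sup>2) + ennreal (2 * x\<^sup>2)"
          by (simp add: ennreal_mult'[symmetric] ennreal_plus[symmetric] del: ennreal_plus ennreal_numeral)
        also have "\<dots> \<le> ennreal 4 * ennreal ((a \<omega> t)\<^sup>2) + ennreal (4 * L\<^sup>2) * (ennreal T * G \<omega>) + ennreal (2 * x\<^sup>2)"
          by (intro add_mono mult_left_mono CS elim order_refl) auto
        also have "ennreal (4 * L\<^sup>2) * (ennreal T * G \<omega>) = ennreal (4 * L\<^sup>2 * T) * G \<omega>"
          using T by (simp add: ennreal_mult mult.assoc)
        finally show ?case .
      qed
    qed
    also have "\<dots> = ennreal 4 * (\<integral>\<^sup>+\<omega>. ennreal ((a \<omega> t)\<^sup>2) \<partial>M) + ennreal (4 * L\<^sup>2 * T) * (\<integral>\<^sup>+\<omega>. G \<omega> \<partial>M) + ennreal (2 * x\<^sup>2)"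
      by (subst nn_integral_add; (subst nn_integral_add)?; simp add: nn_integral_cmult emeasure_space_1 del: ennreal_numeral)
    also have "\<dots> \<le> ennreal 4 * ennreal (2 * A\<^sup>2 + 2 * T) + ennreal (4 * L\<^sup>2 * T) * ennreal ((2 * A\<^sup>2 + 2 * T) * T) + ennreal (2 * x\<^sup>2)"
      by (intro add_mono mult_left_mono Ea EG order_refl) auto
    also have "\<dots> = ennreal (4 * (2 * A\<^sup>2 + 2 * T) + (4 * L\<^sup>2 * T) * ((2 * A\<^sup>2 + 2 * T) * T) + 2 * x\<^sup>2)"
      using T by (simp add: ennreal_mult'[symmetric] ennreal_plus[symmetric] del: ennreal_plus ennreal_numeral)
    also have "4 * (2 * A\<^sup>2 + 2 * T) + (4 * L\<^sup>2 * T) * ((2 * A\<^sup>2 + 2 * T) * T) + 2 * x\<^sup>2 = c"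
      by (simp add: c_def algebra_simps)
    finally show ?thesis .
  qed
  with c0 show ?thesis by blast
qed

end

section \<open>Mixtures and the geometry of the Kantorovich space\<close>

text \<open>Convex combinations of measures, obtained by tossing a coin.\<close>

definition mix :: "real \<Rightarrow> real measure \<Rightarrow> real measure \<Rightarrow> real measure" where
  "mix q \<mu> \<nu> = measure_pmf (bernoulli_pmf q) \<bind> (\<lambda>u. if u then \<mu> else \<nu>)"

context
  fixes q :: real and \<mu> \<nu> :: "real measure"
  assumes q: "0 \<le> q" "q \<le> 1" and \<mu>: "\<mu> \<in> P1" and \<nu>: "\<nu> \<in> P1"
begin

lemma mix_kernel: "(\<lambda>u. if u then \<mu> else \<nu>) \<in> measure_pmf (bernoulli_pmf q) \<rightarrow>\<^sub>M subprob_algebra borel"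
  using P1D[OF \<mu>] P1D[OF \<nu>] by (auto simp: space_subprob_algebra prob_space_imp_subprob_space)

lemma nn_integral_mix:
  assumes f: "f \<in> borel_measurable borel"
  shows "(\<integral>\<^sup>+y. f y \<partial>mix q \<mu> \<nu>) = ennreal q * (\<integral>\<^sup>+y. f y \<partial>\<mu>) + ennreal (1 - q) * (\<integral>\<^sup>+y. f y \<partial>\<nu>)"
  unfolding mix_def nn_integral_bind[OF f mix_kernel]
  using q by (simp add: mult.commute)

lemma sets_mix: "sets (mix q \<mu> \<nu>) = sets borel"
  unfolding mix_def by (rule sets_bind[where N = borel]) (use P1D[OF \<mu>] P1D[OF \<nu>] in auto)

lemma prob_space_mix: "prob_space (mix q \<mu> \<nu>)"
proof (rule prob_spaceI)
  interpret m: prob_space \<mu> using \<mu> by (rule P1D)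
  interpret n: prob_space \<nu> using \<nu> by (rule P1D)
  have "emeasure (mix q \<mu> \<nu>) (space (mix q \<mu> \<nu>)) = (\<integral>\<^sup>+y. 1 \<partial>mix q \<mu> \<nu>)" by simp
  also have "\<dots> = ennreal q + ennreal (1 - q)"
    by (subst nn_integral_mix) (simp_all add: m.emeasure_space_1 n.emeasure_space_1)
  also have "\<dots> = 1" using q by (simp add: ennreal_plus[symmetric] del: ennreal_plus)
  finally show "emeasure (mix q \<mu> \<nu>) (space (mix q \<mu> \<nu>)) = 1" .
qed

lemma integral_mix:
  assumes h: "h \<in> borel_measurable borel" and i: "integrable \<mu> h" "integrable \<nu> h"
  shows "integrable (mix q \<mu> \<nu>) h"
    and "(LINT y|mix q \<mu> \<nu>. h y) = q * (LINT y|\<mu>. h y) + (1 - q) * (LINT y|\<nu>. h y)"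
proof -
  note [measurable] = h
  have m: "h \<in> borel_measurable (mix q \<mu> \<nu>)" using h measurable_cong_sets[OF sets_mix refl] by blast
  have f: "(\<integral>\<^sup>+y. ennreal (norm (h y)) \<partial>N) < \<infinity>" if "integrable N h" for N
    using that by (simp add: integrable_iff_bounded)
  have "(\<integral>\<^sup>+y. ennreal (norm (h y)) \<partial>mix q \<mu> \<nu>) < \<infinity>"
  proof -
    have nm: "(\<lambda>y. ennreal (norm (h y))) \<in> borel_measurable borel" by measurable
    show ?thesis unfolding nn_integral_mix[OF nm]
      using f[OF i(1)] f[OF i(2)] by (simp add: ennreal_mult_less_top)
  qed
  then show I: "integrable (mix q \<mu> \<nu>) h" using m by (simp add: integrable_iff_bounded)
  have fin: "(\<integral>\<^sup>+y. ennreal (h y) \<partial>N) = ennreal (enn2real (\<integral>\<^sup>+y. ennreal (h y) \<partial>N))"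
    "(\<integral>\<^sup>+y. ennreal (- h y) \<partial>N) = ennreal (enn2real (\<integral>\<^sup>+y. ennreal (- h y) \<partial>N))" if "integrable N h" for N
  proof -
    have "(\<integral>\<^sup>+y. ennreal (h y) \<partial>N) \<le> (\<integral>\<^sup>+y. ennreal (norm (h y)) \<partial>N)"
      "(\<integral>\<^sup>+y. ennreal (- h y) \<partial>N) \<le> (\<integral>\<^sup>+y. ennreal (norm (h y)) \<partial>N)"
      by (intro nn_integral_mono ennreal_leI; simp)+
    then show "(\<integral>\<^sup>+y. ennreal (h y) \<partial>N) = ennreal (enn2real (\<integral>\<^sup>+y. ennreal (h y) \<partial>N))"
      "(\<integral>\<^sup>+y. ennreal (- h y) \<partial>N) = ennreal (enn2real (\<integral>\<^sup>+y. ennreal (- h y) \<partial>N))"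
      using f[OF that] by (auto intro!: ennreal_enn2real[symmetric] elim: order_le_less_trans)
  qed
  have e: "enn2real (ennreal q * ennreal u + ennreal (1 - q) * ennreal v) = q * u + (1 - q) * v" if "u \<ge> 0" "v \<ge> 0" for u v
    using that q by (simp add: ennreal_mult'[symmetric] ennreal_plus[symmetric] del: ennreal_plus)
  have p: "enn2real (\<integral>\<^sup>+y. ennreal (h y) \<partial>mix q \<mu> \<nu>) = q * enn2real (\<integral>\<^sup>+y. ennreal (h y) \<partial>\<mu>) + (1 - q) * enn2real (\<integral>\<^sup>+y. ennreal (h y) \<partial>\<nu>)"
    by (subst nn_integral_mix, measurable, subst fin(1)[OF i(1)], subst fin(1)[OF i(2)]) (rule e; simp)
  have n: "enn2real (\<integral>\<^sup>+y. ennreal (- h y) \<partial>mix q \<mu> \<nu>) = q * enn2real (\<integral>\<^sup>+y. ennreal (- h y) \<partial>\<mu>) + (1 - q) * enn2real (\<integral>\<^sup>+y. ennreal (- h y) \<partial>\<nu>)"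
    by (subst nn_integral_mix, measurable, subst fin(2)[OF i(1)], subst fin(2)[OF i(2)]) (rule e; simp)
  show "(LINT y|mix q \<mu> \<nu>. h y) = q * (LINT y|\<mu>. h y) + (1 - q) * (LINT y|\<nu>. h y)"
    unfolding real_lebesgue_integral_def[OF I] real_lebesgue_integral_def[OF i(1)] real_lebesgue_integral_def[OF i(2)] p n
    by (simp add: algebra_simps)
qed

lemma mix_P1: "mix q \<mu> \<nu> \<in> P1"
  unfolding P1_def using prob_space_mix sets_mix integral_mix(1)[of "\<lambda>y. \<bar>y\<bar>"] P1D(4)[OF \<mu>] P1D(4)[OF \<nu>] by simp

end

lemma lipschitz_borel: "1-lipschitz_on UNIV (h :: real \<Rightarrow> real) \<Longrightarrow> h \<in> borel_measurable borel"
  by (rule borel_measurable_continuous_onI[OF lipschitz_on_continuous_on])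

text \<open>Moving a small mass far out of the midpoint \<open>m\<close> of \<open>\<mu>\<close> and \<open>\<nu>\<close> adds, in the limit, its transport cost
  to the distance from \<open>\<mu>\<close>: the Kantorovich potentials of the two displacements live on essentially
  disjoint regions.\<close>

lemma kantorovich_far_mass:
  assumes \<mu>: "\<mu> \<in> P1" and \<nu>: "\<nu> \<in> P1" and m: "m \<in> P1" and c: "c \<ge> 0"
    and mid: "\<And>h :: real \<Rightarrow> real. 1-lipschitz_on UNIV h \<Longrightarrow> (LINT y|m. h y) = ((LINT y|\<mu>. h y) + (LINT y|\<nu>. h y)) / 2"
  shows "(\<lambda>n. kantorovich \<mu> (mix (c / (real n + c + 1)) (return borel (real n + c + 1)) m))
    \<longlonglongrightarrow> kantorovich \<mu> \<nu> / 2 + c"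
proof (rule LIMSEQ_I)
  fix e :: real assume e: "e > 0"
  define s where "s = kantorovich \<mu> \<nu>"
  define a where "a n = real n + c + 1" for n
  have a: "a n > 0" "c / a n \<le> 1" "0 \<le> c / a n" for n using c by (auto simp: a_def)
  define \<eta> where "\<eta> n = mix (c / a n) (return borel (a n)) m" for n
  have \<eta>: "\<eta> n \<in> P1" for n unfolding \<eta>_def by (rule mix_P1[OF a(3) a(2) return_P1 m])
  define A where "A = (LINT y|m. \<bar>y\<bar>)"
  have ih: "(LINT y|\<mu>. h y) - (LINT y|\<eta> n. h y)
     = ((LINT y|\<mu>. h y) - (LINT y|\<nu>. h y)) / 2 + c / a n * ((LINT y|m. h y) - h (a n))"
    if h: "1-lipschitz_on UNIV h" for h :: "real \<Rightarrow> real" and n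
  proof -
    have [measurable]: "h \<in> borel_measurable borel" by (rule lipschitz_borel[OF h])
    have "(LINT y|\<eta> n. h y) = c / a n * h (a n) + (1 - c / a n) * (LINT y|m. h y)"
      unfolding \<eta>_def
      by (subst integral_mix(2)[OF a(3) a(2) return_P1 m])
        (auto simp: lipschitz_integrable_P1(1)[OF m h] lipschitz_integrable_P1(1)[OF return_P1 h] integral_return)
    moreover have "(LINT y|m. h y) = ((LINT y|\<mu>. h y) + (LINT y|\<nu>. h y)) / 2" by (rule mid[OF h])
    moreover have "U - (p * ha + (1 - p) * I) = (U - V) / 2 + p * (I - ha)" if "I = (U + V) / 2" for U V I p ha :: real
      unfolding that by (simp add: field_simps)
    ultimately show ?thesis by (simp only:)
  qed
  have A0: "A \<ge> 0" by (simp add: A_def)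
  have upper: "kantorovich \<mu> (\<eta> n) \<le> s / 2 + c + c * A / a n" for n
  proof (rule kantorovich_least[OF \<mu> \<eta>])
    fix h :: "real \<Rightarrow> real" assume h: "1-lipschitz_on UNIV h"
    have 1: "\<bar>(LINT y|\<mu>. h y) - (LINT y|\<nu>. h y)\<bar> \<le> s" unfolding s_def by (rule kantorovich_upper[OF \<mu> \<nu> h])
    have "\<bar>(LINT y|m. h y) - h 0\<bar> \<le> A" unfolding A_def by (rule lipschitz_integrable_P1(2)[OF m h])
    moreover have "\<bar>h 0 - h (a n)\<bar> \<le> a n" using lipschitz_onD[OF h, of 0 "a n"] a(1)[of n] by (simp add: dist_real_def)
    ultimately have 2: "\<bar>(LINT y|m. h y) - h (a n)\<bar> \<le> A + a n" by linarith
    have "\<bar>c / a n * ((LINT y|m. h y) - h (a n))\<bar> \<le> c / a n * (A + a n)"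
      unfolding abs_mult abs_of_nonneg[OF a(3)] using 2 a(3) by (rule mult_left_mono)
    moreover have "c / a n * (A + a n) = c + c * A / a n" using a(1)[of n] by (simp add: field_simps)
    ultimately show "\<bar>(LINT y|\<mu>. h y) - (LINT y|\<eta> n. h y)\<bar> \<le> s / 2 + c + c * A / a n"
    proof -
      have "\<bar>((LINT y|\<mu>. h y) - (LINT y|\<nu>. h y)) / 2\<bar> \<le> s / 2" using 1 by simp
      then show ?thesis
        unfolding ih[OF h] using \<open>\<bar>c / a n * ((LINT y|m. h y) - h (a n))\<bar> \<le> c / a n * (A + a n)\<close>
          \<open>c / a n * (A + a n) = c + c * A / a n\<close> abs_triangle_ineq[of "((LINT y|\<mu>. h y) - (LINT y|\<nu>. h y)) / 2" "c / a n * ((LINT y|m. h y) - h (a n))"]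
        by simp
    qed
  qed
  \<comment> \<open>a nearly optimal potential for \<open>\<mu>\<close> and \<open>\<nu>\<close>\<close>
  obtain h where h: "1-lipschitz_on UNIV h" and hs: "(LINT y|\<mu>. h y) - (LINT y|\<nu>. h y) > s - e / 2"
  proof -
    obtain g :: "real \<Rightarrow> real" where g: "1-lipschitz_on UNIV g" "\<bar>(LINT y|\<mu>. g y) - (LINT y|\<nu>. g y)\<bar> > s - e / 2"
      using less_cSUP_iff[OF lipschitz_ne kantorovich_bdd_above[OF \<mu> \<nu>], of "s - e / 2"] \<mu> \<nu> e
      by (auto simp: s_def kantorovich_def)
    show ?thesis
    proof (cases "(LINT y|\<mu>. g y) - (LINT y|\<nu>. g y) \<ge> 0")
      case True then show ?thesis using that[of g] g by simp
    next
      case False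
      have "1-lipschitz_on UNIV (\<lambda>y. - g y)" using g(1) by (simp add: lipschitz_on_def dist_minus)
      then show ?thesis using that[of "\<lambda>y. - g y"] g False by simp
    qed
  qed
  \<comment> \<open>modified so as to decrease with slope one to the right of \<open>L\<close>\<close>
  define hL where "hL L y = h (max (- L) (min L y)) - max 0 (y - L)" for L y
  have clamp: "\<bar>max (- L) (min L y) - max (- L) (min L z)\<bar> + \<bar>max 0 (y - L) - max 0 (z - L)\<bar> \<le> \<bar>y - z\<bar>" if "L \<ge> 0" for L y z :: real
    using that by (auto simp: max_def min_def abs_if)
  have hl: "\<bar>h u - h v\<bar> \<le> \<bar>u - v\<bar>" for u v using lipschitz_onD[OF h, of u v] by (simp add: dist_real_def)
  have hL: "1-lipschitz_on UNIV (hL L)" if "L \<ge> 0" for L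
  proof (rule lipschitz_onI)
    fix y z :: real
    have "\<bar>hL L y - hL L z\<bar> \<le> \<bar>h (max (- L) (min L y)) - h (max (- L) (min L z))\<bar> + \<bar>max 0 (y - L) - max 0 (z - L)\<bar>"
      unfolding hL_def by linarith
    also have "\<dots> \<le> \<bar>y - z\<bar>" using hl clamp[OF that] by (meson add_right_mono order_trans)
    finally show "dist (hL L y) (hL L z) \<le> 1 * dist y z" by (simp add: dist_real_def)
  qed simp
  have lim: "(\<lambda>n. LINT y|N. hL (real n) y) \<longlonglongrightarrow> (LINT y|N. h y)" if N: "N \<in> P1" for N
  proof (rule integral_dominated_convergence[where w = "\<lambda>y. \<bar>h 0\<bar> + \<bar>y\<bar>"])
    show "h \<in> borel_measurable N" by (rule lipschitz_measurable_P1[OF N h])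
    show "hL (real n) \<in> borel_measurable N" for n by (rule lipschitz_measurable_P1[OF N hL]) simp
    interpret prob_space N using N by (rule P1D)
    show "integrable N (\<lambda>y. \<bar>h 0\<bar> + \<bar>y\<bar>)" using P1D(4)[OF N] by simp
    show "AE y in N. (\<lambda>n. hL (real n) y) \<longlonglongrightarrow> h y"
    proof (rule AE_I2, rule tendsto_eventually)
      fix y :: real
      obtain n0 :: nat where n0: "\<bar>y\<bar> < real n0" using reals_Archimedean2 by blast
      show "eventually (\<lambda>n. hL (real n) y = h y) sequentially"
        unfolding eventually_sequentially
      proof (intro exI[of _ n0] allI impI)
        fix n assume "n0 \<le> n"
        then have "\<bar>y\<bar> < real n" using n0 by linarith
        then have "max (- real n) (min (real n) y) = y" "max 0 (y - real n) = 0" by linarith+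
        then show "hL (real n) y = h y" by (simp add: hL_def)
      qed
    qed
    fix n
    have "\<bar>hL (real n) y - hL (real n) 0\<bar> \<le> \<bar>y\<bar>" for y
      using lipschitz_onD[OF hL, of "real n" y 0] by (simp add: dist_real_def)
    moreover have "hL (real n) 0 = h 0" by (simp add: hL_def)
    ultimately have "\<bar>hL (real n) y\<bar> \<le> \<bar>h 0\<bar> + \<bar>y\<bar>" for y by (smt (verit))
    then show "AE y in N. norm (hL (real n) y) \<le> \<bar>h 0\<bar> + \<bar>y\<bar>" by simp
  qed
  have "(\<lambda>n. (LINT y|\<mu>. hL (real n) y) - (LINT y|\<nu>. hL (real n) y)) \<longlonglongrightarrow> (LINT y|\<mu>. h y) - (LINT y|\<nu>. h y)"
    by (intro tendsto_diff lim \<mu> \<nu>)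
  from order_tendstoD(1)[OF this hs]
  obtain l where l: "(LINT y|\<mu>. hL (real l) y) - (LINT y|\<nu>. hL (real l) y) > s - e / 2"
    by (auto simp: eventually_sequentially)
  define g where "g = hL (real l)"
  have g: "1-lipschitz_on UNIV g" unfolding g_def by (rule hL) simp
  define R where "R = A + \<bar>h (real l)\<bar> + \<bar>g 0\<bar> + real l"
  have lower: "kantorovich \<mu> (\<eta> n) > s / 2 - e / 4 + c - c * R / a n" if n: "n \<ge> l" for n
  proof -
    have al: "a n \<ge> real l" using n c by (simp add: a_def)
    have "max (- real l) (min (real l) (a n)) = real l" "max 0 (a n - real l) = a n - real l" using al by linarith+
    then have "g (a n) = h (real l) - (a n - real l)" by (simp add: g_def hL_def)
    moreover have "\<bar>(LINT y|m. g y) - g 0\<bar> \<le> A" unfolding A_def by (rule lipschitz_integrable_P1(2)[OF m g])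
    ultimately have "(LINT y|m. g y) - g (a n) \<ge> a n - R" unfolding R_def by linarith
    then have "c / a n * ((LINT y|m. g y) - g (a n)) \<ge> c / a n * (a n - R)"
      using a(3)[of n] by (intro mult_left_mono)
    moreover have "c / a n * (a n - R) = c - c * R / a n" using a(1)[of n] by (simp add: field_simps)
    moreover have "(LINT y|\<mu>. g y) - (LINT y|\<nu>. g y) > s - e / 2" using l by (simp add: g_def)
    moreover have "s / 2 - e / 4 + c - w < u / 2 + v" if "p \<le> v" "p = c - w" "s - e / 2 < u" for u v w p :: real
      using that by (simp add: field_simps)
    ultimately have "(LINT y|\<mu>. g y) - (LINT y|\<eta> n. g y) > s / 2 - e / 4 + c - c * R / a n"
      unfolding ih[OF g] by blast
    then show ?thesis using kantorovich_upper[OF \<mu> \<eta>[of n] g] by linarith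
  qed
  have "(\<lambda>n. c * (A + R) / a n) \<longlonglongrightarrow> 0"
  proof (rule real_tendsto_divide_at_top[OF tendsto_const])
    show "filterlim a at_top sequentially"
      unfolding a_def by (intro filterlim_at_top_mono[OF filterlim_real_sequentially]) (use c in auto)
  qed
  then have "eventually (\<lambda>n. c * (A + R) / a n < e / 4) sequentially" using e by (intro order_tendstoD(2)) auto
  then obtain N where N: "\<And>n. n \<ge> N \<Longrightarrow> c * (A + R) / a n < e / 4" by (auto simp: eventually_sequentially)
  have R0: "R \<ge> 0" using A0 by (simp add: R_def)
  show "\<exists>N. \<forall>n\<ge>N. norm (kantorovich \<mu> (mix (c / (real n + c + 1)) (return borel (real n + c + 1)) m) - (kantorovich \<mu> \<nu> / 2 + c)) < e"
  proof (intro exI allI impI)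
    fix n assume n: "max N l \<le> n"
    have "c * A / a n \<le> c * (A + R) / a n" "c * R / a n \<le> c * (A + R) / a n"
      using a(1)[of n] c A0 R0 by (auto intro!: divide_right_mono mult_left_mono)
    then have "\<bar>kantorovich \<mu> (\<eta> n) - (s / 2 + c)\<bar> < e"
    proof -
      have "\<bar>k - (s / 2 + c)\<bar> < e" if "p \<le> w" "q \<le> w" "k \<le> s / 2 + c + p" "s / 2 - e / 4 + c - q < k" "w < e / 4" for p q w k :: real
        using that e by (simp add: abs_less_iff field_simps)
      then show ?thesis using upper[of n] lower[of n] N[of n] n \<open>c * A / a n \<le> c * (A + R) / a n\<close>
        \<open>c * R / a n \<le> c * (A + R) / a n\<close> by simp
    qed
    then show "norm (kantorovich \<mu> (mix (c / (real n + c + 1)) (return borel (real n + c + 1)) m) - (kantorovich \<mu> \<nu> / 2 + c)) < e"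
      by (simp add: \<eta>_def a_def s_def)
  qed
qed

text \<open>Any two measures have, up to arbitrarily small errors, a common neighbour \<open>\<eta>\<close> at any prescribed larger
  distance. Passing through \<open>\<eta>\<close> bounds the difference by twice the modulus at that distance, which makes
  up for oscillations of \<open>\<theta>\<close>.\<close>

lemma modulus_at_larger_distance:
  fixes f :: "real measure \<Rightarrow> real" and \<theta> :: "real \<Rightarrow> real"
  assumes \<mu>: "\<mu> \<in> P1" and \<nu>: "\<nu> \<in> P1"
    and \<theta>c: "continuous_on {0..} \<theta>" and \<theta>0: "\<And>y. y \<ge> 0 \<Longrightarrow> \<theta> y \<ge> 0"
    and mod: "\<And>\<mu> \<nu>. \<mu> \<in> P1 \<Longrightarrow> \<nu> \<in> P1 \<Longrightarrow> \<bar>f \<mu> - f \<nu>\<bar>\<^sup>2 \<le> \<theta> ((kantorovich \<mu> \<nu>)\<^sup>2)"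
    and z: "(kantorovich \<mu> \<nu>)\<^sup>2 \<le> z"
  shows "\<bar>f \<mu> - f \<nu>\<bar>\<^sup>2 \<le> 4 * \<theta> z"
proof -
  interpret MS: Metric_space P1 kantorovich by (rule Metric_space_P1)
  define s where "s = kantorovich \<mu> \<nu>"
  have s0: "s \<ge> 0" by (simp add: s_def)
  have z0: "z \<ge> 0" using z zero_le_power2[of "kantorovich \<mu> \<nu>"] by linarith
  define r where "r = sqrt z"
  have r: "r \<ge> s" "r\<^sup>2 = z" "r \<ge> 0" using z z0 s0 by (auto simp: r_def s_def real_le_rsqrt)
  define c where "c = r - s / 2"
  have c: "c \<ge> 0" using r s0 by (simp add: c_def)
  define m where "m = mix (1 / 2) \<mu> \<nu>"
  have m: "m \<in> P1" unfolding m_def by (rule mix_P1[OF _ _ \<mu> \<nu>]) auto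
  have mid: "(LINT y|m. h y) = ((LINT y|\<mu>. h y) + (LINT y|\<nu>. h y)) / 2" if h: "1-lipschitz_on UNIV h" for h :: "real \<Rightarrow> real"
    unfolding m_def using lipschitz_integrable_P1(1)[OF \<mu> h] lipschitz_integrable_P1(1)[OF \<nu> h] lipschitz_borel[OF h]
    by (subst integral_mix(2)[OF _ _ \<mu> \<nu>]) auto
  have mid': "(LINT y|m. h y) = ((LINT y|\<nu>. h y) + (LINT y|\<mu>. h y)) / 2" if h: "1-lipschitz_on UNIV h" for h :: "real \<Rightarrow> real"
    using mid[OF h] by simp
  define \<eta> where "\<eta> n = mix (c / (real n + c + 1)) (return borel (real n + c + 1)) m" for n :: nat
  have \<eta>: "\<eta> n \<in> P1" for n
    unfolding \<eta>_def using c by (intro mix_P1 return_P1 m) auto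
  have 1: "(\<lambda>n. kantorovich \<mu> (\<eta> n)) \<longlonglongrightarrow> r"
    using kantorovich_far_mass[OF \<mu> \<nu> m c mid] by (simp add: \<eta>_def c_def s_def)
  have 2: "(\<lambda>n. kantorovich \<nu> (\<eta> n)) \<longlonglongrightarrow> r"
    using kantorovich_far_mass[OF \<nu> \<mu> m c mid'] by (simp add: \<eta>_def c_def s_def MS.commute)
  have \<theta>l: "(\<lambda>n. \<theta> ((u n)\<^sup>2)) \<longlonglongrightarrow> \<theta> z" if "u \<longlonglongrightarrow> r" for u :: "nat \<Rightarrow> real"
  proof -
    have "(\<lambda>n. (u n)\<^sup>2) \<longlonglongrightarrow> z" using tendsto_power[OF that, of 2] r(2) by simp
    then show ?thesis using \<theta>c z0 unfolding continuous_on_sequentially by (auto simp: o_def)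
  qed
  have le: "\<bar>f \<mu> - f \<nu>\<bar> \<le> sqrt (\<theta> ((kantorovich \<mu> (\<eta> n))\<^sup>2)) + sqrt (\<theta> ((kantorovich \<nu> (\<eta> n))\<^sup>2))" for n
  proof -
    have "\<bar>f \<mu> - f (\<eta> n)\<bar> \<le> sqrt (\<theta> ((kantorovich \<mu> (\<eta> n))\<^sup>2))" "\<bar>f \<nu> - f (\<eta> n)\<bar> \<le> sqrt (\<theta> ((kantorovich \<nu> (\<eta> n))\<^sup>2))"
      using mod[OF \<mu> \<eta>[of n]] mod[OF \<nu> \<eta>[of n]] by (auto intro: real_le_rsqrt)
    then show ?thesis by linarith
  qed
  have "(\<lambda>n. sqrt (\<theta> ((kantorovich \<mu> (\<eta> n))\<^sup>2)) + sqrt (\<theta> ((kantorovich \<nu> (\<eta> n))\<^sup>2))) \<longlonglongrightarrow> sqrt (\<theta> z) + sqrt (\<theta> z)"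
    by (intro tendsto_add tendsto_real_sqrt \<theta>l 1 2)
  then have "\<bar>f \<mu> - f \<nu>\<bar> \<le> sqrt (\<theta> z) + sqrt (\<theta> z)"
    by (rule LIMSEQ_le_const) (use le in auto)
  then have "\<bar>f \<mu> - f \<nu>\<bar>\<^sup>2 \<le> (2 * sqrt (\<theta> z))\<^sup>2" by (intro power_mono) auto
  also have "\<dots> = 4 * \<theta> z" using \<theta>0[OF z0] by (simp add: power_mult_distrib)
  finally show ?thesis .
qed

section \<open>Osgood's uniqueness argument\<close>

text \<open>The largest nondecreasing minorant of \<open>\<theta>\<close>.\<close>

definition tail_inf :: "(real \<Rightarrow> real) \<Rightarrow> real \<Rightarrow> real" where
  "tail_inf \<theta> y = Inf (\<theta> ` {y..})"

context
  fixes \<theta> :: "real \<Rightarrow> real"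
  assumes \<theta>_cont: "continuous_on {0..} \<theta>"
    and \<theta>_nonneg: "\<And>y. y \<ge> 0 \<Longrightarrow> \<theta> y \<ge> 0"
begin

lemma tail_inf_le: "0 \<le> y \<Longrightarrow> y \<le> z \<Longrightarrow> tail_inf \<theta> y \<le> \<theta> z"
  unfolding tail_inf_def by (intro cInf_lower bdd_belowI[of _ 0]) (auto intro: \<theta>_nonneg)

lemma le_tail_inf: "(\<And>z. z \<ge> y \<Longrightarrow> c \<le> \<theta> z) \<Longrightarrow> c \<le> tail_inf \<theta> y"
  unfolding tail_inf_def by (intro cInf_greatest) auto

lemma tail_inf_nonneg: "0 \<le> y \<Longrightarrow> 0 \<le> tail_inf \<theta> y"
  by (intro le_tail_inf \<theta>_nonneg) auto

lemma tail_inf_mono: "0 \<le> y \<Longrightarrow> y \<le> z \<Longrightarrow> tail_inf \<theta> y \<le> tail_inf \<theta> z"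
  by (intro le_tail_inf tail_inf_le) auto

lemma tail_inf_measurable:
  assumes f: "f \<in> borel_measurable M" "\<And>\<omega>. f \<omega> \<ge> 0"
  shows "(\<lambda>\<omega>. tail_inf \<theta> (f \<omega>)) \<in> borel_measurable M"
proof -
  have "mono (\<lambda>y. tail_inf \<theta> (max 0 y))" by (intro monoI tail_inf_mono) auto
  then have "(\<lambda>y. tail_inf \<theta> (max 0 y)) \<in> borel_measurable borel" by (rule borel_measurable_mono)
  from measurable_compose[OF f(1) this] show ?thesis using f(2) by (simp add: max_absorb2)
qed

text \<open>Let \<open>G\<close> be the right-hand side of the integral inequality. Since \<open>y \<le> G\<close> and \<open>G\<close> increases, the growth rate of \<open>G\<close> at times
  before \<open>t\<close> is at most \<open>C \<theta> (G t)\<close>. As \<open>\<theta>\<close> varies little on short intervals, the integral of \<open>1 / \<theta>\<close> over the range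
  of \<open>G\<close> is at most a constant times the elapsed time; Bolzano's principle passes from short intervals
  to long ones. If \<open>G\<close> were positive at \<open>T\<close>, its range would reach down to 0, where this integral diverges.\<close>

lemma osgood_uniqueness:
  fixes y :: "real \<Rightarrow> real"
  assumes \<theta>_pos: "\<And>y. y > 0 \<Longrightarrow> \<theta> y > 0"
    and osgood: "\<And>z. z > 0 \<Longrightarrow> (\<integral>\<^sup>+ y\<in>{0<..z}. ennreal (1 / \<theta> y) \<partial>lborel) = \<infinity>"
    and T: "T > 0" and C: "C \<ge> 0" and ym [measurable]: "y \<in> borel_measurable borel"
    and y0: "\<And>s. y s \<ge> 0" and yb: "\<And>s. y s \<le> Y"
    and le: "\<And>t. t \<in> {0<..T} \<Longrightarrow> y t \<le> C * (LINT s:{0..t}|lborel. tail_inf \<theta> (y s))"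
    and t: "t \<in> {0<..T}"
  shows "y t = 0"
proof -
  define w where "w s = tail_inf \<theta> (y s)" for s
  have wm [measurable]: "w \<in> borel_measurable borel" unfolding w_def[abs_def] by (rule tail_inf_measurable[OF ym y0])
  have w0: "w s \<ge> 0" for s unfolding w_def by (rule tail_inf_nonneg[OF y0])
  have wb: "\<bar>w s\<bar> \<le> tail_inf \<theta> Y" for s using w0[of s] tail_inf_mono[OF y0 yb, of s] by (simp add: w_def)
  have wi: "set_integrable lborel A w" if "A \<in> sets borel" "A \<subseteq> {a..b}" for A a b
    using that wb by (intro set_integrable_bounded) auto
  define G where "G t = C * (LINT s:{0..t}|lborel. w s)" for t
  have yG: "y t \<le> G t" if "t \<in> {0<..T}" for t using le[OF that] by (simp add: G_def w_def)
  have Gd: "G t - G u = C * (LINT s:{u<..t}|lborel. w s)" if "0 \<le> u" "u \<le> t" for u t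
    using set_integral_diff_Icc[OF wi[of "{0..t}" 0 t] that] by (simp add: G_def algebra_simps)
  have Gmono: "G u \<le> G t" if "0 \<le> u" "u \<le> t" for u t
  proof -
    have "0 \<le> (LINT s:{u<..t}|lborel. w s)" using w0 by (simp add: set_lebesgue_integral_def)
    then show ?thesis using Gd[OF that] C by (smt (verit) mult_nonneg_nonneg)
  qed
  have Gc: "G t - G u \<le> C * K * (t - u)" if ut: "0 \<le> u" "u \<le> t" and K: "\<And>s. s \<in> {u<..t} \<Longrightarrow> w s \<le> K" for u t K
  proof -
    have "(LINT s:{u<..t}|lborel. w s) \<le> (LINT s:{u<..t}|lborel. K)"
      by (intro set_integral_mono wi[of _ u t] K set_integrable_bounded[where a = u and b = t and K = "\<bar>K\<bar>"]) auto
    also have "\<dots> = K * (t - u)" using ut by (simp add: set_integral_const mult.commute)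
    finally show ?thesis unfolding Gd[OF ut] using C by (simp add: mult.assoc mult_left_mono)
  qed
  define L where "L = C * tail_inf \<theta> Y"
  have L0: "L \<ge> 0" using C wb[of 0] by (simp add: L_def)
  have GL: "\<bar>G t - G u\<bar> \<le> L * \<bar>t - u\<bar>" if "0 \<le> u" "0 \<le> t" for u t
  proof (cases "u \<le> t")
    case True
    then show ?thesis using Gc[of u t "tail_inf \<theta> Y"] Gmono[of u t] that wb by (auto simp: L_def abs_le_iff)
  next
    case False
    then show ?thesis using Gc[of t u "tail_inf \<theta> Y"] Gmono[of t u] that wb by (auto simp: L_def abs_le_iff)
  qed
  have G0: "G 0 = 0"
  proof -
    have "(LINT s:{0..0}|lborel. w s) = 0" unfolding set_lebesgue_integral_def
      by (rule integral_eq_zero_AE) (use AE_lborel_singleton[of "0::real"] in eventually_elim, simp)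
    then show ?thesis by (simp add: G_def)
  qed
  have Gnn: "G u \<ge> 0" if "u \<ge> 0" for u using Gmono[of 0 u] that G0 by simp
  have Gcont: "continuous_on {0..} G"
  proof (rule lipschitz_on_continuous_on)
    show "L-lipschitz_on {0..} G" by (rule lipschitz_onI) (use GL L0 in \<open>auto simp: dist_real_def\<close>)
  qed
  \<comment> \<open>the growth of \<open>G\<close> over an interval is controlled by \<open>\<theta>\<close> at its final value\<close>
  have growth: "G t - G u \<le> C * \<theta> (G t) * (t - u)" if ut: "0 \<le> u" "u \<le> t" "t \<le> T" for u t
  proof (rule Gc[OF ut(1,2)])
    fix s assume s: "s \<in> {u<..t}"
    then have "y s \<le> G s" "G s \<le> G t" using ut by (auto intro!: yG Gmono)
    then show "w s \<le> \<theta> (G t)" unfolding w_def by (intro tail_inf_le y0) linarith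
  qed
  have "G T = 0"
  proof (rule ccontr)
    assume "G T \<noteq> 0"
    then have GT: "G T > 0" using Gnn[of T] T by simp
    have inv: "continuous_on {a..b} (\<lambda>z. 1 / \<theta> z)" if "a > 0" for a b
    proof (intro continuous_on_divide continuous_on_const continuous_on_subset[OF \<theta>_cont] ballI)
      fix z assume "z \<in> {a..b}"
      then show "\<theta> z \<noteq> 0" using \<theta>_pos[of z] that by simp
    qed (use that in auto)
    have bound: "integral {G u..G T} (\<lambda>z. 1 / \<theta> z) \<le> 4 * C * (T - u)" if u: "0 \<le> u" "u \<le> T" "G u > 0" for u
      using u(2)
    proof (rule Bolzano[where P = "\<lambda>p q. 0 < G p \<and> 0 \<le> p \<and> q \<le> T \<longrightarrow> integral {G p..G q} (\<lambda>z. 1 / \<theta> z) \<le> 4 * C * (q - p)", THEN mp])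
      fix p q r assume pq: "0 < G p \<and> 0 \<le> p \<and> q \<le> T \<longrightarrow> integral {G p..G q} (\<lambda>z. 1 / \<theta> z) \<le> 4 * C * (q - p)"
        and qr: "0 < G q \<and> 0 \<le> q \<and> r \<le> T \<longrightarrow> integral {G q..G r} (\<lambda>z. 1 / \<theta> z) \<le> 4 * C * (r - q)" and o: "p \<le> q" "q \<le> r"
      show "0 < G p \<and> 0 \<le> p \<and> r \<le> T \<longrightarrow> integral {G p..G r} (\<lambda>z. 1 / \<theta> z) \<le> 4 * C * (r - p)"
      proof
        assume h: "0 < G p \<and> 0 \<le> p \<and> r \<le> T"
        have m: "G p \<le> G q" "G q \<le> G r" using h o by (auto intro: Gmono)
        have "integral {G p..G r} (\<lambda>z. 1 / \<theta> z) = integral {G p..G q} (\<lambda>z. 1 / \<theta> z) + integral {G q..G r} (\<lambda>z. 1 / \<theta> z)"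
          using h by (intro Henstock_Kurzweil_Integration.integral_combine[symmetric] m integrable_continuous_interval inv) auto
        also have "\<dots> \<le> 4 * C * (q - p) + 4 * C * (r - q)"
          using pq qr h o m by (intro add_mono) auto
        finally show "integral {G p..G r} (\<lambda>z. 1 / \<theta> z) \<le> 4 * C * (r - p)" by (simp add: algebra_simps)
      qed
    next
      fix v assume v: "u \<le> v" "v \<le> T"
      have Gv: "G v > 0" using u v Gmono[of u v] by simp
      define \<theta>0 where "\<theta>0 = \<theta> (G v)"
      have \<theta>0: "\<theta>0 > 0" unfolding \<theta>0_def by (rule \<theta>_pos[OF Gv])
      obtain \<rho> where \<rho>: "\<rho> > 0" "\<And>z. z \<ge> 0 \<Longrightarrow> \<bar>z - G v\<bar> < \<rho> \<Longrightarrow> \<bar>\<theta> z - \<theta>0\<bar> < \<theta>0 / 2"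
        using \<theta>_cont Gv \<theta>0 unfolding continuous_on_iff dist_real_def \<theta>0_def
        by (metis atLeast_iff half_gt_zero less_imp_le)
      have \<rho>L: "\<rho> / (L + 1) > 0" using \<rho>(1) L0 by simp
      show "\<exists>d>0. \<forall>p q. p \<le> v \<and> v \<le> q \<and> q - p < d \<longrightarrow>
        (0 < G p \<and> 0 \<le> p \<and> q \<le> T \<longrightarrow> integral {G p..G q} (\<lambda>z. 1 / \<theta> z) \<le> 4 * C * (q - p))"
      proof (intro exI[of _ "\<rho> / (L + 1)"] conjI allI impI \<rho>L)
        fix p q assume pq: "p \<le> v \<and> v \<le> q \<and> q - p < \<rho> / (L + 1)" and h: "0 < G p \<and> 0 \<le> p \<and> q \<le> T"
        have near: "\<bar>G s - G v\<bar> < \<rho>" if "s \<in> {p..q}" for s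
        proof -
          have "\<bar>G s - G v\<bar> \<le> L * \<bar>s - v\<bar>" by (rule GL) (use that pq h in auto)
          also have "\<dots> \<le> (L + 1) * \<bar>s - v\<bar>" by (rule mult_right_mono) auto
          also have "\<dots> < (L + 1) * (\<rho> / (L + 1))" using that pq L0 by (intro mult_strict_left_mono) auto
          also have "\<dots> = \<rho>" using L0 by simp
          finally show ?thesis .
        qed
        have Gpq: "G p \<le> G q" using pq h by (intro Gmono) auto
        have \<theta>z: "\<bar>\<theta> z - \<theta>0\<bar> < \<theta>0 / 2" if z: "z \<in> {G p..G q}" for z
        proof (rule \<rho>(2))
          have "\<bar>G p - G v\<bar> < \<rho>" "\<bar>G q - G v\<bar> < \<rho>" using pq by (auto intro!: near)
          then show "\<bar>z - G v\<bar> < \<rho>" using z by auto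
        qed (use z h in auto)
        have \<theta>lo: "\<theta>0 / 2 \<le> \<theta> z" if "z \<in> {G p..G q}" for z
          using abs_less_iff[THEN iffD1, OF \<theta>z[OF that]] by (simp add: field_simps)
        have \<theta>hi: "\<theta> z \<le> 2 * \<theta>0" if "z \<in> {G p..G q}" for z
          using abs_less_iff[THEN iffD1, OF \<theta>z[OF that]] \<theta>0 by (simp add: field_simps)
        have "integral {G p..G q} (\<lambda>z. 1 / \<theta> z) \<le> integral {G p..G q} (\<lambda>z. 2 / \<theta>0)"
        proof (rule integral_le)
          show "(\<lambda>z. 1 / \<theta> z) integrable_on {G p..G q}" using h by (intro integrable_continuous_interval inv) auto
          fix z assume "z \<in> {G p..G q}"
          from \<theta>lo[OF this] have "1 / \<theta> z \<le> 1 / (\<theta>0 / 2)" using \<theta>0 by (intro divide_left_mono) auto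
          then show "1 / \<theta> z \<le> 2 / \<theta>0" by simp
        qed auto
        also have "\<dots> = 2 / \<theta>0 * (G q - G p)" using Gpq by simp
        also have "\<dots> \<le> 2 / \<theta>0 * (C * \<theta> (G q) * (q - p))"
          using \<theta>0 pq h by (intro mult_left_mono growth) auto
        also have "\<dots> \<le> 2 / \<theta>0 * (C * (2 * \<theta>0) * (q - p))"
          using \<theta>0 C pq Gpq \<theta>hi[of "G q"] by (intro mult_left_mono mult_right_mono) auto
        also have "\<dots> = 4 * C * (q - p)" using \<theta>0 by simp
        finally show "integral {G p..G q} (\<lambda>z. 1 / \<theta> z) \<le> 4 * C * (q - p)" .
      qed
    qed (use u in auto)
    have nnb: "(\<integral>\<^sup>+z\<in>{a..G T}. ennreal (1 / \<theta> z) \<partial>lborel) \<le> ennreal (4 * C * T)" if a: "a > 0" "a \<le> G T" for a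
    proof -
      obtain u where u: "u \<in> {0..T}" "G u = a"
        using IVT'[of G 0 a T] a T G0 continuous_on_subset[OF Gcont, of "{0..T}"] by auto
      have i: "set_integrable lborel {a..G T} (\<lambda>z. 1 / \<theta> z)" by (rule borel_integrable_atLeastAtMost'[OF inv[OF a(1)]])
      have "(\<integral>\<^sup>+z\<in>{a..G T}. ennreal (1 / \<theta> z) \<partial>lborel) = (\<integral>\<^sup>+z. ennreal (indicator {a..G T} z *\<^sub>R (1 / \<theta> z)) \<partial>lborel)"
        by (intro nn_integral_cong) (auto simp: indicator_def)
      also have "\<dots> = ennreal (LINT z:{a..G T}|lborel. 1 / \<theta> z)"
        unfolding set_lebesgue_integral_def
        by (rule nn_integral_eq_integral) (use i a \<theta>_pos in \<open>auto simp: set_integrable_def indicator_def less_imp_le\<close>)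
      also have "(LINT z:{a..G T}|lborel. 1 / \<theta> z) = integral {G u..G T} (\<lambda>z. 1 / \<theta> z)"
        using set_borel_integral_eq_integral(2)[OF i] u by simp
      also have "\<dots> \<le> 4 * C * T"
        using bound[of u] u a C by (auto intro!: order_trans[OF bound] mult_left_mono)
      finally show ?thesis by (simp add: ennreal_leI)
    qed
    define A where "A n = {G T / real (Suc n)..G T}" for n
    have inc: "incseq (\<lambda>n z. ennreal (1 / \<theta> z) * indicator (A n) z)"
    proof (intro incseq_SucI le_funI mult_left_mono)
      fix n z
      have "G T / real (Suc (Suc n)) \<le> G T / real (Suc n)" using GT by (intro divide_left_mono) auto
      then show "indicator (A n) z \<le> (indicator (A (Suc n)) z :: ennreal)"
        by (auto simp: A_def indicator_def simp del: of_nat_Suc)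
    qed auto
    have "(\<integral>\<^sup>+z\<in>{0<..G T}. ennreal (1 / \<theta> z) \<partial>lborel) = (\<integral>\<^sup>+z. (SUP n. ennreal (1 / \<theta> z) * indicator (A n) z) \<partial>lborel)"
    proof (rule nn_integral_cong)
      fix z
      show "ennreal (1 / \<theta> z) * indicator {0<..G T} z = (SUP n. ennreal (1 / \<theta> z) * indicator (A n) z)"
      proof (cases "z \<in> {0<..G T}")
        case True
        obtain n where n: "inverse (real (Suc n)) < z / G T" using reals_Archimedean[of "z / G T"] True GT by auto
        then have "G T / real (Suc n) \<le> z" using GT by (simp add: field_simps del: of_nat_Suc)
        then have zA: "z \<in> A n" using True by (simp add: A_def)
        have "(SUP n. ennreal (1 / \<theta> z) * indicator (A n) z) = ennreal (1 / \<theta> z)"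
        proof (rule antisym)
          show "(SUP n. ennreal (1 / \<theta> z) * indicator (A n) z) \<le> ennreal (1 / \<theta> z)"
            by (intro SUP_least) (auto simp: indicator_def)
          show "ennreal (1 / \<theta> z) \<le> (SUP n. ennreal (1 / \<theta> z) * indicator (A n) z)"
            by (rule SUP_upper2[of n]) (use zA in auto)
        qed
        then show ?thesis using True by simp
      next
        case False
        have "z \<notin> A n" for n
        proof
          assume "z \<in> A n"
          then have "G T / real (Suc n) \<le> z" "z \<le> G T" by (auto simp: A_def)
          moreover have "G T / real (Suc n) > 0" using GT by simp
          ultimately show False using False by simp
        qed
        then show ?thesis using False by simp
      qed
    qed
    also have "\<dots> = (SUP n. \<integral>\<^sup>+z. ennreal (1 / \<theta> z) * indicator (A n) z \<partial>lborel)"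
    proof (rule nn_integral_monotone_convergence_SUP[OF inc])
      fix n
      have p: "G T / real (Suc n) > 0" using GT by simp
      have "(\<lambda>z. indicator (A n) z *\<^sub>R (1 / \<theta> z)) \<in> borel_measurable lborel"
        using borel_integrable_atLeastAtMost'[OF inv[OF p], of "G T"]
        by (auto simp: set_integrable_def A_def dest: borel_measurable_integrable)
      then have "(\<lambda>z. ennreal (indicator (A n) z *\<^sub>R (1 / \<theta> z))) \<in> borel_measurable lborel" by measurable
      then show "(\<lambda>z. ennreal (1 / \<theta> z) * indicator (A n) z) \<in> borel_measurable lborel"
        by (rule measurable_cong[THEN iffD1, rotated]) (auto simp: indicator_def)
    qed
    also have "\<dots> \<le> ennreal (4 * C * T)"
      unfolding A_def using GT by (intro SUP_least nnb) (auto simp: field_simps)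
    finally show False using osgood[OF GT] by (simp add: top_unique)
  qed
  then have "G t = 0" using Gmono[of t T] Gnn[of t] t by simp
  then show ?thesis using yG[OF t] y0[of t] by simp
qed

end

section \<open>Comparison of two drifts\<close>

lemma clamped_path_bounded:
  fixes X :: "real \<Rightarrow> real"
  assumes t: "t > 0" and X: "continuous_on {0..t} X"
  shows "(\<lambda>s. X (max 0 (min t s))) \<in> borel_measurable borel" "\<exists>R. \<forall>s\<in>{0..t}. \<bar>X s\<bar> \<le> R"
proof -
  have "continuous_on UNIV (\<lambda>s. X (max 0 (min t s)))"
    using t by (intro continuous_on_compose2[OF X] continuous_intros) auto
  then show "(\<lambda>s. X (max 0 (min t s))) \<in> borel_measurable borel" by (rule borel_measurable_continuous_onI)
  have "bounded (X ` {0..t})" by (intro compact_imp_bounded compact_continuous_image X) simp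
  then show "\<exists>R. \<forall>s\<in>{0..t}. \<bar>X s\<bar> \<le> R" by (auto simp: bounded_iff)
qed

lemma drift_along_path_integrable:
  fixes X :: "real \<Rightarrow> real"
  assumes t: "t > 0" and X: "continuous_on {0..t} X"
    and \<beta>: "(\<lambda>(s, y). \<beta> s y) \<in> borel_measurable (borel \<Otimes>\<^sub>M borel)"
    and C: "C \<ge> 0" and growth: "\<And>s y. s \<in> {0..t} \<Longrightarrow> \<bar>\<beta> s y\<bar> \<le> C * (1 + \<bar>y\<bar>)" and u: "u \<in> {0..t}"
  shows "set_integrable lborel {0..u} (\<lambda>s. \<beta> s (X s) :: real)"
proof -
  let ?c = "\<lambda>s. max 0 (min t s)"
  obtain R where R: "\<forall>s\<in>{0..t}. \<bar>X s\<bar> \<le> R" using clamped_path_bounded(2)[OF t X] by blast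
  have m: "(\<lambda>s. \<beta> s (X (?c s))) \<in> borel_measurable borel"
    using measurable_compose[OF measurable_Pair[OF measurable_ident_sets[OF refl] clamped_path_bounded(1)[OF t X]] \<beta>] by simp
  have b: "\<bar>\<beta> s (X (?c s))\<bar> \<le> C * (1 + R)" if "s \<in> {0..u}" for s
  proof -
    have s: "s \<in> {0..t}" "?c s = s" using that u by auto
    have "\<bar>\<beta> s (X s)\<bar> \<le> C * (1 + \<bar>X s\<bar>)" by (rule growth[OF s(1)])
    also have "\<dots> \<le> C * (1 + R)" using R s(1) C by (intro mult_left_mono) auto
    finally show ?thesis unfolding s(2) .
  qed
  have "set_integrable lborel {0..u} (\<lambda>s. \<beta> s (X (?c s)))"
    by (rule set_integrable_bounded[where a = 0 and b = u, OF m _ _ b]) auto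
  moreover have "set_integrable lborel {0..u} (\<lambda>s. \<beta> s (X (?c s))) = set_integrable lborel {0..u} (\<lambda>s. \<beta> s (X s))"
  proof (rule set_integrable_cong)
    fix s assume "s \<in> {0..u}"
    then have "?c s = s" using u by auto
    then show "\<beta> s (X (?c s)) = \<beta> s (X s)" by (simp only:)
  qed auto
  ultimately show ?thesis by (simp only:)
qed

text \<open>The two drifts may be unbounded, but only their difference along the path has to be removed, and this is
  a bounded functional of the path.\<close>

lemma change_of_drift:
  fixes X :: "real \<Rightarrow> 'a \<Rightarrow> real" and D :: "real \<Rightarrow> real"
  assumes sol: "sde_solution t \<beta> x M F B X"
    and \<beta> [measurable]: "(\<lambda>(s, y). \<beta> s y) \<in> borel_measurable (borel \<Otimes>\<^sub>M borel)"
    and \<beta>' [measurable]: "(\<lambda>(s, y). \<beta>' s y) \<in> borel_measurable (borel \<Otimes>\<^sub>M borel)"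
    and C: "C \<ge> 0" and growth: "\<And>s y. s \<in> {0..t} \<Longrightarrow> \<bar>\<beta> s y\<bar> \<le> C * (1 + \<bar>y\<bar>)"
    and growth': "\<And>s y. s \<in> {0..t} \<Longrightarrow> \<bar>\<beta>' s y\<bar> \<le> C * (1 + \<bar>y\<bar>)"
    and D: "D \<in> borel_measurable borel" "\<And>s. \<bar>D s\<bar> \<le> K"
    and diff: "\<And>s y. s \<in> {0..t} \<Longrightarrow> \<bar>\<beta>' s y - \<beta> s y\<bar> \<le> D s"
  obtains Z B' where "Z \<in> borel_measurable M" "\<And>\<omega>. Z \<omega> > 0" "integrable M Z" "(LINT \<omega>|M. Z \<omega>) = 1"
    "(\<integral>\<^sup>+\<omega>. ennreal ((Z \<omega>)\<^sup>2) \<partial>M) \<le> ennreal (exp (LINT s:{0..t}|lborel. (D s)\<^sup>2))"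
    "sde_solution t \<beta>' x (density M (\<lambda>\<omega>. ennreal (Z \<omega>))) F B' X"
proof -
  have bm: "dyadic_bm M t F B" and Xa: "continuous_adapted t M F X"
    and eq: "AE \<omega> in M. \<forall>u\<in>{0..t}. X u \<omega> = x + (LINT s:{0..u}|lborel. \<beta> s (X s \<omega>)) + B u \<omega>"
    using sol by (auto simp: sde_solution_def)
  have t: "t > 0" using bm by (simp add: dyadic_bm_def dyadic_bm_axioms_def)
  have Xc: "continuous_on {0..t} (\<lambda>u. X u \<omega>)" if "\<omega> \<in> space M" for \<omega>
    using Xa that by (simp add: continuous_adapted_def)
  have K0: "K \<ge> 0" using D(2)[of 0] by linarith
  let ?c = "\<lambda>s. max 0 (min t s)"
  define g :: "real \<Rightarrow> (real \<Rightarrow> real) \<Rightarrow> real" where "g s w = (if s \<in> {0..t} then \<beta>' s (w s) - \<beta> s (w s) else 0)" for s w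
  have pd: "path_drift t K g"
  proof
    show "t > 0" by fact
    let ?N = "borel \<Otimes>\<^sub>M path_space t"
    have e [measurable]: "(\<lambda>p. snd p (?c (fst p))) \<in> borel_measurable ?N"
      by (rule eval_joint_measurable[OF t _ _ measurable_snd]) (use t in auto)
    have "(\<lambda>p. if fst p \<in> {0..t} then \<beta>' (fst p) (snd p (?c (fst p))) - \<beta> (fst p) (snd p (?c (fst p))) else 0) \<in> borel_measurable ?N"
      by measurable
    moreover have "(\<lambda>p. if fst p \<in> {0..t} then \<beta>' (fst p) (snd p (?c (fst p))) - \<beta> (fst p) (snd p (?c (fst p))) else 0) = (\<lambda>(s, w). g s w)"
      by (auto simp: fun_eq_iff g_def min_def max_def)
    ultimately show "(\<lambda>(s, w). g s w) \<in> borel_measurable ?N" by (simp only:)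
    show "\<bar>g s w\<bar> \<le> K" for s w
      using diff[of s "w s"] D(2)[of s] K0 by (auto simp: g_def)
    show "g s w = g s w'" if "s \<in> {0..t}" "\<And>u. u \<in> {0..s} \<Longrightarrow> w u = w' u" for s w w'
      using that(2)[of s] that(1) by (simp add: g_def)
  qed
  let ?\<gamma> = "\<lambda>s \<omega>. g s (path_of t X \<omega>)"
  have bd: "bounded_drift M t F B ?\<gamma> K" by (rule path_drift.bounded_drift[OF pd bm Xa])
  interpret bounded_drift M t F B ?\<gamma> K by (rule bd)
  obtain r where r: "strict_mono r" "\<And>j. err (r j) \<le> ennreal ((1 / 4) ^ j)"
    by (rule common_subsequence[OF err_tendsto err_tendsto]) blast
  have \<gamma>D: "\<bar>?\<gamma> s \<omega>\<bar> \<le> D s" if "\<omega> \<in> space M" "s \<in> {0..t}" for s \<omega>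
    using diff[OF that(2), of "path_of t X \<omega> s"] that(2) by (simp add: g_def)
  have drift: "drift u \<omega> = (LINT s:{0..u}|lborel. \<beta>' s (X s \<omega>)) - (LINT s:{0..u}|lborel. \<beta> s (X s \<omega>))"
    if w: "\<omega> \<in> space M" and u: "u \<in> {0..t}" for u \<omega>
  proof -
    have "drift u \<omega> = (LINT s:{0..u}|lborel. \<beta>' s (X s \<omega>) - \<beta> s (X s \<omega>))"
      unfolding drift_def
    proof (rule set_lebesgue_integral_cong)
      show "\<forall>s. s \<in> {0..u} \<longrightarrow> ?\<gamma> s \<omega> = \<beta>' s (X s \<omega>) - \<beta> s (X s \<omega>)"
        using u by (auto simp: g_def path_of_apply)
    qed simp
    also have "\<dots> = (LINT s:{0..u}|lborel. \<beta>' s (X s \<omega>)) - (LINT s:{0..u}|lborel. \<beta> s (X s \<omega>))"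
      by (intro set_integral_diff(2) drift_along_path_integrable[OF t Xc[OF w] _ C _ u] \<beta> \<beta>' growth growth')
    finally show ?thesis .
  qed
  have sol': "sde_solution t \<beta>' x (density M (\<lambda>\<omega>. ennreal (dens r \<omega>))) F (\<lambda>u \<omega>. B u \<omega> - drift u \<omega>) X"
    unfolding sde_solution_def
  proof (intro conjI girsanov[OF r])
    show "continuous_adapted t (density M (\<lambda>\<omega>. ennreal (dens r \<omega>))) F X"
      using Xa by (simp add: continuous_adapted_def)
    have "AE \<omega> in M. \<forall>u\<in>{0..t}. X u \<omega> = x + (LINT s:{0..u}|lborel. \<beta>' s (X s \<omega>)) + (B u \<omega> - drift u \<omega>)"
      using eq AE_space by eventually_elim (simp add: drift)
    then show "AE \<omega> in density M (\<lambda>\<omega>. ennreal (dens r \<omega>)). \<forall>u\<in>{0..t}. X u \<omega> = x + (LINT s:{0..u}|lborel. \<beta>' s (X s \<omega>)) + (B u \<omega> - drift u \<omega>)"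
      by (subst AE_density) (auto elim: eventually_mono)
  qed
  show ?thesis
    by (rule that[OF dens_measurable dens_pos dens_integrable[OF r] dens_integral_1[OF r] dens_second_moment[OF r D \<gamma>D] sol'])
qed

lemma integral_mult_le_L2:
  fixes U V :: "'a \<Rightarrow> real"
  assumes [measurable]: "U \<in> borel_measurable M" "V \<in> borel_measurable M"
    and U: "(\<integral>\<^sup>+\<omega>. ennreal ((U \<omega>)\<^sup>2) \<partial>M) \<le> ennreal a" and V: "(\<integral>\<^sup>+\<omega>. ennreal ((V \<omega>)\<^sup>2) \<partial>M) \<le> ennreal c"
    and "a \<ge> 0" "c \<ge> 0"
  shows "integrable M (\<lambda>\<omega>. U \<omega> * V \<omega>)" "\<bar>LINT \<omega>|M. U \<omega> * V \<omega>\<bar> \<le> sqrt (a * c)"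
proof -
  let ?I = "\<integral>\<^sup>+\<omega>. ennreal \<bar>U \<omega> * V \<omega>\<bar> \<partial>M"
  have "?I\<^sup>2 = (\<integral>\<^sup>+\<omega>. ennreal \<bar>U \<omega>\<bar> * ennreal \<bar>V \<omega>\<bar> \<partial>M)\<^sup>2" by (simp add: abs_mult ennreal_mult)
  also have "\<dots> \<le> (\<integral>\<^sup>+\<omega>. (ennreal \<bar>U \<omega>\<bar>)\<^sup>2 \<partial>M) * (\<integral>\<^sup>+\<omega>. (ennreal \<bar>V \<omega>\<bar>)\<^sup>2 \<partial>M)"
    by (rule Cauchy_Schwarz_nn_integral) measurable
  also have "\<dots> \<le> ennreal a * ennreal c" using U V by (intro mult_mono) (auto simp: ennreal_power)
  also have "\<dots> = (ennreal (sqrt (a * c)))\<^sup>2" using assms by (simp add: ennreal_power ennreal_mult)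
  finally have sq: "?I\<^sup>2 \<le> (ennreal (sqrt (a * c)))\<^sup>2" .
  have I: "?I \<le> ennreal (sqrt (a * c))"
  proof (cases ?I)
    case (real v)
    have "ennreal (v\<^sup>2) \<le> ennreal ((sqrt (a * c))\<^sup>2)" using sq real assms by (simp add: ennreal_power)
    then have "v\<^sup>2 \<le> (sqrt (a * c))\<^sup>2" by (subst (asm) ennreal_le_iff) auto
    then have "v \<le> sqrt (a * c)" by (rule power2_le_imp_le) (use assms in auto)
    then show ?thesis unfolding real(2) by (rule ennreal_leI)
  next
    case top
    then show ?thesis using sq assms by (simp add: ennreal_power top_unique)
  qed
  then show i: "integrable M (\<lambda>\<omega>. U \<omega> * V \<omega>)"
    by (intro integrableI_bounded) (auto elim: order_le_less_trans)
  have "ennreal (LINT \<omega>|M. \<bar>U \<omega> * V \<omega>\<bar>) = ?I"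
    using i by (intro nn_integral_eq_integral[symmetric]) auto
  then have "(LINT \<omega>|M. \<bar>U \<omega> * V \<omega>\<bar>) \<le> sqrt (a * c)"
    using I assms by (metis ennreal_le_iff mult_nonneg_nonneg real_sqrt_ge_zero)
  then show "\<bar>LINT \<omega>|M. U \<omega> * V \<omega>\<bar> \<le> sqrt (a * c)"
    using integral_abs_bound[of M "\<lambda>\<omega>. U \<omega> * V \<omega>"] by linarith
qed

text \<open>As \<open>Z\<close> has mean one, \<open>h\<close> may be replaced by \<open>h - h x\<close>, and the mean of \<open>(Z - 1)\<^sup>2\<close> is the second moment of \<open>Z\<close>
  minus one.\<close>

lemma lipschitz_expectation_difference:
  fixes X1 :: "real \<Rightarrow> 'a \<Rightarrow> real" and X2 :: "real \<Rightarrow> 'b \<Rightarrow> real" and D h :: "real \<Rightarrow> real"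
  assumes sol1: "sde_solution t \<beta>1 x M1 F1 B1 X1" and sol2: "sde_solution t \<beta>2 x M2 F2 B2 X2"
    and \<beta>1: "(\<lambda>(s, y). \<beta>1 s y) \<in> borel_measurable (borel \<Otimes>\<^sub>M borel)"
    and \<beta>2: "(\<lambda>(s, y). \<beta>2 s y) \<in> borel_measurable (borel \<Otimes>\<^sub>M borel)"
    and C: "C \<ge> 0" and growth1: "\<And>s y. s \<in> {0..t} \<Longrightarrow> \<bar>\<beta>1 s y\<bar> \<le> C * (1 + \<bar>y\<bar>)"
    and growth2: "\<And>s y. s \<in> {0..t} \<Longrightarrow> \<bar>\<beta>2 s y\<bar> \<le> C * (1 + \<bar>y\<bar>)"
    and D: "D \<in> borel_measurable borel" "\<And>s. \<bar>D s\<bar> \<le> K"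
    and diff: "\<And>s y. s \<in> {0..t} \<Longrightarrow> \<bar>\<beta>1 s y - \<beta>2 s y\<bar> \<le> D s"
    and c: "c \<ge> 0" "(\<integral>\<^sup>+\<omega>. ennreal ((X2 t \<omega> - x)\<^sup>2) \<partial>M2) \<le> ennreal c"
    and h: "1-lipschitz_on UNIV h"
  shows "\<bar>(LINT \<omega>|M1. h (X1 t \<omega>)) - (LINT \<omega>|M2. h (X2 t \<omega>))\<bar> \<le> sqrt ((exp (LINT s:{0..t}|lborel. (D s)\<^sup>2) - 1) * c)"
proof -
  have bm: "dyadic_bm M1 t F1 B1" "dyadic_bm M2 t F2 B2" and Xa: "continuous_adapted t M1 F1 X1" "continuous_adapted t M2 F2 X2"
    using sol1 sol2 by (auto simp: sde_solution_def)
  interpret S1: dyadic_bm M1 t F1 B1 by (rule bm)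
  interpret S2: dyadic_bm M2 t F2 B2 by (rule bm)
  have t: "t > 0" by (rule S1.T_pos)
  then have tt: "t \<in> {0..t}" by simp
  define E where "E = exp (LINT s:{0..t}|lborel. (D s)\<^sup>2)"
  obtain Z B' where Zm [measurable]: "Z \<in> borel_measurable M2" and Z0: "\<And>\<omega>. Z \<omega> > 0" and Zi: "integrable M2 Z" and Z1: "(LINT \<omega>|M2. Z \<omega>) = 1"
    and Z2: "(\<integral>\<^sup>+\<omega>. ennreal ((Z \<omega>)\<^sup>2) \<partial>M2) \<le> ennreal E"
    and sol': "sde_solution t \<beta>1 x (density M2 (\<lambda>\<omega>. ennreal (Z \<omega>))) F2 B' X2"
    unfolding E_def
    by (rule change_of_drift[OF sol2 \<beta>2 \<beta>1 C growth2 growth1 D diff]) (assumption | blast)+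
  let ?Q = "density M2 (\<lambda>\<omega>. ennreal (Z \<omega>))"
  have [measurable]: "h \<in> borel_measurable borel" by (rule lipschitz_borel[OF h])
  have path: "path_law t M1 X1 = path_law t ?Q X2" by (rule sde_law_unique[OF sol1 sol' \<beta>1 C]) (rule growth1)
  have p1 [measurable]: "path_of t X1 \<in> M1 \<rightarrow>\<^sub>M path_space t"
    using Xa(1) by (intro path_of_measurable t S1.F_measurable_M) (auto simp: continuous_adapted_def)
  have p2 [measurable]: "path_of t X2 \<in> M2 \<rightarrow>\<^sub>M path_space t"
    using Xa(2) by (intro path_of_measurable t S2.F_measurable_M) (auto simp: continuous_adapted_def)
  have [measurable]: "X2 t \<in> borel_measurable M2"
    using Xa(2) tt by (intro S2.F_measurable_M) (auto simp: continuous_adapted_def)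
  have ev [measurable]: "(\<lambda>w. h (w t)) \<in> borel_measurable (path_space t)"
    by (rule measurable_compose[OF eval_measurable_path[OF t tt]]) measurable
  have "(LINT \<omega>|M1. h (X1 t \<omega>)) = (LINT w|path_law t M1 X1. h (w t))"
    unfolding path_law_def by (subst integral_distr[OF p1 ev]) (simp only: path_of_apply[OF tt])
  also have "\<dots> = (LINT \<omega>|?Q. h (X2 t \<omega>))"
    unfolding path unfolding path_law_def by (subst integral_distr[OF _ ev]) (simp, simp only: path_of_apply[OF tt])
  also have "\<dots> = (LINT \<omega>|M2. Z \<omega> * h (X2 t \<omega>))"
    using Z0 by (subst integral_density) (auto intro: less_imp_le)
  finally have eq: "(LINT \<omega>|M1. h (X1 t \<omega>)) = (LINT \<omega>|M2. Z \<omega> * h (X2 t \<omega>))" .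
  define Y where "Y \<omega> = h (X2 t \<omega>) - h x" for \<omega>
  have Ym [measurable]: "Y \<in> borel_measurable M2" unfolding Y_def by measurable
  have Y2: "(\<integral>\<^sup>+\<omega>. ennreal ((Y \<omega>)\<^sup>2) \<partial>M2) \<le> ennreal c"
  proof -
    have "\<bar>Y \<omega>\<bar> \<le> \<bar>X2 t \<omega> - x\<bar>" for \<omega> using lipschitz_onD[OF h, of "X2 t \<omega>" x] by (simp add: Y_def dist_real_def)
    then have "(\<integral>\<^sup>+\<omega>. ennreal ((Y \<omega>)\<^sup>2) \<partial>M2) \<le> (\<integral>\<^sup>+\<omega>. ennreal ((X2 t \<omega> - x)\<^sup>2) \<partial>M2)"
      by (intro nn_integral_mono ennreal_leI) (simp add: abs_le_square_iff)
    then show ?thesis using c(2) by simp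
  qed
  have Zs: "integrable M2 (\<lambda>\<omega>. (Z \<omega>)\<^sup>2)" by (rule integrable_of_square(2)[OF S2.prob_space_axioms Zm Z2])
  have Yi: "integrable M2 Y" by (rule integrable_of_square(1)[OF S2.prob_space_axioms Ym Y2])
  have E0: "E > 0" by (simp add: E_def)
  have W: "integrable M2 (\<lambda>\<omega>. (Z \<omega> - 1)\<^sup>2)" "(LINT \<omega>|M2. (Z \<omega> - 1)\<^sup>2) = (LINT \<omega>|M2. (Z \<omega>)\<^sup>2) - 1"
    using Zs Zi Z1 by (simp_all add: power2_diff S2.prob_space)
  have "ennreal (LINT \<omega>|M2. (Z \<omega>)\<^sup>2) = (\<integral>\<^sup>+\<omega>. ennreal ((Z \<omega>)\<^sup>2) \<partial>M2)"
    using Zs by (intro nn_integral_eq_integral[symmetric]) auto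
  then have "ennreal (LINT \<omega>|M2. (Z \<omega>)\<^sup>2) \<le> ennreal E" using Z2 by simp
  then have ZE: "(LINT \<omega>|M2. (Z \<omega>)\<^sup>2) \<le> E" using E0 by (subst (asm) ennreal_le_iff) auto
  have W2: "(\<integral>\<^sup>+\<omega>. ennreal ((Z \<omega> - 1)\<^sup>2) \<partial>M2) \<le> ennreal (E - 1)"
    using W ZE by (subst nn_integral_eq_integral) (auto intro: ennreal_leI)
  have "0 \<le> (LINT \<omega>|M2. (Z \<omega> - 1)\<^sup>2)" by simp
  then have E1: "E - 1 \<ge> 0" using W(2) ZE by linarith
  have WY: "integrable M2 (\<lambda>\<omega>. (Z \<omega> - 1) * Y \<omega>)" "\<bar>LINT \<omega>|M2. (Z \<omega> - 1) * Y \<omega>\<bar> \<le> sqrt ((E - 1) * c)"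
    by (rule integral_mult_le_L2[OF _ Ym W2 Y2 E1 c(1)]; measurable)+
  have "(LINT \<omega>|M2. Z \<omega> * h (X2 t \<omega>)) = (LINT \<omega>|M2. ((Z \<omega> - 1) * Y \<omega> + Y \<omega>) + h x * Z \<omega>)"
    by (intro Bochner_Integration.integral_cong) (auto simp: Y_def algebra_simps)
  also have "\<dots> = (LINT \<omega>|M2. (Z \<omega> - 1) * Y \<omega>) + ((LINT \<omega>|M2. Y \<omega>) + h x)"
    using WY(1) Yi Zi Z1 by simp
  also have "(LINT \<omega>|M2. Y \<omega>) + h x = (LINT \<omega>|M2. h (X2 t \<omega>))"
  proof -
    have "(LINT \<omega>|M2. h (X2 t \<omega>)) = (LINT \<omega>|M2. Y \<omega> + h x)" by (simp add: Y_def)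
    then show ?thesis using Yi by (simp add: S2.prob_space)
  qed
  finally show ?thesis using WY(2) unfolding eq E_def by simp
qed

section \<open>Coincidence of the marginal laws\<close>

locale solution_pair =
  S1: growth_solution T C x b M1 F1 B1 X1 + S2: growth_solution T C x b M2 F2 B2 X2
  for T C x :: real and b :: "real \<Rightarrow> real \<Rightarrow> real measure \<Rightarrow> real"
    and M1 :: "'a measure" and F1 :: "real \<Rightarrow> 'a measure" and B1 X1 :: "real \<Rightarrow> 'a \<Rightarrow> real"
    and M2 :: "'b measure" and F2 :: "real \<Rightarrow> 'b measure" and B2 X2 :: "real \<Rightarrow> 'b \<Rightarrow> real" +
  fixes \<theta> :: "real \<Rightarrow> real"
  assumes b_meas: "(\<lambda>(t, y, \<mu>). b t y \<mu>) \<in> borel_measurable (restrict_space borel {0..T} \<Otimes>\<^sub>M borel \<Otimes>\<^sub>M borel_P1)"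
    and \<theta>_cont: "continuous_on {0..} \<theta>" and \<theta>_nonneg: "\<And>y. y \<ge> 0 \<Longrightarrow> \<theta> y \<ge> 0"
    and modulus: "\<And>t y \<mu> \<nu>. t \<in> {0..T} \<Longrightarrow> \<mu> \<in> P1 \<Longrightarrow> \<nu> \<in> P1 \<Longrightarrow>
      \<bar>b t y \<mu> - b t y \<nu>\<bar>\<^sup>2 \<le> \<theta> ((kantorovich \<mu> \<nu>)\<^sup>2)"
begin

lemma beta_measurable:
  "(\<lambda>(s, y). S1.beta s y) \<in> borel_measurable (borel \<Otimes>\<^sub>M borel)"
  "(\<lambda>(s, y). S2.beta s y) \<in> borel_measurable (borel \<Otimes>\<^sub>M borel)"
  unfolding S1.beta_def S2.beta_def
  by (rule flow_drift_measurable[OF S1.T b_meas S1.law_measurable] flow_drift_measurable[OF S1.T b_meas S2.law_measurable])+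

definition gap :: "real \<Rightarrow> real" where
  "gap s = kantorovich (S1.law s) (S2.law s)"

lemma gap_nonneg: "gap s \<ge> 0"
  unfolding gap_def by (rule Metric_space.nonneg[OF Metric_space_P1])

lemma gap_continuous: "continuous_on {0..T} gap"
proof -
  interpret MS: Metric_space P1 kantorovich by (rule Metric_space_P1)
  show ?thesis unfolding continuous_on_iff
  proof (intro ballI allI impI)
    fix s e :: real assume s: "s \<in> {0..T}" and "e > 0"
    then have e: "e / 2 > 0" by simp
    obtain d1 where d1: "d1 > 0" "\<forall>t\<in>{0..T}. \<bar>t - s\<bar> < d1 \<longrightarrow> kantorovich (S1.law s) (S1.law t) < e / 2"
      using S1.law_continuous[OF s e] by blast
    obtain d2 where d2: "d2 > 0" "\<forall>t\<in>{0..T}. \<bar>t - s\<bar> < d2 \<longrightarrow> kantorovich (S2.law s) (S2.law t) < e / 2"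
      using S2.law_continuous[OF s e] by blast
    show "\<exists>d>0. \<forall>t\<in>{0..T}. dist t s < d \<longrightarrow> dist (gap t) (gap s) < e"
    proof (intro exI[of _ "min d1 d2"] conjI ballI impI)
      fix t assume t: "t \<in> {0..T}" and "dist t s < min d1 d2"
      then have k: "kantorovich (S1.law s) (S1.law t) < e / 2" "kantorovich (S2.law s) (S2.law t) < e / 2"
        using d1(2) d2(2) by (simp_all add: dist_real_def)
      note P = S1.law_P1[OF s] S1.law_P1[OF t] S2.law_P1[OF s] S2.law_P1[OF t]
      have "kantorovich (S1.law t) (S2.law t) \<le> kantorovich (S1.law t) (S1.law s) + kantorovich (S1.law s) (S2.law t)"
        "kantorovich (S1.law s) (S2.law t) \<le> kantorovich (S1.law s) (S2.law s) + kantorovich (S2.law s) (S2.law t)"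
        "kantorovich (S1.law s) (S2.law s) \<le> kantorovich (S1.law s) (S1.law t) + kantorovich (S1.law t) (S2.law s)"
        "kantorovich (S1.law t) (S2.law s) \<le> kantorovich (S1.law t) (S2.law t) + kantorovich (S2.law t) (S2.law s)"
        by (rule MS.triangle; rule P)+
      moreover have "kantorovich (S1.law t) (S1.law s) = kantorovich (S1.law s) (S1.law t)"
        "kantorovich (S2.law t) (S2.law s) = kantorovich (S2.law s) (S2.law t)" by (rule MS.commute)+
      ultimately have "\<bar>gap t - gap s\<bar> < e" using k unfolding gap_def by linarith
      then show "dist (gap t) (gap s) < e" by (simp only: dist_real_def)
    qed (use d1(1) d2(1) in simp)
  qed
qed

text \<open>Time is clamped to the interval, which makes the squared distance bounded and measurable on the whole
  line.\<close>

definition gap2 :: "real \<Rightarrow> real" where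
  "gap2 s = (gap (max 0 (min T s)))\<^sup>2"

lemma gap2_measurable: "gap2 \<in> borel_measurable borel"
  unfolding gap2_def[abs_def] using clamped_path_bounded(1)[OF S1.T gap_continuous] by measurable

lemma gap2_nonneg: "gap2 s \<ge> 0"
  by (simp add: gap2_def)

lemma gap2_eq: "s \<in> {0..T} \<Longrightarrow> gap2 s = (gap s)\<^sup>2"
  by (auto simp: gap2_def max_def min_def)

lemma gap2_bounded: "\<exists>Y. \<forall>s. gap2 s \<le> Y"
proof -
  obtain R where R: "\<forall>s\<in>{0..T}. \<bar>gap s\<bar> \<le> R" using clamped_path_bounded(2)[OF S1.T gap_continuous] by blast
  have "gap2 s \<le> R\<^sup>2" for s
  proof -
    have "max 0 (min T s) \<in> {0..T}" using S1.T by auto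
    then have "\<bar>gap (max 0 (min T s))\<bar> \<le> R" using R by blast
    from power_mono[OF this abs_ge_zero, of 2] show ?thesis by (simp add: gap2_def)
  qed
  then show ?thesis by blast
qed

lemma beta_difference:
  assumes s: "s \<in> {0..T}"
  shows "\<bar>S1.beta s y - S2.beta s y\<bar> \<le> 2 * sqrt (tail_inf \<theta> (gap2 s))"
proof -
  have eq: "S1.beta s y - S2.beta s y = b s y (S1.law s) - b s y (S2.law s)"
    using s unfolding S1.beta_def S2.beta_def by (simp only: if_True)
  have "(b s y (S1.law s) - b s y (S2.law s))\<^sup>2 / 4 \<le> tail_inf \<theta> (gap2 s)"
  proof (rule le_tail_inf[OF \<theta>_cont \<theta>_nonneg])
    fix z assume z: "z \<ge> gap2 s"
    have "(kantorovich (S1.law s) (S2.law s))\<^sup>2 \<le> z" using z gap2_eq[OF s] by (simp only: gap_def)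
    from modulus_at_larger_distance[OF S1.law_P1[OF s] S2.law_P1[OF s] \<theta>_cont \<theta>_nonneg modulus[OF s] this, of y]
    show "(b s y (S1.law s) - b s y (S2.law s))\<^sup>2 / 4 \<le> \<theta> z" by simp
  qed
  then have "(S1.beta s y - S2.beta s y)\<^sup>2 \<le> 4 * tail_inf \<theta> (gap2 s)" unfolding eq by simp
  then have "\<bar>S1.beta s y - S2.beta s y\<bar> \<le> sqrt (4 * tail_inf \<theta> (gap2 s))" by (simp add: real_le_rsqrt)
  then show ?thesis by (simp add: real_sqrt_mult)
qed

text \<open>The exponent \<open>I\<close> in the bound on the second moment of the density is bounded, so that \<open>exp I - 1 \<le> I exp I\<close>
  is at most a constant times \<open>I\<close>.\<close>

lemma gap2_integral_inequality:
  "\<exists>c\<ge>0. \<forall>t\<in>{0<..T}. gap2 t \<le> c * (LINT s:{0..t}|lborel. tail_inf \<theta> (gap2 s))"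
proof -
  obtain c where c: "c \<ge> 0" "\<forall>t\<in>{0..T}. (\<integral>\<^sup>+\<omega>. ennreal ((X2 t \<omega> - x)\<^sup>2) \<partial>M2) \<le> ennreal c"
    using S2.second_moment by blast
  obtain Y where Y: "\<forall>s. gap2 s \<le> Y" using gap2_bounded by blast
  define w where "w s = tail_inf \<theta> (gap2 s)" for s
  have wm [measurable]: "w \<in> borel_measurable borel"
    unfolding w_def[abs_def] by (rule tail_inf_measurable[OF \<theta>_cont \<theta>_nonneg gap2_measurable gap2_nonneg])
  have w0: "w s \<ge> 0" for s unfolding w_def by (rule tail_inf_nonneg[OF \<theta>_cont \<theta>_nonneg gap2_nonneg])
  define W where "W = tail_inf \<theta> Y"
  have wW: "w s \<le> W" for s
    unfolding w_def W_def by (rule tail_inf_mono[OF \<theta>_cont \<theta>_nonneg gap2_nonneg]) (use Y in auto)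
  have W0: "W \<ge> 0" using w0[of 0] wW[of 0] by linarith
  define D where "D s = 2 * sqrt (w s)" for s
  have Dm: "D \<in> borel_measurable borel" unfolding D_def[abs_def] by measurable
  have Db: "\<bar>D s\<bar> \<le> 2 * sqrt W" for s using w0[of s] wW[of s] by (simp add: D_def)
  define A where "A = C * (1 + max S1.mean_bound S2.mean_bound)"
  have A0: "A \<ge> 0" using S1.C S1.mean_bound(1) by (simp add: A_def)
  have grow: "\<bar>S1.beta s y\<bar> \<le> A * (1 + \<bar>y\<bar>)" "\<bar>S2.beta s y\<bar> \<le> A * (1 + \<bar>y\<bar>)" for s y
  proof -
    have "C * (1 + S1.mean_bound) * (1 + \<bar>y\<bar>) \<le> A * (1 + \<bar>y\<bar>)" "C * (1 + S2.mean_bound) * (1 + \<bar>y\<bar>) \<le> A * (1 + \<bar>y\<bar>)"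
      unfolding A_def using S1.C by (intro mult_right_mono mult_left_mono add_left_mono; simp)+
    then show "\<bar>S1.beta s y\<bar> \<le> A * (1 + \<bar>y\<bar>)" "\<bar>S2.beta s y\<bar> \<le> A * (1 + \<bar>y\<bar>)"
      using S1.beta_growth[of s y] S2.beta_growth[of s y] by linarith+
  qed
  have main: "gap2 t \<le> 4 * c * exp (4 * W * T) * (LINT s:{0..t}|lborel. w s)" if t: "t \<in> {0<..T}" for t
  proof -
    have t': "0 < t" "t \<le> T" "t \<in> {0..T}" using t by auto
    define I where "I = (LINT s:{0..t}|lborel. (D s)\<^sup>2)"
    have Ieq: "I = 4 * (LINT s:{0..t}|lborel. w s)"
      unfolding I_def D_def using w0 by (simp add: power_mult_distrib)
    have I0: "I \<ge> 0" unfolding I_def by (simp add: set_lebesgue_integral_def)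
    have "(LINT s:{0..t}|lborel. w s) \<le> (LINT s:{0..t}|lborel. W)"
      by (intro set_integral_mono set_integrable_bounded[where a = 0 and b = t and K = W]) (use w0 wW W0 in auto)
    also have "\<dots> = W * t" using t'(1) by (simp add: set_integral_const)
    also have "\<dots> \<le> W * T" using t'(2) W0 by (rule mult_left_mono)
    finally have IW: "I \<le> 4 * W * T" unfolding Ieq by simp
    have "gap t \<le> sqrt ((exp I - 1) * c)"
      unfolding gap_def
    proof (rule kantorovich_least[OF S1.law_P1[OF t'(3)] S2.law_P1[OF t'(3)]])
      fix h :: "real \<Rightarrow> real" assume h: "1-lipschitz_on UNIV h"
      have hb: "h \<in> borel_measurable borel" by (rule lipschitz_borel[OF h])
      have "(LINT y|S1.law t. h y) = (LINT \<omega>|M1. h (X1 t \<omega>))"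
        unfolding S1.law_def by (rule integral_distr[OF S1.X_meas[OF t'(3)] hb])
      moreover have "(LINT y|S2.law t. h y) = (LINT \<omega>|M2. h (X2 t \<omega>))"
        unfolding S2.law_def by (rule integral_distr[OF S2.X_meas[OF t'(3)] hb])
      moreover have "\<bar>(LINT \<omega>|M1. h (X1 t \<omega>)) - (LINT \<omega>|M2. h (X2 t \<omega>))\<bar> \<le> sqrt ((exp I - 1) * c)"
        unfolding I_def
      proof (rule lipschitz_expectation_difference[OF S1.sde_solution_horizon[OF t'(1,2)] S2.sde_solution_horizon[OF t'(1,2)]
          beta_measurable A0 grow Dm Db _ c(1) _ h])
        fix s y assume "s \<in> {0..t}"
        then have "s \<in> {0..T}" using t' by auto
        then show "\<bar>S1.beta s y - S2.beta s y\<bar> \<le> D s" unfolding D_def w_def by (rule beta_difference)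
      next
        show "(\<integral>\<^sup>+\<omega>. ennreal ((X2 t \<omega> - x)\<^sup>2) \<partial>M2) \<le> ennreal c" using c(2) t'(3) by blast
      qed
      ultimately show "\<bar>(LINT y|S1.law t. h y) - (LINT y|S2.law t. h y)\<bar> \<le> sqrt ((exp I - 1) * c)" by (simp only:)
    qed
    then have "(gap t)\<^sup>2 \<le> (sqrt ((exp I - 1) * c))\<^sup>2" by (rule power_mono[OF _ gap_nonneg])
    also have "\<dots> = (exp I - 1) * c" using I0 c(1) by simp
    also have "\<dots> \<le> (I * exp (4 * W * T)) * c"
    proof (rule mult_right_mono[OF _ c(1)])
      have "(1 - I) * exp I \<le> exp (- I) * exp I" using exp_ge_add_one_self[of "- I"] by (intro mult_right_mono) auto
      also have "\<dots> = 1" by (simp add: exp_minus)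
      finally have "exp I - 1 \<le> I * exp I" by (simp add: algebra_simps)
      also have "\<dots> \<le> I * exp (4 * W * T)" using I0 IW by (intro mult_left_mono) auto
      finally show "exp I - 1 \<le> I * exp (4 * W * T)" .
    qed
    finally show ?thesis unfolding gap2_eq[OF t'(3)] Ieq by (simp add: mult_ac)
  qed
  show ?thesis
  proof (intro exI[of _ "4 * c * exp (4 * W * T)"] conjI ballI)
    show "0 \<le> 4 * c * exp (4 * W * T)" using c(1) by simp
    show "gap2 t \<le> 4 * c * exp (4 * W * T) * (LINT s:{0..t}|lborel. tail_inf \<theta> (gap2 s))" if "t \<in> {0<..T}" for t
      using main[OF that] unfolding w_def .
  qed
qed

lemma laws_coincide:
  assumes \<theta>_pos: "\<And>y. y > 0 \<Longrightarrow> \<theta> y > 0"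
    and osgood: "\<And>z. z > 0 \<Longrightarrow> (\<integral>\<^sup>+ y\<in>{0<..z}. ennreal (1 / \<theta> y) \<partial>lborel) = \<infinity>"
    and t: "t \<in> {0..T}"
  shows "S1.law t = S2.law t"
proof -
  obtain c where c: "c \<ge> 0" "\<forall>t\<in>{0<..T}. gap2 t \<le> c * (LINT s:{0..t}|lborel. tail_inf \<theta> (gap2 s))"
    using gap2_integral_inequality by blast
  obtain Y where Y: "\<forall>s. gap2 s \<le> Y" using gap2_bounded by blast
  have pos: "gap s = 0" if s: "s \<in> {0<..T}" for s
  proof -
    have "gap2 s = 0"
    proof (rule osgood_uniqueness[OF \<theta>_cont \<theta>_nonneg \<theta>_pos osgood S1.T c(1) gap2_measurable gap2_nonneg _ _ s])
      show "gap2 s \<le> Y" for s using Y by blast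
      show "gap2 t \<le> c * (LINT s:{0..t}|lborel. tail_inf \<theta> (gap2 s))" if "t \<in> {0<..T}" for t using c(2) that by blast
    qed
    then show ?thesis using gap2_eq[of s] s by simp
  qed
  have cl: "closure {0<..T} = {0..T}" using S1.T by (rule closure_greaterThanAtMost)
  have "gap t = 0"
    by (rule continuous_constant_on_closure[of "{0<..T}" gap]) (use gap_continuous pos t in \<open>simp_all only: cl\<close>)
  then show ?thesis unfolding gap_def by (rule kantorovich_zero_imp_eq[OF S1.law_P1[OF t] S2.law_P1[OF t]])
qed

end

section \<open>The joint law of solution and noise\<close>

text \<open>The equation expresses the Brownian motion as a functional of the solution.\<close>

definition noise :: "real \<Rightarrow> (real \<Rightarrow> real \<Rightarrow> real) \<Rightarrow> real \<Rightarrow> (real \<Rightarrow> real) \<Rightarrow> real \<Rightarrow> real" where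
  "noise T \<beta> x w = (\<lambda>t\<in>{0..T}. w t - x - (LINT s:{0..t}|lborel. \<beta> s (w s)))"

lemma noise_measurable:
  assumes T: "T > 0" and \<beta> [measurable]: "(\<lambda>(s, y). \<beta> s y) \<in> borel_measurable (borel \<Otimes>\<^sub>M borel)"
    and C: "C \<ge> 0" and growth: "\<And>s y. \<bar>\<beta> s y\<bar> \<le> C * (1 + \<bar>y\<bar>)"
  shows "noise T \<beta> x \<in> path_space T \<rightarrow>\<^sub>M path_space T"
proof (rule measurable_path_spaceI[OF T])
  fix w assume "w \<in> space (path_space T)"
  then have w: "continuous_on {0..T} w" by (simp add: path_mem_iff)
  have i: "set_integrable lborel {0..t} (\<lambda>s. \<beta> s (w s))" if "t \<in> {0..T}" for t
    by (rule drift_along_path_integrable[OF T w \<beta> C growth that])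
  have "continuous_on {0..T} (\<lambda>t. integral {0..t} (\<lambda>s. \<beta> s (w s)))"
    by (rule indefinite_integral_continuous_1, rule set_borel_integral_eq_integral(1)[OF i]) (use T in simp)
  then have "continuous_on {0..T} (\<lambda>t. w t - x - integral {0..t} (\<lambda>s. \<beta> s (w s)))"
    by (intro continuous_intros w)
  then have "continuous_on {0..T} (noise T \<beta> x w)"
    by (rule continuous_on_eq) (simp add: noise_def set_borel_integral_eq_integral(2)[OF i])
  moreover have "noise T \<beta> x w \<in> extensional {0..T}" unfolding noise_def by (rule restrict_extensional)
  ultimately show "noise T \<beta> x w \<in> space (path_space T)" by (simp only: path_mem_iff)
next
  fix t assume t: "t \<in> {0..T}"
  let ?c = "\<lambda>s. max 0 (min T s)"
  have e [measurable]: "(\<lambda>p. fst p (?c (snd p))) \<in> borel_measurable (path_space T \<Otimes>\<^sub>M borel)"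
    by (rule eval_joint_measurable[OF T _ _ measurable_fst]) (use T in auto)
  have "(\<lambda>p. indicator {0..t} (snd p) *\<^sub>R \<beta> (snd p) (fst p (?c (snd p)))) \<in> borel_measurable (path_space T \<Otimes>\<^sub>M borel)"
    by measurable
  then have "(\<lambda>(w, s). indicator {0..t} s *\<^sub>R \<beta> s (w (?c s))) \<in> borel_measurable (path_space T \<Otimes>\<^sub>M lborel)"
    by (simp add: split_beta')
  from lborel.borel_measurable_lebesgue_integral[OF this]
  have "(\<lambda>w. LINT s:{0..t}|lborel. \<beta> s (w (?c s))) \<in> borel_measurable (path_space T)"
    unfolding set_lebesgue_integral_def .
  moreover have "(LINT s:{0..t}|lborel. \<beta> s (w (?c s))) = (LINT s:{0..t}|lborel. \<beta> s (w s))" for w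
  proof (rule set_lebesgue_integral_cong)
    show "\<forall>s. s \<in> {0..t} \<longrightarrow> \<beta> s (w (?c s)) = \<beta> s (w s)"
    proof (intro allI impI)
      fix s assume "s \<in> {0..t}"
      then have "?c s = s" using t by auto
      then show "\<beta> s (w (?c s)) = \<beta> s (w s)" by (simp only:)
    qed
  qed simp
  ultimately have [measurable]: "(\<lambda>w. LINT s:{0..t}|lborel. \<beta> s (w s)) \<in> borel_measurable (path_space T)" by (simp only:)
  have [measurable]: "(\<lambda>w. w t) \<in> borel_measurable (path_space T)" by (rule eval_measurable_path[OF T t])
  have "(\<lambda>w. w t - x - (LINT s:{0..t}|lborel. \<beta> s (w s))) \<in> borel_measurable (path_space T)" by measurable
  then show "(\<lambda>w. noise T \<beta> x w t) \<in> borel_measurable (path_space T)" unfolding noise_def restrict_apply'[OF t] .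
qed

lemma (in growth_solution) joint_law_of_path_law:
  assumes \<beta>: "(\<lambda>(s, y). beta s y) \<in> borel_measurable (borel \<Otimes>\<^sub>M borel)"
  shows "joint_path_law T M X B = distr (path_law T M X) (path_space T \<Otimes>\<^sub>M path_space T) (\<lambda>w. (w, noise T beta x w))"
proof -
  have C': "C * (1 + mean_bound) \<ge> 0" using C mean_bound(1) by simp
  have n: "noise T beta x \<in> path_space T \<rightarrow>\<^sub>M path_space T"
    by (rule noise_measurable[OF T \<beta> C' beta_growth])
  have g: "(\<lambda>w. (w, noise T beta x w)) \<in> path_space T \<rightarrow>\<^sub>M path_space T \<Otimes>\<^sub>M path_space T"
    by (intro measurable_Pair measurable_ident_sets[OF refl] n)
  have pB: "path_of T B \<in> M \<rightarrow>\<^sub>M path_space T" by (rule path_of_measurable[OF T B_meas B_cont])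
  have "AE \<omega> in M. path_of T B \<omega> = noise T beta x (path_of T X \<omega>)"
    using beta_equation
  proof eventually_elim
    case (elim \<omega>)
    have "B t \<omega> = path_of T X \<omega> t - x - (LINT s:{0..t}|lborel. beta s (path_of T X \<omega> s))" if t: "t \<in> {0..T}" for t
    proof -
      have "(LINT s:{0..t}|lborel. beta s (path_of T X \<omega> s)) = (LINT s:{0..t}|lborel. beta s (X s \<omega>))"
        by (rule set_lebesgue_integral_cong) (use t in \<open>auto simp: path_of_apply\<close>)
      moreover have "X t \<omega> = x + (LINT s:{0..t}|lborel. beta s (X s \<omega>)) + B t \<omega>" using elim t by blast
      ultimately show ?thesis unfolding path_of_apply[OF t] by simp
    qed
    then show ?case unfolding noise_def path_of_def[of T B] by (rule restrict_ext)
  qed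
  then have "joint_path_law T M X B = distr M (path_space T \<Otimes>\<^sub>M path_space T) ((\<lambda>w. (w, noise T beta x w)) \<circ> path_of T X)"
    unfolding joint_path_law_def
    by (intro distr_cong_AE refl measurable_Pair path_X_measurable pB measurable_comp[OF path_X_measurable g]) auto
  also have "\<dots> = distr (path_law T M X) (path_space T \<Otimes>\<^sub>M path_space T) (\<lambda>w. (w, noise T beta x w))"
    unfolding path_law_def by (rule distr_distr[OF g path_X_measurable, symmetric])
  finally show ?thesis .
qed

theorem theorem2p7:
  fixes T C x :: real
    and b :: "real \<Rightarrow> real \<Rightarrow> real measure \<Rightarrow> real"
    and \<theta> :: "real \<Rightarrow> real"
    and M1 :: "'a measure" and F1 :: "real \<Rightarrow> 'a measure" and B1 X1 :: "real \<Rightarrow> 'a \<Rightarrow> real"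
    and M2 :: "'b measure" and F2 :: "real \<Rightarrow> 'b measure" and B2 X2 :: "real \<Rightarrow> 'b \<Rightarrow> real"
  assumes "T > 0"
    and b_measurable: "(\<lambda>(t, y, \<mu>). b t y \<mu>)
      \<in> borel_measurable (restrict_space borel {0..T} \<Otimes>\<^sub>M borel \<Otimes>\<^sub>M borel_P1)"
    and "C > 0"
    and linear_growth: "\<And>t y \<mu>. t \<in> {0..T} \<Longrightarrow> \<mu> \<in> P1 \<Longrightarrow>
      \<bar>b t y \<mu>\<bar> \<le> C * (1 + \<bar>y\<bar> + kantorovich \<mu> (return borel 0))"
    and \<theta>_continuous: "continuous_on {0..} \<theta>"
    and \<theta>_nonneg: "\<And>y. y \<ge> 0 \<Longrightarrow> \<theta> y \<ge> 0"
    and \<theta>_pos: "\<And>y. y > 0 \<Longrightarrow> \<theta> y > 0"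
    and \<theta>_osgood: "\<And>z. z > 0 \<Longrightarrow> (\<integral>\<^sup>+ y\<in>{0<..z}. ennreal (1 / \<theta> y) \<partial>lborel) = \<infinity>"
    and modulus: "\<And>t y \<mu> \<nu>. t \<in> {0..T} \<Longrightarrow> \<mu> \<in> P1 \<Longrightarrow> \<nu> \<in> P1 \<Longrightarrow>
      \<bar>b t y \<mu> - b t y \<nu>\<bar>\<^sup>2 \<le> \<theta> ((kantorovich \<mu> \<nu>)\<^sup>2)"
    and solution1: "weak_solution T b x M1 F1 B1 X1"
    and solution2: "weak_solution T b x M2 F2 B2 X2"
  shows "joint_path_law T M1 X1 B1 = joint_path_law T M2 X2 B2 \<and>
    path_law T M1 X1 = path_law T M2 X2"
proof -
  interpret solution_pair T C x b M1 F1 B1 X1 M2 F2 B2 X2 \<theta>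
    by unfold_locales (fact assms(1) assms(3) solution1 solution2 b_measurable \<theta>_continuous | rule linear_growth \<theta>_nonneg modulus; assumption)+
  have "S1.beta = S2.beta"
    unfolding S1.beta_def[abs_def] S2.beta_def[abs_def] using laws_coincide[OF \<theta>_pos \<theta>_osgood] by (simp cong: if_cong)
  then have \<beta>: "S2.beta = S1.beta" by (rule sym)
  have T': "0 < T" "T \<le> T" using S1.T by auto
  have "0 \<le> C * (1 + S1.mean_bound)" using S1.C S1.mean_bound(1) by simp
  then have path: "path_law T M1 X1 = path_law T M2 X2"
    by (rule sde_law_unique[OF S1.sde_solution_horizon[OF T'] S2.sde_solution_horizon[OF T', unfolded \<beta>] beta_measurable(1) _ S1.beta_growth])
  have "joint_path_law T M1 X1 B1 = joint_path_law T M2 X2 B2"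
    unfolding S1.joint_law_of_path_law[OF beta_measurable(1)] S2.joint_law_of_path_law[OF beta_measurable(2)] \<beta> path ..
  with path show ?thesis by blast
qed

end
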